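(* Let $M$ be a symplectic manifold with a smooth family of natural star products $\{\star_\sigma\}_{\sigma\in\mathcal{T}}$ parametrized by a smooth manifold $\mathcal{T}$ with $H^1(\mathcal{T},\mathbb{R})=0$. Let $D,D'\in\mathcal{F}(M,\star_\sigma)$ be formal connections compatible with the family, and assume that $D$ and $D'$ are flat. Then they are gauge equivalent via a self-equivalence $P\in C^\infty(\mathcal{T},\mathcal{D}_h(M))$ of the family of star products, meaning that $$D'_V=P^{-1}D_VP$$ for any vector field $V$ on $\mathcal{T}$.
   Context: $\mathcal{D}_h(M)=\mathcal{D}(M)[[h]]$, where $\mathcal{D}(M)$ is the space of differential operators on $M$; functions are complex valued. A star product on $(M,\omega)$ is a $\mathbb{C}[[h]]$-bilinear product $f\star g=\sum_{k\ge 0}c^k(f,g)h^k$ on $C^\infty(M)[[h]]$ which is associative, has $1$ as unit, and satisfies $c^0(f,g)=fg$ and $c^1(f,g)-c^1(g,f)=i\{f,g\}$. It is natural if each $c^k$ is a bidifferential operator of order at most $k$ in each argument. A formal connection is a connection on $\mathcal{T}\times C^\infty(M)[[h]]\to\mathcal{T}$ of the form $D_Vf=V[f]+A(V)(f)$, where $V$ is a vector field on $\mathcal{T}$, $V[f]$ is the derivative of the smooth section $f$ along $V$, and $A=\sum_{k\ge1}A^kh^k$ is a smooth $1$-form on $\mathcal{T}$ with values in $\mathcal{D}_h(M)$, with $A=0\bmod h$. It is compatible with $\{\star_\sigma\}$ if $D_V(f\star_\sigma g)=D_V(f)\star_\sigma g+f\star_\sigma D_V(g)$ for all $\sigma,V$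 and all smooth sections $f,g$; for natural star products one also requires $A^k(V)$ to be a differential operator of order at most $k$. $\mathcal{F}(M,\star_\sigma)$ is the set of compatible formal connections. $D$ is flat if $D_VD_W-D_WD_V-D_{[V,W]}=0$ for all vector fields $V,W$ on $\mathcal{T}$. A self-equivalence of the family is $P\in C^\infty(\mathcal{T},\mathcal{D}_h(M))$ with $P=\mathrm{id}\bmod h$ and $P_\sigma(f\star_\sigma g)=P_\sigma(f)\star_\sigma P_\sigma(g)$ for all $\sigma\in\mathcal{T}$ and all smooth functions $f,g$ on $M$. *)

theory Defs
  imports
    "HOL-Analysis.Analysis"
    "HOL-Library.Function_Algebras"
    "HOL-Computational_Algebra.Formal_Power_Series"
begin

section \<open>Model spaces and smooth functions on open sets\<close>

text \<open>
  The model spaces of manifolds are the finite-dimensional real inner product spaces. The class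
  \<open>euclidean_space\<close> would exclude dimension 0. Finite dimension is expressed by a finite set with trivial orthogonal
  complement.
\<close>

class finite_dim_inner = real_inner +
  assumes finite_dim: "\<exists>B. finite B \<and> (\<forall>x. (\<forall>b\<in>B. inner x b = 0) \<longrightarrow> x = 0)"

instance euclidean_space \<subseteq> finite_dim_inner
  by standard (metis finite_Basis euclidean_all_zero_iff)

text \<open>
  Only meant for open \<open>S\<close> in a finite-dimensional space, where continuity of all directional
  derivatives is the same as continuity of the derivative.
\<close>

primrec Ck_on :: "nat \<Rightarrow> ('e::real_normed_vector \<Rightarrow> 'b::real_normed_vector) \<Rightarrow> 'e set \<Rightarrow> bool" where
  "Ck_on 0 f S \<longleftrightarrow> continuous_on S f"
| "Ck_on (Suc k) f S \<longleftrightarrow> (\<forall>x\<in>S. f differentiable (at x)) \<and>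
     (\<forall>v. Ck_on k (\<lambda>x. frechet_derivative f (at x) v) S)"

definition smooth_on :: "'e::real_normed_vector set \<Rightarrow> ('e \<Rightarrow> 'b::real_normed_vector) \<Rightarrow> bool" where
  "smooth_on S f \<longleftrightarrow> (\<forall>k. Ck_on k f S)"

text \<open>\<open>iter_deriv [v\<^sub>1, \<dots>, v\<^sub>r] g = \<partial>\<^bsub>v\<^sub>1\<^esub> \<dots> \<partial>\<^bsub>v\<^sub>r\<^esub> g\<close>\<close>

primrec iter_deriv :: "'e::real_normed_vector list \<Rightarrow> ('e \<Rightarrow> 'b::real_normed_vector) \<Rightarrow> 'e \<Rightarrow> 'b" where
  "iter_deriv [] g = g"
| "iter_deriv (v # vs) g = (\<lambda>y. frechet_derivative (iter_deriv vs g) (at y) v)"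


section \<open>Manifolds\<close>

text \<open>
  A manifold is a (Hausdorff, second countable) topological type together with an atlas. A chart
  is a pair \<open>(U, \<phi>)\<close>; only the values of \<open>\<phi>\<close> on \<open>U\<close> matter, and \<open>inv_into U \<phi>\<close> is the inverse
  chart on the open set \<open>\<phi> ` U\<close>.
\<close>

type_synonym ('a, 'e) atlas = "('a set \<times> ('a \<Rightarrow> 'e)) set"

definition smooth_atlas ::
  "('a::{t2_space,second_countable_topology}, 'e::finite_dim_inner) atlas \<Rightarrow> bool" where
  "smooth_atlas \<A> \<longleftrightarrow>
     (\<Union>(U, \<phi>)\<in>\<A>. U) = UNIV \<and>
     (\<forall>(U, \<phi>)\<in>\<A>. open U \<and> open (\<phi> ` U) \<and> homeomorphism U (\<phi> ` U) \<phi> (inv_into U \<phi>)) \<and>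
     (\<forall>(U, \<phi>)\<in>\<A>. \<forall>(V, \<psi>)\<in>\<A>. smooth_on (\<phi> ` (U \<inter> V)) (\<psi> \<circ> inv_into U \<phi>))"

definition smooth_funs ::
  "('a, 'e::real_normed_vector) atlas \<Rightarrow> ('a \<Rightarrow> 'b::real_normed_vector) set" where
  "smooth_funs \<A> = {f. \<forall>(U, \<phi>)\<in>\<A>. smooth_on (\<phi> ` U) (f \<circ> inv_into U \<phi>)}"

definition prod_atlas :: "('a, 'e) atlas \<Rightarrow> ('b, 'f) atlas \<Rightarrow> ('a \<times> 'b, 'e \<times> 'f) atlas" where
  "prod_atlas \<A> \<B> = {(U \<times> V, map_prod \<phi> \<psi>) | U \<phi> V \<psi>. (U, \<phi>) \<in> \<A> \<and> (V, \<psi>) \<in> \<B>}"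

text \<open>
  Tangent vectors at \<open>p\<close> are the derivations at \<open>p\<close> of the algebra of real smooth functions,
  extended by 0 to non-smooth functions, so that distinct elements are distinct derivations.
\<close>

type_synonym 'a tvec = "('a \<Rightarrow> real) \<Rightarrow> real"

definition tangent_space :: "('a, 'e::real_normed_vector) atlas \<Rightarrow> 'a \<Rightarrow> 'a tvec set" where
  "tangent_space \<A> p = {v.
     (\<forall>f. f \<notin> smooth_funs \<A> \<longrightarrow> v f = 0) \<and>
     (\<forall>f\<in>smooth_funs \<A>. \<forall>g\<in>smooth_funs \<A>. \<forall>a b.
        v (\<lambda>x. a * f x + b * g x) = a * v f + b * v g) \<and>
     (\<forall>f\<in>smooth_funs \<A>. \<forall>g\<in>smooth_funs \<A>. v (\<lambda>x. f x * g x) = f p * v g + g p * v f)}"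

definition vector_fields :: "('a, 'e::real_normed_vector) atlas \<Rightarrow> ('a \<Rightarrow> 'a tvec) set" where
  "vector_fields \<A> = {X. (\<forall>p. X p \<in> tangent_space \<A> p) \<and>
     (\<forall>f\<in>smooth_funs \<A>. (\<lambda>p. X p f) \<in> smooth_funs \<A>)}"

definition lie_bracket ::
  "('a, 'e::real_normed_vector) atlas \<Rightarrow> ('a \<Rightarrow> 'a tvec) \<Rightarrow> ('a \<Rightarrow> 'a tvec) \<Rightarrow> 'a \<Rightarrow> 'a tvec" where
  "lie_bracket \<A> X Y = (\<lambda>p f. if f \<in> smooth_funs \<A>
     then X p (\<lambda>q. Y q f) - Y p (\<lambda>q. X q f) else 0)"

text \<open>Complex-linear extension of a real tangent vector to complex-valued functions\<close>

definition complex_deriv :: "'a tvec \<Rightarrow> ('a \<Rightarrow> complex) \<Rightarrow> complex" where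
  "complex_deriv v u = Complex (v (\<lambda>x. Re (u x))) (v (\<lambda>x. Im (u x)))"


section \<open>De Rham cohomology in degree 1 and symplectic forms\<close>

definition one_forms :: "('a, 'e::real_normed_vector) atlas \<Rightarrow> ('a \<Rightarrow> 'a tvec \<Rightarrow> real) set" where
  "one_forms \<A> = {\<alpha>.
     (\<forall>p. \<forall>v\<in>tangent_space \<A> p. \<forall>w\<in>tangent_space \<A> p. \<forall>a b.
        \<alpha> p (\<lambda>f. a * v f + b * w f) = a * \<alpha> p v + b * \<alpha> p w) \<and>
     (\<forall>X\<in>vector_fields \<A>. (\<lambda>p. \<alpha> p (X p)) \<in> smooth_funs \<A>)}"

definition closed_one_forms ::
  "('a, 'e::real_normed_vector) atlas \<Rightarrow> ('a \<Rightarrow> 'a tvec \<Rightarrow> real) set" where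
  "closed_one_forms \<A> = {\<alpha>\<in>one_forms \<A>.
     \<forall>X\<in>vector_fields \<A>. \<forall>Y\<in>vector_fields \<A>. \<forall>p.
       X p (\<lambda>q. \<alpha> q (Y q)) - Y p (\<lambda>q. \<alpha> q (X q)) - \<alpha> p (lie_bracket \<A> X Y p) = 0}"

definition exact_one_forms ::
  "('a, 'e::real_normed_vector) atlas \<Rightarrow> ('a \<Rightarrow> 'a tvec \<Rightarrow> real) set" where
  "exact_one_forms \<A> = {\<alpha>\<in>one_forms \<A>.
     \<exists>u\<in>smooth_funs \<A>. \<forall>p. \<forall>v\<in>tangent_space \<A> p. \<alpha> p v = v u}"

text \<open>\<open>H\<^sup>1(M, \<real>) = 0\<close>, for de Rham cohomology\<close>

definition H1_vanishes :: "('a, 'e::real_normed_vector) atlas \<Rightarrow> bool" where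
  "H1_vanishes \<A> \<longleftrightarrow> closed_one_forms \<A> \<subseteq> exact_one_forms \<A>"

type_synonym 'a two_form = "'a \<Rightarrow> 'a tvec \<Rightarrow> 'a tvec \<Rightarrow> real"

definition two_forms :: "('a, 'e::real_normed_vector) atlas \<Rightarrow> 'a two_form set" where
  "two_forms \<A> = {\<omega>.
     (\<forall>p. \<forall>u\<in>tangent_space \<A> p. \<forall>v\<in>tangent_space \<A> p. \<forall>w\<in>tangent_space \<A> p. \<forall>a b.
        \<omega> p (\<lambda>f. a * u f + b * v f) w = a * \<omega> p u w + b * \<omega> p v w) \<and>
     (\<forall>p. \<forall>v\<in>tangent_space \<A> p. \<forall>w\<in>tangent_space \<A> p. \<omega> p w v = - \<omega> p v w) \<and>
     (\<forall>X\<in>vector_fields \<A>. \<forall>Y\<in>vector_fields \<A>. (\<lambda>p. \<omega> p (X p) (Y p)) \<in> smooth_funs \<A>)}"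

definition symplectic_form :: "('a, 'e::real_normed_vector) atlas \<Rightarrow> 'a two_form \<Rightarrow> bool" where
  "symplectic_form \<A> \<omega> \<longleftrightarrow> \<omega> \<in> two_forms \<A> \<and>
     (\<forall>X\<in>vector_fields \<A>. \<forall>Y\<in>vector_fields \<A>. \<forall>Z\<in>vector_fields \<A>. \<forall>p.
        X p (\<lambda>q. \<omega> q (Y q) (Z q)) - Y p (\<lambda>q. \<omega> q (X q) (Z q)) + Z p (\<lambda>q. \<omega> q (X q) (Y q))
        - \<omega> p (lie_bracket \<A> X Y p) (Z p) + \<omega> p (lie_bracket \<A> X Z p) (Y p)
        - \<omega> p (lie_bracket \<A> Y Z p) (X p) = 0) \<and>
     (\<forall>p. \<forall>v\<in>tangent_space \<A> p. (\<forall>w\<in>tangent_space \<A> p. \<omega> p v w = 0) \<longrightarrow> v = 0)"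

text \<open>
  Sign conventions: \<open>\<omega>(X\<^sub>f, \<cdot>) = df\<close> and \<open>{f, g} = \<omega>(X\<^sub>f, X\<^sub>g)\<close>, extended complex-bilinearly.
  The opposite sign of the bracket corresponds to replacing \<open>\<omega>\<close> by \<open>- \<omega>\<close>.
\<close>

definition hamiltonian_vec ::
  "('a, 'e::real_normed_vector) atlas \<Rightarrow> 'a two_form \<Rightarrow> ('a \<Rightarrow> real) \<Rightarrow> 'a \<Rightarrow> 'a tvec" where
  "hamiltonian_vec \<A> \<omega> f p =
     (THE v. v \<in> tangent_space \<A> p \<and> (\<forall>w\<in>tangent_space \<A> p. \<omega> p v w = w f))"

definition real_poisson ::
  "('a, 'e::real_normed_vector) atlas \<Rightarrow> 'a two_form \<Rightarrow> ('a \<Rightarrow> real) \<Rightarrow> ('a \<Rightarrow> real) \<Rightarrow> 'a \<Rightarrow> real" where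
  "real_poisson \<A> \<omega> f g p = \<omega> p (hamiltonian_vec \<A> \<omega> f p) (hamiltonian_vec \<A> \<omega> g p)"

definition poisson ::
  "('a, 'e::real_normed_vector) atlas \<Rightarrow> 'a two_form \<Rightarrow> ('a \<Rightarrow> complex) \<Rightarrow> ('a \<Rightarrow> complex) \<Rightarrow> 'a \<Rightarrow> complex"
  where
  "poisson \<A> \<omega> f g p = Complex
     (real_poisson \<A> \<omega> (Re \<circ> f) (Re \<circ> g) p - real_poisson \<A> \<omega> (Im \<circ> f) (Im \<circ> g) p)
     (real_poisson \<A> \<omega> (Re \<circ> f) (Im \<circ> g) p + real_poisson \<A> \<omega> (Im \<circ> f) (Re \<circ> g) p)"


section \<open>Differential operators\<close>

text \<open>
  Operators and bidifferential operators on \<open>C\<^sup>\<infinity>(M)\<close> are total functions of which only the values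
  at smooth functions matter. In each chart they have to be finite sums
  \<open>\<Sum> a\<^sub>l \<partial>\<^sub>l\<close> resp. \<open>\<Sum> a\<^bsub>l l'\<^esub> \<partial>\<^sub>l \<otimes> \<partial>\<^bsub>l'\<^esub>\<close> with smooth coefficients and derivatives \<open>\<partial>\<^sub>l\<close> of order
  at most \<open>k\<close>.
\<close>

type_synonym 'm operator = "('m \<Rightarrow> complex) \<Rightarrow> ('m \<Rightarrow> complex)"

definition diff_ops_le :: "('m, 'f::real_normed_vector) atlas \<Rightarrow> nat \<Rightarrow> 'm operator set" where
  "diff_ops_le \<M> k = {P. \<forall>(U, \<phi>)\<in>\<M>. \<exists>L a.
     finite L \<and> (\<forall>l\<in>L. length l \<le> k \<and> smooth_on (\<phi> ` U) (a l)) \<and>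
     (\<forall>f\<in>smooth_funs \<M>. \<forall>p\<in>U.
        P f p = (\<Sum>l\<in>L. a l (\<phi> p) * iter_deriv l (f \<circ> inv_into U \<phi>) (\<phi> p)))}"

definition diff_ops :: "('m, 'f::real_normed_vector) atlas \<Rightarrow> 'm operator set" where
  "diff_ops \<M> = (\<Union>k. diff_ops_le \<M> k)"

definition bidiff_ops_le ::
  "('m, 'f::real_normed_vector) atlas \<Rightarrow> nat \<Rightarrow>
     (('m \<Rightarrow> complex) \<Rightarrow> ('m \<Rightarrow> complex) \<Rightarrow> ('m \<Rightarrow> complex)) set" where
  "bidiff_ops_le \<M> k = {b. \<forall>(U, \<phi>)\<in>\<M>. \<exists>L a.
     finite L \<and>
     (\<forall>(l, l')\<in>L. length l \<le> k \<and> length l' \<le> k \<and> smooth_on (\<phi> ` U) (a l l')) \<and>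
     (\<forall>f\<in>smooth_funs \<M>. \<forall>g\<in>smooth_funs \<M>. \<forall>p\<in>U.
        b f g p = (\<Sum>(l, l')\<in>L. a l l' (\<phi> p) * iter_deriv l (f \<circ> inv_into U \<phi>) (\<phi> p)
                                          * iter_deriv l' (g \<circ> inv_into U \<phi>) (\<phi> p)))}"

text \<open>
  \<open>C\<^sup>\<infinity>(T, D(M))\<close>: a family of differential operators is smooth if it maps each smooth
  function on \<open>M\<close> to a smooth function on \<open>T \<times> M\<close>.
\<close>

definition smooth_diff_op_families ::
  "('t, 'e::real_normed_vector) atlas \<Rightarrow> ('m, 'f::real_normed_vector) atlas \<Rightarrow> ('t \<Rightarrow> 'm operator) set"
  where
  "smooth_diff_op_families \<T> \<M> = {P. (\<forall>\<sigma>. P \<sigma> \<in> diff_ops \<M>) \<and>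
     (\<forall>f\<in>smooth_funs \<M>. (\<lambda>(\<sigma>, x). P \<sigma> f x) \<in> smooth_funs (prod_atlas \<T> \<M>))}"


section \<open>Formal functions and formal differential operators\<close>

definition formal_funs :: "('m, 'f::real_normed_vector) atlas \<Rightarrow> ('m \<Rightarrow> complex) fps set" where
  "formal_funs \<M> = {f. \<forall>n. fps_nth f n \<in> smooth_funs \<M>}"

text \<open>Smooth sections of the trivial bundle \<open>T \<times> C\<^sup>\<infinity>(M)[[h]] \<rightarrow> T\<close>\<close>

definition smooth_sections ::
  "('t, 'e::real_normed_vector) atlas \<Rightarrow> ('m, 'f::real_normed_vector) atlas \<Rightarrow>
     ('t \<Rightarrow> ('m \<Rightarrow> complex) fps) set" where
  "smooth_sections \<T> \<M> =
     {f. \<forall>n. (\<lambda>(\<sigma>, x). fps_nth (f \<sigma>) n x) \<in> smooth_funs (prod_atlas \<T> \<M>)}"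

text \<open>
  A formal operator \<open>\<Sum>\<^sub>k P\<^sup>k h\<^sup>k\<close> is the sequence of its coefficients; it acts
  \<open>\<complex>[[h]]\<close>-linearly.
\<close>

type_synonym 'm formal_operator = "nat \<Rightarrow> 'm operator"

definition act :: "'m formal_operator \<Rightarrow> ('m \<Rightarrow> complex) fps \<Rightarrow> ('m \<Rightarrow> complex) fps" where
  "act P f = Abs_fps (\<lambda>n. \<Sum>k\<le>n. P k (fps_nth f (n - k)))"

text \<open>
  The inverse as a map of \<open>C\<^sup>\<infinity>(M)[[h]]\<close>. Operators that are the identity modulo \<open>h\<close> are
  bijections of this space, so that \<open>inv_into\<close> is a two-sided inverse for them.
\<close>

definition act_inverse ::
  "('m, 'f::real_normed_vector) atlas \<Rightarrow> 'm formal_operator \<Rightarrow>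
     ('m \<Rightarrow> complex) fps \<Rightarrow> ('m \<Rightarrow> complex) fps" where
  "act_inverse \<M> P = inv_into (formal_funs \<M>) (act P)"


section \<open>Star products\<close>

text \<open>
  A \<open>\<complex>[[h]]\<close>-bilinear product \<open>f \<star> g = \<Sum>\<^sub>k c\<^sup>k(f, g) h\<^sup>k\<close> is given by its coefficients \<open>c\<close>;
  \<open>star c\<close> is the bilinear extension to formal functions.
\<close>

type_synonym 'm cochains = "nat \<Rightarrow> ('m \<Rightarrow> complex) \<Rightarrow> ('m \<Rightarrow> complex) \<Rightarrow> ('m \<Rightarrow> complex)"

definition star ::
  "'m cochains \<Rightarrow> ('m \<Rightarrow> complex) fps \<Rightarrow> ('m \<Rightarrow> complex) fps \<Rightarrow> ('m \<Rightarrow> complex) fps" where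
  "star c f g = Abs_fps (\<lambda>n. \<Sum>k\<le>n. \<Sum>i\<le>n - k. c k (fps_nth f i) (fps_nth g (n - k - i)))"

definition star_product ::
  "('m, 'f::real_normed_vector) atlas \<Rightarrow> 'm two_form \<Rightarrow> 'm cochains \<Rightarrow> bool" where
  "star_product \<M> \<omega> c \<longleftrightarrow>
     (\<forall>k. \<forall>f\<in>smooth_funs \<M>. \<forall>g\<in>smooth_funs \<M>. c k f g \<in> smooth_funs \<M>) \<and>
     (\<forall>k. \<forall>f\<in>smooth_funs \<M>. \<forall>g\<in>smooth_funs \<M>. \<forall>u\<in>smooth_funs \<M>. \<forall>a b.
        c k (\<lambda>x. a * f x + b * g x) u = (\<lambda>x. a * c k f u x + b * c k g u x) \<and>
        c k u (\<lambda>x. a * f x + b * g x) = (\<lambda>x. a * c k u f x + b * c k u g x)) \<and>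
     (\<forall>f\<in>formal_funs \<M>. \<forall>g\<in>formal_funs \<M>. \<forall>u\<in>formal_funs \<M>.
        star c (star c f g) u = star c f (star c g u)) \<and>
     (\<forall>f\<in>formal_funs \<M>. star c 1 f = f \<and> star c f 1 = f) \<and>
     (\<forall>f\<in>smooth_funs \<M>. \<forall>g\<in>smooth_funs \<M>. c 0 f g = f * g) \<and>
     (\<forall>f\<in>smooth_funs \<M>. \<forall>g\<in>smooth_funs \<M>.
        c 1 f g - c 1 g f = (\<lambda>x. \<i> * poisson \<M> \<omega> f g x))"

definition natural_star_product ::
  "('m, 'f::real_normed_vector) atlas \<Rightarrow> 'm two_form \<Rightarrow> 'm cochains \<Rightarrow> bool" where
  "natural_star_product \<M> \<omega> c \<longleftrightarrow> star_product \<M> \<omega> c \<and> (\<forall>k. c k \<in> bidiff_ops_le \<M> k)"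

definition smooth_natural_star_family ::
  "('t, 'e::real_normed_vector) atlas \<Rightarrow> ('m, 'f::real_normed_vector) atlas \<Rightarrow> 'm two_form \<Rightarrow>
     ('t \<Rightarrow> 'm cochains) \<Rightarrow> bool" where
  "smooth_natural_star_family \<T> \<M> \<omega> c \<longleftrightarrow>
     (\<forall>\<sigma>. natural_star_product \<M> \<omega> (c \<sigma>)) \<and>
     (\<forall>k. \<forall>f\<in>smooth_funs \<M>. \<forall>g\<in>smooth_funs \<M>.
        (\<lambda>(\<sigma>, x). c \<sigma> k f g x) \<in> smooth_funs (prod_atlas \<T> \<M>))"


section \<open>Formal connections\<close>

definition section_deriv ::
  "('t \<Rightarrow> 't tvec) \<Rightarrow> ('t \<Rightarrow> ('m \<Rightarrow> complex) fps) \<Rightarrow> 't \<Rightarrow> ('m \<Rightarrow> complex) fps" where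
  "section_deriv V f \<sigma> =
     Abs_fps (\<lambda>n x. complex_deriv (V \<sigma>) (\<lambda>\<tau>. fps_nth (f \<tau>) n x))"

text \<open>
  Smooth 1-forms \<open>A = \<Sum>\<^sub>k A\<^sup>k h\<^sup>k\<close> on \<open>T\<close> with values in formal differential operators on \<open>M\<close> such
  that \<open>A = 0\<close> modulo \<open>h\<close> and \<open>A\<^sup>k\<close> takes values in operators of order at most \<open>k\<close>
\<close>

definition natural_op_one_forms ::
  "('t, 'e::real_normed_vector) atlas \<Rightarrow> ('m, 'f::real_normed_vector) atlas \<Rightarrow>
     (nat \<Rightarrow> 't \<Rightarrow> 't tvec \<Rightarrow> 'm operator) set" where
  "natural_op_one_forms \<T> \<M> = {A.
     (\<forall>k \<sigma>. \<forall>v\<in>tangent_space \<T> \<sigma>. A k \<sigma> v \<in> diff_ops_le \<M> k) \<and>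
     (\<forall>k \<sigma>. \<forall>v\<in>tangent_space \<T> \<sigma>. \<forall>w\<in>tangent_space \<T> \<sigma>. \<forall>a b. \<forall>f\<in>smooth_funs \<M>.
        A k \<sigma> (\<lambda>u. a * v u + b * w u) f =
          (\<lambda>x. of_real a * A k \<sigma> v f x + of_real b * A k \<sigma> w f x)) \<and>
     (\<forall>k. \<forall>V\<in>vector_fields \<T>. (\<lambda>\<sigma>. A k \<sigma> (V \<sigma>)) \<in> smooth_diff_op_families \<T> \<M>) \<and>
     (\<forall>\<sigma>. \<forall>v\<in>tangent_space \<T> \<sigma>. \<forall>f\<in>smooth_funs \<M>. A 0 \<sigma> v f = 0)}"

type_synonym ('t, 'm) connection =
  "('t \<Rightarrow> 't tvec) \<Rightarrow> ('t \<Rightarrow> ('m \<Rightarrow> complex) fps) \<Rightarrow> ('t \<Rightarrow> ('m \<Rightarrow> complex) fps)"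

definition natural_formal_connection ::
  "('t, 'e::real_normed_vector) atlas \<Rightarrow> ('m, 'f::real_normed_vector) atlas \<Rightarrow>
     ('t, 'm) connection \<Rightarrow> bool" where
  "natural_formal_connection \<T> \<M> D \<longleftrightarrow> (\<exists>A\<in>natural_op_one_forms \<T> \<M>.
     \<forall>V\<in>vector_fields \<T>. \<forall>f\<in>smooth_sections \<T> \<M>.
       D V f = (\<lambda>\<sigma>. section_deriv V f \<sigma> + act (\<lambda>k. A k \<sigma> (V \<sigma>)) (f \<sigma>)))"

text \<open>The set \<open>F(M, \<star>\<^sub>\<sigma>)\<close> for a family of natural star products\<close>

definition compatible_connections ::
  "('t, 'e::real_normed_vector) atlas \<Rightarrow> ('m, 'f::real_normed_vector) atlas \<Rightarrow>
     ('t \<Rightarrow> 'm cochains) \<Rightarrow> ('t, 'm) connection set" where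
  "compatible_connections \<T> \<M> c = {D. natural_formal_connection \<T> \<M> D \<and>
     (\<forall>V\<in>vector_fields \<T>. \<forall>f\<in>smooth_sections \<T> \<M>. \<forall>g\<in>smooth_sections \<T> \<M>.
       D V (\<lambda>\<sigma>. star (c \<sigma>) (f \<sigma>) (g \<sigma>)) =
         (\<lambda>\<sigma>. star (c \<sigma>) (D V f \<sigma>) (g \<sigma>) + star (c \<sigma>) (f \<sigma>) (D V g \<sigma>)))}"

definition flat_connection ::
  "('t, 'e::real_normed_vector) atlas \<Rightarrow> ('m, 'f::real_normed_vector) atlas \<Rightarrow>
     ('t, 'm) connection \<Rightarrow> bool" where
  "flat_connection \<T> \<M> D \<longleftrightarrow>
     (\<forall>V\<in>vector_fields \<T>. \<forall>W\<in>vector_fields \<T>. \<forall>f\<in>smooth_sections \<T> \<M>.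
       D V (D W f) - D W (D V f) - D (lie_bracket \<T> V W) f = 0)"

definition self_equivalence ::
  "('t, 'e::real_normed_vector) atlas \<Rightarrow> ('m, 'f::real_normed_vector) atlas \<Rightarrow>
     ('t \<Rightarrow> 'm cochains) \<Rightarrow> ('t \<Rightarrow> 'm formal_operator) \<Rightarrow> bool" where
  "self_equivalence \<T> \<M> c P \<longleftrightarrow>
     (\<forall>k. (\<lambda>\<sigma>. P \<sigma> k) \<in> smooth_diff_op_families \<T> \<M>) \<and>
     (\<forall>\<sigma>. \<forall>f\<in>smooth_funs \<M>. P \<sigma> 0 f = f) \<and>
     (\<forall>\<sigma>. \<forall>f\<in>smooth_funs \<M>. \<forall>g\<in>smooth_funs \<M>.
        act (P \<sigma>) (star (c \<sigma>) (fps_const f) (fps_const g)) =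
          star (c \<sigma>) (act (P \<sigma>) (fps_const f)) (act (P \<sigma>) (fps_const g)))"

text \<open>\<open>D'\<^sub>V = P\<^sup>-\<^sup>1 D\<^sub>V P\<close> as operators on smooth sections, for all vector fields \<open>V\<close> on \<open>T\<close>\<close>

definition gauge_related ::
  "('t, 'e::real_normed_vector) atlas \<Rightarrow> ('m, 'f::real_normed_vector) atlas \<Rightarrow>
     ('t \<Rightarrow> 'm formal_operator) \<Rightarrow> ('t, 'm) connection \<Rightarrow> ('t, 'm) connection \<Rightarrow> bool" where
  "gauge_related \<T> \<M> P D D' \<longleftrightarrow>
     (\<forall>V\<in>vector_fields \<T>. \<forall>f\<in>smooth_sections \<T> \<M>.
       D' V f = (\<lambda>\<sigma>. act_inverse \<M> (P \<sigma>) (D V (\<lambda>\<tau>. act (P \<tau>) (f \<tau>)) \<sigma>)))"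

end

theory Submission
  imports Defs
begin

text \<open>
  A gauge transformation is a solution \<open>P\<close> of \<open>D\<^sub>V P = P D'\<^sub>V\<close>. With \<open>D = d + A\<close> and \<open>D' = d + A'\<close> the
  coefficient of \<open>h\<^sup>n\<close> of this equation prescribes \<open>d P\<^sub>n\<close> as a 1-form on the parameter manifold that is
  built from \<open>P\<^sub>0, \<dots>, P\<^bsub>n-1\<^esub>\<close> and closed by flatness. For each function \<open>f\<close> and each point \<open>x\<close> it has a
  primitive, since the first cohomology vanishes; normalise it to vanish at one base point of each component.
  The primitive is smooth in \<open>x\<close> because it is locally an integral along segments. It is a differential
  operator in \<open>f\<close> because iterated commutators with functions are again primitives vanishing at the base
  points, so that Grothendieck's criterion passes from \<open>d P\<^sub>n\<close> to \<open>P\<^sub>n\<close>. Finally \<open>P\<close> is multiplicative: it is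
  the identity at the base points, and the defect of multiplicativity is parallel.
\<close>

section \<open>Smooth functions on finite-dimensional spaces\<close>

text \<open>The cohomological hypothesis concerns scalar 1-forms, so primitives are chosen for each
  \<open>f\<close> and \<open>x\<close> separately and nothing relates two choices. Normalisation
  repairs this: a primitive vanishing at the base points is unique, so linear relations between the
  1-forms pass to the primitives. Smoothness in \<open>x\<close> is propagated over a component from
  the base point, where the slice is zero. The order criterion is stated for functionals at one
  point \<open>x\<close>: there a commutator with \<open>u\<close> is a scalar combination of values
  and commutes with differentiation along the parameters. The way back to coordinate expressions is
  a Taylor formula whose coefficients are 1/r! times iterated commutators with coordinates. Tangent
  vectors act on globally defined functions, so local constructions are cut off and extended; in
  products the cut-off depends on the parameter alone, because one neighbourhood must serve all
  \<open>x\<close>. The order of \<open>P\<^sub>n\<close> is bounded through the sum of the earlier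
  bounds.\<close>

lemma ex_orthonormal_basis:
  "\<exists>B::'e::finite_dim_inner set. finite B \<and> (\<forall>b\<in>B. norm b = 1) \<and>
     (\<forall>b\<in>B. \<forall>c\<in>B. b \<noteq> c \<longrightarrow> inner b c = 0) \<and> (\<forall>x. x = (\<Sum>b\<in>B. inner x b *\<^sub>R b))"
proof -
  obtain B :: "'e set" where B: "finite B" "\<And>x. (\<And>b. b \<in> B \<Longrightarrow> inner x b = 0) \<Longrightarrow> x = 0"
    using finite_dim[where 'a='e] by metis
  \<comment> \<open>Gram-Schmidt without normalisation; a zero vector that it may leave is discarded
    before dividing by norms.\<close>
  obtain C where C: "finite C" "span C = span B" "pairwise orthogonal C"
    using basis_orthogonal[OF B(1)] by blast
  define D where "D = (\<lambda>c. c /\<^sub>R norm c) ` (C - {0})"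
  have fin: "finite D" by (simp add: D_def C(1))
  have nrm: "\<forall>b\<in>D. norm b = 1" by (auto simp: D_def)
  have orth: "\<forall>b\<in>D. \<forall>c\<in>D. b \<noteq> c \<longrightarrow> inner b c = 0"
    using C(3) by (auto simp: D_def pairwise_def orthogonal_def)
  \<comment> \<open>That only 0 is orthogonal to \<open>B\<close> depends on the span alone, so it
    passes to \<open>C\<close> and to the normalised vectors. Below it is applied to the difference
    of \<open>x\<close> and its expansion.\<close>
  have zero: "x = 0" if *: "\<And>b. b \<in> D \<Longrightarrow> inner x b = 0" for x
  proof -
    have "inner x c = 0" if "c \<in> C" for c
    proof (cases "c = 0")
      case False
      then have "inner x (c /\<^sub>R norm c) = 0"
        using that by (intro *) (auto simp: D_def)
      then show ?thesis using False by simp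
    qed simp
    then have "orthogonal x c" if "c \<in> C" for c using that by (simp add: orthogonal_def)
    then have "orthogonal x y" if "y \<in> span C" for y
      using orthogonal_to_span that by blast
    then have "inner x b = 0" if "b \<in> B" for b
      using that C(2) span_base by (auto simp: orthogonal_def)
    then show ?thesis using B(2) by blast
  qed
  have "x = (\<Sum>b\<in>D. inner x b *\<^sub>R b)" for x
  proof -
    have "inner (x - (\<Sum>b\<in>D. inner x b *\<^sub>R b)) c = 0" if c: "c \<in> D" for c
    proof -
      have "inner (\<Sum>b\<in>D. inner x b *\<^sub>R b) c = (\<Sum>b\<in>D. inner x b * inner b c)"
        by (simp add: inner_sum_left)
      also have "\<dots> = (\<Sum>b\<in>D. if b = c then inner x c else 0)"
        by (intro sum.cong refl) (use c nrm orth in \<open>auto simp: norm_eq_1\<close>)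
      also have "\<dots> = inner x c" using fin c by simp
      finally show ?thesis by (simp add: inner_diff_left)
    qed
    then show ?thesis using zero by fastforce
  qed
  then show ?thesis using fin nrm orth by blast
qed

text \<open>A fixed orthonormal basis, empty in dimension 0. Smoothness is defined through
  derivatives in fixed directions, so varying directions are always expanded in it.\<close>

definition onb :: "'e::finite_dim_inner set" where
  "onb = (SOME B. finite B \<and> (\<forall>b\<in>B. norm b = 1) \<and>
     (\<forall>b\<in>B. \<forall>c\<in>B. b \<noteq> c \<longrightarrow> inner b c = 0) \<and> (\<forall>x. x = (\<Sum>b\<in>B. inner x b *\<^sub>R b)))"

lemma
  shows finite_onb [simp, intro]: "finite (onb :: 'e::finite_dim_inner set)"
    and inner_onb: "b \<in> onb \<Longrightarrow> c \<in> onb \<Longrightarrow> inner b c = (if b = (c::'e) then 1 else 0)"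
    and onb_expand: "(\<Sum>b\<in>onb. inner x b *\<^sub>R b) = (x::'e)"
  using someI_ex[OF ex_orthonormal_basis[where 'e='e], folded onb_def]
  by (auto simp: norm_eq_1)

lemma linear_onb_expand:
  fixes f :: "'e::finite_dim_inner \<Rightarrow> 'b::real_vector"
  assumes "linear f"
  shows "f x = (\<Sum>b\<in>onb. inner x b *\<^sub>R f b)"
proof -
  have "f x = f (\<Sum>b\<in>onb. inner x b *\<^sub>R b)" by (simp add: onb_expand)
  also have "\<dots> = (\<Sum>b\<in>onb. inner x b *\<^sub>R f b)"
    by (simp add: linear_sum[OF assms] linear_cmul[OF assms])
  finally show ?thesis .
qed

text \<open>Bolzano-Weierstrass, coordinate by coordinate in \<open>onb\<close>. Compactness of
  closed balls serves the cut-off functions, completeness the differentiation under the integral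
  sign.\<close>

instance finite_dim_inner \<subseteq> heine_borel
proof
  fix f :: "nat \<Rightarrow> 'a"
  assume f: "bounded (range f)"
  have "\<forall>\<delta>\<subseteq>onb. \<exists>l::'a. \<exists>r. strict_mono r \<and>
      (\<forall>e>0. \<forall>\<^sub>F n in sequentially. \<forall>i\<in>\<delta>. dist (inner (f (r n)) i) (inner l i) < e)"
  proof (rule compact_lemma_general[where unproj="\<lambda>e. \<Sum>i\<in>onb. e i *\<^sub>R i"])
    show "bounded ((\<lambda>x. inner x k) ` range f)" for k :: 'a
      using bounded_linear_image[OF f bounded_linear_inner_left] .
    show "inner (\<Sum>i\<in>onb. \<epsilon> i *\<^sub>R i) k = \<epsilon> k" if "k \<in> onb" for \<epsilon> and k :: 'a
    proof -
      have "inner (\<Sum>i\<in>onb. \<epsilon> i *\<^sub>R i) k = (\<Sum>i\<in>onb. if i = k then \<epsilon> k else 0)"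
        unfolding inner_sum_left by (intro sum.cong) (auto simp: inner_onb that)
      then show ?thesis using that by simp
    qed
  qed (auto simp: onb_expand)
  then obtain l :: 'a and r where r: "strict_mono r"
    and l: "\<And>e. e > 0 \<Longrightarrow> \<forall>\<^sub>F n in sequentially. \<forall>i\<in>onb. dist (inner (f (r n)) i) (inner l i) < e"
    by blast
  have "(\<lambda>n. inner (f (r n)) i) \<longlonglongrightarrow> inner l i" if "i \<in> onb" for i
    unfolding tendsto_iff
  proof (intro allI impI)
    fix e :: real assume "e > 0"
    then show "\<forall>\<^sub>F n in sequentially. dist (inner (f (r n)) i) (inner l i) < e"
      using l[of e] that by (auto elim: eventually_mono)
  qed
  then have "(\<lambda>n. \<Sum>i\<in>onb. inner (f (r n)) i *\<^sub>R i) \<longlonglongrightarrow> (\<Sum>i\<in>onb. inner l i *\<^sub>R i)"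
    by (intro tendsto_sum tendsto_scaleR tendsto_const)
  then have "(f \<circ> r) \<longlonglongrightarrow> l" by (simp add: onb_expand o_def)
  with r show "\<exists>l r. strict_mono r \<and> (f \<circ> r) \<longlonglongrightarrow> l" by blast
qed

instance finite_dim_inner \<subseteq> banach ..

text \<open>The charts of a product manifold take values in the product of the model spaces.\<close>

instance prod :: (finite_dim_inner, finite_dim_inner) finite_dim_inner
proof
  let ?B = "(\<lambda>b. (b, 0)) ` onb \<union> (\<lambda>b. (0, b)) ` onb :: ('a \<times> 'b) set"
  have "x = 0" if "\<forall>b\<in>?B. inner x b = 0" for x :: "'a \<times> 'b"
  proof -
    have "inner (fst x) b = 0" if "b \<in> onb" for b
      using bspec[OF \<open>\<forall>b\<in>?B. inner x b = 0\<close>, of "(b, 0)"] that by (simp add: inner_prod_def)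
    moreover have "inner (snd x) b = 0" if "b \<in> onb" for b
      using bspec[OF \<open>\<forall>b\<in>?B. inner x b = 0\<close>, of "(0, b)"] that by (simp add: inner_prod_def)
    ultimately show ?thesis
      using onb_expand[of "fst x"] onb_expand[of "snd x"] by (simp add: prod_eq_iff)
  qed
  then show "\<exists>B. finite B \<and> (\<forall>x::'a \<times> 'b. (\<forall>b\<in>B. inner x b = 0) \<longrightarrow> x = 0)"
    by (intro exI[of _ ?B]) simp
qed

section \<open>Calculus of finitely often differentiable maps\<close>

lemma Ck_on_cong:
  assumes "open S" "\<And>x. x \<in> S \<Longrightarrow> f x = g x" "Ck_on k f S"
  shows "Ck_on k g S"
  using assms(2,3)
proof (induction k arbitrary: f g)
  case 0
  then show ?case using continuous_on_cong by force
next
  case (Suc k)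
  have d: "frechet_derivative f (at x) = frechet_derivative g (at x)" if "x \<in> S" for x
    by (rule frechet_derivative_transform_within_open[OF _ assms(1) that])
      (use Suc.prems that in auto)
  have "g differentiable at x" if "x \<in> S" for x
    using Suc.prems that assms(1)
    by (metis Ck_on.simps(2) differentiable_def has_derivative_transform_within_open)
  moreover have "Ck_on k (\<lambda>x. frechet_derivative g (at x) v) S" for v
    by (rule Suc.IH[of "\<lambda>x. frechet_derivative f (at x) v"]) (use Suc.prems d in auto)
  ultimately show ?case by simp
qed

lemma Ck_on_SucD: "Ck_on (Suc k) f S \<Longrightarrow> Ck_on k f S"
proof (induction k arbitrary: f)
  case 0
  then have "f differentiable_on S" using differentiable_at_imp_differentiable_on[of S f] by auto
  then show ?case by (simp add: differentiable_imp_continuous_on)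
next
  case (Suc k)
  then show ?case by (metis Ck_on.simps(2))
qed

lemma Ck_on_subset: "Ck_on k f S \<Longrightarrow> T \<subseteq> S \<Longrightarrow> Ck_on k f T"
  by (induction k arbitrary: f) (auto intro: continuous_on_subset)

text \<open>Together with the elimination rule below, this trades the Frechet derivative operator
  for any family of derivatives, so that inductions on the order can use the usual differentiation
  rules.\<close>

lemma Ck_on_SucI:
  assumes "open S" "\<And>x. x \<in> S \<Longrightarrow> (f has_derivative f' x) (at x)"
    and "\<And>v. Ck_on k (\<lambda>x. f' x v) S"
  shows "Ck_on (Suc k) f S"
proof -
  have "frechet_derivative f (at x) = f' x" if "x \<in> S" for x
    using assms(2)[OF that] frechet_derivative_at by metis
  then have "Ck_on k (\<lambda>x. frechet_derivative f (at x) v) S" for v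
    using Ck_on_cong[OF assms(1) _ assms(3)[of v]] by simp
  then show ?thesis using assms(2) by (auto simp: differentiable_def)
qed

lemma Ck_on_SucE:
  assumes "Ck_on (Suc k) f S"
  obtains f' where "\<And>x. x \<in> S \<Longrightarrow> (f has_derivative f' x) (at x)"
    and "\<And>v. Ck_on k (\<lambda>x. f' x v) S"
  using assms frechet_derivative_works by fastforce

lemma Ck_on_const: "open S \<Longrightarrow> Ck_on k (\<lambda>x. c) S"
  by (induction k arbitrary: c) (auto intro!: Ck_on_SucI continuous_intros derivative_eq_intros simp del: Ck_on.simps(2))

lemma Ck_on_bounded_linear:
  assumes "open S" "bounded_linear L" shows "Ck_on k f S \<Longrightarrow> Ck_on k (\<lambda>x. L (f x)) S"
proof (induction k arbitrary: f)
  case 0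
  then show ?case using bounded_linear.continuous_on[OF assms(2)] by simp
next
  case (Suc k)
  obtain f' where f': "\<And>x. x \<in> S \<Longrightarrow> (f has_derivative f' x) (at x)"
    and k: "\<And>v. Ck_on k (\<lambda>x. f' x v) S" using Ck_on_SucE[OF Suc.prems] by blast
  show ?case
    by (rule Ck_on_SucI[OF assms(1), where f'="\<lambda>x v. L (f' x v)"])
      (use f' k Suc.IH in \<open>auto intro: bounded_linear.has_derivative[OF assms(2)]\<close>)
qed

lemma Ck_on_id: "open S \<Longrightarrow> Ck_on k (\<lambda>x. x) S"
proof (induction k)
  case (Suc k)
  show ?case
    by (rule Ck_on_SucI[OF Suc.prems, where f'="\<lambda>x v. v"]) (auto intro!: Ck_on_const Suc.prems)
qed simp

lemma Ck_on_add:
  assumes "open S" shows "Ck_on k f S \<Longrightarrow> Ck_on k g S \<Longrightarrow> Ck_on k (\<lambda>x. f x + g x) S"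
proof (induction k arbitrary: f g)
  case 0
  then show ?case by (simp add: continuous_on_add)
next
  case (Suc k)
  obtain f' where f': "\<And>x. x \<in> S \<Longrightarrow> (f has_derivative f' x) (at x)" "\<And>v. Ck_on k (\<lambda>x. f' x v) S"
    using Ck_on_SucE[OF Suc.prems(1)] by blast
  obtain g' where g': "\<And>x. x \<in> S \<Longrightarrow> (g has_derivative g' x) (at x)" "\<And>v. Ck_on k (\<lambda>x. g' x v) S"
    using Ck_on_SucE[OF Suc.prems(2)] by blast
  show ?case
    by (rule Ck_on_SucI[OF assms, where f'="\<lambda>x v. f' x v + g' x v"])
      (use f' g' Suc.IH in \<open>auto intro: has_derivative_add\<close>)
qed

lemma Ck_on_sum:
  assumes "open S" "\<And>i. i \<in> I \<Longrightarrow> Ck_on k (f i) S"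
  shows "Ck_on k (\<lambda>x. \<Sum>i\<in>I. f i x) S"
  using assms(2) by (induction I rule: infinite_finite_induct) (simp_all add: Ck_on_const Ck_on_add assms(1))

lemma Ck_on_bilinear:
  assumes "open S" "bounded_bilinear h"
  shows "Ck_on k f S \<Longrightarrow> Ck_on k g S \<Longrightarrow> Ck_on k (\<lambda>x. h (f x) (g x)) S"
proof (induction k arbitrary: f g)
  case 0
  then show ?case using bounded_bilinear.continuous_on[OF assms(2)] by auto
next
  case (Suc k)
  obtain f' where f': "\<And>x. x \<in> S \<Longrightarrow> (f has_derivative f' x) (at x)" "\<And>v. Ck_on k (\<lambda>x. f' x v) S"
    using Ck_on_SucE[OF Suc.prems(1)] by blast
  obtain g' where g': "\<And>x. x \<in> S \<Longrightarrow> (g has_derivative g' x) (at x)" "\<And>v. Ck_on k (\<lambda>x. g' x v) S"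
    using Ck_on_SucE[OF Suc.prems(2)] by blast
  show ?case
    by (rule Ck_on_SucI[OF assms(1), where f'="\<lambda>x v. h (f x) (g' x v) + h (f' x v) (g x)"])
      (intro bounded_bilinear.FDERIV[OF assms(2)] Ck_on_add[OF assms(1)] f' g' Suc.IH
        Ck_on_SucD[OF Suc.prems(1)] Ck_on_SucD[OF Suc.prems(2)]; assumption)+
qed

text \<open>The chain rule gives the derivative of \<open>g\<close> in the moving direction
  \<open>f' x v\<close>, whereas regularity is known for fixed directions only. Expansion in
  \<open>onb\<close> moves the dependence on \<open>x\<close> into scalar coefficients; this is
  where finite dimension enters.\<close>

lemma Ck_on_compose:
  fixes f :: "'a::real_normed_vector \<Rightarrow> 'e::finite_dim_inner"
  assumes "open S" "open T" "f ` S \<subseteq> T"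
  shows "Ck_on k g T \<Longrightarrow> Ck_on k f S \<Longrightarrow> Ck_on k (\<lambda>x. g (f x)) S"
proof (induction k arbitrary: g)
  case 0
  then show ?case using continuous_on_compose2 assms(3) by auto
next
  case (Suc k)
  obtain f' where f': "\<And>x. x \<in> S \<Longrightarrow> (f has_derivative f' x) (at x)" "\<And>v. Ck_on k (\<lambda>x. f' x v) S"
    using Ck_on_SucE[OF Suc.prems(2)] by blast
  obtain g' where g': "\<And>x. x \<in> T \<Longrightarrow> (g has_derivative g' x) (at x)" "\<And>v. Ck_on k (\<lambda>x. g' x v) T"
    using Ck_on_SucE[OF Suc.prems(1)] by blast
  have lin: "g' (f x) w = (\<Sum>b\<in>onb. inner w b *\<^sub>R g' (f x) b)" if "x \<in> S" for x w
    using linear_onb_expand g'(1) assms(3) that has_derivative_linear by blast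
  show ?case
  proof (rule Ck_on_SucI[OF assms(1), where f'="\<lambda>x v. \<Sum>b\<in>onb. inner (f' x v) b *\<^sub>R g' (f x) b"])
    fix x assume "x \<in> S"
    then have "((\<lambda>x. g (f x)) has_derivative (\<lambda>v. g' (f x) (f' x v))) (at x)"
      using has_derivative_compose[OF f'(1) g'(1)] assms(3) by blast
    then show "((\<lambda>x. g (f x)) has_derivative (\<lambda>v. \<Sum>b\<in>onb. inner (f' x v) b *\<^sub>R g' (f x) b)) (at x)"
      by (simp only: lin[OF \<open>x \<in> S\<close>, symmetric])
  next
    fix v
    show "Ck_on k (\<lambda>x. \<Sum>b\<in>onb. inner (f' x v) b *\<^sub>R g' (f x) b) S"
      by (intro Ck_on_sum Ck_on_bilinear[OF _ bounded_bilinear_scaleR] assms(1)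
          Ck_on_bounded_linear[OF _ bounded_linear_inner_left] f'(2) Suc.IH g'(2)
          Ck_on_SucD[OF Suc.prems(2)])
  qed
qed

lemma Ck_on_inverse:
  fixes f :: "'a::real_normed_vector \<Rightarrow> real"
  assumes "open S" "\<And>x. x \<in> S \<Longrightarrow> f x \<noteq> 0"
  shows "Ck_on k f S \<Longrightarrow> Ck_on k (\<lambda>x. inverse (f x)) S"
proof (induction k)
  case 0
  then show ?case using assms(2) by (auto intro: continuous_on_inverse)
next
  case (Suc k)
  obtain f' where f': "\<And>x. x \<in> S \<Longrightarrow> (f has_derivative f' x) (at x)" "\<And>v. Ck_on k (\<lambda>x. f' x v) S"
    using Ck_on_SucE[OF Suc.prems] by blast
  have i: "Ck_on k (\<lambda>x. inverse (f x)) S" using Suc Ck_on_SucD by blast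
  have m: "Ck_on k (\<lambda>x. - (inverse (f x) * f' x v * inverse (f x))) S" for v
    by (intro Ck_on_bounded_linear[OF assms(1) bounded_linear_minus[OF bounded_linear_ident]]
        Ck_on_bilinear[OF assms(1) bounded_bilinear_mult] i f'(2))
  show ?case
  proof (rule Ck_on_SucI[OF assms(1) _ m])
    show "((\<lambda>x. inverse (f x)) has_derivative (\<lambda>v. - (inverse (f x) * f' x v * inverse (f x)))) (at x)"
      if "x \<in> S" for x
      by (intro Deriv.has_derivative_inverse assms(2) f'(1) that)
  qed
qed

text \<open>The Frechet derivative at a point does not depend on the set considered, so regularity
  of each order is local.\<close>

lemma Ck_on_local:
  assumes "\<And>x. x \<in> S \<Longrightarrow> \<exists>N. open N \<and> x \<in> N \<and> Ck_on k f N"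
  shows "Ck_on k f S"
  using assms
proof (induction k arbitrary: f)
  case 0
  have "isCont f x" if "x \<in> S" for x
    using 0[OF that] by (auto simp: continuous_on_eq_continuous_at)
  then show ?case by (simp add: continuous_at_imp_continuous_on)
next
  case (Suc k)
  have "f differentiable (at x)" if "x \<in> S" for x
    using Suc.prems[OF that] by auto
  moreover have "Ck_on k (\<lambda>x. frechet_derivative f (at x) v) S" for v
  proof (rule Suc.IH)
    fix x assume "x \<in> S"
    then obtain N where "open N" "x \<in> N" "Ck_on (Suc k) f N" using Suc.prems by blast
    then show "\<exists>N. open N \<and> x \<in> N \<and> Ck_on k (\<lambda>x. frechet_derivative f (at x) v) N"
      by (intro exI[of _ N]) simp
  qed
  ultimately show ?case by simp
qed

section \<open>Smoothness at a point\<close>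

definition smooth_at :: "('e::real_normed_vector \<Rightarrow> 'b::real_normed_vector) \<Rightarrow> 'e \<Rightarrow> bool" where
  "smooth_at f x \<longleftrightarrow> (\<exists>N. open N \<and> x \<in> N \<and> smooth_on N f)"

text \<open>\<open>smooth_at\<close> asks for one neighbourhood that serves all orders. On open sets
  the pointwise notion loses nothing, and its closure rules carry no domains.\<close>

lemma smooth_on_iff_smooth_at: "open S \<Longrightarrow> smooth_on S f \<longleftrightarrow> (\<forall>x\<in>S. smooth_at f x)"
  unfolding smooth_at_def by (meson Ck_on_local smooth_on_def)

lemma smooth_at_cong:
  assumes "\<forall>\<^sub>F y in nhds x. f y = g y" "smooth_at f x"
  shows "smooth_at g x"
proof -
  obtain N where N: "open N" "x \<in> N" "smooth_on N f" using assms(2) unfolding smooth_at_def by blast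
  obtain N' where N': "open N'" "x \<in> N'" "\<And>y. y \<in> N' \<Longrightarrow> f y = g y"
    using assms(1) by (auto simp: eventually_nhds)
  have "smooth_on (N \<inter> N') g"
    unfolding smooth_on_def
  proof
    fix k
    have "Ck_on k f (N \<inter> N')" using N(3) Ck_on_subset unfolding smooth_on_def by blast
    then show "Ck_on k g (N \<inter> N')" using Ck_on_cong[of "N \<inter> N'" f g] N N' by auto
  qed
  then show ?thesis unfolding smooth_at_def using N N' by blast
qed

lemma smooth_at_cong_iff: "\<forall>\<^sub>F y in nhds x. f y = g y \<Longrightarrow> smooth_at f x \<longleftrightarrow> smooth_at g x"
  using smooth_at_cong[of f g x] smooth_at_cong[of g f x] by (auto simp: eq_commute)

lemma smooth_at_const [simp]: "smooth_at (\<lambda>x. c) x"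
  unfolding smooth_at_def smooth_on_def using Ck_on_const by blast

lemma smooth_at_id [simp]: "smooth_at (\<lambda>x. x) x"
  unfolding smooth_at_def smooth_on_def using Ck_on_id by blast

lemma smooth_at_bounded_linear:
  assumes "bounded_linear L" "smooth_at f x" shows "smooth_at (\<lambda>x. L (f x)) x"
  using assms(2) Ck_on_bounded_linear[OF _ assms(1)] unfolding smooth_at_def smooth_on_def by blast

lemma smooth_at_bilinear:
  assumes "bounded_bilinear h" "smooth_at f x" "smooth_at g x" shows "smooth_at (\<lambda>x. h (f x) (g x)) x"
proof -
  obtain N where N: "open N" "x \<in> N" "smooth_on N f" using assms(2) unfolding smooth_at_def by blast
  obtain N' where N': "open N'" "x \<in> N'" "smooth_on N' g" using assms(3) unfolding smooth_at_def by blast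
  have "smooth_on (N \<inter> N') (\<lambda>x. h (f x) (g x))"
    unfolding smooth_on_def
  proof
    fix k
    have "Ck_on k f (N \<inter> N')" "Ck_on k g (N \<inter> N')"
      using N(3) N'(3) unfolding smooth_on_def by (auto elim: Ck_on_subset)
    then show "Ck_on k (\<lambda>x. h (f x) (g x)) (N \<inter> N')"
      using Ck_on_bilinear[OF open_Int[OF N(1) N'(1)] assms(1)] by blast
  qed
  then show ?thesis unfolding smooth_at_def using N N' by blast
qed

lemma smooth_at_add: "smooth_at f x \<Longrightarrow> smooth_at g x \<Longrightarrow> smooth_at (\<lambda>x. f x + g x) x"
proof -
  assume "smooth_at f x" "smooth_at g x"
  then obtain N N' where N: "open N" "x \<in> N" "smooth_on N f" "open N'" "x \<in> N'" "smooth_on N' g"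
    unfolding smooth_at_def by blast
  have "smooth_on (N \<inter> N') (\<lambda>x. f x + g x)"
    unfolding smooth_on_def
  proof
    fix k
    have "Ck_on k f (N \<inter> N')" "Ck_on k g (N \<inter> N')"
      using N unfolding smooth_on_def by (auto elim: Ck_on_subset)
    then show "Ck_on k (\<lambda>x. f x + g x) (N \<inter> N')"
      using Ck_on_add[OF open_Int[OF N(1) N(4)]] by blast
  qed
  then show ?thesis unfolding smooth_at_def using N by blast
qed

lemma smooth_at_compose:
  fixes f :: "'a::real_normed_vector \<Rightarrow> 'e::finite_dim_inner"
  assumes "smooth_at g (f x)" "smooth_at f x"
  shows "smooth_at (\<lambda>x. g (f x)) x"
proof -
  obtain N where N: "open N" "x \<in> N" "smooth_on N f" using assms(2) unfolding smooth_at_def by blast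
  obtain T where T: "open T" "f x \<in> T" "smooth_on T g" using assms(1) unfolding smooth_at_def by blast
  have "continuous_on N f" using N(3) Ck_on.simps(1) unfolding smooth_on_def by blast
  then have o: "open (N \<inter> f -` T)"
    using continuous_on_open_vimage[OF N(1), of f] T(1) by (metis Int_commute)
  have "smooth_on (N \<inter> f -` T) (\<lambda>x. g (f x))"
    unfolding smooth_on_def
  proof
    fix k
    have "Ck_on k f (N \<inter> f -` T)" "Ck_on k g T"
      using N(3) T(3) unfolding smooth_on_def by (auto elim: Ck_on_subset)
    then show "Ck_on k (\<lambda>x. g (f x)) (N \<inter> f -` T)"
      using Ck_on_compose[OF o T(1), of f k g] by auto
  qed
  then show ?thesis unfolding smooth_at_def using o N(2) T(2) by (intro exI[of _ "N \<inter> f -` T"]) simp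
qed

lemma smooth_at_inverse:
  fixes f :: "'a::real_normed_vector \<Rightarrow> real"
  assumes "smooth_at f x" "f x \<noteq> 0"
  shows "smooth_at (\<lambda>x. inverse (f x)) x"
proof -
  obtain N where N: "open N" "x \<in> N" "smooth_on N f" using assms(1) unfolding smooth_at_def by blast
  have "continuous_on N f" using N(3) Ck_on.simps(1) unfolding smooth_on_def by blast
  then have o: "open (N \<inter> f -` (- {0}))"
    using continuous_on_open_vimage[OF N(1), of f] by (metis Int_commute open_Compl closed_singleton)
  have "smooth_on (N \<inter> f -` (- {0})) (\<lambda>x. inverse (f x))"
    unfolding smooth_on_def
  proof
    fix k
    have "Ck_on k f (N \<inter> f -` (- {0}))"
      using N(3) unfolding smooth_on_def by (auto elim: Ck_on_subset)
    then show "Ck_on k (\<lambda>x. inverse (f x)) (N \<inter> f -` (- {0}))"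
      by (intro Ck_on_inverse[OF o]) auto
  qed
  then show ?thesis unfolding smooth_at_def using o N(2) assms(2) by (intro exI[of _ "N \<inter> f -` (- {0})"]) simp
qed

lemma smooth_at_derivative:
  assumes "smooth_at f x" shows "smooth_at (\<lambda>x. frechet_derivative f (at x) v) x"
proof -
  obtain N where N: "open N" "x \<in> N" "smooth_on N f" using assms unfolding smooth_at_def by blast
  then have "Ck_on k (\<lambda>x. frechet_derivative f (at x) v) N" for k
    unfolding smooth_on_def using Ck_on.simps(2) by blast
  then show ?thesis unfolding smooth_at_def smooth_on_def using N by blast
qed

lemma smooth_at_has_derivative:
  assumes "smooth_at f x" shows "(f has_derivative frechet_derivative f (at x)) (at x)"
proof -
  obtain N where N: "open N" "x \<in> N" "smooth_on N f" using assms unfolding smooth_at_def by blast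
  then have "f differentiable at x" unfolding smooth_on_def using Ck_on.simps(2)[of 0] by blast
  then show ?thesis using frechet_derivative_works by blast
qed

lemma smooth_at_isCont: "smooth_at f x \<Longrightarrow> isCont f x"
  using smooth_at_has_derivative has_derivative_continuous by blast

lemma smooth_at_iter_deriv: "smooth_at f x \<Longrightarrow> smooth_at (iter_deriv l f) x"
proof (induction l arbitrary: x)
  case (Cons v l)
  then show ?case using smooth_at_derivative by auto
qed simp

lemma smooth_at_fst: "smooth_at f x \<Longrightarrow> smooth_at (\<lambda>x. fst (f x)) x"
  by (rule smooth_at_bounded_linear[OF bounded_linear_fst])
lemma smooth_at_snd: "smooth_at f x \<Longrightarrow> smooth_at (\<lambda>x. snd (f x)) x"
  by (rule smooth_at_bounded_linear[OF bounded_linear_snd])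
lemma smooth_at_minus: "smooth_at f x \<Longrightarrow> smooth_at (\<lambda>x. - f x) x"
  by (rule smooth_at_bounded_linear[OF bounded_linear_minus[OF bounded_linear_ident]])
lemma smooth_at_diff: "smooth_at f x \<Longrightarrow> smooth_at g x \<Longrightarrow> smooth_at (\<lambda>x. f x - g x) x"
  using smooth_at_add[OF _ smooth_at_minus, of f x g] by simp
lemma smooth_at_sum: "(\<And>i. i \<in> I \<Longrightarrow> smooth_at (f i) x) \<Longrightarrow> smooth_at (\<lambda>x. \<Sum>i\<in>I. f i x) x"
  by (induction I rule: infinite_finite_induct) (simp_all add: smooth_at_add)
lemma smooth_at_mult:
  fixes f g :: "'a::real_normed_vector \<Rightarrow> 'b::real_normed_algebra"
  shows "smooth_at f x \<Longrightarrow> smooth_at g x \<Longrightarrow> smooth_at (\<lambda>x. f x * g x) x"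
  by (rule smooth_at_bilinear[OF bounded_bilinear_mult])
lemma smooth_at_scaleR: "smooth_at f x \<Longrightarrow> smooth_at g x \<Longrightarrow> smooth_at (\<lambda>x. f x *\<^sub>R g x) x"
  by (rule smooth_at_bilinear[OF bounded_bilinear_scaleR])
lemma smooth_at_Re: "smooth_at f x \<Longrightarrow> smooth_at (\<lambda>x. Re (f x)) x"
  by (rule smooth_at_bounded_linear[OF bounded_linear_Re])
lemma smooth_at_Im: "smooth_at f x \<Longrightarrow> smooth_at (\<lambda>x. Im (f x)) x"
  by (rule smooth_at_bounded_linear[OF bounded_linear_Im])
lemma smooth_at_of_real: "smooth_at f x \<Longrightarrow> smooth_at (\<lambda>x. complex_of_real (f x)) x"
  by (rule smooth_at_bounded_linear[OF bounded_linear_of_real])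
lemma smooth_at_inner_left: "smooth_at f x \<Longrightarrow> smooth_at (\<lambda>x. inner (f x) b) x"
  by (rule smooth_at_bounded_linear[OF bounded_linear_inner_left])
lemma smooth_at_Pair:
  fixes f :: "'a::real_normed_vector \<Rightarrow> 'b::real_normed_vector"
    and g :: "'a \<Rightarrow> 'c::real_normed_vector"
  assumes "smooth_at f x" "smooth_at g x" shows "smooth_at (\<lambda>x. (f x, g x)) x"
proof -
  have l: "bounded_linear (\<lambda>y::'b. (y, 0::'c))" "bounded_linear (\<lambda>y::'c. (0::'b, y))"
    by (intro bounded_linear_Pair bounded_linear_ident bounded_linear_zero)+
  show ?thesis
    using smooth_at_add[OF smooth_at_bounded_linear[OF l(1) assms(1)] smooth_at_bounded_linear[OF l(2) assms(2)]]
    by simp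
qed

lemmas smooth_at_intros = smooth_at_const smooth_at_id smooth_at_add smooth_at_minus smooth_at_diff smooth_at_sum smooth_at_mult smooth_at_scaleR
  smooth_at_Re smooth_at_Im smooth_at_of_real smooth_at_inner_left smooth_at_Pair smooth_at_fst smooth_at_snd

subsection \<open>Bump functions\<close>

text \<open>One term of the exponential series is at most its sum.\<close>

lemma power_le_fact_exp:
  fixes x :: real assumes "x \<ge> 0" shows "x ^ m \<le> fact m * exp x"
proof -
  have "x ^ m /\<^sub>R fact m \<le> exp x"
    unfolding exp_def
    using sum_le_suminf[OF sums_summable[OF exp_converges[of x]], of "{m}"] assms
    by simp
  then show ?thesis by (simp add: field_simps)
qed

text \<open>The classical flat function exp(-1/t), multiplied by powers of 1/t so that derivatives
  are linear combinations of members of the family.\<close>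

definition flat_fun :: "nat \<Rightarrow> real \<Rightarrow> real" where
  "flat_fun n t = (if t \<le> 0 then 0 else exp (- inverse t) * inverse t ^ n)"

text \<open>The quadratic bound makes the difference quotient at 0 tend to 0, which is the only
  delicate point of differentiability.\<close>

lemma flat_fun_le: "\<bar>flat_fun n t\<bar> \<le> fact (n + 2) * t\<^sup>2"
proof (cases "t \<le> 0")
  case False
  \<comment> \<open>The exponent exceeds \<open>n\<close> by two so that a factor t^2 is left
    over.\<close>
  then have "inverse t ^ (n + 2) \<le> fact (n + 2) * exp (inverse t)"
    by (intro power_le_fact_exp) simp
  then have "inverse t ^ (n + 2) * exp (- inverse t) \<le> fact (n + 2) * exp (inverse t) * exp (- inverse t)"
    by (intro mult_right_mono) auto
  also have "\<dots> = fact (n + 2)" by (simp add: mult_exp_exp mult.assoc)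
  finally have "inverse t ^ (n + 2) * exp (- inverse t) * t\<^sup>2 \<le> fact (n + 2) * t\<^sup>2"
    by (intro mult_right_mono) auto
  moreover have "inverse t ^ (n + 2) * exp (- inverse t) * t\<^sup>2 = flat_fun n t"
    using False by (simp add: flat_fun_def power_add power2_eq_square field_simps)
  moreover have "flat_fun n t \<ge> 0" using False by (simp add: flat_fun_def)
  ultimately show ?thesis by simp
qed (simp add: flat_fun_def)

lemma flat_fun_deriv:
  "(flat_fun n has_real_derivative flat_fun (n + 2) t - real n * flat_fun (n + 1) t) (at t)"
proof -
  consider "t > 0" | "t < 0" | "t = 0" by linarith
  then show ?thesis
  proof cases
    case 1
    have "((\<lambda>t. exp (- inverse t) * inverse t ^ n) has_real_derivative
        flat_fun (n + 2) t - real n * flat_fun (n + 1) t) (at t)"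
    proof (cases n)
      case 0
      then show ?thesis using 1
        by (auto intro!: derivative_eq_intros simp: flat_fun_def power2_eq_square)
    next
      case (Suc m)
      show ?thesis unfolding Suc using 1
        by (auto intro!: derivative_eq_intros simp: flat_fun_def power2_eq_square algebra_simps)
          (metis One_nat_def power_eq_if)
    qed
    then show ?thesis
      by (rule has_field_derivative_transform_within_open[where S="{0<..}"])
        (use 1 in \<open>auto simp: flat_fun_def\<close>)
  next
    case 2
    have "((\<lambda>t. 0) has_real_derivative 0) (at t)" by simp
    then have "(flat_fun n has_real_derivative 0) (at t)"
      by (rule has_field_derivative_transform_within_open[where S="{..<0}"])
        (use 2 in \<open>auto simp: flat_fun_def\<close>)
    then show ?thesis using 2 by (simp add: flat_fun_def)
  next
    case 3
    have "((\<lambda>h. flat_fun n h / h) \<longlongrightarrow> 0) (at 0)"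
    proof (rule Lim_null_comparison)
      show "\<forall>\<^sub>F h in at 0. norm (flat_fun n h / h) \<le> fact (n + 2) * \<bar>h\<bar>"
      proof (rule eventuallyI)
        fix h :: real
        have "\<bar>flat_fun n h\<bar> \<le> (fact (n + 2) * \<bar>h\<bar>) * \<bar>h\<bar>"
          using flat_fun_le[of n h] by (simp only: mult.assoc abs_mult_self_eq power2_eq_square)
        then show "norm (flat_fun n h / h) \<le> fact (n + 2) * \<bar>h\<bar>"
          by (cases "h = 0") (simp_all only: real_norm_def abs_divide pos_divide_le_eq zero_less_abs_iff
              not_False_eq_True div_by_0 abs_zero mult_zero_right order_refl)
      qed
      show "((\<lambda>h::real. fact (n + 2) * \<bar>h\<bar>) \<longlongrightarrow> 0) (at 0)"
        by (auto intro!: tendsto_eq_intros)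
    qed
    then show ?thesis unfolding 3 DERIV_def by (simp add: flat_fun_def)
  qed
qed

lemma Ck_on_flat_fun: "Ck_on k (flat_fun n) UNIV"
proof (induction k arbitrary: n)
  case 0
  have "isCont (flat_fun n) t" for t using flat_fun_deriv DERIV_isCont by blast
  then show ?case by (simp add: continuous_at_imp_continuous_on)
next
  case (Suc k)
  show ?case
  proof (rule Ck_on_SucI[where f'="\<lambda>t v. (flat_fun (n + 2) t + (- real n) * flat_fun (n + 1) t) * v"])
    show "(flat_fun n has_derivative (\<lambda>v. (flat_fun (n + 2) t + (- real n) * flat_fun (n + 1) t) * v)) (at t)" for t
      using flat_fun_deriv[of n t] by (simp add: has_field_derivative_def)
    show "Ck_on k (\<lambda>t. (flat_fun (n + 2) t + (- real n) * flat_fun (n + 1) t) * v) UNIV" for v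
      by (intro Ck_on_bilinear[OF _ bounded_bilinear_mult] Ck_on_add Ck_on_const Suc.IH) auto
  qed simp
qed

lemma smooth_at_flat_fun: "smooth_at (flat_fun n) t"
  unfolding smooth_at_def smooth_on_def using Ck_on_flat_fun by blast

lemma ex_bump:
  fixes x0 :: "'e::finite_dim_inner"
  assumes "r > 0"
  obtains \<eta> :: "'e \<Rightarrow> real" where "\<And>x. smooth_at \<eta> x" "\<And>x. x \<in> cball x0 (r/2) \<Longrightarrow> \<eta> x = 1"
    "\<And>x. x \<notin> ball x0 r \<Longrightarrow> \<eta> x = 0"
proof -
  let ?\<rho> = "flat_fun 0"
  have nn: "?\<rho> t \<ge> 0" for t by (simp add: flat_fun_def)
  have pos: "?\<rho> t > 0" if "t > 0" for t using that by (simp add: flat_fun_def)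
  have ne: "?\<rho> t + ?\<rho> (1 - t) \<noteq> 0" for t
    using nn[of t] nn[of "1 - t"] pos[of t] pos[of "1 - t"] by (cases "t > 0") auto
  \<comment> \<open>A smooth step from 0 to 1: at each \<open>t\<close> one of \<open>t\<close> and
    \<open>1 - t\<close> is positive, so the denominator never vanishes.\<close>
  define s where "s t = ?\<rho> t * inverse (?\<rho> t + ?\<rho> (1 - t))" for t
  have ss: "smooth_at s t" for t
    unfolding s_def
    by (intro smooth_at_mult smooth_at_inverse smooth_at_add smooth_at_flat_fun ne
        smooth_at_compose[of "flat_fun 0" "\<lambda>t. 1 - t"] smooth_at_diff smooth_at_const smooth_at_id)
  have s1: "s t = 1" if "t \<ge> 1" for t
    using that ne[of t] by (auto simp: s_def flat_fun_def)
  have s0: "s t = 0" if "t \<le> 0" for t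
    using that by (auto simp: s_def flat_fun_def)
  \<comment> \<open>The factor 4/(3 r^2) normalises \<open>q\<close> to 1 at distance r/2, where r^2
    minus the squared distance is 3 r^2/4. At distance \<open>r\<close> the value is 0.\<close>
  define q where "q x = (r\<^sup>2 - inner (x - x0) (x - x0)) * (4 / (3 * r\<^sup>2))" for x
  have q: "smooth_at q x" for x
    unfolding q_def
    by (intro smooth_at_mult smooth_at_diff smooth_at_bilinear[OF bounded_bilinear_inner] smooth_at_const smooth_at_id)
  have n2: "inner (x - x0) (x - x0) = (dist x0 x)\<^sup>2" for x
    by (metis dist_norm dist_commute power2_norm_eq_inner)
  have q1: "q x \<ge> 1" if "x \<in> cball x0 (r/2)" for x
  proof -
    have "(dist x0 x)\<^sup>2 \<le> (r/2)\<^sup>2" using that by (intro power_mono) auto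
    then have "(r\<^sup>2 - (dist x0 x)\<^sup>2) * (4 / (3 * r\<^sup>2)) \<ge> (r\<^sup>2 * (3/4)) * (4 / (3 * r\<^sup>2))"
      by (intro mult_right_mono) (auto simp: power_divide)
    then show ?thesis using assms by (simp add: q_def n2)
  qed
  have q0: "q x \<le> 0" if "x \<notin> ball x0 r" for x
  proof -
    have "(dist x0 x)\<^sup>2 \<ge> r\<^sup>2" using that assms by (intro power_mono) auto
    then show ?thesis unfolding q_def n2 by (intro mult_nonpos_nonneg) auto
  qed
  show ?thesis
  proof (rule that[of "\<lambda>x. s (q x)"])
    show "smooth_at (\<lambda>x. s (q x)) x" for x by (rule smooth_at_compose[OF ss q])
  qed (use s1 s0 q1 q0 in auto)
qed

subsection \<open>Integrals depending smoothly on parameters\<close>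

text \<open>Leibniz's rule wants the derivative in \<open>x\<close> as a continuous map into the
  bounded linear operators. Only directional derivatives are known to be continuous, so the operator
  is assembled from its values on \<open>onb\<close>.\<close>

lemma has_derivative_param_integral:
  fixes F :: "'e::finite_dim_inner \<times> real \<Rightarrow> 'c::banach"
  assumes "open N" "x0 \<in> N"
    and d: "\<And>p. p \<in> N \<times> {0..1} \<Longrightarrow> (F has_derivative F' p) (at p)"
    and c: "\<And>v. continuous_on (N \<times> {0..1}) (\<lambda>p. F' p v)"
  shows "((\<lambda>x. integral {0..1} (\<lambda>t. F (x, t))) has_derivative
      (\<lambda>v. integral {0..1} (\<lambda>t. F' (x0, t) (v, 0)))) (at x0)"
proof -
  obtain e where e: "e > 0" "ball x0 e \<subseteq> N" using assms(1,2) openE by blast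
  define fx where "fx x t = (\<Sum>b\<in>onb. blinfun_scaleR_left (F' (x, t) (b, 0)) o\<^sub>L blinfun_inner_left b)" for x t
  have fx: "blinfun_apply (fx x t) v = F' (x, t) (v, 0)" if "x \<in> N" "t \<in> {0..1}" for x t v
  proof -
    have "linear (F' (x, t))" using d that has_derivative_linear by blast
    moreover have "linear (\<lambda>v::'e. (v, 0::real))" by (simp add: linear_iff)
    ultimately have "linear (\<lambda>v. F' (x, t) (v, 0))" using linear_compose[unfolded o_def] by blast
    then have "F' (x, t) (v, 0) = (\<Sum>b\<in>onb. inner v b *\<^sub>R F' (x, t) (b, 0))"
      using linear_onb_expand by blast
    then show ?thesis by (simp add: fx_def blinfun.sum_left)
  qed
  have cont: "continuous_on (ball x0 e \<times> cbox 0 1) (\<lambda>(x, t). fx x t)"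
    unfolding fx_def split_beta
    by (intro continuous_on_sum bounded_bilinear.continuous_on[OF bounded_bilinear_blinfun_compose]
        bounded_linear.continuous_on[OF bounded_linear_blinfun_scaleR_left] continuous_on_const)
      (use e(2) in \<open>auto intro!: continuous_on_subset[OF c]\<close>)
  have Fc: "continuous_on (N \<times> {0..1}) F"
    using d by (meson continuous_at_imp_continuous_on has_derivative_continuous)
  have "((\<lambda>x. integral (cbox 0 1) (\<lambda>t. F (x, t))) has_derivative integral (cbox 0 1) (fx x0)) (at x0 within ball x0 e)"
  proof (rule leibniz_rule[OF _ _ cont])
    fix x t assume xt: "x \<in> ball x0 e" "t \<in> cbox (0::real) 1"
    then have "x \<in> N" and t: "t \<in> {0..1}" using e by auto
    have "((\<lambda>x. F (x, t)) has_derivative (\<lambda>v. F' (x, t) (v, 0))) (at x)"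
      by (rule has_derivative_compose[of "\<lambda>x. (x, t)" "\<lambda>v. (v, 0)" x UNIV F])
        (use d \<open>x \<in> N\<close> t in \<open>auto intro!: derivative_eq_intros\<close>)
    moreover have "(\<lambda>v. F' (x, t) (v, 0)) = blinfun_apply (fx x t)"
      using fx[OF \<open>x \<in> N\<close> t] by auto
    ultimately show "((\<lambda>x. F (x, t)) has_derivative blinfun_apply (fx x t)) (at x within ball x0 e)"
      using has_derivative_at_withinI by metis
  next
    fix x assume "x \<in> ball x0 e"
    then show "(\<lambda>t. F (x, t)) integrable_on cbox 0 1"
      using e(2) by (intro integrable_continuous continuous_on_compose2[OF Fc]) (auto intro!: continuous_intros)
  qed (use e in auto)
  then have "((\<lambda>x. integral (cbox 0 1) (\<lambda>t. F (x, t))) has_derivative integral (cbox 0 1) (fx x0)) (at x0)"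
    using at_within_open[of x0 "ball x0 e"] e by simp
  moreover have "blinfun_apply (integral {0..1} (fx x0)) = (\<lambda>v. integral {0..1} (\<lambda>t. F' (x0, t) (v, 0)))"
  proof
    fix v
    have "continuous_on {0..1} (\<lambda>t. (\<lambda>(x, t). fx x t) (x0, t))"
      by (rule continuous_on_compose2[OF cont]) (use e in \<open>auto intro!: continuous_intros\<close>)
    then have "fx x0 integrable_on {0..1}" by (intro integrable_continuous_real) simp
    from integral_linear[OF this blinfun.bounded_linear_left]
    have "blinfun_apply (integral {0..1} (fx x0)) v = integral {0..1} (\<lambda>t. blinfun_apply (fx x0 t) v)"
      by (simp add: o_def)
    also have "\<dots> = integral {0..1} (\<lambda>t. F' (x0, t) (v, 0))"
      by (intro integral_cong fx assms(2))
    finally show "blinfun_apply (integral {0..1} (fx x0)) v = integral {0..1} (\<lambda>t. F' (x0, t) (v, 0))" .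
  qed
  ultimately show ?thesis by simp
qed

text \<open>The interval (-1, 2) is an open neighbourhood of [0, 1]: \<open>Ck_on\<close> is meant
  for open sets, while the integral runs over a closed interval.\<close>

lemma Ck_on_param_integral:
  fixes F :: "'e::finite_dim_inner \<times> real \<Rightarrow> 'c::banach"
  assumes "open N"
  shows "Ck_on k F (N \<times> {-1<..<2}) \<Longrightarrow> Ck_on k (\<lambda>x. integral {0..1} (\<lambda>t. F (x, t))) N"
proof (induction k arbitrary: F)
  case 0
  have "continuous_on (N \<times> cbox 0 1) (\<lambda>(x, t). F (x, t))"
    using 0 by (auto intro: continuous_on_subset)
  from integral_continuous_on_param[OF this] show ?case by simp
next
  case (Suc k)
  obtain F' where F': "\<And>p. p \<in> N \<times> {-1<..<2} \<Longrightarrow> (F has_derivative F' p) (at p)"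
    "\<And>v. Ck_on k (\<lambda>p. F' p v) (N \<times> {-1<..<2})" using Ck_on_SucE[OF Suc.prems] by blast
  have F'c: "Ck_on 0 (\<lambda>p. F' p v) (N \<times> {-1<..<2})" for v
  proof -
    have "Ck_on j f S \<Longrightarrow> Ck_on 0 f S" for j and f :: "'e \<times> real \<Rightarrow> 'c" and S
      by (induction j) (use Ck_on_SucD in blast)+
    then show ?thesis using F'(2) by blast
  qed
  show ?case
  proof (rule Ck_on_SucI[OF assms])
    fix x assume "x \<in> N"
    then show "((\<lambda>x. integral {0..1} (\<lambda>t. F (x, t))) has_derivative
      (\<lambda>v. integral {0..1} (\<lambda>t. F' (x, t) (v, 0)))) (at x)"
      by (intro has_derivative_param_integral[OF assms])
        (use F'(1) F'c in \<open>auto intro: continuous_on_subset[of "N \<times> {- 1<..<2}"]\<close>)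
  next
    show "Ck_on k (\<lambda>x. integral {0..1} (\<lambda>t. F' (x, t) (v, 0))) N" for v
      using Suc.IH[OF F'(2)] .
  qed
qed

text \<open>Halving the radius absorbs the factor |t| < 2 that comes from the enlarged parameter
  interval.\<close>

lemma segment_in_ball:
  fixes y0 :: "'e::real_normed_vector"
  assumes "y \<in> ball y0 (r/2)" "t \<in> {-1<..<2}"
  shows "y0 + t *\<^sub>R (y - y0) \<in> ball y0 r"
proof -
  have "\<bar>t\<bar> \<le> 2" using assms(2) by auto
  then have "\<bar>t\<bar> * norm (y - y0) \<le> 2 * norm (y - y0)" by (intro mult_right_mono) auto
  also have "\<dots> < r" using assms(1) by (simp add: dist_norm norm_minus_commute)
  finally show ?thesis by (simp add: dist_norm)
qed

lemma smooth_at_segment_integral: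
  fixes k :: "'e::finite_dim_inner \<times> 'z::finite_dim_inner \<Rightarrow> 'c::banach"
  assumes "open Z" "\<And>p. p \<in> ball y0 r \<times> Z \<Longrightarrow> smooth_at k p"
    and "y \<in> ball y0 (r/2)" "z \<in> Z"
  shows "smooth_at (\<lambda>p. integral {0..1} (\<lambda>t. k (y0 + t *\<^sub>R (fst p - y0), snd p))) (y, z)"
proof -
  define F where "F q = k (y0 + snd q *\<^sub>R (fst (fst q) - y0), snd (fst q))" for q
  have o: "open ((ball y0 (r/2) \<times> Z) \<times> {-1<..<2::real})" using assms(1) by (intro open_Times) auto
  have "smooth_at F q" if "q \<in> (ball y0 (r/2) \<times> Z) \<times> {-1<..<2}" for q
    unfolding F_def
  proof (rule smooth_at_compose[where g=k])
    show "smooth_at k (y0 + snd q *\<^sub>R (fst (fst q) - y0), snd (fst q))"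
      using that segment_in_ball by (intro assms(2)) (auto simp: mem_Times_iff)
    show "smooth_at (\<lambda>q. (y0 + snd q *\<^sub>R (fst (fst q) - y0), snd (fst q))) q"
      by (intro smooth_at_intros)
  qed
  then have "smooth_on ((ball y0 (r/2) \<times> Z) \<times> {-1<..<2}) F"
    using smooth_on_iff_smooth_at[OF o] by blast
  then have "smooth_on (ball y0 (r/2) \<times> Z) (\<lambda>x. integral {0..1} (\<lambda>t. F (x, t)))"
    unfolding smooth_on_def using Ck_on_param_integral open_Times[OF open_ball assms(1)] by blast
  then show ?thesis unfolding F_def smooth_at_def
    using assms(1,3,4) by (intro exI[of _ "ball y0 (r/2) \<times> Z"]) (auto intro: open_Times)
qed

text \<open>The fundamental theorem of calculus along the segment from \<open>y0\<close> to
  \<open>y\<close>. Expanding the direction \<open>y - y0\<close> in \<open>onb\<close> leaves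
  integrals of derivatives in fixed directions, the form that Hadamard's lemma needs.\<close>

lemma segment_fundamental_theorem:
  fixes f :: "'e::finite_dim_inner \<Rightarrow> 'c::banach"
  assumes d: "\<And>y. y \<in> ball y0 r \<Longrightarrow> (f has_derivative f' y) (at y)"
    and c: "\<And>b. continuous_on (ball y0 r) (\<lambda>y. f' y b)"
    and y: "y \<in> ball y0 r"
  shows "f y = f y0 + (\<Sum>b\<in>onb. inner (y - y0) b *\<^sub>R integral {0..1} (\<lambda>t. f' (y0 + t *\<^sub>R (y - y0)) b))"
proof -
  have sub: "y0 + t *\<^sub>R (y - y0) \<in> ball y0 r" if "t \<in> {0..1}" for t
  proof -
    have "\<bar>t\<bar> * norm (y - y0) \<le> 1 * norm (y - y0)" using that by (intro mult_right_mono) auto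
    also have "\<dots> < r" using y by (simp add: dist_norm norm_minus_commute)
    finally show ?thesis by (simp add: dist_norm)
  qed
  have "((\<lambda>t. f' (y0 + t *\<^sub>R (y - y0)) (y - y0)) has_integral
      (f (y0 + 1 *\<^sub>R (y - y0)) - f (y0 + 0 *\<^sub>R (y - y0)))) {0..1}"
  proof (rule fundamental_theorem_of_calculus[where f="\<lambda>t. f (y0 + t *\<^sub>R (y - y0))"])
    fix t :: real assume t: "t \<in> {0..1}"
    have "((\<lambda>t. f (y0 + t *\<^sub>R (y - y0))) has_derivative (\<lambda>s. f' (y0 + t *\<^sub>R (y - y0)) (s *\<^sub>R (y - y0)))) (at t)"
      by (rule has_derivative_compose[where f="\<lambda>t. y0 + t *\<^sub>R (y - y0)"])
        (use d[OF sub[OF t]] in \<open>auto intro!: derivative_eq_intros\<close>)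
    moreover have "linear (f' (y0 + t *\<^sub>R (y - y0)))" using d[OF sub[OF t]] has_derivative_linear by blast
    ultimately show "((\<lambda>t. f (y0 + t *\<^sub>R (y - y0))) has_vector_derivative f' (y0 + t *\<^sub>R (y - y0)) (y - y0)) (at t within {0..1})"
      unfolding has_vector_derivative_def by (simp add: linear_cmul has_derivative_at_withinI)
  qed simp
  then have "f y - f y0 = integral {0..1} (\<lambda>t. f' (y0 + t *\<^sub>R (y - y0)) (y - y0))"
    by (simp add: integral_unique)
  also have "\<dots> = integral {0..1} (\<lambda>t. \<Sum>b\<in>onb. inner (y - y0) b *\<^sub>R f' (y0 + t *\<^sub>R (y - y0)) b)"
    using linear_onb_expand[OF has_derivative_linear[OF d[OF sub]]] by (intro integral_cong) blast
  also have "\<dots> = (\<Sum>b\<in>onb. integral {0..1} (\<lambda>t. inner (y - y0) b *\<^sub>R f' (y0 + t *\<^sub>R (y - y0)) b))"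
    by (intro integral_sum integrable_continuous_real continuous_intros continuous_on_compose2[OF c])
      (use sub in auto)
  finally have "f y - f y0 =
    (\<Sum>b\<in>onb. inner (y - y0) b *\<^sub>R integral {0..1} (\<lambda>t. f' (y0 + t *\<^sub>R (y - y0)) b))"
    by simp
  then show ?thesis by (metis add.commute diff_add_cancel)
qed

section \<open>Iterated derivatives of segment integrals\<close>

lemma iter_deriv_cong:
  assumes "open S" "\<And>x. x \<in> S \<Longrightarrow> f x = g x" "\<And>x. x \<in> S \<Longrightarrow> smooth_at f x" "x \<in> S"
  shows "iter_deriv l f x = iter_deriv l g x"
  using assms(4)
proof (induction l arbitrary: x)
  case (Cons v l)
  have "frechet_derivative (iter_deriv l f) (at x) = frechet_derivative (iter_deriv l g) (at x)"
    by (rule frechet_derivative_transform_within_open[OF _ assms(1) Cons.prems Cons.IH])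
      (use smooth_at_has_derivative[OF smooth_at_iter_deriv[OF assms(3)[OF Cons.prems]]] in
        \<open>auto simp: differentiable_def\<close>)
  then show ?case by simp
qed (use assms(2) in simp)

text \<open>The variable \<open>y\<close> enters only through t (y - y0), so by the chain rule each
  derivative contributes one factor \<open>t\<close>.\<close>

lemma iter_deriv_segment_integral:
  fixes k :: "'e::finite_dim_inner \<Rightarrow> 'c::banach"
  assumes "\<And>p. p \<in> ball y0 r \<Longrightarrow> smooth_at k p" and "y \<in> ball y0 (r/2)"
  shows "iter_deriv l (\<lambda>y. integral {0..1} (\<lambda>t. k (y0 + t *\<^sub>R (y - y0)))) y =
    integral {0..1} (\<lambda>t. t ^ length l *\<^sub>R iter_deriv l k (y0 + t *\<^sub>R (y - y0)))"
  using assms(2)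
proof (induction l arbitrary: y)
  case (Cons v l)
  let ?I = "\<lambda>y. integral {0..1} (\<lambda>t. t ^ length l *\<^sub>R iter_deriv l k (y0 + t *\<^sub>R (y - y0)))"
  define K where "K q = snd q ^ length l *\<^sub>R iter_deriv l k (y0 + snd q *\<^sub>R (fst q - y0))" for q :: "'e \<times> real"
  have sK: "smooth_at K q" if "q \<in> ball y0 (r/2) \<times> {-1<..<2}" for q
  proof -
    have "smooth_at (iter_deriv l k) (y0 + snd q *\<^sub>R (fst q - y0))"
      using that segment_in_ball by (intro smooth_at_iter_deriv assms(1)) (auto simp: mem_Times_iff)
    then have "smooth_at (\<lambda>q. iter_deriv l k (y0 + snd q *\<^sub>R (fst q - y0))) q"
      by (rule smooth_at_compose) (intro smooth_at_intros)
    moreover have "smooth_at (\<lambda>q::'e \<times> real. snd q ^ n) q" for n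
      by (induction n) (auto intro!: smooth_at_intros)
    ultimately show ?thesis unfolding K_def by (intro smooth_at_scaleR)
  qed
  have KD: "frechet_derivative K (at (y, t)) (v, 0) =
      t ^ Suc (length l) *\<^sub>R frechet_derivative (iter_deriv l k) (at (y0 + t *\<^sub>R (y - y0))) v"
    if "t \<in> {0..1}" for t
  proof -
    have yt: "(y, t) \<in> ball y0 (r/2) \<times> {-1<..<2}" using that Cons.prems by auto
    have "(K has_derivative frechet_derivative K (at (y, t))) (at (y, t))"
      using smooth_at_has_derivative[OF sK[OF yt]] .
    then have 1: "((\<lambda>y. K (y, t)) has_derivative (\<lambda>v. frechet_derivative K (at (y, t)) (v, 0))) (at y)"
      by (rule has_derivative_compose[of "\<lambda>x. (x, t)" "\<lambda>v. (v, 0)" y UNIV K, rotated])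
        (auto intro!: derivative_eq_intros)
    have s: "smooth_at (iter_deriv l k) (y0 + t *\<^sub>R (y - y0))"
      using segment_in_ball yt by (intro smooth_at_iter_deriv assms(1)) auto
    have D: "((\<lambda>y. iter_deriv l k (y0 + t *\<^sub>R (y - y0))) has_derivative
        (\<lambda>v. frechet_derivative (iter_deriv l k) (at (y0 + t *\<^sub>R (y - y0))) (t *\<^sub>R v))) (at y)"
      by (rule has_derivative_compose[of "\<lambda>y. y0 + t *\<^sub>R (y - y0)", OF _ smooth_at_has_derivative[OF s]])
        (auto intro!: derivative_eq_intros)
    then have 2: "((\<lambda>y. K (y, t)) has_derivative (\<lambda>v. t ^ length l *\<^sub>R
        frechet_derivative (iter_deriv l k) (at (y0 + t *\<^sub>R (y - y0))) (t *\<^sub>R v))) (at y)"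
      unfolding K_def by (auto intro!: has_derivative_scaleR_right)
    have "frechet_derivative K (at (y, t)) (v, 0) = t ^ length l *\<^sub>R
        frechet_derivative (iter_deriv l k) (at (y0 + t *\<^sub>R (y - y0))) (t *\<^sub>R v)"
      using has_derivative_unique[OF 1 2] by meson
    then show ?thesis
      by (simp add: linear_cmul[OF has_derivative_linear[OF smooth_at_has_derivative[OF s]]] mult.commute)
  qed
  have der: "(?I has_derivative (\<lambda>v. integral {0..1} (\<lambda>t. frechet_derivative K (at (y, t)) (v, 0)))) (at y)"
  proof -
    have "continuous_on (ball y0 (r/2) \<times> {0..1}) (\<lambda>p. frechet_derivative K (at p) v)" for v
      by (intro continuous_at_imp_continuous_on ballI smooth_at_isCont smooth_at_derivative sK) auto
    then have "((\<lambda>x. integral {0..1} (\<lambda>t. K (x, t))) has_derivative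
      (\<lambda>v. integral {0..1} (\<lambda>t. frechet_derivative K (at (y, t)) (v, 0)))) (at y)"
      using Cons.prems
      by (intro has_derivative_param_integral[OF open_ball]) (auto intro!: smooth_at_has_derivative sK)
    then show ?thesis by (simp add: K_def)
  qed
  have "iter_deriv (v # l) (\<lambda>y. integral {0..1} (\<lambda>t. k (y0 + t *\<^sub>R (y - y0)))) y = frechet_derivative ?I (at y) v"
  proof -
    have "frechet_derivative ?I (at y) =
      frechet_derivative (iter_deriv l (\<lambda>y. integral {0..1} (\<lambda>t. k (y0 + t *\<^sub>R (y - y0))))) (at y)"
      by (rule frechet_derivative_transform_within_open[OF _ open_ball Cons.prems])
        (use der Cons.IH in \<open>auto simp: differentiable_def\<close>)
    then show ?thesis by simp
  qed
  also have "\<dots> = integral {0..1} (\<lambda>t. frechet_derivative K (at (y, t)) (v, 0))"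
    using frechet_derivative_at[OF der] by metis
  also have "\<dots> = integral {0..1} (\<lambda>t. t ^ Suc (length l) *\<^sub>R iter_deriv (v # l) k (y0 + t *\<^sub>R (y - y0)))"
    using KD by (intro integral_cong) simp
  finally show ?case by simp
qed simp

text \<open>At the centre the derivative of \<open>k\<close> is constant in \<open>t\<close>, and
  t^r integrates to 1/(r + 1) over [0, 1]. These factors accumulate to the 1/r! of Taylor's
  formula.\<close>

lemma iter_deriv_segment_integral_center:
  fixes k :: "'e::finite_dim_inner \<Rightarrow> complex"
  assumes "r > 0" "\<And>p. p \<in> ball y0 r \<Longrightarrow> smooth_at k p"
  shows "iter_deriv l (\<lambda>y. integral {0..1} (\<lambda>t. k (y0 + t *\<^sub>R (y - y0)))) y0 =
    iter_deriv l k y0 / (of_nat (length l) + 1)"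
proof -
  have "((\<lambda>t::real. t ^ n) has_integral (1 / (real n + 1))) {0..1}" for n
  proof -
    have "((\<lambda>t::real. t ^ n) has_integral (1 ^ Suc n / (real n + 1) - 0 ^ Suc n / (real n + 1))) {0..1}"
      by (rule fundamental_theorem_of_calculus)
        (auto intro!: derivative_eq_intros simp: has_real_derivative_iff_has_vector_derivative[symmetric]
           simp del: power_Suc simp: add.commute)
    then show ?thesis by simp
  qed
  from has_integral_scaleR_left[OF this, of "length l" "iter_deriv l k y0"]
  have "integral {0..1} (\<lambda>t. t ^ length l *\<^sub>R iter_deriv l k y0) = (1 / (real (length l) + 1)) *\<^sub>R iter_deriv l k y0"
    by (rule integral_unique)
  then show ?thesis
    using iter_deriv_segment_integral[OF assms(2), of y0 r y0 l] assms(1)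
    by (simp add: scaleR_conv_of_real)
qed

section \<open>Calculus on manifolds\<close>

definition msmooth_at ::
  "('a, 'e::real_normed_vector) atlas \<Rightarrow> ('a \<Rightarrow> 'b::real_normed_vector) \<Rightarrow> 'a \<Rightarrow> bool" where
  "msmooth_at \<A> f p \<longleftrightarrow> (\<forall>(U, \<phi>)\<in>\<A>. p \<in> U \<longrightarrow> smooth_at (f \<circ> inv_into U \<phi>) (\<phi> p))"

locale manifold =
  fixes \<A> :: "('a::{t2_space,second_countable_topology}, 'e::finite_dim_inner) atlas"
  assumes atlas: "smooth_atlas \<A>"
begin

abbreviation "S \<equiv> smooth_funs \<A>"

lemma ex_chart: obtains U \<phi> where "(U, \<phi>) \<in> \<A>" "p \<in> U"
proof -
  have "(\<Union>(U, \<phi>)\<in>\<A>. U) = UNIV" using atlas unfolding smooth_atlas_def by (elim conjE)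
  then have "p \<in> (\<Union>(U, \<phi>)\<in>\<A>. U)" by simp
  then show ?thesis using that by auto
qed

lemma
  assumes "(U, \<phi>) \<in> \<A>"
  shows chart_open: "open U" and chart_open_image: "open (\<phi> ` U)"
    and chart_homeo: "homeomorphism U (\<phi> ` U) \<phi> (inv_into U \<phi>)"
  using assms atlas unfolding smooth_atlas_def by blast+

lemma chart_inj: "(U, \<phi>) \<in> \<A> \<Longrightarrow> inj_on \<phi> U"
  using chart_homeo homeomorphism_apply1 inj_on_inverseI by metis

lemma chart_inv [simp]: "(U, \<phi>) \<in> \<A> \<Longrightarrow> p \<in> U \<Longrightarrow> inv_into U \<phi> (\<phi> p) = p"
  by (simp add: chart_inj inv_into_f_f)

lemma chart_trans:
  "(U, \<phi>) \<in> \<A> \<Longrightarrow> (V, \<psi>) \<in> \<A> \<Longrightarrow> smooth_on (\<phi> ` (U \<inter> V)) (\<psi> \<circ> inv_into U \<phi>)"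
  using atlas unfolding smooth_atlas_def by blast

lemma chart_image_open:
  assumes "(U, \<phi>) \<in> \<A>" "open N" shows "open (\<phi> ` (U \<inter> N))"
proof -
  have "open (inv_into U \<phi> -` N \<inter> \<phi> ` U)"
    using continuous_on_open_vimage[OF chart_open_image[OF assms(1)]] assms(2)
      homeomorphism_cont2[OF chart_homeo[OF assms(1)]] by metis
  also have "inv_into U \<phi> -` N \<inter> \<phi> ` U = \<phi> ` (U \<inter> N)"
    using assms(1) by (auto simp: image_iff) 
  finally show ?thesis .
qed

lemma eventually_chart:
  assumes "(U, \<phi>) \<in> \<A>" "p \<in> U" "\<forall>\<^sub>F q in nhds p. P q"
  shows "\<forall>\<^sub>F y in nhds (\<phi> p). y \<in> \<phi> ` U \<and> P (inv_into U \<phi> y)"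
proof -
  obtain N where N: "open N" "p \<in> N" "\<And>q. q \<in> N \<Longrightarrow> P q"
    using assms(3) by (auto simp: eventually_nhds)
  show ?thesis unfolding eventually_nhds
    using chart_image_open[OF assms(1) N(1)] N assms by (intro exI[of _ "\<phi> ` (U \<inter> N)"]) auto
qed

lemma eventually_chart_inv:
  assumes "(U, \<phi>) \<in> \<A>" "p \<in> U" "\<forall>\<^sub>F y in nhds (\<phi> p). P y"
  shows "\<forall>\<^sub>F q in nhds p. q \<in> U \<and> P (\<phi> q)"
proof -
  obtain N where N: "open N" "\<phi> p \<in> N" "\<And>q. q \<in> N \<Longrightarrow> P q"
    using assms(3) by (auto simp: eventually_nhds)
  have "open (\<phi> -` N \<inter> U)"
    using continuous_on_open_vimage[OF chart_open[OF assms(1)]] N(1)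
      homeomorphism_cont1[OF chart_homeo[OF assms(1)]] by metis
  then show ?thesis unfolding eventually_nhds
    using N assms by (intro exI[of _ "\<phi> -` N \<inter> U"]) auto
qed

lemma msmooth_atD: "msmooth_at \<A> f p \<Longrightarrow> (U, \<phi>) \<in> \<A> \<Longrightarrow> p \<in> U \<Longrightarrow> smooth_at (f \<circ> inv_into U \<phi>) (\<phi> p)"
  unfolding msmooth_at_def by blast

text \<open>One chart suffices: near \<open>p\<close> the expression in any other chart is the given
  one composed with a smooth transition map.\<close>

lemma msmooth_atI:
  assumes U: "(U, \<phi>) \<in> \<A>" "p \<in> U" "smooth_at (f \<circ> inv_into U \<phi>) (\<phi> p)"
  shows "msmooth_at \<A> f p"
  unfolding msmooth_at_def
proof safe
  fix V \<psi> assume V: "(V, \<psi>) \<in> \<A>" "p \<in> V"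
  have o: "open (\<psi> ` (V \<inter> U))" using chart_image_open V(1) chart_open[OF U(1)] by blast
  have "smooth_at (\<phi> \<circ> inv_into V \<psi>) (\<psi> p)"
    using chart_trans[OF V(1) U(1)] smooth_on_iff_smooth_at[OF o] U V by blast
  moreover have "(\<phi> \<circ> inv_into V \<psi>) (\<psi> p) = \<phi> p" using V by simp
  ultimately have "smooth_at (\<lambda>y. (f \<circ> inv_into U \<phi>) ((\<phi> \<circ> inv_into V \<psi>) y)) (\<psi> p)"
    using smooth_at_compose[of "f \<circ> inv_into U \<phi>" "\<phi> \<circ> inv_into V \<psi>" "\<psi> p"] U(3) by metis
  moreover have "\<forall>\<^sub>F y in nhds (\<psi> p). (f \<circ> inv_into U \<phi>) ((\<phi> \<circ> inv_into V \<psi>) y) = (f \<circ> inv_into V \<psi>) y"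
    unfolding eventually_nhds using o U V by (intro exI[of _ "\<psi> ` (V \<inter> U)"]) auto
  ultimately show "smooth_at (f \<circ> inv_into V \<psi>) (\<psi> p)" using smooth_at_cong by metis
qed

lemma msmooth_at_iff:
  "(U, \<phi>) \<in> \<A> \<Longrightarrow> p \<in> U \<Longrightarrow> msmooth_at \<A> f p \<longleftrightarrow> smooth_at (\<lambda>y. f (inv_into U \<phi> y)) (\<phi> p)"
  using msmooth_atI[of U \<phi> p f] msmooth_atD[of f p U \<phi>] by (auto simp: o_def)

lemma smooth_funs_iff: "f \<in> S \<longleftrightarrow> (\<forall>p. msmooth_at \<A> f p)"
proof
  assume f: "f \<in> S"
  show "\<forall>p. msmooth_at \<A> f p"
  proof
    fix p
    obtain U \<phi> where U: "(U, \<phi>) \<in> \<A>" "p \<in> U" using ex_chart .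
    then have "smooth_on (\<phi> ` U) (f \<circ> inv_into U \<phi>)" using f unfolding smooth_funs_def by blast
    then have "smooth_at (f \<circ> inv_into U \<phi>) (\<phi> p)"
      using U(2) smooth_on_iff_smooth_at[OF chart_open_image[OF U(1)]] by blast
    then show "msmooth_at \<A> f p" by (rule msmooth_atI[OF U])
  qed
next
  assume *: "\<forall>p. msmooth_at \<A> f p"
  have "smooth_on (\<phi> ` U) (f \<circ> inv_into U \<phi>)" if U: "(U, \<phi>) \<in> \<A>" for U \<phi>
    using msmooth_atD[OF *[rule_format] U] by (auto simp: smooth_on_iff_smooth_at[OF chart_open_image[OF U]])
  then show "f \<in> S" unfolding smooth_funs_def by blast
qed

lemma smooth_funsD: "f \<in> S \<Longrightarrow> msmooth_at \<A> f p" by (simp add: smooth_funs_iff)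

lemma msmooth_at_cong:
  assumes "\<forall>\<^sub>F q in nhds p. f q = g q" "msmooth_at \<A> f p" shows "msmooth_at \<A> g p"
proof -
  obtain U \<phi> where U: "(U, \<phi>) \<in> \<A>" "p \<in> U" using ex_chart .
  have "\<forall>\<^sub>F y in nhds (\<phi> p). f (inv_into U \<phi> y) = g (inv_into U \<phi> y)"
    using eventually_chart[OF U assms(1)] by (rule eventually_mono) simp
  then show ?thesis using assms(2) unfolding msmooth_at_iff[OF U] by (rule smooth_at_cong)
qed

lemma msmooth_at_const [simp]: "msmooth_at \<A> (\<lambda>q. c) p" by (simp add: msmooth_at_def o_def)
lemma msmooth_at_add: "msmooth_at \<A> f p \<Longrightarrow> msmooth_at \<A> g p \<Longrightarrow> msmooth_at \<A> (\<lambda>q. f q + g q) p"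
  by (auto simp: msmooth_at_def o_def intro!: smooth_at_add)
lemma msmooth_at_diff: "msmooth_at \<A> f p \<Longrightarrow> msmooth_at \<A> g p \<Longrightarrow> msmooth_at \<A> (\<lambda>q. f q - g q) p"
  by (auto simp: msmooth_at_def o_def intro!: smooth_at_diff)
lemma msmooth_at_minus: "msmooth_at \<A> f p \<Longrightarrow> msmooth_at \<A> (\<lambda>q. - f q) p"
  by (auto simp: msmooth_at_def o_def intro!: smooth_at_minus)
lemma msmooth_at_mult:
  fixes f g :: "'a \<Rightarrow> 'b::real_normed_algebra"
  shows "msmooth_at \<A> f p \<Longrightarrow> msmooth_at \<A> g p \<Longrightarrow> msmooth_at \<A> (\<lambda>q. f q * g q) p"
  by (auto simp: msmooth_at_def o_def intro!: smooth_at_mult)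
lemma msmooth_at_scaleR: "msmooth_at \<A> f p \<Longrightarrow> msmooth_at \<A> g p \<Longrightarrow> msmooth_at \<A> (\<lambda>q. f q *\<^sub>R g q) p"
  by (auto simp: msmooth_at_def o_def intro!: smooth_at_scaleR)
lemma msmooth_at_Re: "msmooth_at \<A> f p \<Longrightarrow> msmooth_at \<A> (\<lambda>q. Re (f q)) p"
  by (auto simp: msmooth_at_def o_def intro!: smooth_at_Re)
lemma msmooth_at_Im: "msmooth_at \<A> f p \<Longrightarrow> msmooth_at \<A> (\<lambda>q. Im (f q)) p"
  by (auto simp: msmooth_at_def o_def intro!: smooth_at_Im)
lemma msmooth_at_of_real: "msmooth_at \<A> f p \<Longrightarrow> msmooth_at \<A> (\<lambda>q. complex_of_real (f q)) p"
  by (auto simp: msmooth_at_def o_def intro!: smooth_at_of_real)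
lemma msmooth_at_sum: "(\<And>i. i \<in> I \<Longrightarrow> msmooth_at \<A> (f i) p) \<Longrightarrow> msmooth_at \<A> (\<lambda>q. \<Sum>i\<in>I. f i q) p"
  by (induction I rule: infinite_finite_induct) (simp_all add: msmooth_at_add)

lemmas msmooth_at_intros = msmooth_at_const msmooth_at_add msmooth_at_diff msmooth_at_minus msmooth_at_mult msmooth_at_scaleR msmooth_at_Re
  msmooth_at_Im msmooth_at_of_real msmooth_at_sum

lemma msmooth_at_Complex:
  assumes "msmooth_at \<A> f p" "msmooth_at \<A> g p" shows "msmooth_at \<A> (\<lambda>q. Complex (f q) (g q)) p"
proof -
  have "msmooth_at \<A> (\<lambda>q. complex_of_real (f q) + \<i> * complex_of_real (g q)) p"
    by (intro msmooth_at_intros assms)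
  then show ?thesis by (simp add: Complex_eq)
qed

lemma msmooth_at_coord:
  assumes "(U, \<phi>) \<in> \<A>" "p \<in> U" shows "msmooth_at \<A> (\<lambda>q. inner (\<phi> q) b) p"
proof -
  have "smooth_at (\<lambda>y. inner y b) (\<phi> p)" by (intro smooth_at_intros)
  moreover have "\<forall>\<^sub>F y in nhds (\<phi> p). inner y b = inner (\<phi> (inv_into U \<phi> y)) b"
    using eventually_chart[OF assms, of "\<lambda>_. True"]
    by (rule eventually_mono[OF _]) (auto simp: f_inv_into_f)
  ultimately show ?thesis unfolding msmooth_at_iff[OF assms] by (rule smooth_at_cong[rotated])
qed

text \<open>A bump function transported from a chart. It lives on the image of a compact ball, which
  is closed because the manifold is Hausdorff; therefore extension by zero is smooth at every point
  outside the chart as well.\<close>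

lemma ex_cutoff:
  assumes "open W" "p \<in> W"
  obtains \<eta> :: "'a \<Rightarrow> real" and C where "\<eta> \<in> S" "\<forall>\<^sub>F q in nhds p. \<eta> q = 1"
    "closed C" "C \<subseteq> W" "\<And>q. q \<notin> C \<Longrightarrow> \<eta> q = 0"
proof -
  obtain U \<phi> where U: "(U, \<phi>) \<in> \<A>" "p \<in> U" using ex_chart .
  have "open (\<phi> ` (U \<inter> W))" "\<phi> p \<in> \<phi> ` (U \<inter> W)"
    using chart_image_open[OF U(1)] assms U by auto
  then obtain r where r: "r > 0" "cball (\<phi> p) r \<subseteq> \<phi> ` (U \<inter> W)"
    using open_contains_cball by blast
  obtain \<eta> where \<eta>: "\<And>x. smooth_at \<eta> x" "\<And>x. x \<in> cball (\<phi> p) (r/2) \<Longrightarrow> \<eta> x = 1"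
    "\<And>x. x \<notin> ball (\<phi> p) r \<Longrightarrow> \<eta> x = (0::real)" using ex_bump[OF r(1)] by blast
  define C where "C = inv_into U \<phi> ` cball (\<phi> p) r"
  have sub: "cball (\<phi> p) r \<subseteq> \<phi> ` U" using r(2) by blast
  have "compact C"
    unfolding C_def
    using continuous_on_subset[OF homeomorphism_cont2[OF chart_homeo[OF U(1)]] sub]
    by (intro compact_continuous_image) auto
  then have C: "closed C" using compact_imp_closed by blast
  have CU: "C \<subseteq> U" "C \<subseteq> W" using r(2) U(1) by (auto simp: C_def) 
  define h where "h q = (if q \<in> U then \<eta> (\<phi> q) else 0)" for q
  have h0: "h q = 0" if "q \<notin> C" for q
  proof (cases "q \<in> U")
    case True
    then have "\<phi> q \<notin> cball (\<phi> p) r" using that U(1) unfolding C_def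
      by (metis chart_inv image_eqI)
    then show ?thesis using \<eta>(3) by (simp add: h_def)
  qed (simp add: h_def)
  have "msmooth_at \<A> h q" for q
  proof (cases "q \<in> U")
    case True
    have "\<forall>\<^sub>F y in nhds (\<phi> q). \<eta> y = h (inv_into U \<phi> y)"
      using eventually_chart[OF U(1) True, of "\<lambda>_. True"]
      by (rule eventually_mono[OF _]) (auto simp: f_inv_into_f h_def U(1))
    then show ?thesis unfolding msmooth_at_iff[OF U(1) True] by (rule smooth_at_cong) (rule \<eta>(1))
  next
    case False
    then have "\<forall>\<^sub>F y in nhds q. 0 = h y"
      using C CU h0 by (auto simp: eventually_nhds intro!: exI[of _ "- C"])
    then show ?thesis by (rule msmooth_at_cong) simp
  qed
  moreover have "\<forall>\<^sub>F q in nhds p. h q = 1"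
  proof -
    have "\<forall>\<^sub>F y in nhds (\<phi> p). y \<in> ball (\<phi> p) (r/2)"
      using r(1) by (intro eventually_nhds_in_open) auto
    from eventually_chart_inv[OF U this] show ?thesis
      by (rule eventually_mono) (simp add: h_def \<eta>(2))
  qed
  ultimately show ?thesis using that[of h C] C CU h0 by (auto simp: smooth_funs_iff)
qed

text \<open>Tangent vectors and operators are meaningful on globally smooth functions only; a local
  function is therefore replaced by a global one with the same germ at \<open>p\<close>.\<close>

lemma ex_extension:
  fixes g :: "'a \<Rightarrow> 'b::real_normed_vector"
  assumes "open W" "p \<in> W" "\<And>q. q \<in> W \<Longrightarrow> msmooth_at \<A> g q"
  obtains G where "G \<in> S" "\<forall>\<^sub>F q in nhds p. G q = g q"
proof -
  obtain \<eta> :: "'a \<Rightarrow> real" and C where \<eta>: "\<eta> \<in> S" "\<forall>\<^sub>F q in nhds p. \<eta> q = 1"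
    "closed C" "C \<subseteq> W" "\<And>q. q \<notin> C \<Longrightarrow> \<eta> q = 0" using ex_cutoff[OF assms(1,2)] by blast
  define G where "G q = (if q \<in> W then \<eta> q *\<^sub>R g q else 0)" for q
  have "msmooth_at \<A> G q" for q
  proof (cases "q \<in> W")
    case True
    have "\<forall>\<^sub>F q in nhds q. \<eta> q *\<^sub>R g q = G q"
      using assms(1) True by (auto simp: eventually_nhds G_def)
    then show ?thesis
      by (rule msmooth_at_cong) (intro msmooth_at_scaleR smooth_funsD \<eta>(1) assms(3) True)
  next
    case False
    then have "\<forall>\<^sub>F y in nhds q. 0 = G y"
      using \<eta> by (auto simp: eventually_nhds G_def intro!: exI[of _ "- C"])
    then show ?thesis by (rule msmooth_at_cong) simp
  qed
  moreover have "\<forall>\<^sub>F q in nhds p. q \<in> W" using assms by (intro eventually_nhds_in_open)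
  with \<eta>(2) have "\<forall>\<^sub>F q in nhds p. G q = g q" by eventually_elim (simp add: G_def)
  ultimately show ?thesis using that by (auto simp: smooth_funs_iff)
qed

lemma S_const [simp]: "(\<lambda>x. c) \<in> S" by (simp add: smooth_funs_iff)
lemma S_zero [simp]: "0 \<in> smooth_funs \<A>"
  using S_const[of 0] by (simp add: zero_fun_def[symmetric] del: S_const)
lemma S_add [simp]: "f \<in> S \<Longrightarrow> g \<in> S \<Longrightarrow> f + g \<in> S"
  by (simp add: smooth_funs_iff plus_fun_def msmooth_at_add)
lemma S_diff [simp]: "f \<in> S \<Longrightarrow> g \<in> S \<Longrightarrow> f - g \<in> S"
  by (simp add: smooth_funs_iff fun_diff_def msmooth_at_diff)
lemma S_sum [simp]: "(\<And>i. i \<in> I \<Longrightarrow> f i \<in> S) \<Longrightarrow> (\<Sum>i\<in>I. f i) \<in> S"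
  by (induction I rule: infinite_finite_induct) auto

subsection \<open>Tangent vectors\<close>

lemma
  assumes "v \<in> tangent_space \<A> p"
  shows tangent_linear: "f \<in> S \<Longrightarrow> g \<in> S \<Longrightarrow> v (\<lambda>x. a * f x + b * g x) = a * v f + b * v g"
    and tangent_mult: "f \<in> S \<Longrightarrow> g \<in> S \<Longrightarrow> v (\<lambda>x. f x * g x) = f p * v g + g p * v f"
  using assms unfolding tangent_space_def by blast+

lemma tangent_zero: "v \<in> tangent_space \<A> p \<Longrightarrow> v (\<lambda>x. 0) = 0"
  using tangent_linear[of v p "\<lambda>x. 0" "\<lambda>x. 0" 0 0] by simp

lemma tangent_const: assumes "v \<in> tangent_space \<A> p" shows "v (\<lambda>x. c) = 0"
proof -
  have "v (\<lambda>x. 1 * 1) = 1 * v (\<lambda>x. 1) + 1 * v (\<lambda>x. 1)"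
    using tangent_mult[OF assms, of "\<lambda>x. 1" "\<lambda>x. 1"] by simp
  then have "v (\<lambda>x. 1) = 0" by simp
  then show ?thesis using tangent_linear[OF assms, of "\<lambda>x. 1" "\<lambda>x. 1" c 0] by simp
qed

text \<open>With a cut-off \<eta> that is 1 at \<open>p\<close> and vanishes where \<open>f\<close>
  and \<open>g\<close> may differ, the product rule applied to the zero function \<eta> (f - g)
  isolates v (f - g).\<close>

lemma tangent_local:
  assumes v: "v \<in> tangent_space \<A> p" and fg: "f \<in> S" "g \<in> S" "\<forall>\<^sub>F q in nhds p. f q = g q"
  shows "v f = v g"
proof -
  obtain W where W: "open W" "p \<in> W" "\<And>q. q \<in> W \<Longrightarrow> f q = g q"
    using fg(3) by (auto simp: eventually_nhds)
  obtain \<eta> :: "'a \<Rightarrow> real" and C where \<eta>: "\<eta> \<in> S" "\<forall>\<^sub>F q in nhds p. \<eta> q = 1"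
    "closed C" "C \<subseteq> W" "\<And>q. q \<notin> C \<Longrightarrow> \<eta> q = 0" using ex_cutoff[OF W(1,2)] by blast
  have s: "(\<lambda>x. f x - g x) \<in> S" using fg by (simp add: smooth_funs_iff msmooth_at_diff)
  have "\<eta> x * (f x - g x) = 0" for x using W \<eta> by (cases "x \<in> C") auto
  then have "(\<lambda>x. \<eta> x * (f x - g x)) = (\<lambda>x. 0)" by (rule ext)
  then have "v (\<lambda>x. \<eta> x * (f x - g x)) = 0" using tangent_zero[OF v] by simp
  then have "v (\<lambda>x. f x - g x) = 0"
    using tangent_mult[OF v \<eta>(1) s] W(2,3) eventually_nhds_x_imp_x[OF \<eta>(2)] by simp
  then show ?thesis using tangent_linear[OF v fg(1,2), of 1 "- 1"] by simp
qed

lemma S_Re: "f \<in> S \<Longrightarrow> (\<lambda>x. Re (f x)) \<in> S" by (simp add: smooth_funs_iff msmooth_at_Re)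
lemma S_Im: "f \<in> S \<Longrightarrow> (\<lambda>x. Im (f x)) \<in> S" by (simp add: smooth_funs_iff msmooth_at_Im)

context
  fixes v p assumes v: "v \<in> tangent_space \<A> p"
begin

lemma complex_deriv_add:
  assumes "f \<in> S" "g \<in> S"
  shows "complex_deriv v (\<lambda>x. f x + g x) = complex_deriv v f + complex_deriv v g"
  using tangent_linear[OF v S_Re[OF assms(1)] S_Re[OF assms(2)], of 1 1]
    tangent_linear[OF v S_Im[OF assms(1)] S_Im[OF assms(2)], of 1 1]
  by (simp add: complex_deriv_def complex_add)

lemma complex_deriv_mult:
  assumes "f \<in> S" "g \<in> S"
  shows "complex_deriv v (\<lambda>x. f x * g x) = f p * complex_deriv v g + g p * complex_deriv v f"
proof -
  note s = S_Re[OF assms(1)] S_Re[OF assms(2)] S_Im[OF assms(1)] S_Im[OF assms(2)]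
  have m: "(\<lambda>x. a x * b x) \<in> S" if "a \<in> S" "b \<in> S" for a b :: "'a \<Rightarrow> real"
    using that by (simp add: smooth_funs_iff msmooth_at_mult)
  have "v (\<lambda>x. Re (f x) * Re (g x) - Im (f x) * Im (g x)) =
      v (\<lambda>x. Re (f x) * Re (g x)) - v (\<lambda>x. Im (f x) * Im (g x))"
    using tangent_linear[OF v m[OF s(1,2)] m[OF s(3,4)], of 1 "-1"] by simp
  moreover have "v (\<lambda>x. Re (f x) * Im (g x) + Im (f x) * Re (g x)) =
      v (\<lambda>x. Re (f x) * Im (g x)) + v (\<lambda>x. Im (f x) * Re (g x))"
    using tangent_linear[OF v m[OF s(1,4)] m[OF s(3,2)], of 1 1] by simp
  ultimately show ?thesis
    by (simp add: complex_deriv_def tangent_mult[OF v] s complex_eq_iff)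
qed

lemma complex_deriv_const: "complex_deriv v (\<lambda>x. c) = 0"
  by (simp add: complex_deriv_def tangent_const[OF v] complex_eq_iff)

lemma complex_deriv_cmult:
  assumes "f \<in> S" shows "complex_deriv v (\<lambda>x. c * f x) = c * complex_deriv v f"
  using complex_deriv_mult[OF S_const[of c] assms] by (simp add: complex_deriv_const)

lemma complex_deriv_diff:
  assumes "f \<in> S" "g \<in> S"
  shows "complex_deriv v (\<lambda>x. f x - g x) = complex_deriv v f - complex_deriv v g"
proof -
  have "(\<lambda>x. - 1 * g x) \<in> S" using assms by (simp add: smooth_funs_iff msmooth_at_minus)
  from complex_deriv_add[OF assms(1) this] show ?thesis
    using complex_deriv_cmult[OF assms(2), of "- 1"] by simp
qed

lemma complex_deriv_sum:
  assumes "\<And>i. i \<in> I \<Longrightarrow> f i \<in> S"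
  shows "complex_deriv v (\<lambda>x. \<Sum>i\<in>I. f i x) = (\<Sum>i\<in>I. complex_deriv v (f i))"
  using assms
proof (induction I rule: infinite_finite_induct)
  case (insert i I)
  have "(\<lambda>x. \<Sum>i\<in>I. f i x) \<in> S"
    using insert.prems by (auto simp: smooth_funs_iff intro!: msmooth_at_sum)
  then show ?case using insert by (simp add: complex_deriv_add)
qed (simp_all add: complex_deriv_const)

lemma complex_deriv_local:
  assumes "f \<in> S" "g \<in> S" "\<forall>\<^sub>F q in nhds p. f q = g q"
  shows "complex_deriv v f = complex_deriv v g"
proof -
  have "\<forall>\<^sub>F q in nhds p. Re (f q) = Re (g q)" "\<forall>\<^sub>F q in nhds p. Im (f q) = Im (g q)"
    using assms(3) by (auto elim: eventually_mono)
  then show ?thesis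
    using tangent_local[OF v S_Re[OF assms(1)] S_Re[OF assms(2)]]
      tangent_local[OF v S_Im[OF assms(1)] S_Im[OF assms(2)]]
    by (simp add: complex_deriv_def)
qed

end

section \<open>Vector fields\<close>

lemma vector_fields_tangent: "X \<in> vector_fields \<A> \<Longrightarrow> X p \<in> tangent_space \<A> p"
  unfolding vector_fields_def by blast

lemma vector_fields_complex_smooth:
  assumes "X \<in> vector_fields \<A>" "f \<in> S" shows "(\<lambda>p. complex_deriv (X p) f) \<in> S"
  using assms S_Re[OF assms(2)] S_Im[OF assms(2)] unfolding vector_fields_def complex_deriv_def
  by (auto simp: smooth_funs_iff intro!: msmooth_at_Complex)

text \<open>In the product rule for a second derivative the mixed terms are symmetric in the two
  fields, so they cancel in the bracket.\<close>

lemma lie_bracket_vector_field: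
  assumes X: "X \<in> vector_fields \<A>" and Y: "Y \<in> vector_fields \<A>"
  shows "lie_bracket \<A> X Y \<in> vector_fields \<A>"
proof -
  have s: "(\<lambda>p. Z p f) \<in> S" if "Z \<in> vector_fields \<A>" "f \<in> S" for Z f
    using that unfolding vector_fields_def by blast
  have l: "(\<lambda>x. a * f x + b * g x) \<in> S" "(\<lambda>x. f x * g x) \<in> S"
    if "f \<in> S" "g \<in> S" for f g :: "'a \<Rightarrow> real" and a b
    using that by (simp_all add: smooth_funs_iff msmooth_at_intros)
  have lin: "X p (\<lambda>q. Y q (\<lambda>x. a * f x + b * g x)) = a * X p (\<lambda>q. Y q f) + b * X p (\<lambda>q. Y q g)"
    if "X \<in> vector_fields \<A>" "Y \<in> vector_fields \<A>" "f \<in> S" "g \<in> S" for X Y p f g a b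
    using tangent_linear[OF vector_fields_tangent[OF that(2)] that(3,4)]
      tangent_linear[OF vector_fields_tangent[OF that(1)] s[OF that(2,3)] s[OF that(2,4)]] by simp
  have mul: "X p (\<lambda>q. Y q (\<lambda>x. f x * g x)) =
      (f p * X p (\<lambda>q. Y q g) + Y p g * X p f) + (g p * X p (\<lambda>q. Y q f) + Y p f * X p g)"
    if "X \<in> vector_fields \<A>" "Y \<in> vector_fields \<A>" "f \<in> S" "g \<in> S" for X Y p f g
  proof -
    have "X p (\<lambda>q. Y q (\<lambda>x. f x * g x)) = X p (\<lambda>q. 1 * (f q * Y q g) + 1 * (g q * Y q f))"
      using tangent_mult[OF vector_fields_tangent[OF that(2)] that(3,4)] by simp
    also have "\<dots> = X p (\<lambda>q. f q * Y q g) + X p (\<lambda>q. g q * Y q f)"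
      using tangent_linear[OF vector_fields_tangent[OF that(1)] l(2)[OF that(3) s[OF that(2,4)]]
          l(2)[OF that(4) s[OF that(2,3)]], of p 1 1] by simp
    also have "\<dots> = (f p * X p (\<lambda>q. Y q g) + Y p g * X p f) + (g p * X p (\<lambda>q. Y q f) + Y p f * X p g)"
      using tangent_mult[OF vector_fields_tangent[OF that(1)]] that s by simp
    finally show ?thesis .
  qed
  have "lie_bracket \<A> X Y p \<in> tangent_space \<A> p" for p
    unfolding tangent_space_def lie_bracket_def
    using l lin[OF X Y] lin[OF Y X] mul[OF X Y] mul[OF Y X] by (auto simp: algebra_simps)
  moreover have "(\<lambda>p. lie_bracket \<A> X Y p f) \<in> S" if "f \<in> S" for f
  proof -
    have "(\<lambda>p. lie_bracket \<A> X Y p f) = (\<lambda>p. X p (\<lambda>q. Y q f) - Y p (\<lambda>q. X q f))"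
      using that by (simp add: lie_bracket_def)
    then show ?thesis using s[OF X s[OF Y that]] s[OF Y s[OF X that]]
      by (simp add: smooth_funs_iff msmooth_at_diff)
  qed
  ultimately show ?thesis unfolding vector_fields_def by blast
qed

lemma frechet_chart_lin_mult:
  fixes f g :: "'a \<Rightarrow> real"
  assumes U: "(U, \<phi>) \<in> \<A>" "q \<in> U" and f: "f \<in> S" and g: "g \<in> S"
  shows "frechet_derivative ((\<lambda>x. a * f x + c * g x) \<circ> inv_into U \<phi>) (at (\<phi> q)) b =
      a * frechet_derivative (f \<circ> inv_into U \<phi>) (at (\<phi> q)) b + c * frechet_derivative (g \<circ> inv_into U \<phi>) (at (\<phi> q)) b"
    and "frechet_derivative ((\<lambda>x. f x * g x) \<circ> inv_into U \<phi>) (at (\<phi> q)) b =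
      f q * frechet_derivative (g \<circ> inv_into U \<phi>) (at (\<phi> q)) b + g q * frechet_derivative (f \<circ> inv_into U \<phi>) (at (\<phi> q)) b"
proof -
  have d: "(h \<circ> inv_into U \<phi> has_derivative frechet_derivative (h \<circ> inv_into U \<phi>) (at (\<phi> q))) (at (\<phi> q))"
    if "h \<in> S" for h :: "'a \<Rightarrow> real"
    using smooth_at_has_derivative[OF msmooth_atD[OF smooth_funsD[OF that] U]] .
  have l: "((\<lambda>x. a * f x + c * g x) \<circ> inv_into U \<phi> has_derivative
     (\<lambda>b. a * frechet_derivative (f \<circ> inv_into U \<phi>) (at (\<phi> q)) b + c * frechet_derivative (g \<circ> inv_into U \<phi>) (at (\<phi> q)) b)) (at (\<phi> q))"
    using has_derivative_add[OF has_derivative_mult_right[OF d[OF f], of a] has_derivative_mult_right[OF d[OF g], of c]]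
    by (simp add: o_def)
  show
    "frechet_derivative ((\<lambda>x. a * f x + c * g x) \<circ> inv_into U \<phi>) (at (\<phi> q)) b =
      a * frechet_derivative (f \<circ> inv_into U \<phi>) (at (\<phi> q)) b + c * frechet_derivative (g \<circ> inv_into U \<phi>) (at (\<phi> q)) b"
    unfolding fun_cong[OF frechet_derivative_at[OF l], symmetric] ..
  have m: "((\<lambda>x. f x * g x) \<circ> inv_into U \<phi> has_derivative
     (\<lambda>b. f q * frechet_derivative (g \<circ> inv_into U \<phi>) (at (\<phi> q)) b + frechet_derivative (f \<circ> inv_into U \<phi>) (at (\<phi> q)) b * g q)) (at (\<phi> q))"
    using has_derivative_mult[OF d[OF f] d[OF g]] U by (simp add: o_def)
  show "frechet_derivative ((\<lambda>x. f x * g x) \<circ> inv_into U \<phi>) (at (\<phi> q)) b =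
      f q * frechet_derivative (g \<circ> inv_into U \<phi>) (at (\<phi> q)) b + g q * frechet_derivative (f \<circ> inv_into U \<phi>) (at (\<phi> q)) b"
    unfolding fun_cong[OF frechet_derivative_at[OF m], symmetric] by (simp add: mult.commute)
qed

text \<open>A partial derivative of the chart, multiplied by a cut-off function to become a global
  field. Such fields turn statements about all vector fields into statements about Frechet
  derivatives in a chart.\<close>

lemma ex_coordinate_field:
  assumes U: "(U, \<phi>) \<in> \<A>" "p \<in> U"
  obtains X where "X \<in> vector_fields \<A>"
    "\<forall>\<^sub>F q in nhds p. q \<in> U \<and> (\<forall>f\<in>S. complex_deriv (X q) f = frechet_derivative (f \<circ> inv_into U \<phi>) (at (\<phi> q)) b)"
proof -
  obtain \<eta> :: "'a \<Rightarrow> real" and C where \<eta>: "\<eta> \<in> S" "\<forall>\<^sub>F q in nhds p. \<eta> q = 1"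
    "closed C" "C \<subseteq> U" "\<And>q. q \<notin> C \<Longrightarrow> \<eta> q = 0"
    using ex_cutoff[OF chart_open[OF U(1)] U(2)] by blast
  define X :: "'a \<Rightarrow> 'a tvec" where
    "X q f = (if f \<in> S \<and> q \<in> U then \<eta> q * frechet_derivative (f \<circ> inv_into U \<phi>) (at (\<phi> q)) b else 0)" for q f
  have "X q \<in> tangent_space \<A> q" for q
  proof -
    have "(\<lambda>x. a * f x + b * g x) \<in> S" "(\<lambda>x. f x * g x) \<in> S"
      if "f \<in> S" "g \<in> S" for f g :: "'a \<Rightarrow> real" and a b
      using that by (simp_all add: smooth_funs_iff msmooth_at_intros)
    then show ?thesis unfolding tangent_space_def X_def
      using frechet_chart_lin_mult[OF U(1), of q] by (auto simp: algebra_simps)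
  qed
  moreover have "(\<lambda>q. X q f) \<in> S" if f: "f \<in> S" for f
    unfolding smooth_funs_iff
  proof
    fix q
    show "msmooth_at \<A> (\<lambda>q. X q f) q"
    proof (cases "q \<in> U")
      case True
      have "smooth_at (\<lambda>y. \<eta> (inv_into U \<phi> y) * frechet_derivative (f \<circ> inv_into U \<phi>) (at y) b) (\<phi> q)"
        using msmooth_at_iff[OF U(1) True, of \<eta>] smooth_funsD[OF \<eta>(1)]
        by (intro smooth_at_mult smooth_at_derivative msmooth_atD[OF smooth_funsD[OF f] U(1) True]) blast
      moreover have "\<forall>\<^sub>F y in nhds (\<phi> q). \<eta> (inv_into U \<phi> y) * frechet_derivative (f \<circ> inv_into U \<phi>) (at y) b = X (inv_into U \<phi> y) f"
        using eventually_chart[OF U(1) True, of "\<lambda>_. True"]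
        by (rule eventually_mono[OF _]) (auto simp: f_inv_into_f X_def U(1) f)
      ultimately show ?thesis unfolding msmooth_at_iff[OF U(1) True] by (rule smooth_at_cong[rotated])
    next
      case False
      then have "\<forall>\<^sub>F y in nhds q. 0 = X y f"
        using \<eta> by (auto simp: eventually_nhds X_def intro!: exI[of _ "- C"])
      then show ?thesis by (rule msmooth_at_cong) simp
    qed
  qed
  ultimately have "X \<in> vector_fields \<A>" unfolding vector_fields_def by blast
  moreover have "\<forall>\<^sub>F q in nhds p. q \<in> U"
    using U chart_open by (intro eventually_nhds_in_open) auto
  with \<eta>(2) have "\<forall>\<^sub>F q in nhds p. q \<in> U \<and> (\<forall>f\<in>S. complex_deriv (X q) f = frechet_derivative (f \<circ> inv_into U \<phi>) (at (\<phi> q)) b)"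
  proof eventually_elim
    case (elim q)
    have "complex_deriv (X q) f = frechet_derivative (f \<circ> inv_into U \<phi>) (at (\<phi> q)) b" if f: "f \<in> S" for f
    proof -
      let ?d = "frechet_derivative (f \<circ> inv_into U \<phi>) (at (\<phi> q))"
      have "(f \<circ> inv_into U \<phi> has_derivative ?d) (at (\<phi> q))"
        using smooth_at_has_derivative[OF msmooth_atD[OF smooth_funsD[OF f] U(1)]] elim by blast
      from has_derivative_Re[OF this] has_derivative_Im[OF this]
      have "frechet_derivative ((\<lambda>x. Re (f x)) \<circ> inv_into U \<phi>) (at (\<phi> q)) = (\<lambda>b. Re (?d b))"
        "frechet_derivative ((\<lambda>x. Im (f x)) \<circ> inv_into U \<phi>) (at (\<phi> q)) = (\<lambda>b. Im (?d b))"
        by (auto simp: o_def dest!: frechet_derivative_at)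
      then show ?thesis using elim S_Re[OF f] S_Im[OF f]
        by (simp add: complex_deriv_def X_def complex_eq_iff)
    qed
    then show ?case using elim by blast
  qed
  ultimately show ?thesis using that by blast
qed

section \<open>Base points of the connected components\<close>

definition base :: "'a \<Rightarrow> 'a" where
  "base p = (SOME q. q \<in> connected_component_set UNIV p)"

text \<open>The points \<open>q\<close> and \<open>q'\<close> of \<open>N\<close> are arbitrary, so
  the property spreads both to and from the centre of \<open>N\<close>: it is open and closed in the
  component.\<close>

lemma base_clopen:
  assumes "\<And>p. \<exists>N. open N \<and> p \<in> N \<and> (\<forall>q\<in>N. \<forall>q'\<in>N. P q \<longrightarrow> P q')" and "P (base p)"
  shows "P p"
proof (rule connected_induction_simple[where S="connected_component_set UNIV p" and a="base p"])
  show "base p \<in> connected_component_set UNIV p"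
    unfolding base_def by (rule someI[of _ p]) simp
  show "\<exists>T. openin (top_of_set (connected_component_set UNIV p)) T \<and> a \<in> T \<and> (\<forall>x\<in>T. \<forall>y\<in>T. P x \<longrightarrow> P y)"
    if a: "a \<in> connected_component_set UNIV p" for a
  proof -
    from assms(1)[of a] obtain N where "open N" "a \<in> N" "\<forall>q\<in>N. \<forall>q'\<in>N. P q \<longrightarrow> P q'"
      by (elim exE conjE)
    then show ?thesis using a
      by (intro exI[of _ "connected_component_set UNIV p \<inter> N"]) (auto simp: openin_open_Int)
  qed
qed (use assms(2) in auto)

text \<open>The preimage of a chart ball is connected, so nearby points lie in one component, and
  the choice of base point depends on the component only.\<close>

lemma base_locally_const: "\<forall>\<^sub>F q in nhds p. base q = base p"
proof -
  obtain U \<phi> where U: "(U, \<phi>) \<in> \<A>" "p \<in> U" using ex_chart .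
  obtain r where r: "r > 0" "ball (\<phi> p) r \<subseteq> \<phi> ` U"
    using chart_open_image[OF U(1)] U(2) openE[of "\<phi> ` U" "\<phi> p"] by auto
  have "connected (inv_into U \<phi> ` ball (\<phi> p) r)"
    using continuous_on_subset[OF homeomorphism_cont2[OF chart_homeo[OF U(1)]] r(2)]
    by (intro connected_continuous_image) auto
  moreover have "\<forall>\<^sub>F q in nhds p. q \<in> U \<and> \<phi> q \<in> ball (\<phi> p) r"
    using r(1) by (intro eventually_chart_inv[OF U] eventually_nhds_in_open) auto
  ultimately show ?thesis
  proof (rule_tac eventually_mono)
    fix q assume c: "connected (inv_into U \<phi> ` ball (\<phi> p) r)" and q: "q \<in> U \<and> \<phi> q \<in> ball (\<phi> p) r"
    have "p \<in> inv_into U \<phi> ` ball (\<phi> p) r" using U r by (auto simp: image_iff intro!: bexI[of _ "\<phi> p"])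
    moreover have "q \<in> inv_into U \<phi> ` ball (\<phi> p) r" using U q by (auto simp: image_iff intro!: bexI[of _ "\<phi> q"])
    ultimately have "connected_component UNIV q p" using c unfolding connected_component_def by blast
    then show "base q = base p" unfolding base_def using connected_component_eq[of p UNIV q] by simp
  qed
qed

text \<open>Coordinate fields make the Frechet derivative vanish in every chart; the function is
  then constant on chart balls, and by propagation on components.\<close>

lemma zero_deriv_const:
  fixes u :: "'a \<Rightarrow> complex"
  assumes u: "u \<in> S" and z: "\<And>X q. X \<in> vector_fields \<A> \<Longrightarrow> complex_deriv (X q) u = 0"
  shows "u p0 = u (base p0)"
proof (rule base_clopen[where P="\<lambda>q. u q = u (base p0)"])
  fix p
  obtain U \<phi> where U: "(U, \<phi>) \<in> \<A>" "p \<in> U" using ex_chart .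
  obtain r where r: "r > 0" "ball (\<phi> p) r \<subseteq> \<phi> ` U"
    using chart_open_image[OF U(1)] U(2) openE[of "\<phi> ` U" "\<phi> p"] by auto
  have *: "(u \<circ> inv_into U \<phi> has_derivative (\<lambda>h. 0)) (at y)" if "y \<in> \<phi> ` U" for y
  proof -
    obtain q where q: "q \<in> U" "y = \<phi> q" using \<open>y \<in> \<phi> ` U\<close> by blast
    have "frechet_derivative (u \<circ> inv_into U \<phi>) (at (\<phi> q)) b = 0" for b
    proof -
      obtain X where X: "X \<in> vector_fields \<A>"
        "\<forall>\<^sub>F q in nhds q. q \<in> U \<and> (\<forall>f\<in>S. complex_deriv (X q) f = frechet_derivative (f \<circ> inv_into U \<phi>) (at (\<phi> q)) b)"
        using ex_coordinate_field[OF U(1) q(1)] by blast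
      then show ?thesis using eventually_nhds_x_imp_x[OF X(2)] z[OF X(1), of q] u by simp
    qed
    then have "frechet_derivative (u \<circ> inv_into U \<phi>) (at (\<phi> q)) = (\<lambda>h. 0)" by auto
    then show ?thesis
      using smooth_at_has_derivative[OF msmooth_atD[OF smooth_funsD[OF u] U(1) q(1)]] q by simp
  qed
  have ex: "\<exists>d. \<forall>y\<in>ball (\<phi> p) r. (u \<circ> inv_into U \<phi>) y = d"
  proof (intro has_derivative_zero_constant convex_ball)
    show "(u \<circ> inv_into U \<phi> has_derivative (\<lambda>h. 0)) (at y within ball (\<phi> p) r)"
      if "y \<in> ball (\<phi> p) r" for y
      by (rule has_derivative_at_withinI[OF *[OF subsetD[OF r(2) that]]])
  qed
  from ex obtain d where d: "\<forall>y\<in>ball (\<phi> p) r. (u \<circ> inv_into U \<phi>) y = d" ..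
  have c: "u q = u q'" if "q \<in> U" "q' \<in> U" "\<phi> q \<in> ball (\<phi> p) r" "\<phi> q' \<in> ball (\<phi> p) r" for q q'
  proof -
    from bspec[OF d that(3)] bspec[OF d that(4)] show ?thesis using that(1,2) U(1) by simp
  qed
  have "\<forall>\<^sub>F q in nhds p. q \<in> U \<and> \<phi> q \<in> ball (\<phi> p) r"
    using r(1) by (intro eventually_chart_inv[OF U] eventually_nhds_in_open) auto
  then obtain N where N: "open N" "p \<in> N" "\<And>q. q \<in> N \<Longrightarrow> q \<in> U \<and> \<phi> q \<in> ball (\<phi> p) r"
    by (auto simp: eventually_nhds)
  show "\<exists>N. open N \<and> p \<in> N \<and> (\<forall>q\<in>N. \<forall>q'\<in>N. u q = u (base p0) \<longrightarrow> u q' = u (base p0))"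
  proof (intro exI[of _ N] conjI N(1,2) ballI impI)
    fix q q' assume "q \<in> N" "q' \<in> N" "u q = u (base p0)"
    then show "u q' = u (base p0)" using c[of q q'] N(3)[of q] N(3)[of q'] by simp
  qed
qed simp

end

subsection \<open>Products\<close>

lemma inv_into_map_prod:
  assumes "inj_on \<phi> U" "inj_on \<psi> V" "y \<in> \<phi> ` U" "z \<in> \<psi> ` V"
  shows "inv_into (U \<times> V) (map_prod \<phi> \<psi>) (y, z) = (inv_into U \<phi> y, inv_into V \<psi> z)"
  by (rule inv_into_f_eq) (use assms in \<open>auto simp: inj_on_def inv_into_into f_inv_into_f\<close>)

lemma smooth_atlas_prod:
  fixes \<T> :: "('t::{t2_space,second_countable_topology}, 'e::finite_dim_inner) atlas"
    and \<M> :: "('m::{t2_space,second_countable_topology}, 'f::finite_dim_inner) atlas"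
  assumes "smooth_atlas \<T>" "smooth_atlas \<M>"
  shows "smooth_atlas (prod_atlas \<T> \<M>)"
proof -
  interpret T: manifold \<T> by unfold_locales (rule assms)
  interpret M: manifold \<M> by unfold_locales (rule assms)
  have im: "map_prod \<phi> \<psi> ` (U \<times> V) = \<phi> ` U \<times> \<psi> ` V"
    for U V and \<phi> :: "'t \<Rightarrow> 'e" and \<psi> :: "'m \<Rightarrow> 'f" by auto
  have cover: "(\<Union>(U, \<phi>)\<in>prod_atlas \<T> \<M>. U) = UNIV"
  proof -
    have "\<exists>W\<in>prod_atlas \<T> \<M>. p \<in> fst W" for p
    proof -
      obtain U \<phi> where U: "(U, \<phi>) \<in> \<T>" "fst p \<in> U" using T.ex_chart .
      obtain V \<psi> where V: "(V, \<psi>) \<in> \<M>" "snd p \<in> V" using M.ex_chart .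
      show ?thesis using U V unfolding prod_atlas_def
        by (intro bexI[of _ "(U \<times> V, map_prod \<phi> \<psi>)"]) (auto simp: mem_Times_iff)
    qed
    then show ?thesis by (auto simp: split_beta)
  qed
  have inv: "inv_into (U \<times> V) (map_prod \<phi> \<psi>) p = (inv_into U \<phi> (fst p), inv_into V \<psi> (snd p))"
    if "(U, \<phi>) \<in> \<T>" "(V, \<psi>) \<in> \<M>" "p \<in> \<phi> ` U \<times> \<psi> ` V" for U \<phi> V \<psi> p
    using inv_into_map_prod[OF T.chart_inj[OF that(1)] M.chart_inj[OF that(2)], of "fst p" "snd p"] that(3)
    by (simp add: mem_Times_iff)
  have homeo: "open (U \<times> V) \<and> open (map_prod \<phi> \<psi> ` (U \<times> V)) \<and>
      homeomorphism (U \<times> V) (map_prod \<phi> \<psi> ` (U \<times> V)) (map_prod \<phi> \<psi>) (inv_into (U \<times> V) (map_prod \<phi> \<psi>))"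
    if U: "(U, \<phi>) \<in> \<T>" and V: "(V, \<psi>) \<in> \<M>" for U \<phi> V \<psi>
  proof (intro conjI)
    show "open (U \<times> V)" using open_Times T.chart_open[OF U] M.chart_open[OF V] by blast
    show "open (map_prod \<phi> \<psi> ` (U \<times> V))"
      unfolding im using open_Times T.chart_open_image[OF U] M.chart_open_image[OF V] by blast
    have c1: "continuous_on (U \<times> V) (map_prod \<phi> \<psi>)"
      unfolding map_prod_def split_beta
      by (intro continuous_on_Pair continuous_on_compose2[OF homeomorphism_cont1[OF T.chart_homeo[OF U]]]
          continuous_on_compose2[OF homeomorphism_cont1[OF M.chart_homeo[OF V]]]
          continuous_on_fst continuous_on_snd continuous_on_id) auto
    have "continuous_on (\<phi> ` U \<times> \<psi> ` V) (\<lambda>p. (inv_into U \<phi> (fst p), inv_into V \<psi> (snd p)))"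
      by (intro continuous_on_Pair continuous_on_compose2[OF homeomorphism_cont2[OF T.chart_homeo[OF U]]]
          continuous_on_compose2[OF homeomorphism_cont2[OF M.chart_homeo[OF V]]]
          continuous_on_fst continuous_on_snd continuous_on_id) auto
    then have c2: "continuous_on (map_prod \<phi> \<psi> ` (U \<times> V)) (inv_into (U \<times> V) (map_prod \<phi> \<psi>))"
      unfolding im by (rule continuous_on_eq) (rule inv[OF U V, symmetric])
    have "inj_on (map_prod \<phi> \<psi>) (U \<times> V)"
      using T.chart_inj[OF U] M.chart_inj[OF V] by (auto simp: inj_on_def)
    then show "homeomorphism (U \<times> V) (map_prod \<phi> \<psi> ` (U \<times> V)) (map_prod \<phi> \<psi>) (inv_into (U \<times> V) (map_prod \<phi> \<psi>))"
      unfolding homeomorphism_def using c1 c2 by (auto simp: inv_into_f_f f_inv_into_f inv_into_image_cancel)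
  qed
  have trans: "smooth_on (map_prod \<phi> \<psi> ` (U \<times> V \<inter> U' \<times> V')) (map_prod \<phi>' \<psi>' \<circ> inv_into (U \<times> V) (map_prod \<phi> \<psi>))"
    if U: "(U, \<phi>) \<in> \<T>" and V: "(V, \<psi>) \<in> \<M>" and U': "(U', \<phi>') \<in> \<T>" and V': "(V', \<psi>') \<in> \<M>"
    for U \<phi> V \<psi> U' \<phi>' V' \<psi>'
  proof -
    have e: "map_prod \<phi> \<psi> ` (U \<times> V \<inter> U' \<times> V') = \<phi> ` (U \<inter> U') \<times> \<psi> ` (V \<inter> V')" by force
    have oU: "open (\<phi> ` (U \<inter> U'))" and oV: "open (\<psi> ` (V \<inter> V'))"
      using T.chart_image_open[OF U T.chart_open[OF U']] M.chart_image_open[OF V M.chart_open[OF V']] by auto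
    have o: "open (\<phi> ` (U \<inter> U') \<times> \<psi> ` (V \<inter> V'))" using oU oV by (rule open_Times)
    show ?thesis unfolding e smooth_on_iff_smooth_at[OF o]
    proof
      fix p assume p: "p \<in> \<phi> ` (U \<inter> U') \<times> \<psi> ` (V \<inter> V')"
      have pU: "fst p \<in> \<phi> ` (U \<inter> U')" and pV: "snd p \<in> \<psi> ` (V \<inter> V')"
        using p by (simp_all only: mem_Times_iff)
      have "smooth_at (\<phi>' \<circ> inv_into U \<phi>) (fst p)"
        by (rule bspec[OF smooth_on_iff_smooth_at[OF oU, THEN iffD1, OF T.chart_trans[OF U U']] pU])
      moreover have "smooth_at (\<psi>' \<circ> inv_into V \<psi>) (snd p)"
        by (rule bspec[OF smooth_on_iff_smooth_at[OF oV, THEN iffD1, OF M.chart_trans[OF V V']] pV])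
      ultimately have "smooth_at (\<lambda>p. ((\<phi>' \<circ> inv_into U \<phi>) (fst p), (\<psi>' \<circ> inv_into V \<psi>) (snd p))) p"
        using smooth_at_Pair[OF smooth_at_compose[of "\<phi>' \<circ> inv_into U \<phi>" fst p, OF _ smooth_at_fst[OF smooth_at_id]]
            smooth_at_compose[of "\<psi>' \<circ> inv_into V \<psi>" snd p, OF _ smooth_at_snd[OF smooth_at_id]]] by blast
      moreover have "\<forall>\<^sub>F q in nhds p. ((\<phi>' \<circ> inv_into U \<phi>) (fst q), (\<psi>' \<circ> inv_into V \<psi>) (snd q)) =
          (map_prod \<phi>' \<psi>' \<circ> inv_into (U \<times> V) (map_prod \<phi> \<psi>)) q"
      proof (rule eventually_mono[OF eventually_nhds_in_open[OF o p]])
        fix q assume "q \<in> \<phi> ` (U \<inter> U') \<times> \<psi> ` (V \<inter> V')"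
        then have "q \<in> \<phi> ` U \<times> \<psi> ` V" by auto
        from inv[OF U V this] show "((\<phi>' \<circ> inv_into U \<phi>) (fst q), (\<psi>' \<circ> inv_into V \<psi>) (snd q)) =
          (map_prod \<phi>' \<psi>' \<circ> inv_into (U \<times> V) (map_prod \<phi> \<psi>)) q" by simp
      qed
      ultimately show "smooth_at (map_prod \<phi>' \<psi>' \<circ> inv_into (U \<times> V) (map_prod \<phi> \<psi>)) p" by (rule smooth_at_cong[rotated])
    qed
  qed
  show ?thesis unfolding smooth_atlas_def
  proof (intro conjI cover)
    show "\<forall>(W, \<theta>)\<in>prod_atlas \<T> \<M>. open W \<and> open (\<theta> ` W) \<and> homeomorphism W (\<theta> ` W) \<theta> (inv_into W \<theta>)"
      using homeo unfolding prod_atlas_def by fast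
    show "\<forall>(W, \<theta>)\<in>prod_atlas \<T> \<M>. \<forall>(W', \<theta>')\<in>prod_atlas \<T> \<M>. smooth_on (\<theta> ` (W \<inter> W')) (\<theta>' \<circ> inv_into W \<theta>)"
      using trans unfolding prod_atlas_def by fast
  qed
qed

locale manifold_pair = T: manifold \<T> + M: manifold \<M>
  for \<T> :: "('t::{t2_space,second_countable_topology}, 'e::finite_dim_inner) atlas"
    and \<M> :: "('m::{t2_space,second_countable_topology}, 'f::finite_dim_inner) atlas"
begin

sublocale PM: manifold "prod_atlas \<T> \<M>"
  by unfold_locales (rule smooth_atlas_prod[OF T.atlas M.atlas])

lemma prod_chart: "(U, \<phi>) \<in> \<T> \<Longrightarrow> (V, \<psi>) \<in> \<M> \<Longrightarrow> (U \<times> V, map_prod \<phi> \<psi>) \<in> prod_atlas \<T> \<M>"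
  unfolding prod_atlas_def by blast

text \<open>\<open>inv_into\<close> of a product map is the pair of inverses on the image only,
  which is enough because smoothness depends on the germ.\<close>

lemma msmooth_at_prod_iff:
  assumes U: "(U, \<phi>) \<in> \<T>" "\<sigma> \<in> U" and V: "(V, \<psi>) \<in> \<M>" "x \<in> V"
  shows "msmooth_at (prod_atlas \<T> \<M>) F (\<sigma>, x) \<longleftrightarrow>
    smooth_at (\<lambda>p. F (inv_into U \<phi> (fst p), inv_into V \<psi> (snd p))) (\<phi> \<sigma>, \<psi> x)"
proof -
  have "msmooth_at (prod_atlas \<T> \<M>) F (\<sigma>, x) \<longleftrightarrow>
      smooth_at (\<lambda>y. F (inv_into (U \<times> V) (map_prod \<phi> \<psi>) y)) (map_prod \<phi> \<psi> (\<sigma>, x))"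
    by (rule PM.msmooth_at_iff[OF prod_chart[OF U(1) V(1)]]) (use U V in simp)
  also have "\<dots> \<longleftrightarrow> smooth_at (\<lambda>y. F (inv_into (U \<times> V) (map_prod \<phi> \<psi>) y)) (\<phi> \<sigma>, \<psi> x)" by simp
  also have "\<dots> \<longleftrightarrow> smooth_at (\<lambda>p. F (inv_into U \<phi> (fst p), inv_into V \<psi> (snd p))) (\<phi> \<sigma>, \<psi> x)"
  proof (rule smooth_at_cong_iff)
    have "\<forall>\<^sub>F p in nhds (\<phi> \<sigma>, \<psi> x). p \<in> \<phi> ` U \<times> \<psi> ` V"
      using U V T.chart_open_image M.chart_open_image by (intro eventually_nhds_in_open open_Times) auto
    then show "\<forall>\<^sub>F p in nhds (\<phi> \<sigma>, \<psi> x). F (inv_into (U \<times> V) (map_prod \<phi> \<psi>) p) =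
        F (inv_into U \<phi> (fst p), inv_into V \<psi> (snd p))"
    proof (rule eventually_mono)
      fix p assume "p \<in> \<phi> ` U \<times> \<psi> ` V"
      then show "F (inv_into (U \<times> V) (map_prod \<phi> \<psi>) p) = F (inv_into U \<phi> (fst p), inv_into V \<psi> (snd p))"
        using inv_into_map_prod[OF T.chart_inj[OF U(1)] M.chart_inj[OF V(1)], of "fst p" "snd p"]
        by (simp add: mem_Times_iff)
    qed
  qed
  finally show ?thesis .
qed

lemma msmooth_at_slice:
  assumes "msmooth_at (prod_atlas \<T> \<M>) F (\<sigma>, x)"
  shows "msmooth_at \<M> (\<lambda>x. F (\<sigma>, x)) x" "msmooth_at \<T> (\<lambda>\<sigma>. F (\<sigma>, x)) \<sigma>"
proof -
  obtain U \<phi> where U: "(U, \<phi>) \<in> \<T>" "\<sigma> \<in> U" using T.ex_chart .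
  obtain V \<psi> where V: "(V, \<psi>) \<in> \<M>" "x \<in> V" using M.ex_chart .
  have s: "smooth_at (\<lambda>p. F (inv_into U \<phi> (fst p), inv_into V \<psi> (snd p))) (\<phi> \<sigma>, \<psi> x)"
    using assms unfolding msmooth_at_prod_iff[OF U V] .
  show "msmooth_at \<M> (\<lambda>x. F (\<sigma>, x)) x"
    unfolding M.msmooth_at_iff[OF V]
    using smooth_at_compose[of _ "\<lambda>z. (\<phi> \<sigma>, z)" "\<psi> x", OF s] U by (simp add: smooth_at_Pair)
  show "msmooth_at \<T> (\<lambda>\<sigma>. F (\<sigma>, x)) \<sigma>"
    unfolding T.msmooth_at_iff[OF U]
    using smooth_at_compose[of _ "\<lambda>z. (z, \<psi> x)" "\<phi> \<sigma>", OF s] V by (simp add: smooth_at_Pair)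
qed

lemma S_slice:
  assumes "F \<in> PM.S"
  shows "(\<lambda>x. F (\<sigma>, x)) \<in> M.S" "(\<lambda>\<sigma>. F (\<sigma>, x)) \<in> T.S"
  unfolding T.smooth_funs_iff M.smooth_funs_iff
  using msmooth_at_slice[OF PM.smooth_funsD[OF assms]] by blast+

lemma msmooth_at_snd:
  assumes "msmooth_at \<M> f x" shows "msmooth_at (prod_atlas \<T> \<M>) (\<lambda>p. f (snd p)) (\<sigma>, x)"
proof -
  obtain U \<phi> where U: "(U, \<phi>) \<in> \<T>" "\<sigma> \<in> U" using T.ex_chart .
  obtain V \<psi> where V: "(V, \<psi>) \<in> \<M>" "x \<in> V" using M.ex_chart .
  have "smooth_at (\<lambda>p. f (inv_into V \<psi> (snd p))) (\<phi> \<sigma>, \<psi> x)"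
    using assms smooth_at_compose[of "\<lambda>y. f (inv_into V \<psi> y)" snd "(\<phi> \<sigma>, \<psi> x)"]
    unfolding M.msmooth_at_iff[OF V] by (simp add: smooth_at_snd)
  then show ?thesis unfolding msmooth_at_prod_iff[OF U V] by simp
qed

lemma msmooth_at_fst:
  assumes "msmooth_at \<T> f \<sigma>" shows "msmooth_at (prod_atlas \<T> \<M>) (\<lambda>p. f (fst p)) (\<sigma>, x)"
proof -
  obtain U \<phi> where U: "(U, \<phi>) \<in> \<T>" "\<sigma> \<in> U" using T.ex_chart .
  obtain V \<psi> where V: "(V, \<psi>) \<in> \<M>" "x \<in> V" using M.ex_chart .
  have "smooth_at (\<lambda>p. f (inv_into U \<phi> (fst p))) (\<phi> \<sigma>, \<psi> x)"
    using assms smooth_at_compose[of "\<lambda>y. f (inv_into U \<phi> y)" fst "(\<phi> \<sigma>, \<psi> x)"]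
    unfolding T.msmooth_at_iff[OF U] by (simp add: smooth_at_fst)
  then show ?thesis unfolding msmooth_at_prod_iff[OF U V] by simp
qed

lemma S_fst: "f \<in> T.S \<Longrightarrow> (\<lambda>p. f (fst p)) \<in> PM.S"
  by (auto simp: T.smooth_funs_iff PM.smooth_funs_iff intro: msmooth_at_fst)
lemma S_snd: "f \<in> M.S \<Longrightarrow> (\<lambda>p. f (snd p)) \<in> PM.S"
  by (auto simp: M.smooth_funs_iff PM.smooth_funs_iff intro: msmooth_at_snd)

text \<open>The cut-off depends on the parameter alone, so the extension agrees with
  \<open>g\<close> on all of \<open>M\<close> for parameters near \<sigma>. A cut-off in both
  variables would spoil the slices to which operators on \<open>M\<close> are applied.\<close>

lemma ex_extension_fst:
  fixes g :: "'t \<times> 'm \<Rightarrow> 'b::real_normed_vector"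
  assumes "open W" "\<sigma> \<in> W" "\<And>\<tau> x. \<tau> \<in> W \<Longrightarrow> msmooth_at (prod_atlas \<T> \<M>) g (\<tau>, x)"
  obtains G where "G \<in> PM.S" "\<forall>\<^sub>F \<tau> in nhds \<sigma>. \<forall>x. G (\<tau>, x) = g (\<tau>, x)"
proof -
  obtain \<eta> :: "'t \<Rightarrow> real" and C where \<eta>: "\<eta> \<in> T.S" "\<forall>\<^sub>F q in nhds \<sigma>. \<eta> q = 1"
    "closed C" "C \<subseteq> W" "\<And>q. q \<notin> C \<Longrightarrow> \<eta> q = 0" using T.ex_cutoff[OF assms(1,2)] by blast
  define G where "G p = (if fst p \<in> W then \<eta> (fst p) *\<^sub>R g p else 0)" for p
  have "msmooth_at (prod_atlas \<T> \<M>) G q" for q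
  proof (cases "fst q \<in> W")
    case True
    have "q \<in> W \<times> UNIV" using True by (simp add: mem_Times_iff)
    then have "\<forall>\<^sub>F q in nhds q. q \<in> W \<times> UNIV" using assms(1) by (intro eventually_nhds_in_open open_Times) auto
    then have "\<forall>\<^sub>F q in nhds q. \<eta> (fst q) *\<^sub>R g q = G q"
      by (rule eventually_mono) (auto simp: G_def)
    then show ?thesis
      by (rule PM.msmooth_at_cong)
        (use True assms(3)[of "fst q" "snd q"] PM.smooth_funsD[OF S_fst[OF \<eta>(1)], of q] in \<open>auto intro!: PM.msmooth_at_scaleR\<close>)
  next
    case False
    then have "q \<in> (- C) \<times> UNIV" using \<eta>(4) by (auto simp: mem_Times_iff)
    then have "\<forall>\<^sub>F q in nhds q. q \<in> (- C) \<times> UNIV"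
      using \<eta>(3) by (intro eventually_nhds_in_open open_Times) auto
    then have "\<forall>\<^sub>F q in nhds q. 0 = G q"
      by (rule eventually_mono) (auto simp: G_def \<eta>(5))
    then show ?thesis by (rule PM.msmooth_at_cong) simp
  qed
  moreover have "\<forall>\<^sub>F q in nhds \<sigma>. q \<in> W" using assms by (intro eventually_nhds_in_open)
  with \<eta>(2) have "\<forall>\<^sub>F \<tau> in nhds \<sigma>. \<forall>x. G (\<tau>, x) = g (\<tau>, x)" by eventually_elim (simp add: G_def)
  ultimately show ?thesis using that by (auto simp: PM.smooth_funs_iff)
qed

section \<open>Hadamard's lemma, with and without parameters\<close>

lemma frechet_partial:
  fixes F :: "'x::real_normed_vector \<times> 'y::real_normed_vector \<Rightarrow> 'c::real_normed_vector"
  assumes "smooth_at F (s, z)"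
  shows "frechet_derivative (\<lambda>y. F (y, z)) (at s) b = frechet_derivative F (at (s, z)) (b, 0)"
proof -
  have "((\<lambda>y. F (y, z)) has_derivative (\<lambda>b. frechet_derivative F (at (s, z)) (b, 0))) (at s)"
    by (rule has_derivative_compose[of "\<lambda>x. (x, z)" "\<lambda>v. (v, 0)", OF _ smooth_at_has_derivative[OF assms]])
      (auto intro!: derivative_eq_intros)
  from fun_cong[OF frechet_derivative_at[OF this], of b] show ?thesis by simp
qed

lemma chart_deriv_smooth:
  assumes U: "(U, \<phi>) \<in> \<T>" "\<tau> \<in> U" and F: "F \<in> PM.S"
  shows "msmooth_at (prod_atlas \<T> \<M>) (\<lambda>p. frechet_derivative (\<lambda>y. F (inv_into U \<phi> y, snd p)) (at (\<phi> (fst p))) b) (\<tau>, x)"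
proof -
  obtain V \<psi> where V: "(V, \<psi>) \<in> \<M>" "x \<in> V" using M.ex_chart .
  let ?F = "\<lambda>p. F (inv_into U \<phi> (fst p), inv_into V \<psi> (snd p))"
  have s: "smooth_at ?F (\<phi> t, \<psi> z)" if "t \<in> U" "z \<in> V" for t z
    using PM.smooth_funsD[OF F, of "(t, z)"] unfolding msmooth_at_prod_iff[OF U(1) that(1) V(1) that(2)] .
  have "\<forall>\<^sub>F p in nhds (\<phi> \<tau>, \<psi> x). p \<in> \<phi> ` U \<times> \<psi> ` V"
    using U V T.chart_open_image M.chart_open_image by (intro eventually_nhds_in_open open_Times) auto
  then have "\<forall>\<^sub>F p in nhds (\<phi> \<tau>, \<psi> x). frechet_derivative ?F (at p) (b, 0) =
     frechet_derivative (\<lambda>y. F (inv_into U \<phi> y, snd (inv_into U \<phi> (fst p), inv_into V \<psi> (snd p)))) (at (\<phi> (fst (inv_into U \<phi> (fst p), inv_into V \<psi> (snd p))))) b"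
  proof (rule eventually_mono)
    fix p assume "p \<in> \<phi> ` U \<times> \<psi> ` V"
    then obtain t z where p: "p = (\<phi> t, \<psi> z)" "t \<in> U" "z \<in> V" by auto
    show "frechet_derivative ?F (at p) (b, 0) =
     frechet_derivative (\<lambda>y. F (inv_into U \<phi> y, snd (inv_into U \<phi> (fst p), inv_into V \<psi> (snd p)))) (at (\<phi> (fst (inv_into U \<phi> (fst p), inv_into V \<psi> (snd p))))) b"
      using frechet_partial[OF s[OF p(2,3)], of b] p U(1) V(1) by simp
  qed
  then show ?thesis unfolding msmooth_at_prod_iff[OF U V]
    by (rule smooth_at_cong) (rule smooth_at_derivative[OF s[OF U(2) V(2)]])
qed

lemma segment_integral_smooth:
  fixes H :: "'t \<times> 'm \<Rightarrow> complex"
  assumes U: "(U, \<phi>) \<in> \<T>" "ball y0 r \<subseteq> \<phi> ` U"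
    and H: "\<And>\<tau> x. \<tau> \<in> U \<Longrightarrow> \<phi> \<tau> \<in> ball y0 r \<Longrightarrow> msmooth_at (prod_atlas \<T> \<M>) H (\<tau>, x)"
    and \<tau>: "\<tau> \<in> U" "\<phi> \<tau> \<in> ball y0 (r/2)"
  shows "msmooth_at (prod_atlas \<T> \<M>) (\<lambda>p. integral {0..1} (\<lambda>t. H (inv_into U \<phi> (y0 + t *\<^sub>R (\<phi> (fst p) - y0)), snd p))) (\<tau>, x)"
proof -
  obtain V \<psi> where V: "(V, \<psi>) \<in> \<M>" "x \<in> V" using M.ex_chart .
  let ?k = "\<lambda>p. H (inv_into U \<phi> (fst p), inv_into V \<psi> (snd p))"
  have "smooth_at ?k p" if p: "p \<in> ball y0 r \<times> \<psi> ` V" for p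
  proof -
    obtain z where z: "z \<in> V" "snd p = \<psi> z" using p by auto
    obtain t where t: "t \<in> U" "fst p = \<phi> t" using p U(2) by (auto simp: mem_Times_iff)
    have "msmooth_at (prod_atlas \<T> \<M>) H (t, z)" by (rule H) (use p t in \<open>auto simp: mem_Times_iff\<close>)
    then show ?thesis unfolding msmooth_at_prod_iff[OF U(1) t(1) V(1) z(1)] t(2)[symmetric] z(2)[symmetric] by simp
  qed
  then have "smooth_at (\<lambda>p. integral {0..1} (\<lambda>t. ?k (y0 + t *\<^sub>R (fst p - y0), snd p))) (\<phi> \<tau>, \<psi> x)"
    using \<tau> V M.chart_open_image by (intro smooth_at_segment_integral[where Z="\<psi> ` V" and r=r]) auto
  moreover have "\<forall>\<^sub>F p in nhds (\<phi> \<tau>, \<psi> x). integral {0..1} (\<lambda>t. ?k (y0 + t *\<^sub>R (fst p - y0), snd p)) =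
      integral {0..1} (\<lambda>t. H (inv_into U \<phi> (y0 + t *\<^sub>R (\<phi> (fst (inv_into U \<phi> (fst p), inv_into V \<psi> (snd p))) - y0)),
        snd (inv_into U \<phi> (fst p), inv_into V \<psi> (snd p))))"
  proof -
    have "\<forall>\<^sub>F p in nhds (\<phi> \<tau>, \<psi> x). p \<in> \<phi> ` U \<times> \<psi> ` V"
      using U \<tau> V T.chart_open_image M.chart_open_image by (intro eventually_nhds_in_open open_Times) auto
    then show ?thesis by (rule eventually_mono) (auto simp: U(1) V(1))
  qed
  ultimately show ?thesis unfolding msmooth_at_prod_iff[OF U(1) \<tau>(1) V] by (rule smooth_at_cong[rotated])
qed

lemma chart_segment_expand:
  fixes F :: "'t \<times> 'm \<Rightarrow> complex"
  assumes U: "(U, \<phi>) \<in> \<T>" "ball (\<phi> \<sigma>) r \<subseteq> \<phi> ` U" and \<tau>: "\<tau> \<in> U" "\<phi> \<tau> \<in> ball (\<phi> \<sigma>) r" "\<sigma> \<in> U"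
    and F: "(\<lambda>\<tau>. F (\<tau>, x)) \<in> T.S"
  shows "F (\<tau>, x) = F (\<sigma>, x) + (\<Sum>b\<in>onb. complex_of_real (inner (\<phi> \<tau> - \<phi> \<sigma>) b) *
    integral {0..1} (\<lambda>t. frechet_derivative (\<lambda>y. F (inv_into U \<phi> y, x)) (at (\<phi> \<sigma> + t *\<^sub>R (\<phi> \<tau> - \<phi> \<sigma>))) b))"
proof -
  let ?f = "\<lambda>y. F (inv_into U \<phi> y, x)"
  have s: "smooth_at ?f y" if y: "y \<in> ball (\<phi> \<sigma>) r" for y
  proof -
    obtain q where q: "q \<in> U" "y = \<phi> q" using subsetD[OF U(2) y] by blast
    show ?thesis using T.smooth_funsD[OF F, of q] unfolding T.msmooth_at_iff[OF U(1) q(1)] q(2) .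
  qed
  have "?f (\<phi> \<tau>) = ?f (\<phi> \<sigma>) + (\<Sum>b\<in>onb. inner (\<phi> \<tau> - \<phi> \<sigma>) b *\<^sub>R
    integral {0..1} (\<lambda>t. frechet_derivative ?f (at (\<phi> \<sigma> + t *\<^sub>R (\<phi> \<tau> - \<phi> \<sigma>))) b))"
  proof (rule segment_fundamental_theorem[OF _ _ \<tau>(2)])
    show "(?f has_derivative frechet_derivative ?f (at y)) (at y)" if "y \<in> ball (\<phi> \<sigma>) r" for y
      by (rule smooth_at_has_derivative[OF s[OF that]])
    show "continuous_on (ball (\<phi> \<sigma>) r) (\<lambda>y. frechet_derivative ?f (at y) b)" for b
      by (rule continuous_at_imp_continuous_on, rule ballI, rule smooth_at_isCont, rule smooth_at_derivative, rule s)
  qed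
  then show ?thesis
    by (simp only: T.chart_inv[OF U(1) \<tau>(1)] T.chart_inv[OF U(1) \<tau>(3)] scaleR_conv_of_real)
qed

text \<open>Hadamard's lemma in the parameter directions, with \<open>x\<close> as a spectator. One
  neighbourhood of \<sigma> serves all \<open>x\<close>, so that an operator in \<open>x\<close> can
  be applied to both sides.\<close>

lemma hadamard_param:
  fixes F :: "'t \<times> 'm \<Rightarrow> complex"
  assumes U: "(U, \<phi>) \<in> \<T>" "\<sigma> \<in> U" and F: "F \<in> PM.S"
  obtains G where "\<And>b. G b \<in> PM.S"
    "\<forall>\<^sub>F \<tau> in nhds \<sigma>. \<forall>x. F (\<tau>, x) = F (\<sigma>, x) + (\<Sum>b\<in>onb. complex_of_real (inner (\<phi> \<tau> - \<phi> \<sigma>) b) * G b (\<tau>, x))"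
    "\<And>b x. G b (\<sigma>, x) = frechet_derivative (\<lambda>y. F (inv_into U \<phi> y, x)) (at (\<phi> \<sigma>)) b"
proof -
  obtain r where r: "r > 0" "ball (\<phi> \<sigma>) r \<subseteq> \<phi> ` U"
    using T.chart_open_image[OF U(1)] U(2) openE[of "\<phi> ` U" "\<phi> \<sigma>"] by auto
  define H where "H b = (\<lambda>p. frechet_derivative (\<lambda>y. F (inv_into U \<phi> y, snd p)) (at (\<phi> (fst p))) b)" for b
  define g where "g b = (\<lambda>p. integral {0..1} (\<lambda>t. H b (inv_into U \<phi> (\<phi> \<sigma> + t *\<^sub>R (\<phi> (fst p) - \<phi> \<sigma>)), snd p)))" for b
  have "\<forall>\<^sub>F \<tau> in nhds \<sigma>. \<tau> \<in> U \<and> \<phi> \<tau> \<in> ball (\<phi> \<sigma>) (r/2)"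
    using r(1) by (intro T.eventually_chart_inv[OF U] eventually_nhds_in_open) auto
  then obtain W where W: "open W" "\<sigma> \<in> W" "\<And>\<tau>. \<tau> \<in> W \<Longrightarrow> \<tau> \<in> U" "\<And>\<tau>. \<tau> \<in> W \<Longrightarrow> \<phi> \<tau> \<in> ball (\<phi> \<sigma>) (r/2)"
    by (auto simp: eventually_nhds)
  have g: "msmooth_at (prod_atlas \<T> \<M>) (g b) (\<tau>, x)" if "\<tau> \<in> W" for b \<tau> x
    unfolding g_def
    by (rule segment_integral_smooth[OF U(1) r(2) _ W(3)[OF that] W(4)[OF that]],
        unfold H_def, rule chart_deriv_smooth[OF U(1) _ F])
  \<comment> \<open>The segment integrals are smooth for parameters near \<sigma> only; they are
    replaced by global functions that agree with them there for all \<open>x\<close>.\<close>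
  have "\<forall>b. \<exists>G. G \<in> PM.S \<and> (\<forall>\<^sub>F \<tau> in nhds \<sigma>. \<forall>x. G (\<tau>, x) = g b (\<tau>, x))"
  proof
    fix b
    obtain G where "G \<in> PM.S" "\<forall>\<^sub>F \<tau> in nhds \<sigma>. \<forall>x. G (\<tau>, x) = g b (\<tau>, x)"
      by (rule ex_extension_fst[OF W(1,2) g])
    then show "\<exists>G. G \<in> PM.S \<and> (\<forall>\<^sub>F \<tau> in nhds \<sigma>. \<forall>x. G (\<tau>, x) = g b (\<tau>, x))"
      by (intro exI[of _ G] conjI)
  qed
  from choice[OF this] obtain G where
    "\<forall>b. G b \<in> PM.S \<and> (\<forall>\<^sub>F \<tau> in nhds \<sigma>. \<forall>x. G b (\<tau>, x) = g b (\<tau>, x))" ..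
  then have G: "\<And>b. G b \<in> PM.S" "\<And>b. \<forall>\<^sub>F \<tau> in nhds \<sigma>. \<forall>x. G b (\<tau>, x) = g b (\<tau>, x)"
    by simp_all
  have geq: "g b (\<tau>, x) = integral {0..1} (\<lambda>t. frechet_derivative (\<lambda>y. F (inv_into U \<phi> y, x)) (at (\<phi> \<sigma> + t *\<^sub>R (\<phi> \<tau> - \<phi> \<sigma>))) b)"
    if "\<tau> \<in> W" for b \<tau> x
    unfolding g_def
  proof (rule integral_cong)
    fix t :: real assume "t \<in> {0..1}"
    then have "\<phi> \<sigma> + t *\<^sub>R (\<phi> \<tau> - \<phi> \<sigma>) \<in> \<phi> ` U"
      using segment_in_ball[OF W(4)[OF that], of t] r(2) by auto
    then show "H b (inv_into U \<phi> (\<phi> \<sigma> + t *\<^sub>R (\<phi> (fst (\<tau>, x)) - \<phi> \<sigma>)), snd (\<tau>, x)) =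
      frechet_derivative (\<lambda>y. F (inv_into U \<phi> y, x)) (at (\<phi> \<sigma> + t *\<^sub>R (\<phi> \<tau> - \<phi> \<sigma>))) b"
      by (simp add: H_def f_inv_into_f)
  qed
  have "\<forall>\<^sub>F \<tau> in nhds \<sigma>. \<forall>b\<in>onb. \<forall>x. G b (\<tau>, x) = g b (\<tau>, x)"
    using G(2) by (simp add: eventually_ball_finite)
  moreover have "\<forall>\<^sub>F \<tau> in nhds \<sigma>. \<tau> \<in> W" using W by (intro eventually_nhds_in_open)
  ultimately have "\<forall>\<^sub>F \<tau> in nhds \<sigma>. \<forall>x. F (\<tau>, x) = F (\<sigma>, x) + (\<Sum>b\<in>onb. complex_of_real (inner (\<phi> \<tau> - \<phi> \<sigma>) b) * G b (\<tau>, x))"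
  proof eventually_elim
    case (elim \<tau>)
    have "\<phi> \<tau> \<in> ball (\<phi> \<sigma>) r" using W(4)[OF elim(2)] r(1) by auto
    then show ?case
      using chart_segment_expand[OF U(1) r(2) W(3)[OF elim(2)] _ U(2) S_slice(2)[OF F]] elim by (simp add: geq)
  qed
  moreover have "G b (\<sigma>, x) = frechet_derivative (\<lambda>y. F (inv_into U \<phi> y, x)) (at (\<phi> \<sigma>)) b" for b x
    using eventually_nhds_x_imp_x[OF G(2)[of b]] geq[OF W(2), of b x] by simp
  ultimately show ?thesis by (intro that[of G] G(1))
qed

end

context manifold
begin

text \<open>Besides the expansion, the derivatives of the remainders at \<open>p\<close> are needed.
  Each \<open>G b\<close> averages a partial derivative of \<open>f\<close> along segments from
  \<open>p\<close>, so its derivatives at \<open>p\<close> are derivatives of \<open>f\<close> of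
  one order more, divided by the number of differentiations plus one.\<close>

lemma hadamard:
  fixes f :: "'a \<Rightarrow> complex"
  assumes U: "(U, \<phi>) \<in> \<A>" "p \<in> U" and f: "f \<in> S"
  obtains G where "\<And>b. G b \<in> S"
    "\<forall>\<^sub>F q in nhds p. f q = f p + (\<Sum>b\<in>onb. complex_of_real (inner (\<phi> q - \<phi> p) b) * G b q)"
    "\<And>b l. iter_deriv l (G b \<circ> inv_into U \<phi>) (\<phi> p) =
      iter_deriv (l @ [b]) (f \<circ> inv_into U \<phi>) (\<phi> p) / (of_nat (length l) + 1)"
proof -
  let ?f = "f \<circ> inv_into U \<phi>"
  have app: "iter_deriv (l @ [b]) g = iter_deriv l (\<lambda>y. frechet_derivative g (at y) b)"
    for l b and g :: "'e \<Rightarrow> complex"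
    by (induction l) auto
  obtain r where r: "r > 0" "ball (\<phi> p) r \<subseteq> \<phi> ` U"
    using chart_open_image[OF U(1)] U(2) openE[of "\<phi> ` U" "\<phi> p"] by auto
  have s: "smooth_at ?f y" if "y \<in> ball (\<phi> p) r" for y
    using that r(2) msmooth_atD[OF smooth_funsD[OF f] U(1)] by blast
  define k where "k b = (\<lambda>y. frechet_derivative ?f (at y) b)" for b
  have k: "smooth_at (k b) y" if "y \<in> ball (\<phi> p) r" for b y
    unfolding k_def using smooth_at_derivative[OF s[OF that]] .
  define g where "g b = (\<lambda>y. integral {0..1} (\<lambda>t. k b (\<phi> p + t *\<^sub>R (y - \<phi> p))))" for b
  have g: "smooth_at (g b) y" if "y \<in> ball (\<phi> p) (r/2)" for b y
  proof -
    have "smooth_at (\<lambda>q. integral {0..1} (\<lambda>t. k b (fst (\<phi> p + t *\<^sub>R (fst q - \<phi> p), snd q)))) (y, 0::real)"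
    proof (rule smooth_at_segment_integral[where Z=UNIV and r=r])
      show "smooth_at (\<lambda>p. k b (fst p)) q" if "q \<in> ball (\<phi> p) r \<times> UNIV" for q
        by (rule smooth_at_compose[OF k]) (use that in \<open>auto intro!: smooth_at_intros simp: mem_Times_iff\<close>)
    qed (use that in auto)
    then have "smooth_at (\<lambda>q. g b (fst q)) (y, 0::real)" by (simp add: g_def)
    from smooth_at_compose[of _ "\<lambda>y. (y, 0)", OF this] show ?thesis by (simp add: smooth_at_Pair)
  qed
  have "\<forall>\<^sub>F q in nhds p. q \<in> U \<and> \<phi> q \<in> ball (\<phi> p) (r/2)"
    using r(1) by (intro eventually_chart_inv[OF U] eventually_nhds_in_open) auto
  then obtain W where W: "open W" "p \<in> W" "\<And>q. q \<in> W \<Longrightarrow> q \<in> U" "\<And>q. q \<in> W \<Longrightarrow> \<phi> q \<in> ball (\<phi> p) (r/2)"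
    by (auto simp: eventually_nhds)
  have "msmooth_at \<A> (\<lambda>q. g b (\<phi> q)) q" if "q \<in> W" for b q
    unfolding msmooth_at_iff[OF U(1) W(3)[OF that]]
  proof (rule smooth_at_cong)
    show "\<forall>\<^sub>F y in nhds (\<phi> q). g b y = g b (\<phi> (inv_into U \<phi> y))"
      using eventually_chart[OF U(1) W(3)[OF that], of "\<lambda>_. True"]
      by (rule eventually_mono[OF _]) (auto simp: U(1))
  qed (use g W that in blast)
  note sm = this
  have "\<forall>b. \<exists>G. G \<in> S \<and> (\<forall>\<^sub>F q in nhds p. G q = g b (\<phi> q))"
  proof
    fix b
    obtain G where "G \<in> S" "\<forall>\<^sub>F q in nhds p. G q = g b (\<phi> q)"
      by (rule ex_extension[OF W(1,2) sm])
    then show "\<exists>G. G \<in> S \<and> (\<forall>\<^sub>F q in nhds p. G q = g b (\<phi> q))"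
      by (intro exI[of _ G] conjI)
  qed
  from choice[OF this] obtain G where
    "\<forall>b. G b \<in> S \<and> (\<forall>\<^sub>F q in nhds p. G b q = g b (\<phi> q))" ..
  then have G: "\<And>b. G b \<in> S" "\<And>b. \<forall>\<^sub>F q in nhds p. G b q = g b (\<phi> q)"
    by simp_all
  have "\<forall>\<^sub>F q in nhds p. \<forall>b\<in>onb. G b q = g b (\<phi> q)"
    using G(2) by (simp add: eventually_ball_finite)
  moreover have "\<forall>\<^sub>F q in nhds p. q \<in> W" using W by (intro eventually_nhds_in_open)
  ultimately have "\<forall>\<^sub>F q in nhds p. f q = f p + (\<Sum>b\<in>onb. complex_of_real (inner (\<phi> q - \<phi> p) b) * G b q)"
  proof eventually_elim
    case (elim q)
    have "\<phi> q \<in> ball (\<phi> p) r" using W(4)[OF elim(2)] r(1) by auto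
    then have "?f (\<phi> q) = ?f (\<phi> p) + (\<Sum>b\<in>onb. inner (\<phi> q - \<phi> p) b *\<^sub>R
      integral {0..1} (\<lambda>t. frechet_derivative ?f (at (\<phi> p + t *\<^sub>R (\<phi> q - \<phi> p))) b))"
    proof (rule segment_fundamental_theorem[rotated 2])
      show "(?f has_derivative frechet_derivative ?f (at y)) (at y)" if "y \<in> ball (\<phi> p) r" for y
        by (rule smooth_at_has_derivative[OF s[OF that]])
      show "continuous_on (ball (\<phi> p) r) (\<lambda>y. frechet_derivative ?f (at y) b)" for b
        by (rule continuous_at_imp_continuous_on, rule ballI, rule smooth_at_isCont, rule smooth_at_derivative, rule s)
    qed
    then have "?f (\<phi> q) = ?f (\<phi> p) + (\<Sum>b\<in>onb. complex_of_real (inner (\<phi> q - \<phi> p) b) * g b (\<phi> q))"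
      by (simp only: scaleR_conv_of_real g_def k_def)
    also have "\<dots> = ?f (\<phi> p) + (\<Sum>b\<in>onb. complex_of_real (inner (\<phi> q - \<phi> p) b) * G b q)"
      using elim(1) by simp
    finally show ?case
      by (simp only: o_apply chart_inv[OF U] chart_inv[OF U(1) W(3)[OF elim(2)]])
  qed
  moreover have "iter_deriv l (G b \<circ> inv_into U \<phi>) (\<phi> p) = iter_deriv (l @ [b]) ?f (\<phi> p) / (of_nat (length l) + 1)" for b l
  proof -
    have "\<forall>\<^sub>F y in nhds (\<phi> p). y \<in> \<phi> ` U \<and> G b (inv_into U \<phi> y) = g b (\<phi> (inv_into U \<phi> y))"
      by (rule eventually_chart[OF U G(2)])
    then obtain N where N: "open N" "\<phi> p \<in> N" "\<And>y. y \<in> N \<Longrightarrow> y \<in> \<phi> ` U \<and> G b (inv_into U \<phi> y) = g b (\<phi> (inv_into U \<phi> y))"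
      unfolding eventually_nhds by (elim exE conjE) simp
    have "iter_deriv l (G b \<circ> inv_into U \<phi>) (\<phi> p) = iter_deriv l (g b) (\<phi> p)"
    proof (rule iter_deriv_cong[OF N(1) _ _ N(2)])
      fix y assume "y \<in> N"
      with N(3)[OF this] show "(G b \<circ> inv_into U \<phi>) y = g b y" by (simp add: f_inv_into_f)
      show "smooth_at (G b \<circ> inv_into U \<phi>) y"
        using N(3)[OF \<open>y \<in> N\<close>] msmooth_atD[OF smooth_funsD[OF G(1)] U(1)] by blast
    qed
    also have "\<dots> = iter_deriv l (k b) (\<phi> p) / (of_nat (length l) + 1)"
      unfolding g_def by (rule iter_deriv_segment_integral_center[OF r(1) k])
    finally show ?thesis unfolding app k_def .
  qed
  ultimately show ?thesis by (intro that[of G] G(1))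
qed

end

section \<open>Order of functionals and smooth families of operators\<close>

text \<open>Products of functions stay elements of the function algebra, to which closure rules and
  functionals apply; they are evaluated on demand.\<close>

declare times_fun_apply [simp del]

definition lin_on :: "('a \<Rightarrow> complex) set \<Rightarrow> (('a \<Rightarrow> complex) \<Rightarrow> complex) \<Rightarrow> bool" where
  "lin_on S \<Lambda> \<longleftrightarrow> (\<forall>f\<in>S. \<forall>g\<in>S. \<forall>a b. \<Lambda> (\<lambda>x. a * f x + b * g x) = a * \<Lambda> f + b * \<Lambda> g)"

text \<open>If \<Lambda> is the evaluation at \<open>p\<close> of an operator, this is the
  evaluation at \<open>p\<close> of its commutator with multiplication by \<open>u\<close>: the
  multiplication that comes after the operator becomes the scalar \<open>u p\<close>.\<close>

definition commutator :: "('a \<Rightarrow> complex) \<Rightarrow> 'a \<Rightarrow> (('a \<Rightarrow> complex) \<Rightarrow> complex) \<Rightarrow> ('a \<Rightarrow> complex) \<Rightarrow> complex" where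
  "commutator u p \<Lambda> = (\<lambda>f. \<Lambda> (u * f) - u p * \<Lambda> f)"

text \<open>
  Grothendieck's description of differential operators, at one point: \<open>order_at S p n\<close> holds for the
  evaluations at \<open>p\<close> of the operators of order less than \<open>n\<close>.
\<close>

primrec order_at :: "('a \<Rightarrow> complex) set \<Rightarrow> 'a \<Rightarrow> nat \<Rightarrow> (('a \<Rightarrow> complex) \<Rightarrow> complex) \<Rightarrow> bool" where
  "order_at S p 0 \<Lambda> \<longleftrightarrow> (\<forall>f\<in>S. \<Lambda> f = 0)"
| "order_at S p (Suc n) \<Lambda> \<longleftrightarrow> (\<forall>u\<in>S. order_at S p n (commutator u p \<Lambda>))"

text \<open>There are two kinds of instances: smooth functions on a manifold, and functions smooth
  at all points of an open set of a model space. The order of a derivative is computed in the second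
  and transported to the first.\<close>

locale function_algebra =
  fixes S :: "('a \<Rightarrow> complex) set"
  assumes mult_closed: "f \<in> S \<Longrightarrow> g \<in> S \<Longrightarrow> f * g \<in> S"
    and lin_closed: "f \<in> S \<Longrightarrow> g \<in> S \<Longrightarrow> (\<lambda>x. a * f x + b * g x) \<in> S"
    and const_closed: "(\<lambda>x. c) \<in> S"
begin

lemma order_at_cong:
  "(\<And>f. f \<in> S \<Longrightarrow> \<Lambda> f = \<Lambda>' f) \<Longrightarrow> order_at S p n \<Lambda> \<Longrightarrow> order_at S p n \<Lambda>'"
proof (induction n arbitrary: \<Lambda> \<Lambda>')
  case (Suc n)
  have "order_at S p n (commutator u p \<Lambda>')" if "u \<in> S" for u
  proof (rule Suc.IH)
    show "order_at S p n (commutator u p \<Lambda>)" using Suc.prems(2) that by simp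
    show "commutator u p \<Lambda> f = commutator u p \<Lambda>' f" if "f \<in> S" for f
      unfolding commutator_def Suc.prems(1)[OF that] Suc.prems(1)[OF mult_closed[OF \<open>u \<in> S\<close> that]] ..
  qed
  then show ?case by simp
qed simp

lemma order_at_zero: "(\<And>f. f \<in> S \<Longrightarrow> \<Lambda> f = 0) \<Longrightarrow> order_at S p n \<Lambda>"
  by (induction n arbitrary: \<Lambda>) (simp_all add: commutator_def mult_closed)

lemma order_at_Suc: "order_at S p n \<Lambda> \<Longrightarrow> order_at S p (Suc n) \<Lambda>"
proof (induction n arbitrary: \<Lambda>)
  case 0
  then show ?case by (simp add: commutator_def mult_closed)
next
  case (Suc n)
  have "order_at S p (Suc n) (commutator u p \<Lambda>)" if "u \<in> S" for u
    using Suc.prems that by (intro Suc.IH) simp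
  then show ?case by (subst order_at.simps(2)) blast
qed

lemma order_at_mono: "order_at S p n \<Lambda> \<Longrightarrow> n \<le> m \<Longrightarrow> order_at S p m \<Lambda>"
  by (induction m) (auto simp: le_Suc_eq intro: order_at_Suc simp del: order_at.simps)

lemma order_at_add:
  "order_at S p n \<Lambda> \<Longrightarrow> order_at S p n \<Lambda>' \<Longrightarrow> order_at S p n (\<lambda>f. \<Lambda> f + \<Lambda>' f)"
proof (induction n arbitrary: \<Lambda> \<Lambda>')
  case (Suc n)
  have "order_at S p n (commutator u p (\<lambda>f. \<Lambda> f + \<Lambda>' f))" if "u \<in> S" for u
  proof (rule order_at_cong[OF _ Suc.IH])
    show "order_at S p n (commutator u p \<Lambda>)" "order_at S p n (commutator u p \<Lambda>')"
      using Suc.prems that by simp_all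
  qed (simp add: commutator_def algebra_simps)
  then show ?case by simp
qed simp

lemma order_at_cmult: "order_at S p n \<Lambda> \<Longrightarrow> order_at S p n (\<lambda>f. c * \<Lambda> f)"
proof (induction n arbitrary: \<Lambda>)
  case (Suc n)
  have "order_at S p n (commutator u p (\<lambda>f. c * \<Lambda> f))" if "u \<in> S" for u
  proof (rule order_at_cong[OF _ Suc.IH])
    show "order_at S p n (commutator u p \<Lambda>)" using Suc.prems that by simp
  qed (simp add: commutator_def algebra_simps)
  then show ?case by simp
qed simp

lemma order_at_diff:
  "order_at S p n \<Lambda> \<Longrightarrow> order_at S p n \<Lambda>' \<Longrightarrow> order_at S p n (\<lambda>f. \<Lambda> f - \<Lambda>' f)"
  using order_at_add[of p n \<Lambda> "\<lambda>f. - 1 * \<Lambda>' f"] order_at_cmult[of p n \<Lambda>' "- 1"] by simp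

lemma order_at_sum:
  "(\<And>i. i \<in> I \<Longrightarrow> order_at S p n (\<Lambda> i)) \<Longrightarrow> order_at S p n (\<lambda>f. \<Sum>i\<in>I. \<Lambda> i f)"
proof (induction I rule: infinite_finite_induct)
  case (insert i I)
  have "order_at S p n (\<lambda>f. \<Lambda> i f + (\<Sum>i\<in>I. \<Lambda> i f))"
    by (intro order_at_add insert.IH insert.prems) auto
  then show ?case using insert.hyps by simp
qed (simp_all add: order_at_zero)

text \<open>Multiplications by \<open>u\<close> and \<open>w\<close> commute, so commutators with
  \<open>u\<close> ignore the factor \<open>w\<close>.\<close>

lemma order_at_mult:
  assumes "w \<in> S" shows "order_at S p n \<Lambda> \<Longrightarrow> order_at S p n (\<lambda>f. \<Lambda> (w * f))"
proof (induction n arbitrary: \<Lambda>)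
  case (Suc n)
  have "order_at S p n (commutator u p (\<lambda>f. \<Lambda> (w * f)))" if "u \<in> S" for u
  proof (rule order_at_cong[OF _ Suc.IH])
    show "order_at S p n (commutator u p \<Lambda>)" using Suc.prems that by simp
    have "w * (u * f) = u * (w * f)" for f by (rule mult.left_commute)
    then show "commutator u p \<Lambda> (w * f) = commutator u p (\<lambda>f. \<Lambda> (w * f)) f" for f
      by (simp only: commutator_def)
  qed
  then show ?case by simp
qed (use assms mult_closed in simp)

lemma lin_on_add: "lin_on S \<Lambda> \<Longrightarrow> f \<in> S \<Longrightarrow> g \<in> S \<Longrightarrow> \<Lambda> (\<lambda>x. f x + g x) = \<Lambda> f + \<Lambda> g"
  unfolding lin_on_def by (metis (no_types, lifting) ext mult_1)
lemma lin_on_diff: "lin_on S \<Lambda> \<Longrightarrow> f \<in> S \<Longrightarrow> g \<in> S \<Longrightarrow> \<Lambda> (\<lambda>x. f x - g x) = \<Lambda> f - \<Lambda> g"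
  unfolding lin_on_def by (drule bspec[of _ _ f], assumption, drule bspec[of _ _ g], assumption)
    (drule spec[of _ 1], drule spec[of _ "- 1"], simp)
lemma lin_on_cmult: "lin_on S \<Lambda> \<Longrightarrow> f \<in> S \<Longrightarrow> \<Lambda> (\<lambda>x. c * f x) = c * \<Lambda> f"
  unfolding lin_on_def by (drule bspec[of _ _ f], assumption, drule bspec[of _ _ f], assumption)
    (drule spec[of _ c], drule spec[of _ 0], simp)
lemma lin_on_zero: "lin_on S \<Lambda> \<Longrightarrow> \<Lambda> (\<lambda>x. 0) = 0"
  using lin_on_cmult[of \<Lambda> "\<lambda>x. 0" 0] const_closed by simp
lemma sum_closed: "(\<And>i. i \<in> I \<Longrightarrow> f i \<in> S) \<Longrightarrow> (\<lambda>x. \<Sum>i\<in>I. f i x) \<in> S"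
proof (induction I rule: infinite_finite_induct)
  case (insert i I)
  then show ?case using lin_closed[of "f i" "\<lambda>x. \<Sum>i\<in>I. f i x" 1 1] by simp
qed (simp_all add: const_closed)
lemma lin_on_sum:
  "lin_on S \<Lambda> \<Longrightarrow> (\<And>i. i \<in> I \<Longrightarrow> f i \<in> S) \<Longrightarrow> \<Lambda> (\<lambda>x. \<Sum>i\<in>I. f i x) = (\<Sum>i\<in>I. \<Lambda> (f i))"
proof (induction I rule: infinite_finite_induct)
  case (insert i I)
  then show ?case using lin_on_add[of \<Lambda> "f i" "\<lambda>x. \<Sum>i\<in>I. f i x"] sum_closed[of I f] by simp
qed (simp_all add: lin_on_zero)

lemma lin_on_commutator: "lin_on S \<Lambda> \<Longrightarrow> u \<in> S \<Longrightarrow> lin_on S (commutator u p \<Lambda>)"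
  unfolding lin_on_def[of _ "commutator u p \<Lambda>"]
proof (intro ballI allI)
  fix f g a b assume \<Lambda>: "lin_on S \<Lambda>" and s: "u \<in> S" "f \<in> S" "g \<in> S"
  have "u * (\<lambda>x. a * f x + b * g x) = (\<lambda>x. a * (u * f) x + b * (u * g) x)"
    by (auto simp: algebra_simps times_fun_apply)
  moreover have "\<Lambda> (\<lambda>x. a * h x + b * k x) = a * \<Lambda> h + b * \<Lambda> k" if "h \<in> S" "k \<in> S" for h k
    using \<Lambda> that unfolding lin_on_def by simp
  ultimately show "commutator u p \<Lambda> (\<lambda>x. a * f x + b * g x) = a * commutator u p \<Lambda> f + b * commutator u p \<Lambda> g"
    using s mult_closed[OF s(1,2)] mult_closed[OF s(1,3)] unfolding commutator_def
    by (simp add: algebra_simps del: times_fun_apply)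
qed

text \<open>Leibniz rule for commutators: [\<Lambda> R, u] = \<Lambda> [R, u] + [\<Lambda>, u] R.
  Each summand lowers one of the two orders, so the induction runs on \<open>m + n\<close>; if
  \<open>m\<close> or \<open>n\<close> is 0, one factor and hence the composition vanishes.\<close>

lemma order_at_compose:
  assumes "lin_on S \<Lambda>" "order_at S p m \<Lambda>"
    and "\<And>q. order_at S q n (\<lambda>f. R f q)" "\<And>f. f \<in> S \<Longrightarrow> R f \<in> S"
  shows "order_at S p (m + n) (\<lambda>f. \<Lambda> (R f))"
  using assms
proof (induction "m + n" arbitrary: m n \<Lambda> R)
  case 0
  have "\<Lambda> g = 0" if "g \<in> S" for g using 0(1,3) that by simp
  then show ?case using 0(1,5) by simp
next
  case (Suc k)
  show ?case
  proof (cases "m = 0 \<or> n = 0")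
    case True
    have "\<Lambda> (R f) = 0" if "f \<in> S" for f
    proof (cases "m = 0")
      case True
      then show ?thesis using Suc.prems that by simp
    next
      case False
      then have "n = 0" using True by simp
      then have "R f = (\<lambda>x. 0)" using Suc.prems(3) that by auto
      then show ?thesis using lin_on_zero[OF Suc.prems(1)] by simp
    qed
    then show ?thesis by (rule order_at_zero)
  next
    case False
    then obtain m' n' where mn: "m = Suc m'" "n = Suc n'" by (metis not0_implies_Suc)
    have "order_at S p k (commutator u p (\<lambda>f. \<Lambda> (R f)))" if u: "u \<in> S" for u
    proof -
      have a: "order_at S p k (\<lambda>f. \<Lambda> (R (u * f) - u * R f))"
      proof -
        have "order_at S p (m + n') (\<lambda>f. \<Lambda> ((\<lambda>f. R (u * f) - u * R f) f))"
        proof (rule Suc.hyps(1)[OF _ Suc.prems(1,2)])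
          show "k = m + n'" using Suc.hyps(2) mn by simp
          show "order_at S q n' (\<lambda>f. (R (u * f) - u * R f) q)" for q
            using Suc.prems(3)[of q] u unfolding mn by (simp add: commutator_def times_fun_apply[of u "R _"])
          show "R (u * f) - u * R f \<in> S" if "f \<in> S" for f
            using lin_closed[of "R (u * f)" "u * R f" 1 "- 1"] Suc.prems(4) mult_closed u that
            by (simp add: fun_diff_def times_fun_def)
        qed
        then show ?thesis using Suc.hyps(2) mn by simp
      qed
      have b: "order_at S p k (\<lambda>f. commutator u p \<Lambda> (R f))"
      proof -
        have "order_at S p (m' + n) (\<lambda>f. commutator u p \<Lambda> (R f))"
        proof (rule Suc.hyps(1)[OF _ lin_on_commutator[OF Suc.prems(1) u]])
          show "k = m' + n" using Suc.hyps(2) mn by simp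
        qed (use Suc.prems u in \<open>simp_all add: mn\<close>)
        then show ?thesis using Suc.hyps(2) mn by simp
      qed
      show ?thesis
      proof (rule order_at_cong[OF _ order_at_add[OF a b]])
        fix f assume f: "f \<in> S"
        have "\<Lambda> (R (u * f) - u * R f) = \<Lambda> (R (u * f)) - \<Lambda> (u * R f)"
          using lin_on_diff[OF Suc.prems(1), of "R (u * f)" "u * R f"] Suc.prems(4) mult_closed u f
          by (simp add: fun_diff_def)
        then show "\<Lambda> (R (u * f) - u * R f) + commutator u p \<Lambda> (R f) = commutator u p (\<lambda>f. \<Lambda> (R f)) f"
          by (simp add: commutator_def)
      qed
    qed
    then show ?thesis using Suc.hyps(2) by (metis order_at.simps(2))
  qed
qed

end

section \<open>Order of iterated derivatives in open sets\<close>

definition smooth_at_funs :: "'e::real_normed_vector set \<Rightarrow> ('e \<Rightarrow> complex) set" where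
  "smooth_at_funs \<Omega> = {f. \<forall>y\<in>\<Omega>. smooth_at f y}"

lemma function_algebra_smooth_at_funs: "function_algebra (smooth_at_funs \<Omega>)"
  by unfold_locales (auto simp: smooth_at_funs_def times_fun_def intro!: smooth_at_intros)

text \<open>The last vector of the list is differentiated first. Splitting it off keeps the outer
  functional and changes its argument, which is why the inductions below run over the end of the
  list.\<close>

lemma iter_deriv_append:
  "iter_deriv (l @ [b]) g = iter_deriv l (\<lambda>y. frechet_derivative g (at y) b)"
  by (induction l) auto

lemma iter_deriv_lin_on: "y \<in> \<Omega> \<Longrightarrow> lin_on (smooth_at_funs \<Omega>) (\<lambda>f. iter_deriv l f y)"
  if "open \<Omega>" for \<Omega> :: "'e::real_normed_vector set"
proof (induction l arbitrary: y rule: rev_induct)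
  case Nil
  then show ?case by (simp add: lin_on_def)
next
  case (snoc v l)
  show ?case unfolding lin_on_def
  proof safe
    fix f g a b assume s: "f \<in> smooth_at_funs \<Omega>" "g \<in> smooth_at_funs \<Omega>"
    have "frechet_derivative (\<lambda>x. a * f x + b * g x) (at z) v =
      a * frechet_derivative f (at z) v + b * frechet_derivative g (at z) v" if "z \<in> \<Omega>" for z
    proof -
      have "((\<lambda>x. a * f x + b * g x) has_derivative (\<lambda>v. a * frechet_derivative f (at z) v + b * frechet_derivative g (at z) v)) (at z)"
        using s that unfolding smooth_at_funs_def
        by (intro has_derivative_add has_derivative_mult_right smooth_at_has_derivative) auto
      from fun_cong[OF frechet_derivative_at[OF this], of v] show ?thesis by simp
    qed
    then have "iter_deriv l (\<lambda>z. frechet_derivative (\<lambda>x. a * f x + b * g x) (at z) v) y =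
      iter_deriv l (\<lambda>z. a * frechet_derivative f (at z) v + b * frechet_derivative g (at z) v) y"
      using s by (intro iter_deriv_cong[OF that _ _ snoc.prems])
        (auto simp: smooth_at_funs_def intro!: smooth_at_derivative smooth_at_intros)
    also have "\<dots> = a * iter_deriv l (\<lambda>z. frechet_derivative f (at z) v) y + b * iter_deriv l (\<lambda>z. frechet_derivative g (at z) v) y"
    proof -
      have "(\<lambda>z. frechet_derivative h (at z) v) \<in> smooth_at_funs \<Omega>" if "h \<in> smooth_at_funs \<Omega>" for h
        using that by (auto simp: smooth_at_funs_def intro: smooth_at_derivative)
      from snoc.IH[OF snoc.prems, unfolded lin_on_def, rule_format, OF this[OF s(1)] this[OF s(2)]]
      show ?thesis .
    qed
    finally show "iter_deriv (l @ [v]) (\<lambda>x. a * f x + b * g x) y = a * iter_deriv (l @ [v]) f y + b * iter_deriv (l @ [v]) g y"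
      by (simp add: iter_deriv_append)
  qed
qed

text \<open>Write \<partial> for the derivative along \<open>v\<close>. The product rule gives
  [\<Lambda> \<partial>, u] f = \<Lambda> (\<partial>u f) + [\<Lambda>, u] \<partial>f: the first
  term has the order of \<Lambda>, the second is covered by induction. The product rule holds on
  \<Omega>, hence the requirement that \<Lambda> sees only values there.\<close>

lemma order_at_directional:
  fixes \<Omega> :: "'e::real_normed_vector set"
  assumes "open \<Omega>" "y \<in> \<Omega>"
  shows "lin_on (smooth_at_funs \<Omega>) \<Lambda> \<Longrightarrow>
    (\<And>f g. f \<in> smooth_at_funs \<Omega> \<Longrightarrow> g \<in> smooth_at_funs \<Omega> \<Longrightarrow> (\<And>z. z \<in> \<Omega> \<Longrightarrow> f z = g z) \<Longrightarrow> \<Lambda> f = \<Lambda> g) \<Longrightarrow>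
    order_at (smooth_at_funs \<Omega>) y n \<Lambda> \<Longrightarrow>
    order_at (smooth_at_funs \<Omega>) y (Suc n) (\<lambda>f. \<Lambda> (\<lambda>z. frechet_derivative f (at z) v))"
proof (induction n arbitrary: \<Lambda>)
  case 0
  interpret function_algebra "smooth_at_funs \<Omega>" by (rule function_algebra_smooth_at_funs)
  have d: "(\<lambda>z. frechet_derivative h (at z) v) \<in> smooth_at_funs \<Omega>" if "h \<in> smooth_at_funs \<Omega>" for h
    using that by (auto simp: smooth_at_funs_def intro: smooth_at_derivative)
  have z: "\<Lambda> (\<lambda>z. frechet_derivative h (at z) v) = 0" if "h \<in> smooth_at_funs \<Omega>" for h
    by (rule bspec[OF 0(3)[unfolded order_at.simps] d[OF that]])
  show ?case unfolding order_at.simps commutator_def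
    by (intro ballI) (simp only: z mult_closed mult_zero_right diff_self)
next
  case (Suc n)
  interpret function_algebra "smooth_at_funs \<Omega>" by (rule function_algebra_smooth_at_funs)
  let ?S = "smooth_at_funs \<Omega>" and ?d = "\<lambda>f z. frechet_derivative f (at z) v"
  have d: "?d h \<in> ?S" if "h \<in> ?S" for h
    using that by (auto simp: smooth_at_funs_def intro: smooth_at_derivative)
  have "order_at ?S y (Suc n) (commutator u y (\<lambda>f. \<Lambda> (?d f)))" if u: "u \<in> ?S" for u
  proof (rule order_at_cong)
    show "order_at ?S y (Suc n) (\<lambda>f. \<Lambda> (?d u * f) + commutator u y \<Lambda> (?d f))"
    proof (rule order_at_add)
      show "order_at ?S y (Suc n) (\<lambda>f. \<Lambda> (?d u * f))" using order_at_mult[OF d[OF u] Suc.prems(3)] .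
      show "order_at ?S y (Suc n) (\<lambda>f. commutator u y \<Lambda> (?d f))"
      proof (rule Suc.IH[OF lin_on_commutator[OF Suc.prems(1) u]])
        show "commutator u y \<Lambda> f = commutator u y \<Lambda> g" if "f \<in> ?S" "g \<in> ?S" "\<And>z. z \<in> \<Omega> \<Longrightarrow> f z = g z" for f g
          unfolding commutator_def using that u mult_closed
          by (intro arg_cong2[where f="(-)"] arg_cong2[where f="(*)"] Suc.prems(2) refl)
            (assumption | simp add: times_fun_apply)+
        show "order_at ?S y n (commutator u y \<Lambda>)" using Suc.prems(3) u by simp
      qed
    qed
    fix f assume f: "f \<in> ?S"
    have prod: "?d (u * f) z = u z * ?d f z + ?d u z * f z" if "z \<in> \<Omega>" for z
    proof -
      have "((\<lambda>x. u x * f x) has_derivative (\<lambda>v. u z * frechet_derivative f (at z) v + frechet_derivative u (at z) v * f z)) (at z)"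
        using u f that unfolding smooth_at_funs_def by (intro has_derivative_mult smooth_at_has_derivative) auto
      from fun_cong[OF frechet_derivative_at[OF this], of v] show ?thesis by (simp add: times_fun_def)
    qed
    have "\<Lambda> (?d (u * f)) = \<Lambda> (\<lambda>z. (u * ?d f) z + (?d u * f) z)"
      using prod lin_closed[of "u * ?d f" "?d u * f" 1 1] u f d mult_closed
      by (intro Suc.prems(2)) (simp_all add: times_fun_apply[of u] times_fun_apply[of _ f])
    also have "\<dots> = \<Lambda> (u * ?d f) + \<Lambda> (?d u * f)"
      by (intro lin_on_add Suc.prems(1) mult_closed u f d)
    finally show "\<Lambda> (?d u * f) + commutator u y \<Lambda> (?d f) = commutator u y (\<lambda>f. \<Lambda> (?d f)) f"
      by (simp add: commutator_def)
  qed
  then show ?case by (subst order_at.simps(2)) blast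
qed

lemma order_at_iter_deriv:
  fixes \<Omega> :: "'e::real_normed_vector set"
  assumes "open \<Omega>" "y \<in> \<Omega>"
  shows "order_at (smooth_at_funs \<Omega>) y (Suc (length l)) (\<lambda>f. iter_deriv l f y)"
proof (induction l rule: rev_induct)
  case Nil
  show ?case by (simp add: commutator_def times_fun_apply)
next
  case (snoc v l)
  have "order_at (smooth_at_funs \<Omega>) y (Suc (Suc (length l))) (\<lambda>f. iter_deriv l (\<lambda>z. frechet_derivative f (at z) v) y)"
    by (rule order_at_directional[OF assms iter_deriv_lin_on[OF assms] _ snoc.IH])
      (auto simp: smooth_at_funs_def intro: iter_deriv_cong[OF assms(1) _ _ assms(2)])
  then show ?case by (simp only: iter_deriv_append length_append list.size add_Suc_right add_0_right)
qed

text \<open>1/r! times the r-fold commutator with the coordinates of the word, applied to the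
  constant 1: the divisors are r, r - 1, ..., 1. A multi-index \<alpha> is represented by
  r!/\<alpha>! words, which gives the usual factor 1/\<alpha>!.\<close>

primrec taylor_coeff ::
  "('e \<Rightarrow> 'a \<Rightarrow> complex) \<Rightarrow> 'a \<Rightarrow> 'e list \<Rightarrow> (('a \<Rightarrow> complex) \<Rightarrow> complex) \<Rightarrow> complex" where
  "taylor_coeff Y p [] \<Lambda> = \<Lambda> (\<lambda>x. 1)"
| "taylor_coeff Y p (b # l) \<Lambda> = taylor_coeff Y p l (commutator (Y b) p \<Lambda>) / (of_nat (length l) + 1)"

text \<open>The length is strictly below \<open>n\<close>, in line with \<open>order_at\<close>,
  where \<open>n\<close> bounds the order strictly. Words instead of multi-indices avoid the
  symmetry of higher derivatives.\<close>

definition onb_lists :: "nat \<Rightarrow> 'e::finite_dim_inner list set" where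
  "onb_lists n = {l. set l \<subseteq> onb \<and> length l < n}"

lemma onb_lists_0 [simp]: "onb_lists 0 = {}"
  and onb_lists_Suc: "(onb_lists (Suc n) :: 'e::finite_dim_inner list set) = insert [] ((\<lambda>(b, l). b # l) ` (onb \<times> onb_lists n))"
proof -
  show "onb_lists 0 = {}" by (simp add: onb_lists_def)
  show "(onb_lists (Suc n) :: 'e list set) = insert [] ((\<lambda>(b, l). b # l) ` (onb \<times> onb_lists n))"
  proof (intro set_eqI)
    show "l \<in> onb_lists (Suc n) \<longleftrightarrow> l \<in> insert [] ((\<lambda>(b, l). b # l) ` (onb \<times> onb_lists n))"
      for l :: "'e list"
      by (cases l) (auto simp: onb_lists_def image_iff)
  qed
qed

lemma finite_onb_lists [simp]: "finite (onb_lists n)"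
  by (induction n) (simp_all add: onb_lists_Suc)

lemma sum_onb_lists_Suc:
  fixes g :: "'e::finite_dim_inner list \<Rightarrow> 'c::comm_monoid_add"
  shows "sum g (onb_lists (Suc n)) = g [] + (\<Sum>b\<in>onb. \<Sum>l\<in>onb_lists n. g (b # l))"
proof -
  have "sum g (onb_lists (Suc n)) = g [] + sum g ((\<lambda>(b, l). b # l) ` (onb \<times> onb_lists n))"
    unfolding onb_lists_Suc by (subst sum.insert) (auto intro!: finite_imageI finite_cartesian_product)
  also have "sum g ((\<lambda>(b, l). b # l) ` (onb \<times> onb_lists n)) = (\<Sum>(b, l)\<in>onb \<times> onb_lists n. g (b # l))"
    by (subst sum.reindex) (auto simp: inj_on_def split_beta)
  finally show ?thesis by (simp add: sum.cartesian_product)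
qed

section \<open>Locality and Taylor expansion of functionals of finite order\<close>

context manifold
begin

sublocale S: function_algebra "smooth_funs \<A> :: ('a \<Rightarrow> complex) set"
  by unfold_locales (auto simp: smooth_funs_iff times_fun_def intro!: msmooth_at_intros)

text \<open>Take \<open>u\<close> that vanishes at \<open>p\<close> and equals 1 wherever
  \<open>f\<close> is nonzero. Then u f = f, so the commutator with \<open>u\<close> has the same
  value at \<open>f\<close> while its order is lower.\<close>

lemma order_at_local:
  assumes "lin_on S \<Lambda>" "order_at S p n \<Lambda>" "f \<in> S" "\<forall>\<^sub>F q in nhds p. f q = 0"
  shows "\<Lambda> f = 0"
  using assms(1,2)
proof (induction n arbitrary: \<Lambda>)
  case 0
  then show ?case using assms(3) by simp
next
  case (Suc n)
  obtain W where W: "open W" "p \<in> W" "\<And>q. q \<in> W \<Longrightarrow> f q = 0"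
    using assms(4) by (auto simp: eventually_nhds)
  obtain \<eta> :: "'a \<Rightarrow> real" and C where \<eta>: "\<eta> \<in> S" "\<forall>\<^sub>F q in nhds p. \<eta> q = 1"
    "closed C" "C \<subseteq> W" "\<And>q. q \<notin> C \<Longrightarrow> \<eta> q = 0"
    by (rule ex_cutoff[OF W(1,2)]) metis
  define u where "u q = 1 - complex_of_real (\<eta> q)" for q
  have u: "u \<in> S" using \<eta>(1) by (auto simp: u_def[abs_def] smooth_funs_iff intro!: msmooth_at_intros)
  have "u p = 0" using eventually_nhds_x_imp_x[OF \<eta>(2)] by (simp add: u_def)
  moreover have "(u * f) q = f q" for q
    using W(3)[of q] \<eta>(5)[of q] \<eta>(4) by (cases "q \<in> W") (auto simp: u_def times_fun_apply)
  then have "u * f = f" by (rule ext)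
  ultimately have "commutator u p \<Lambda> f = \<Lambda> f" by (simp add: commutator_def)
  moreover have "commutator u p \<Lambda> f = 0"
    using Suc.prems u by (intro Suc.IH S.lin_on_commutator) auto
  ultimately show ?case by simp
qed

lemma order_at_local_eq:
  assumes "lin_on S \<Lambda>" "order_at S p n \<Lambda>" "f \<in> S" "g \<in> S" "\<forall>\<^sub>F q in nhds p. f q = g q"
  shows "\<Lambda> f = \<Lambda> g"
proof -
  have "\<Lambda> (\<lambda>x. f x - g x) = 0"
  proof (rule order_at_local[OF assms(1,2)])
    show "(\<lambda>x. f x - g x) \<in> S" using S_diff[OF assms(3,4)] by (simp add: fun_diff_def)
    show "\<forall>\<^sub>F q in nhds p. f q - g q = 0" using assms(5) by (rule eventually_mono) simp
  qed
  then show ?thesis using S.lin_on_diff[OF assms(1,3,4)] by simp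
qed

text \<open>Hadamard's lemma writes f - f(p) near \<open>p\<close> as a sum of products of Y_b -
  Y_b(p) with G_b. On such a product \<Lambda> acts as its commutator with \<open>Y b\<close> does
  on \<open>G b\<close>, and that commutator has lower order. The derivatives of \<open>G b\<close>
  at \<open>p\<close> bring in exactly the divisors of \<open>taylor_coeff\<close>.\<close>

lemma taylor:
  assumes U: "(U, \<phi>) \<in> \<A>" "p \<in> U"
    and Y: "\<And>b. b \<in> onb \<Longrightarrow> Y b \<in> S"
      "\<And>b. b \<in> onb \<Longrightarrow> \<forall>\<^sub>F q in nhds p. Y b q = complex_of_real (inner (\<phi> q) b)"
  shows "lin_on S \<Lambda> \<Longrightarrow> order_at S p n \<Lambda> \<Longrightarrow> f \<in> S \<Longrightarrow>
    \<Lambda> f = (\<Sum>l\<in>onb_lists n. taylor_coeff Y p l \<Lambda> * iter_deriv (rev l) (f \<circ> inv_into U \<phi>) (\<phi> p))"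
proof (induction n arbitrary: \<Lambda> f)
  case 0
  then show ?case by simp
next
  case (Suc n)
  obtain G where G: "\<And>b. G b \<in> S"
    "\<forall>\<^sub>F q in nhds p. f q = f p + (\<Sum>b\<in>onb. complex_of_real (inner (\<phi> q - \<phi> p) b) * G b q)"
    "\<And>b l. iter_deriv l (G b \<circ> inv_into U \<phi>) (\<phi> p) =
      iter_deriv (l @ [b]) (f \<circ> inv_into U \<phi>) (\<phi> p) / (of_nat (length l) + 1)"
    by (rule hadamard[OF U Suc.prems(3)]) blast
  have Yp: "Y b p = complex_of_real (inner (\<phi> p) b)" if "b \<in> onb" for b
    using eventually_nhds_x_imp_x[OF Y(2)[OF that]] .
  define g where "g b q = Y b q * G b q - Y b p * G b q" for b q
  have gS: "g b \<in> S" if "b \<in> onb" for b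
    using smooth_funsD[OF Y(1)[OF that]] smooth_funsD[OF G(1)[of b]]
    by (auto simp: g_def[abs_def] smooth_funs_iff intro!: msmooth_at_intros)
  have \<Lambda>g: "\<Lambda> (g b) = commutator (Y b) p \<Lambda> (G b)" if "b \<in> onb" for b
  proof -
    have "(\<lambda>q. Y b q * G b q) \<in> S" "(\<lambda>q. Y b p * G b q) \<in> S"
      using S.mult_closed[OF Y(1)[OF that] G(1), of b] S.lin_closed[OF G(1)[of b] G(1)[of b], where a="Y b p" and b=0]
      by (simp_all add: times_fun_def)
    from S.lin_on_diff[OF Suc.prems(1) this] show ?thesis
      using S.lin_on_cmult[OF Suc.prems(1) G(1)] by (simp add: g_def[abs_def] commutator_def times_fun_def)
  qed
  have fS: "(\<lambda>q. f p + (\<Sum>b\<in>onb. g b q)) \<in> S"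
    using S.lin_closed[OF S.const_closed[of "f p"] S.sum_closed[OF gS], where a=1 and b=1] by simp
  have ev: "\<forall>\<^sub>F q in nhds p. \<forall>b\<in>onb. Y b q = complex_of_real (inner (\<phi> q) b)"
    using Y(2) by (intro eventually_ball_finite) auto
  \<comment> \<open>The expansion is valid near \<open>p\<close> only; this suffices because a
    functional of finite order sees only the germ.\<close>
  have "\<Lambda> f = \<Lambda> (\<lambda>q. f p + (\<Sum>b\<in>onb. g b q))"
  proof (rule order_at_local_eq[OF Suc.prems(1,2,3) fS])
    show "\<forall>\<^sub>F q in nhds p. f q = f p + (\<Sum>b\<in>onb. g b q)"
      using G(2) ev
    proof eventually_elim
      case (elim q)
      have "(\<Sum>b\<in>onb. complex_of_real (inner (\<phi> q - \<phi> p) b) * G b q) = (\<Sum>b\<in>onb. g b q)"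
        using elim(2) Yp by (intro sum.cong refl) (simp add: g_def inner_diff_left algebra_simps)
      then show ?case using elim(1) by simp
    qed
  qed
  also have "\<dots> = \<Lambda> (\<lambda>q. f p) + \<Lambda> (\<lambda>q. \<Sum>b\<in>onb. g b q)"
    by (rule S.lin_on_add[OF Suc.prems(1) S.const_closed S.sum_closed[OF gS]])
  also have "\<Lambda> (\<lambda>q. f p) = f p * \<Lambda> (\<lambda>q. 1)"
    using S.lin_on_cmult[OF Suc.prems(1) S.const_closed[of 1], of "f p"] by simp
  also have "\<Lambda> (\<lambda>q. \<Sum>b\<in>onb. g b q) = (\<Sum>b\<in>onb. commutator (Y b) p \<Lambda> (G b))"
    using S.lin_on_sum[OF Suc.prems(1), of onb g, OF gS] \<Lambda>g by simp
  also have "\<dots> = (\<Sum>b\<in>onb. \<Sum>l\<in>onb_lists n. taylor_coeff Y p (b # l) \<Lambda> *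
      iter_deriv (rev (b # l)) (f \<circ> inv_into U \<phi>) (\<phi> p))"
  proof (rule sum.cong[OF refl])
    fix b :: 'e assume b: "b \<in> onb"
    have "commutator (Y b) p \<Lambda> (G b) = (\<Sum>l\<in>onb_lists n. taylor_coeff Y p l (commutator (Y b) p \<Lambda>) *
        iter_deriv (rev l) (G b \<circ> inv_into U \<phi>) (\<phi> p))"
      using Suc.prems(2) Y(1)[OF b] by (intro Suc.IH S.lin_on_commutator Suc.prems(1) G(1)) auto
    then show "commutator (Y b) p \<Lambda> (G b) = (\<Sum>l\<in>onb_lists n. taylor_coeff Y p (b # l) \<Lambda> *
      iter_deriv (rev (b # l)) (f \<circ> inv_into U \<phi>) (\<phi> p))" by (simp add: G(3))
  qed
  finally show ?case using U(1) U(2) by (simp add: sum_onb_lists_Suc mult.commute o_def)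
qed

text \<open>Global coordinate functions are chosen anew at each point. As the coefficients see only
  their germs, one choice can serve all nearby points.\<close>

lemma taylor_coeff_cong:
  assumes Y: "\<And>b. b \<in> set l \<Longrightarrow> Y b \<in> S" "\<And>b. b \<in> set l \<Longrightarrow> Y' b \<in> S"
    "\<And>b. b \<in> set l \<Longrightarrow> \<forall>\<^sub>F q in nhds p. Y b q = Y' b q"
  shows "lin_on S \<Lambda> \<Longrightarrow> lin_on S \<Lambda>' \<Longrightarrow> order_at S p n \<Lambda> \<Longrightarrow> (\<And>f. f \<in> S \<Longrightarrow> \<Lambda> f = \<Lambda>' f) \<Longrightarrow>
    taylor_coeff Y p l \<Lambda> = taylor_coeff Y' p l \<Lambda>'"
  using Y
proof (induction l arbitrary: \<Lambda> \<Lambda>')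
  case Nil
  then show ?case by simp
next
  case (Cons b l)
  have b: "Y b \<in> S" "Y' b \<in> S" "\<forall>\<^sub>F q in nhds p. Y b q = Y' b q" using Cons.prems by auto
  \<comment> \<open>The commutator even has lower order, but with \<open>n\<close> kept fixed one
    bound serves the whole induction over the list.\<close>
  have o: "order_at S p n (commutator (Y b) p \<Lambda>)"
    using S.order_at_Suc[OF Cons.prems(3)] b(1) by simp
  have "commutator (Y b) p \<Lambda> f = commutator (Y' b) p \<Lambda>' f" if f: "f \<in> S" for f
  proof -
    have "\<Lambda> (Y b * f) = \<Lambda> (Y' b * f)"
    proof (rule order_at_local_eq[OF Cons.prems(1,3) S.mult_closed[OF b(1) f] S.mult_closed[OF b(2) f]])
      show "\<forall>\<^sub>F q in nhds p. (Y b * f) q = (Y' b * f) q"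
        using b(3) by (rule eventually_mono) (simp add: times_fun_apply)
    qed
    then show ?thesis
      using eventually_nhds_x_imp_x[OF b(3)] Cons.prems(4) f S.mult_closed[OF b(2) f]
      by (simp add: commutator_def)
  qed
  then have "taylor_coeff Y p l (commutator (Y b) p \<Lambda>) = taylor_coeff Y' p l (commutator (Y' b) p \<Lambda>')"
    using Cons.prems b by (intro Cons.IH S.lin_on_commutator o) auto
  then show ?case by simp
qed

lemma ex_coord_functions:
  assumes U: "(U, \<phi>) \<in> \<A>" "p \<in> U"
  obtains Y :: "'e \<Rightarrow> 'a \<Rightarrow> complex" where "\<And>b. Y b \<in> S"
    "\<And>b. \<forall>\<^sub>F q in nhds p. Y b q = complex_of_real (inner (\<phi> q) b)"
proof -
  have "\<forall>b. \<exists>Y. Y \<in> S \<and> (\<forall>\<^sub>F q in nhds p. Y q = complex_of_real (inner (\<phi> q) b))"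
  proof
    fix b
    obtain Y where "Y \<in> S" "\<forall>\<^sub>F q in nhds p. Y q = complex_of_real (inner (\<phi> q) b)"
      by (rule ex_extension[OF chart_open[OF U(1)] U(2) msmooth_at_of_real[OF msmooth_at_coord[OF U(1)]]])
    then show "\<exists>Y. Y \<in> S \<and> (\<forall>\<^sub>F q in nhds p. Y q = complex_of_real (inner (\<phi> q) b))"
      by (intro exI[of _ Y] conjI)
  qed
  from choice[OF this] obtain Y where
    "\<forall>b. Y b \<in> S \<and> (\<forall>\<^sub>F q in nhds p. Y b q = complex_of_real (inner (\<phi> q) b))" ..
  then show ?thesis by (intro that[of Y]) simp_all
qed

text \<open>Composition with the inverse chart is multiplicative, so commutators on the manifold
  correspond to commutators in the chart and the order carries over.\<close>

lemma chart_functional: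
  assumes U: "(U, \<phi>) \<in> \<A>" "p \<in> U"
  shows "lin_on S (\<lambda>f. iter_deriv l (f \<circ> inv_into U \<phi>) (\<phi> p))"
    and "order_at S p (Suc (length l)) (\<lambda>f. iter_deriv l (f \<circ> inv_into U \<phi>) (\<phi> p))"
proof -
  have sm: "f \<circ> inv_into U \<phi> \<in> smooth_at_funs (\<phi> ` U)" if "f \<in> S" for f
    using msmooth_atD[OF smooth_funsD[OF that] U(1)] by (auto simp: smooth_at_funs_def)
  have y: "\<phi> p \<in> \<phi> ` U" using U by blast
  show "lin_on S (\<lambda>f. iter_deriv l (f \<circ> inv_into U \<phi>) (\<phi> p))"
    using iter_deriv_lin_on[OF chart_open_image[OF U(1)] y, of l] sm unfolding lin_on_def
    by (simp add: o_def)
  have tr: "order_at S p n (\<lambda>f. \<Lambda> (f \<circ> inv_into U \<phi>))" if "order_at (smooth_at_funs (\<phi> ` U)) (\<phi> p) n \<Lambda>" for n \<Lambda>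
    using that
  proof (induction n arbitrary: \<Lambda>)
    case 0
    then show ?case using sm by (simp add: o_def)
  next
    case (Suc n)
    have "order_at S p n (commutator u p (\<lambda>f. \<Lambda> (f \<circ> inv_into U \<phi>)))" if u: "u \<in> S" for u
    proof -
      have "order_at S p n (\<lambda>f. commutator (u \<circ> inv_into U \<phi>) (\<phi> p) \<Lambda> (f \<circ> inv_into U \<phi>))"
        by (rule Suc.IH, rule bspec[OF Suc.prems[unfolded order_at.simps] sm[OF u]])
      moreover have "(\<lambda>f. commutator (u \<circ> inv_into U \<phi>) (\<phi> p) \<Lambda> (f \<circ> inv_into U \<phi>)) = commutator u p (\<lambda>f. \<Lambda> (f \<circ> inv_into U \<phi>))"
        using U by (auto simp: commutator_def times_fun_def o_def)
      ultimately show ?thesis by (simp only:)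
    qed
    then show ?case unfolding order_at.simps by (intro ballI)
  qed
  from tr[OF order_at_iter_deriv[OF chart_open_image[OF U(1)] y]]
  show "order_at S p (Suc (length l)) (\<lambda>f. iter_deriv l (f \<circ> inv_into U \<phi>) (\<phi> p))" .
qed

lemma chart_functional_sum:
  assumes U: "(U, \<phi>) \<in> \<A>" "p \<in> U" and L: "finite L" "\<And>i. i \<in> L \<Longrightarrow> length (d i) \<le> k"
    and \<Lambda>: "\<And>f. f \<in> S \<Longrightarrow> \<Lambda> f = (\<Sum>i\<in>L. a i * iter_deriv (d i) (f \<circ> inv_into U \<phi>) (\<phi> p))"
  shows "lin_on S \<Lambda>" "order_at S p (Suc k) \<Lambda>"
proof -
  show "lin_on S \<Lambda>"
    unfolding lin_on_def
  proof safe
    fix f g :: "'a \<Rightarrow> complex" and c e :: complex assume fg: "f \<in> S" "g \<in> S"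
    have "\<Lambda> (\<lambda>x. c * f x + e * g x) = (\<Sum>i\<in>L. a i * (c * iter_deriv (d i) (f \<circ> inv_into U \<phi>) (\<phi> p) + e * iter_deriv (d i) (g \<circ> inv_into U \<phi>) (\<phi> p)))"
      unfolding \<Lambda>[OF S.lin_closed[OF fg]]
      using chart_functional(1)[OF U] fg unfolding lin_on_def by (intro sum.cong refl) simp
    then show "\<Lambda> (\<lambda>x. c * f x + e * g x) = c * \<Lambda> f + e * \<Lambda> g"
      by (simp add: \<Lambda> fg sum.distrib sum_distrib_left algebra_simps)
  qed
  have "order_at S p (Suc k) (\<lambda>f. \<Sum>i\<in>L. a i * iter_deriv (d i) (f \<circ> inv_into U \<phi>) (\<phi> p))"
    using L(2) by (intro S.order_at_sum S.order_at_cmult S.order_at_mono[OF chart_functional(2)[OF U]]) simp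
  then show "order_at S p (Suc k) \<Lambda>" by (rule S.order_at_cong[rotated]) (simp add: \<Lambda>)
qed

text \<open>The easy half of Grothendieck's criterion. Order at most \<open>k\<close> is the strict
  bound \<open>Suc k\<close>.\<close>

lemma diff_ops_le_functional:
  assumes "Q \<in> diff_ops_le \<A> k"
  shows "lin_on S (\<lambda>f. Q f p)" "order_at S p (Suc k) (\<lambda>f. Q f p)"
proof -
  obtain U \<phi> where U: "(U, \<phi>) \<in> \<A>" "p \<in> U" by (rule ex_chart)
  have "\<exists>L a. finite L \<and> (\<forall>l\<in>L. length l \<le> k \<and> smooth_on (\<phi> ` U) (a l)) \<and>
     (\<forall>f\<in>S. \<forall>p\<in>U. Q f p = (\<Sum>l\<in>L. a l (\<phi> p) * iter_deriv l (f \<circ> inv_into U \<phi>) (\<phi> p)))"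
    using assms U(1) unfolding diff_ops_le_def by blast
  then obtain L a where L: "finite L" "\<And>l. l \<in> L \<Longrightarrow> length l \<le> k"
    "\<And>f. f \<in> S \<Longrightarrow> Q f p = (\<Sum>l\<in>L. a l (\<phi> p) * iter_deriv l (f \<circ> inv_into U \<phi>) (\<phi> p))"
    using U(2) by (elim exE conjE) simp
  from chart_functional_sum[OF U L] show "lin_on S (\<lambda>f. Q f p)" "order_at S p (Suc k) (\<lambda>f. Q f p)" by blast+
qed

text \<open>With one argument frozen, its derivatives at \<open>p\<close> are mere
  coefficients.\<close>

lemma bidiff_ops_le_functional:
  assumes "B \<in> bidiff_ops_le \<A> k" and g: "g \<in> S"
  shows "lin_on S (\<lambda>f. B f g p)" "order_at S p (Suc k) (\<lambda>f. B f g p)"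
    and "lin_on S (\<lambda>f. B g f p)" "order_at S p (Suc k) (\<lambda>f. B g f p)"
proof -
  obtain U \<phi> where U: "(U, \<phi>) \<in> \<A>" "p \<in> U" by (rule ex_chart)
  have "\<exists>L a. finite L \<and>
     (\<forall>(l, l')\<in>L. length l \<le> k \<and> length l' \<le> k \<and> smooth_on (\<phi> ` U) (a l l')) \<and>
     (\<forall>f\<in>S. \<forall>g\<in>S. \<forall>p\<in>U.
        B f g p = (\<Sum>(l, l')\<in>L. a l l' (\<phi> p) * iter_deriv l (f \<circ> inv_into U \<phi>) (\<phi> p)
                                          * iter_deriv l' (g \<circ> inv_into U \<phi>) (\<phi> p)))"
    using assms U(1) unfolding bidiff_ops_le_def by blast
  then obtain L a where L: "finite L" "\<And>i. i \<in> L \<Longrightarrow> length (fst i) \<le> k" "\<And>i. i \<in> L \<Longrightarrow> length (snd i) \<le> k"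
    and B: "\<And>f g. f \<in> S \<Longrightarrow> g \<in> S \<Longrightarrow> B f g p = (\<Sum>i\<in>L. a (fst i) (snd i) (\<phi> p) * iter_deriv (fst i) (f \<circ> inv_into U \<phi>) (\<phi> p)
                                          * iter_deriv (snd i) (g \<circ> inv_into U \<phi>) (\<phi> p))"
    using U(2) by (elim exE conjE) (simp add: split_beta)
  have 1: "B f g p = (\<Sum>i\<in>L. (a (fst i) (snd i) (\<phi> p) * iter_deriv (snd i) (g \<circ> inv_into U \<phi>) (\<phi> p)) * iter_deriv (fst i) (f \<circ> inv_into U \<phi>) (\<phi> p))"
    and 2: "B g f p = (\<Sum>i\<in>L. (a (fst i) (snd i) (\<phi> p) * iter_deriv (fst i) (g \<circ> inv_into U \<phi>) (\<phi> p)) * iter_deriv (snd i) (f \<circ> inv_into U \<phi>) (\<phi> p))"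
    if "f \<in> S" for f
    using B[OF that g] B[OF g that] by (simp_all add: mult.commute mult.left_commute)
  from chart_functional_sum[OF U L(1,2) 1] show "lin_on S (\<lambda>f. B f g p)" "order_at S p (Suc k) (\<lambda>f. B f g p)" by blast+
  from chart_functional_sum[OF U L(1,3) 2] show "lin_on S (\<lambda>f. B g f p)" "order_at S p (Suc k) (\<lambda>f. B g f p)" by blast+
qed

end

section \<open>From the order at each point back to differential operators\<close>

context manifold
begin

text \<open>As \<open>p\<close> varies, the commutator functionals are the values of an operator
  that again preserves smooth functions. The induction therefore runs over operators instead of
  functionals.\<close>

lemma taylor_coeff_smooth:
  assumes "\<And>b. Y b \<in> S"
  shows "(\<And>f. f \<in> S \<Longrightarrow> Q f \<in> S) \<Longrightarrow> (\<lambda>p. taylor_coeff Y p l (\<lambda>f. Q f p)) \<in> S"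
proof (induction l arbitrary: Q)
  case Nil
  from Nil[OF S.const_closed[of 1]] show ?case by simp
next
  case (Cons b l)
  have "(\<lambda>p. taylor_coeff Y p l (\<lambda>f. (\<lambda>x. Q (Y b * f) x - Y b x * Q f x) p)) \<in> S"
  proof (rule Cons.IH)
    fix f :: "'a \<Rightarrow> complex" assume f: "f \<in> S"
    show "(\<lambda>x. Q (Y b * f) x - Y b x * Q f x) \<in> S"
      using smooth_funsD[OF Cons.prems[OF S.mult_closed[OF assms f]]] smooth_funsD[OF Cons.prems[OF f]]
        smooth_funsD[OF assms[of b]]
      unfolding smooth_funs_iff by (intro allI msmooth_at_diff msmooth_at_mult)
  qed
  from S.lin_closed[OF this this, where a="1 / (of_nat (length l) + 1)" and b=0]
  show ?case by (simp add: commutator_def)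
qed

text \<open>The converse half of Grothendieck's criterion: the Taylor formula at the points of a
  chart is the coordinate expression. Its coefficients involve coordinate functions chosen
  independently at each point, so their smoothness is the issue; near a given point they coincide
  with those of one fixed choice.\<close>

lemma diff_ops_le_order_at:
  assumes lin: "\<And>p. lin_on S (\<lambda>f. Q f p)" and ord: "\<And>p. order_at S p n (\<lambda>f. Q f p)"
    and sm: "\<And>f. f \<in> S \<Longrightarrow> Q f \<in> S"
  shows "Q \<in> diff_ops_le \<A> n"
  unfolding diff_ops_le_def
proof (intro CollectI ballI, clarify)
  fix U and \<phi> :: "'a \<Rightarrow> 'e" assume U: "(U, \<phi>) \<in> \<A>"
  have "\<forall>p. \<exists>Y. p \<in> U \<longrightarrow> ((\<forall>b. Y b \<in> S) \<and> (\<forall>b. \<forall>\<^sub>F q in nhds p. Y b q = complex_of_real (inner (\<phi> q) b)))"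
  proof
    fix p
    show "\<exists>Y. p \<in> U \<longrightarrow> ((\<forall>b. Y b \<in> S) \<and> (\<forall>b. \<forall>\<^sub>F q in nhds p. Y b q = complex_of_real (inner (\<phi> q) b)))"
    proof (cases "p \<in> U")
      case True
      obtain Y where "\<And>b. Y b \<in> S" "\<And>b. \<forall>\<^sub>F q in nhds p. Y b q = complex_of_real (inner (\<phi> q) b)"
        by (rule ex_coord_functions[OF U True]) blast
      then show ?thesis by (intro exI[of _ Y] impI conjI allI)
    qed simp
  qed
  from choice[OF this] obtain Y where
    "\<forall>p. p \<in> U \<longrightarrow> ((\<forall>b. Y p b \<in> S) \<and> (\<forall>b. \<forall>\<^sub>F q in nhds p. Y p b q = complex_of_real (inner (\<phi> q) b)))" ..
  then have Y: "\<And>p b. p \<in> U \<Longrightarrow> Y p b \<in> S"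
    "\<And>p b. p \<in> U \<Longrightarrow> \<forall>\<^sub>F q in nhds p. Y p b q = complex_of_real (inner (\<phi> q) b)" by simp_all
  define a where "a l y = taylor_coeff (Y (inv_into U \<phi> y)) (inv_into U \<phi> y) (rev l) (\<lambda>f. Q f (inv_into U \<phi> y))" for l y
  have eq: "Q f p = (\<Sum>l\<in>rev ` onb_lists n. a l (\<phi> p) * iter_deriv l (f \<circ> inv_into U \<phi>) (\<phi> p))"
    if "f \<in> S" "p \<in> U" for f p
  proof -
    have "Q f p = (\<Sum>l\<in>onb_lists n. taylor_coeff (Y p) p l (\<lambda>f. Q f p) * iter_deriv (rev l) (f \<circ> inv_into U \<phi>) (\<phi> p))"
      by (rule taylor[OF U that(2) Y[OF that(2)] lin ord that(1)])
    also have "\<dots> = (\<Sum>l\<in>onb_lists n. a (rev l) (\<phi> p) * iter_deriv (rev l) (f \<circ> inv_into U \<phi>) (\<phi> p))"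
      using U that(2) by (simp add: a_def)
    also have "\<dots> = (\<Sum>l\<in>rev ` onb_lists n. a l (\<phi> p) * iter_deriv l (f \<circ> inv_into U \<phi>) (\<phi> p))"
      by (subst sum.reindex) (simp_all add: o_def)
    finally show ?thesis .
  qed
  have sma: "smooth_on (\<phi> ` U) (a l)" if l: "l \<in> rev ` onb_lists n" for l
    unfolding smooth_on_iff_smooth_at[OF chart_open_image[OF U]]
  proof (intro ballI, clarify)
    fix p assume p: "p \<in> U"
    have lo: "set (rev l) \<subseteq> onb" using l by (auto simp: onb_lists_def)
    have "msmooth_at \<A> (\<lambda>q. taylor_coeff (Y p) q (rev l) (\<lambda>f. Q f q)) p"
      by (rule smooth_funsD[OF taylor_coeff_smooth[OF Y(1)[OF p] sm]])
    moreover have "\<forall>\<^sub>F y in nhds (\<phi> p). taylor_coeff (Y p) (inv_into U \<phi> y) (rev l) (\<lambda>f. Q f (inv_into U \<phi> y)) = a l y"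
    proof -
      \<comment> \<open>On \<open>W\<close> the functions \<open>Y p\<close> represent the
        coordinates not only at \<open>p\<close> but near every point, so they have the germs of the
        functions chosen at that point.\<close>
      have "\<forall>\<^sub>F q in nhds p. \<forall>b\<in>onb. Y p b q = complex_of_real (inner (\<phi> q) b)"
        using Y(2)[OF p] by (intro eventually_ball_finite) auto
      then obtain W where W: "open W" "p \<in> W" "\<And>q b. q \<in> W \<Longrightarrow> b \<in> onb \<Longrightarrow> Y p b q = complex_of_real (inner (\<phi> q) b)"
        by (auto simp: eventually_nhds)
      have "\<forall>\<^sub>F q in nhds p. q \<in> W" using W by (intro eventually_nhds_in_open)
      from eventually_chart[OF U p this] show ?thesis
      proof (rule eventually_mono)
        fix y assume y: "y \<in> \<phi> ` U \<and> inv_into U \<phi> y \<in> W"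
        let ?q = "inv_into U \<phi> y"
        have q: "?q \<in> U" using y by (simp add: inv_into_into)
        show "taylor_coeff (Y p) ?q (rev l) (\<lambda>f. Q f ?q) = a l y"
          unfolding a_def
        proof (rule taylor_coeff_cong[OF _ _ _ lin lin ord])
          fix b assume "b \<in> set (rev l)"
          then have b: "b \<in> onb" using lo by blast
          have "\<forall>\<^sub>F q' in nhds ?q. q' \<in> W" using W(1) y by (intro eventually_nhds_in_open) auto
          with Y(2)[OF q, of b] show "\<forall>\<^sub>F q' in nhds ?q. Y p b q' = Y ?q b q'"
            by eventually_elim (simp add: W(3) b)
        qed (use Y(1) p q in auto)
      qed
    qed
    ultimately show "smooth_at (a l) (\<phi> p)" unfolding msmooth_at_iff[OF U p] by (rule smooth_at_cong[rotated])
  qed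
  show "\<exists>L a. finite L \<and> (\<forall>l\<in>L. length l \<le> n \<and> smooth_on (\<phi> ` U) (a l)) \<and>
     (\<forall>f\<in>S. \<forall>p\<in>U. Q f p = (\<Sum>l\<in>L. a l (\<phi> p) * iter_deriv l (f \<circ> inv_into U \<phi>) (\<phi> p)))"
  proof (intro exI[of _ "rev ` onb_lists n"] exI[of _ a] conjI ballI)
    show "length l \<le> n" if "l \<in> rev ` onb_lists n" for l using that by (auto simp: onb_lists_def)
  qed (use eq sma in auto)
qed

end

section \<open>Smooth families of operators of bounded order\<close>

context manifold_pair
begin

text \<open>The bound \<open>n\<close> is uniform in \<sigma> and \<open>x\<close>, so that one
  finite Taylor sum represents the operators at all points. Smoothness in the parameter is demanded
  for fixed functions only; for sections it has to be derived.\<close>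

definition op_family :: "nat \<Rightarrow> ('t \<Rightarrow> 'm operator) \<Rightarrow> bool" where
  "op_family n Q \<longleftrightarrow> (\<forall>\<sigma> x. lin_on M.S (\<lambda>f. Q \<sigma> f x) \<and> order_at M.S x n (\<lambda>f. Q \<sigma> f x)) \<and>
     (\<forall>f\<in>M.S. (\<lambda>p. Q (fst p) f (snd p)) \<in> PM.S)"

lemma
  assumes "op_family n Q"
  shows op_family_lin: "lin_on M.S (\<lambda>f. Q \<sigma> f x)" and op_family_order: "order_at M.S x n (\<lambda>f. Q \<sigma> f x)"
    and op_family_smooth: "f \<in> M.S \<Longrightarrow> (\<lambda>p. Q (fst p) f (snd p)) \<in> PM.S"
  using assms unfolding op_family_def by blast+

lemma op_family_S: assumes "op_family n Q" "f \<in> M.S" shows "Q \<sigma> f \<in> M.S"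
  using S_slice(1)[OF op_family_smooth[OF assms], of \<sigma>] by simp

lemma op_family_diff_ops: "op_family n Q \<Longrightarrow> Q \<sigma> \<in> diff_ops_le \<M> n"
  using M.diff_ops_le_order_at[of "Q \<sigma>" n] op_family_lin op_family_order op_family_S by blast

lemma param_taylor_coeff_smooth:
  assumes "\<And>b. Y b \<in> M.S"
  shows "(\<And>f. f \<in> M.S \<Longrightarrow> (\<lambda>p. Q (fst p) f (snd p)) \<in> PM.S) \<Longrightarrow>
    (\<lambda>p. taylor_coeff Y (snd p) l (\<lambda>f. Q (fst p) f (snd p))) \<in> PM.S"
proof (induction l arbitrary: Q)
  case Nil
  from Nil[OF M.S.const_closed[of 1]] show ?case by simp
next
  case (Cons b l)
  have "(\<lambda>p. taylor_coeff Y (snd p) l (\<lambda>f. (\<lambda>\<sigma> f x. Q \<sigma> (Y b * f) x - Y b x * Q \<sigma> f x) (fst p) f (snd p))) \<in> PM.S"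
  proof (rule Cons.IH)
    fix f :: "'m \<Rightarrow> complex" assume f: "f \<in> M.S"
    show "(\<lambda>p. (\<lambda>\<sigma> f x. Q \<sigma> (Y b * f) x - Y b x * Q \<sigma> f x) (fst p) f (snd p)) \<in> PM.S"
      using PM.smooth_funsD[OF Cons.prems[OF M.S.mult_closed[OF assms f]]] PM.smooth_funsD[OF Cons.prems[OF f]]
        PM.smooth_funsD[OF S_snd[OF assms[of b]]]
      unfolding PM.smooth_funs_iff by (intro allI PM.msmooth_at_diff PM.msmooth_at_mult)
  qed
  from PM.S.lin_closed[OF this this, where a="1 / (of_nat (length l) + 1)" and b=0]
  show ?case by (simp add: commutator_def)
qed

text \<open>Derivatives of a slice are derivatives of \<open>F\<close> in directions
  \<open>(0, v)\<close>, and in this form their smoothness in both variables is evident.\<close>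

lemma iter_deriv_partial:
  fixes F :: "'x::real_normed_vector \<times> 'y::real_normed_vector \<Rightarrow> complex"
  assumes "open Z" "\<And>z. z \<in> Z \<Longrightarrow> smooth_at F (s, z)"
  shows "z \<in> Z \<Longrightarrow> iter_deriv l (\<lambda>z. F (s, z)) z = iter_deriv (map (\<lambda>v. (0, v)) l) F (s, z)"
proof (induction l arbitrary: z)
  case (Cons v l)
  let ?H = "iter_deriv (map (\<lambda>v. (0, v)) l) F"
  have d: "((\<lambda>z. ?H (s, z)) has_derivative (\<lambda>v. frechet_derivative ?H (at (s, z)) (0, v))) (at z)"
    by (rule has_derivative_compose[of "\<lambda>z. (s, z)" "\<lambda>v. (0, v)", OF _ smooth_at_has_derivative[OF smooth_at_iter_deriv[OF assms(2)[OF Cons.prems]]]])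
      (auto intro!: derivative_eq_intros)
  have "frechet_derivative (\<lambda>z. ?H (s, z)) (at z) = frechet_derivative (iter_deriv l (\<lambda>z. F (s, z))) (at z)"
    by (rule frechet_derivative_transform_within_open[OF _ assms(1) Cons.prems])
      (use d Cons.IH in \<open>auto simp: differentiable_def\<close>)
  with fun_cong[OF frechet_derivative_at[OF d], of v] show ?case by simp
qed simp

lemma iter_deriv_slice_smooth:
  fixes F :: "'t \<times> 'm \<Rightarrow> complex"
  assumes V: "(V, \<psi>) \<in> \<M>" "x \<in> V" and F: "F \<in> PM.S"
  shows "msmooth_at (prod_atlas \<T> \<M>) (\<lambda>p. iter_deriv l (\<lambda>z. F (fst p, inv_into V \<psi> z)) (\<psi> (snd p))) (\<sigma>, x)"
proof -
  obtain U \<phi> where U: "(U, \<phi>) \<in> \<T>" "\<sigma> \<in> U" by (rule T.ex_chart)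
  let ?F = "\<lambda>p. F (inv_into U \<phi> (fst p), inv_into V \<psi> (snd p))"
  have s: "smooth_at ?F (\<phi> t, \<psi> z)" if "t \<in> U" "z \<in> V" for t z
    using PM.smooth_funsD[OF F, of "(t, z)"] unfolding msmooth_at_prod_iff[OF U(1) that(1) V(1) that(2)] .
  have "\<forall>\<^sub>F p in nhds (\<phi> \<sigma>, \<psi> x). p \<in> \<phi> ` U \<times> \<psi> ` V"
    using U V T.chart_open_image M.chart_open_image by (intro eventually_nhds_in_open open_Times) auto
  then have "\<forall>\<^sub>F p in nhds (\<phi> \<sigma>, \<psi> x). iter_deriv (map (\<lambda>v. (0, v)) l) ?F p =
     iter_deriv l (\<lambda>z. F (fst (inv_into U \<phi> (fst p), inv_into V \<psi> (snd p)), inv_into V \<psi> z)) (\<psi> (snd (inv_into U \<phi> (fst p), inv_into V \<psi> (snd p))))"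
  proof (rule eventually_mono)
    fix p assume "p \<in> \<phi> ` U \<times> \<psi> ` V"
    then obtain t z where p: "p = (\<phi> t, \<psi> z)" "t \<in> U" "z \<in> V" by auto
    have "iter_deriv l (\<lambda>z. ?F (\<phi> t, z)) (\<psi> z) = iter_deriv (map (\<lambda>v. (0, v)) l) ?F (\<phi> t, \<psi> z)"
      by (rule iter_deriv_partial[OF M.chart_open_image[OF V(1)]]) (use s p in auto)
    then show "iter_deriv (map (\<lambda>v. (0, v)) l) ?F p =
     iter_deriv l (\<lambda>z. F (fst (inv_into U \<phi> (fst p), inv_into V \<psi> (snd p)), inv_into V \<psi> z)) (\<psi> (snd (inv_into U \<phi> (fst p), inv_into V \<psi> (snd p))))"
      using p U(1) V(1) by simp
  qed
  then show ?thesis unfolding msmooth_at_prod_iff[OF U V]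
    by (rule smooth_at_cong) (rule smooth_at_iter_deriv[OF s[OF U(2) V(2)]])
qed

text \<open>The value of a differential operator on a section is smooth because its Taylor coefficients are.\<close>

lemma op_family_apply_smooth:
  assumes Q: "op_family n Q" and F: "F \<in> PM.S"
  shows "(\<lambda>p. Q (fst p) (\<lambda>x. F (fst p, x)) (snd p)) \<in> PM.S"
  unfolding PM.smooth_funs_iff
proof
  fix p0 :: "'t \<times> 'm"
  obtain V \<psi> where V: "(V, \<psi>) \<in> \<M>" "snd p0 \<in> V" by (rule M.ex_chart)
  obtain Y where Y: "\<And>b. Y b \<in> M.S" "\<And>b. \<forall>\<^sub>F q in nhds (snd p0). Y b q = complex_of_real (inner (\<psi> q) b)"
    by (rule M.ex_coord_functions[OF V]) blast
  have "\<forall>\<^sub>F q in nhds (snd p0). \<forall>b\<in>onb. Y b q = complex_of_real (inner (\<psi> q) b)"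
    using Y(2) by (intro eventually_ball_finite) auto
  moreover have "\<forall>\<^sub>F q in nhds (snd p0). q \<in> V"
    using V(2) M.chart_open[OF V(1)] by (intro eventually_nhds_in_open)
  ultimately have "\<forall>\<^sub>F q in nhds (snd p0). q \<in> V \<and> (\<forall>b\<in>onb. Y b q = complex_of_real (inner (\<psi> q) b))"
    by eventually_elim simp
  then obtain W where W: "open W" "snd p0 \<in> W" "\<And>q. q \<in> W \<Longrightarrow> q \<in> V"
    "\<And>q b. q \<in> W \<Longrightarrow> b \<in> onb \<Longrightarrow> Y b q = complex_of_real (inner (\<psi> q) b)"
    by (auto simp: eventually_nhds)
  have "p0 \<in> UNIV \<times> W" using W(2) by (simp add: mem_Times_iff)
  \<comment> \<open>The coordinate functions depend on \<open>x\<close> alone, so the Taylor formula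
    holds for all parameters at once.\<close>
  then have "\<forall>\<^sub>F p in nhds p0. p \<in> UNIV \<times> W" using W(1) by (intro eventually_nhds_in_open open_Times) auto
  then have ev: "\<forall>\<^sub>F p in nhds p0. (\<Sum>l\<in>onb_lists n. taylor_coeff Y (snd p) l (\<lambda>f. Q (fst p) f (snd p)) *
      iter_deriv (rev l) (\<lambda>z. F (fst p, inv_into V \<psi> z)) (\<psi> (snd p))) = Q (fst p) (\<lambda>x. F (fst p, x)) (snd p)"
  proof (rule eventually_mono)
    fix p :: "'t \<times> 'm" assume "p \<in> UNIV \<times> W"
    then have p: "snd p \<in> W" by auto
    have "Q (fst p) (\<lambda>x. F (fst p, x)) (snd p) = (\<Sum>l\<in>onb_lists n. taylor_coeff Y (snd p) l (\<lambda>f. Q (fst p) f (snd p)) *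
      iter_deriv (rev l) ((\<lambda>x. F (fst p, x)) \<circ> inv_into V \<psi>) (\<psi> (snd p)))"
    proof (rule M.taylor[OF V(1) W(3)[OF p] Y(1) _ op_family_lin[OF Q] op_family_order[OF Q] S_slice(1)[OF F]])
      fix b :: 'f assume b: "b \<in> onb"
      have "\<forall>\<^sub>F q in nhds (snd p). q \<in> W" using W(1) p by (intro eventually_nhds_in_open)
      then show "\<forall>\<^sub>F q in nhds (snd p). Y b q = complex_of_real (inner (\<psi> q) b)"
        by (rule eventually_mono) (simp add: W(4) b)
    qed
    then show "(\<Sum>l\<in>onb_lists n. taylor_coeff Y (snd p) l (\<lambda>f. Q (fst p) f (snd p)) *
      iter_deriv (rev l) (\<lambda>z. F (fst p, inv_into V \<psi> z)) (\<psi> (snd p))) = Q (fst p) (\<lambda>x. F (fst p, x)) (snd p)"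
      by (simp add: o_def)
  qed
  have "msmooth_at (prod_atlas \<T> \<M>) (\<lambda>p. \<Sum>l\<in>onb_lists n. taylor_coeff Y (snd p) l (\<lambda>f. Q (fst p) f (snd p)) *
      iter_deriv (rev l) (\<lambda>z. F (fst p, inv_into V \<psi> z)) (\<psi> (snd p))) (fst p0, snd p0)"
    by (intro PM.msmooth_at_sum PM.msmooth_at_mult iter_deriv_slice_smooth[OF V F]
        PM.smooth_funsD[OF param_taylor_coeff_smooth[OF Y(1) op_family_smooth[OF Q]]])
  then show "msmooth_at (prod_atlas \<T> \<M>) (\<lambda>p. Q (fst p) (\<lambda>x. F (fst p, x)) (snd p)) p0"
    unfolding prod.collapse by (rule PM.msmooth_at_cong[OF ev])
qed

section \<open>Differentiation along the parameter manifold\<close>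

lemma coord_increment:
  fixes F :: "'t \<times> 'm \<Rightarrow> complex"
  assumes U: "(U, \<phi>) \<in> \<T>" "\<sigma> \<in> U" and F: "F \<in> PM.S"
    and Y: "\<And>b. Y b \<in> T.S" "\<And>b. b \<in> onb \<Longrightarrow> \<forall>\<^sub>F \<tau> in nhds \<sigma>. Y b \<tau> = complex_of_real (inner (\<phi> \<tau>) b)"
  obtains G where "\<And>b. G b \<in> PM.S"
    "\<forall>\<^sub>F \<tau> in nhds \<sigma>. \<forall>x. F (\<tau>, x) = F (\<sigma>, x) + (\<Sum>b\<in>onb. (Y b \<tau> - Y b \<sigma>) * G b (\<tau>, x))"
    "\<And>b x. G b (\<sigma>, x) = frechet_derivative (\<lambda>y. F (inv_into U \<phi> y, x)) (at (\<phi> \<sigma>)) b"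
proof -
  obtain G where G: "\<And>b. G b \<in> PM.S"
    "\<forall>\<^sub>F \<tau> in nhds \<sigma>. \<forall>x. F (\<tau>, x) = F (\<sigma>, x) + (\<Sum>b\<in>onb. complex_of_real (inner (\<phi> \<tau> - \<phi> \<sigma>) b) * G b (\<tau>, x))"
    "\<And>b x. G b (\<sigma>, x) = frechet_derivative (\<lambda>y. F (inv_into U \<phi> y, x)) (at (\<phi> \<sigma>)) b"
    by (rule hadamard_param[OF U F]) blast
  have "\<forall>\<^sub>F \<tau> in nhds \<sigma>. \<forall>b\<in>onb. Y b \<tau> = complex_of_real (inner (\<phi> \<tau>) b)"
    using Y(2) by (intro eventually_ball_finite) auto
  with G(2) have "\<forall>\<^sub>F \<tau> in nhds \<sigma>. \<forall>x. F (\<tau>, x) = F (\<sigma>, x) + (\<Sum>b\<in>onb. (Y b \<tau> - Y b \<sigma>) * G b (\<tau>, x))"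
  proof eventually_elim
    case (elim \<tau>)
    have "(\<Sum>b\<in>onb. complex_of_real (inner (\<phi> \<tau> - \<phi> \<sigma>) b) * G b (\<tau>, x)) = (\<Sum>b\<in>onb. (Y b \<tau> - Y b \<sigma>) * G b (\<tau>, x))" for x
      using elim(2) eventually_nhds_x_imp_x[OF Y(2)]
      by (intro sum.cong refl) (simp add: inner_diff_left)
    then show ?case using elim(1) by simp
  qed
  then show ?thesis by (intro that[of G] G(1,3))
qed

text \<open>The factors Y_b(\<tau>) - Y_b(\<sigma>) vanish at \<sigma>, so the product rule keeps
  only the terms in which they are differentiated.\<close>

lemma deriv_increment:
  assumes v: "v \<in> tangent_space \<T> \<sigma>" and f: "f \<in> T.S" "g0 \<in> T.S" "\<And>b. Y b \<in> T.S" "\<And>b. g b \<in> T.S"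
    and ev: "\<forall>\<^sub>F \<tau> in nhds \<sigma>. f \<tau> = g0 \<tau> + (\<Sum>b\<in>I. (Y b \<tau> - Y b \<sigma>) * g b \<tau>)"
  shows "complex_deriv v f = complex_deriv v g0 + (\<Sum>b\<in>I. complex_deriv v (Y b) * g b \<sigma>)"
proof -
  have Yc: "(\<lambda>\<tau>. Y b \<tau> - Y b \<sigma>) \<in> T.S" for b
    using T.smooth_funsD[OF f(3)[of b]] by (auto simp: T.smooth_funs_iff intro!: T.msmooth_at_intros)
  have t: "(\<lambda>\<tau>. (Y b \<tau> - Y b \<sigma>) * g b \<tau>) \<in> T.S" for b
    using T.smooth_funsD[OF Yc[of b]] T.smooth_funsD[OF f(4)[of b]]
    unfolding T.smooth_funs_iff by (intro allI T.msmooth_at_mult)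
  have s: "(\<lambda>\<tau>. \<Sum>b\<in>I. (Y b \<tau> - Y b \<sigma>) * g b \<tau>) \<in> T.S"
    by (rule T.S.sum_closed) (rule t)
  have a: "(\<lambda>\<tau>. g0 \<tau> + (\<Sum>b\<in>I. (Y b \<tau> - Y b \<sigma>) * g b \<tau>)) \<in> T.S"
    using T.smooth_funsD[OF f(2)] T.smooth_funsD[OF s]
    unfolding T.smooth_funs_iff by (intro allI T.msmooth_at_add)
  have "complex_deriv v f = complex_deriv v (\<lambda>\<tau>. g0 \<tau> + (\<Sum>b\<in>I. (Y b \<tau> - Y b \<sigma>) * g b \<tau>))"
    by (rule T.complex_deriv_local[OF v f(1) a ev])
  also have "\<dots> = complex_deriv v g0 + complex_deriv v (\<lambda>\<tau>. \<Sum>b\<in>I. (Y b \<tau> - Y b \<sigma>) * g b \<tau>)"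
    by (rule T.complex_deriv_add[OF v f(2) s])
  also have "complex_deriv v (\<lambda>\<tau>. \<Sum>b\<in>I. (Y b \<tau> - Y b \<sigma>) * g b \<tau>) = (\<Sum>b\<in>I. complex_deriv v (\<lambda>\<tau>. (Y b \<tau> - Y b \<sigma>) * g b \<tau>))"
    by (rule T.complex_deriv_sum[OF v]) (rule t)
  also have "\<dots> = (\<Sum>b\<in>I. complex_deriv v (Y b) * g b \<sigma>)"
    using T.complex_deriv_mult[OF v Yc f(4)] T.complex_deriv_diff[OF v f(3) T.S.const_closed]
      T.complex_deriv_const[OF v] by (intro sum.cong refl) simp
  finally show ?thesis .
qed

text \<open>An abstract derivation becomes a combination of partial derivatives whose coefficients,
  its values on the coordinates, do not depend on \<open>x\<close>.\<close>

lemma section_chain: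
  fixes F :: "'t \<times> 'm \<Rightarrow> complex"
  assumes U: "(U, \<phi>) \<in> \<T>" "\<sigma> \<in> U" and F: "F \<in> PM.S"
    and Y: "\<And>b. Y b \<in> T.S" "\<And>b. b \<in> onb \<Longrightarrow> \<forall>\<^sub>F \<tau> in nhds \<sigma>. Y b \<tau> = complex_of_real (inner (\<phi> \<tau>) b)"
    and v: "v \<in> tangent_space \<T> \<sigma>"
  shows "complex_deriv v (\<lambda>\<tau>. F (\<tau>, x)) =
    (\<Sum>b\<in>onb. complex_deriv v (Y b) * frechet_derivative (\<lambda>y. F (inv_into U \<phi> y, x)) (at (\<phi> \<sigma>)) b)"
proof -
  obtain G where G: "\<And>b. G b \<in> PM.S"
    "\<forall>\<^sub>F \<tau> in nhds \<sigma>. \<forall>x. F (\<tau>, x) = F (\<sigma>, x) + (\<Sum>b\<in>onb. (Y b \<tau> - Y b \<sigma>) * G b (\<tau>, x))"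
    "\<And>b x. G b (\<sigma>, x) = frechet_derivative (\<lambda>y. F (inv_into U \<phi> y, x)) (at (\<phi> \<sigma>)) b"
    by (rule coord_increment[OF U F Y]) blast+
  have "\<forall>\<^sub>F \<tau> in nhds \<sigma>. F (\<tau>, x) = F (\<sigma>, x) + (\<Sum>b\<in>onb. (Y b \<tau> - Y b \<sigma>) * G b (\<tau>, x))"
    using G(2) by (rule eventually_mono) simp
  from deriv_increment[OF v S_slice(2)[OF F] T.S.const_closed Y(1) S_slice(2)[OF G(1)] this]
  show ?thesis by (simp add: T.complex_deriv_const[OF v] G(3))
qed

text \<open>A derivation acts for each \<open>x\<close> separately, which says nothing about
  smoothness in \<open>x\<close>. The chain rule separates coefficients that depend on the parameter
  alone from partial derivatives that are smooth in both variables.\<close>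

lemma section_deriv_smooth:
  fixes F :: "'t \<times> 'm \<Rightarrow> complex"
  assumes X: "X \<in> vector_fields \<T>" and F: "F \<in> PM.S"
  shows "(\<lambda>p. complex_deriv (X (fst p)) (\<lambda>\<tau>. F (\<tau>, snd p))) \<in> PM.S"
  unfolding PM.smooth_funs_iff
proof
  fix p0 :: "'t \<times> 'm"
  obtain U \<phi> where U: "(U, \<phi>) \<in> \<T>" "fst p0 \<in> U" by (rule T.ex_chart)
  obtain Y where Y: "\<And>b. Y b \<in> T.S" "\<And>b. \<forall>\<^sub>F q in nhds (fst p0). Y b q = complex_of_real (inner (\<phi> q) b)"
    by (rule T.ex_coord_functions[OF U]) blast
  have "\<forall>\<^sub>F q in nhds (fst p0). \<forall>b\<in>onb. Y b q = complex_of_real (inner (\<phi> q) b)"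
    using Y(2) by (intro eventually_ball_finite) auto
  moreover have "\<forall>\<^sub>F q in nhds (fst p0). q \<in> U"
    using U(2) T.chart_open[OF U(1)] by (intro eventually_nhds_in_open)
  ultimately have "\<forall>\<^sub>F q in nhds (fst p0). q \<in> U \<and> (\<forall>b\<in>onb. Y b q = complex_of_real (inner (\<phi> q) b))"
    by eventually_elim simp
  then obtain W where W: "open W" "fst p0 \<in> W" "\<And>q. q \<in> W \<Longrightarrow> q \<in> U"
    "\<And>q b. q \<in> W \<Longrightarrow> b \<in> onb \<Longrightarrow> Y b q = complex_of_real (inner (\<phi> q) b)"
    by (auto simp: eventually_nhds)
  have "p0 \<in> W \<times> UNIV" using W(2) by (simp add: mem_Times_iff)
  then have "\<forall>\<^sub>F p in nhds p0. p \<in> W \<times> UNIV" using W(1) by (intro eventually_nhds_in_open open_Times) auto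
  then have ev: "\<forall>\<^sub>F p in nhds p0. (\<Sum>b\<in>onb. complex_deriv (X (fst p)) (Y b) *
      frechet_derivative (\<lambda>y. F (inv_into U \<phi> y, snd p)) (at (\<phi> (fst p))) b) = complex_deriv (X (fst p)) (\<lambda>\<tau>. F (\<tau>, snd p))"
  proof (rule eventually_mono)
    fix p :: "'t \<times> 'm" assume "p \<in> W \<times> UNIV"
    then have p: "fst p \<in> W" by auto
    show "(\<Sum>b\<in>onb. complex_deriv (X (fst p)) (Y b) *
      frechet_derivative (\<lambda>y. F (inv_into U \<phi> y, snd p)) (at (\<phi> (fst p))) b) = complex_deriv (X (fst p)) (\<lambda>\<tau>. F (\<tau>, snd p))"
    proof (rule section_chain[OF U(1) W(3)[OF p] F Y(1) _ T.vector_fields_tangent[OF X], symmetric])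
      fix b :: 'e assume b: "b \<in> onb"
      have "\<forall>\<^sub>F q in nhds (fst p). q \<in> W" using W(1) p by (intro eventually_nhds_in_open)
      then show "\<forall>\<^sub>F q in nhds (fst p). Y b q = complex_of_real (inner (\<phi> q) b)"
        by (rule eventually_mono) (simp add: W(4) b)
    qed
  qed
  have "msmooth_at (prod_atlas \<T> \<M>) (\<lambda>p. \<Sum>b\<in>onb. complex_deriv (X (fst p)) (Y b) *
      frechet_derivative (\<lambda>y. F (inv_into U \<phi> y, snd p)) (at (\<phi> (fst p))) b) (fst p0, snd p0)"
    by (intro PM.msmooth_at_sum PM.msmooth_at_mult chart_deriv_smooth[OF U F]
        PM.smooth_funsD[OF S_fst[OF T.vector_fields_complex_smooth[OF X Y(1)]]])
  then show "msmooth_at (prod_atlas \<T> \<M>) (\<lambda>p. complex_deriv (X (fst p)) (\<lambda>\<tau>. F (\<tau>, snd p))) p0"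
    unfolding prod.collapse by (rule PM.msmooth_at_cong[OF ev])
qed

text \<open>The section is expanded around \<sigma> by Hadamard's lemma, uniformly in
  \<open>x\<close>. The coordinate increments are constant in \<open>x\<close>, so linearity of
  \<open>Q \<tau>\<close> takes them out, and differentiation at \<sigma> sees only their
  derivatives. The resulting sum is recognised as \<open>Q \<sigma>\<close> applied to the
  derivative of the section.\<close>

lemma op_family_product_rule:
  fixes F :: "'t \<times> 'm \<Rightarrow> complex"
  assumes Q: "op_family n Q" and F: "F \<in> PM.S" and v: "v \<in> tangent_space \<T> \<sigma>"
  shows "complex_deriv v (\<lambda>\<tau>. Q \<tau> (\<lambda>x. F (\<tau>, x)) x) =
    complex_deriv v (\<lambda>\<tau>. Q \<tau> (\<lambda>x. F (\<sigma>, x)) x) + Q \<sigma> (\<lambda>x. complex_deriv v (\<lambda>\<tau>. F (\<tau>, x))) x"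
proof -
  obtain U \<phi> where U: "(U, \<phi>) \<in> \<T>" "\<sigma> \<in> U" by (rule T.ex_chart)
  obtain Y where Y: "\<And>b. Y b \<in> T.S" "\<And>b. \<forall>\<^sub>F q in nhds \<sigma>. Y b q = complex_of_real (inner (\<phi> q) b)"
    by (rule T.ex_coord_functions[OF U]) blast
  obtain G where G: "\<And>b. G b \<in> PM.S"
    "\<forall>\<^sub>F \<tau> in nhds \<sigma>. \<forall>x. F (\<tau>, x) = F (\<sigma>, x) + (\<Sum>b\<in>onb. (Y b \<tau> - Y b \<sigma>) * G b (\<tau>, x))"
    "\<And>b x. G b (\<sigma>, x) = frechet_derivative (\<lambda>y. F (inv_into U \<phi> y, x)) (at (\<phi> \<sigma>)) b"
    by (rule coord_increment[OF U F Y]) blast+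
  have QF: "(\<lambda>\<tau>. Q \<tau> (\<lambda>x. H (\<tau>, x)) x) \<in> T.S" if "H \<in> PM.S" for H
    using S_slice(2)[OF op_family_apply_smooth[OF Q that], of x] by simp
  have Gs: "(\<lambda>x. G b (\<tau>, x)) \<in> M.S" for b \<tau> by (rule S_slice(1)[OF G(1)])
  have "\<forall>\<^sub>F \<tau> in nhds \<sigma>. Q \<tau> (\<lambda>x. F (\<tau>, x)) x =
    Q \<tau> (\<lambda>x. F (\<sigma>, x)) x + (\<Sum>b\<in>onb. (Y b \<tau> - Y b \<sigma>) * Q \<tau> (\<lambda>x. G b (\<tau>, x)) x)"
    using G(2)
  proof (rule eventually_mono)
    fix \<tau> assume "\<forall>x. F (\<tau>, x) = F (\<sigma>, x) + (\<Sum>b\<in>onb. (Y b \<tau> - Y b \<sigma>) * G b (\<tau>, x))"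
    then have e: "(\<lambda>x. F (\<tau>, x)) = (\<lambda>x. F (\<sigma>, x) + (\<Sum>b\<in>onb. (Y b \<tau> - Y b \<sigma>) * G b (\<tau>, x)))" by simp
    note l = op_family_lin[OF Q, of \<tau> x]
    have c: "(\<lambda>x. (Y b \<tau> - Y b \<sigma>) * G b (\<tau>, x)) \<in> M.S" for b
      using M.S.lin_closed[OF Gs Gs, where b=0] by simp
    show "Q \<tau> (\<lambda>x. F (\<tau>, x)) x =
      Q \<tau> (\<lambda>x. F (\<sigma>, x)) x + (\<Sum>b\<in>onb. (Y b \<tau> - Y b \<sigma>) * Q \<tau> (\<lambda>x. G b (\<tau>, x)) x)"
      unfolding e M.S.lin_on_add[OF l S_slice(1)[OF F] M.S.sum_closed, OF c]
        M.S.lin_on_sum[OF l, of onb, OF c] M.S.lin_on_cmult[OF l Gs] ..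
  qed
  from deriv_increment[OF v QF[OF F] _ Y(1) QF[OF G(1)] this]
  have 1: "complex_deriv v (\<lambda>\<tau>. Q \<tau> (\<lambda>x. F (\<tau>, x)) x) = complex_deriv v (\<lambda>\<tau>. Q \<tau> (\<lambda>x. F (\<sigma>, x)) x) +
    (\<Sum>b\<in>onb. complex_deriv v (Y b) * Q \<sigma> (\<lambda>x. G b (\<sigma>, x)) x)"
    using S_slice(2)[OF op_family_smooth[OF Q S_slice(1)[OF F]]] by simp
  have "Q \<sigma> (\<lambda>x. complex_deriv v (\<lambda>\<tau>. F (\<tau>, x))) x = Q \<sigma> (\<lambda>x. \<Sum>b\<in>onb. complex_deriv v (Y b) * G b (\<sigma>, x)) x"
    unfolding section_chain[OF U F Y v] G(3) ..
  also have "\<dots> = (\<Sum>b\<in>onb. complex_deriv v (Y b) * Q \<sigma> (\<lambda>x. G b (\<sigma>, x)) x)"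
  proof -
    note l = op_family_lin[OF Q, of \<sigma> x]
    have c: "(\<lambda>x. complex_deriv v (Y b) * G b (\<sigma>, x)) \<in> M.S" for b
      using M.S.lin_closed[OF Gs Gs, where b=0] by simp
    show ?thesis unfolding M.S.lin_on_sum[OF l, of onb, OF c] M.S.lin_on_cmult[OF l Gs] ..
  qed
  finally show ?thesis using 1 by simp
qed

text \<open>If one slice is smooth in \<open>x\<close>, then integrating the smooth derivative from
  it along segments in a chart gives joint smoothness nearby. The slices at base points start the
  propagation over their components.\<close>

lemma primitive_smooth:
  fixes u :: "'t \<times> 'm \<Rightarrow> complex"
  assumes u: "\<And>x. (\<lambda>\<tau>. u (\<tau>, x)) \<in> T.S"
    and B: "\<And>X. X \<in> vector_fields \<T> \<Longrightarrow> B X \<in> PM.S"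
    and d: "\<And>X \<sigma> x. X \<in> vector_fields \<T> \<Longrightarrow> complex_deriv (X \<sigma>) (\<lambda>\<tau>. u (\<tau>, x)) = B X (\<sigma>, x)"
    and b0: "\<And>\<sigma>. (\<lambda>x. u (T.base \<sigma>, x)) \<in> M.S"
  shows "u \<in> PM.S"
proof -
  have loc: "\<exists>N. open N \<and> \<sigma>0 \<in> N \<and> (\<forall>\<sigma>\<in>N. (\<lambda>x. u (\<sigma>, x)) \<in> M.S \<longrightarrow>
      (\<forall>\<tau>\<in>N. \<forall>x. msmooth_at (prod_atlas \<T> \<M>) u (\<tau>, x)))" for \<sigma>0
  proof -
    obtain U \<phi> where U: "(U, \<phi>) \<in> \<T>" "\<sigma>0 \<in> U" by (rule T.ex_chart)
    have "\<forall>b. \<exists>X. X \<in> vector_fields \<T> \<and> (\<forall>\<^sub>F q in nhds \<sigma>0. q \<in> U \<and>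
      (\<forall>f\<in>T.S. complex_deriv (X q) f = frechet_derivative (f \<circ> inv_into U \<phi>) (at (\<phi> q)) b))"
    proof
      fix b
      obtain X where "X \<in> vector_fields \<T>" "\<forall>\<^sub>F q in nhds \<sigma>0. q \<in> U \<and>
        (\<forall>f\<in>T.S. complex_deriv (X q) f = frechet_derivative (f \<circ> inv_into U \<phi>) (at (\<phi> q)) b)"
        by (rule T.ex_coordinate_field[OF U])
      then show "\<exists>X. X \<in> vector_fields \<T> \<and> (\<forall>\<^sub>F q in nhds \<sigma>0. q \<in> U \<and>
        (\<forall>f\<in>T.S. complex_deriv (X q) f = frechet_derivative (f \<circ> inv_into U \<phi>) (at (\<phi> q)) b))"
        by (intro exI[of _ X] conjI)
    qed
    from choice[OF this] obtain X where X0: "\<forall>b. X b \<in> vector_fields \<T> \<and> (\<forall>\<^sub>F q in nhds \<sigma>0. q \<in> U \<and>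
      (\<forall>f\<in>T.S. complex_deriv (X b q) f = frechet_derivative (f \<circ> inv_into U \<phi>) (at (\<phi> q)) b))" ..
    then have X: "X b \<in> vector_fields \<T>" for b by simp
    have "\<forall>\<^sub>F q in nhds \<sigma>0. \<forall>b\<in>onb. q \<in> U \<and>
      (\<forall>f\<in>T.S. complex_deriv (X b q) f = frechet_derivative (f \<circ> inv_into U \<phi>) (at (\<phi> q)) b)"
      using X0 by (intro eventually_ball_finite) auto
    from T.eventually_chart[OF U this] obtain O' where O': "open O'" "\<phi> \<sigma>0 \<in> O'"
      "\<And>y. y \<in> O' \<Longrightarrow> y \<in> \<phi> ` U \<and> (\<forall>b\<in>onb. inv_into U \<phi> y \<in> U \<and>
      (\<forall>f\<in>T.S. complex_deriv (X b (inv_into U \<phi> y)) f = frechet_derivative (f \<circ> inv_into U \<phi>) (at (\<phi> (inv_into U \<phi> y))) b))"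
      by (auto simp: eventually_nhds)
    obtain r where r: "r > 0" "ball (\<phi> \<sigma>0) r \<subseteq> O'" using openE[OF O'(1,2)] by blast
    have XB: "frechet_derivative (\<lambda>y. u (inv_into U \<phi> y, x)) (at y) b = B (X b) (inv_into U \<phi> y, x)"
      if y: "y \<in> ball (\<phi> \<sigma>0) r" and b: "b \<in> onb" for y b x
    proof -
      have y': "y \<in> O'" using y r(2) by blast
      have "complex_deriv (X b (inv_into U \<phi> y)) (\<lambda>\<tau>. u (\<tau>, x)) =
        frechet_derivative ((\<lambda>\<tau>. u (\<tau>, x)) \<circ> inv_into U \<phi>) (at (\<phi> (inv_into U \<phi> y))) b"
        using O'(3)[OF y'] b u by blast
      moreover have "\<phi> (inv_into U \<phi> y) = y" using O'(3)[OF y'] by (simp add: f_inv_into_f)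
      ultimately show ?thesis using d[OF X] by (simp add: o_def)
    qed
    \<comment> \<open>With r/8 any two points of \<open>N\<close> are less than r/4 apart in the
      chart, and the ball of radius r/2 about either of them stays in the ball of radius
      \<open>r\<close>. Segment integrals over radius r/2 are smooth on radius r/4.\<close>
    have "\<forall>\<^sub>F q in nhds \<sigma>0. q \<in> U \<and> \<phi> q \<in> ball (\<phi> \<sigma>0) (r/8)"
      using r(1) by (intro T.eventually_chart_inv[OF U] eventually_nhds_in_open) auto
    then obtain N where N: "open N" "\<sigma>0 \<in> N" "\<And>q. q \<in> N \<Longrightarrow> q \<in> U" "\<And>q. q \<in> N \<Longrightarrow> \<phi> q \<in> ball (\<phi> \<sigma>0) (r/8)"
      by (auto simp: eventually_nhds)
    have "msmooth_at (prod_atlas \<T> \<M>) u (\<tau>0, x)" if s: "\<sigma> \<in> N" "(\<lambda>x. u (\<sigma>, x)) \<in> M.S" and t: "\<tau>0 \<in> N" for \<sigma> \<tau>0 x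
    proof -
      have near: "\<phi> \<tau> \<in> ball (\<phi> \<sigma>) (r/2/2)" if "\<tau> \<in> N" for \<tau>
        using N(4)[OF that] N(4)[OF s(1)] dist_triangle2[of "\<phi> \<sigma>" "\<phi> \<tau>" "\<phi> \<sigma>0"]
        by (simp add: dist_commute)
      have sub: "ball (\<phi> \<sigma>) (r/2) \<subseteq> ball (\<phi> \<sigma>0) r"
      proof
        fix y assume "y \<in> ball (\<phi> \<sigma>) (r/2)"
        then show "y \<in> ball (\<phi> \<sigma>0) r"
          using N(4)[OF s(1)] dist_triangle[of "\<phi> \<sigma>0" y "\<phi> \<sigma>"] r(1) by simp
      qed
      have sU: "ball (\<phi> \<sigma>) (r/2) \<subseteq> \<phi> ` U" using sub r(2) O'(3) by blast
      define w where "w b = (\<lambda>p. integral {0..1} (\<lambda>t. B (X b) (inv_into U \<phi> (\<phi> \<sigma> + t *\<^sub>R (\<phi> (fst p) - \<phi> \<sigma>)), snd p)))" for b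
      have w: "msmooth_at (prod_atlas \<T> \<M>) (w b) (\<tau>0, x)" for b
        unfolding w_def
        by (rule segment_integral_smooth[OF U(1) sU PM.smooth_funsD[OF B[OF X]] N(3)[OF t] near[OF t]])
      have eq: "u (\<tau>, x) = u (\<sigma>, x) + (\<Sum>b\<in>onb. complex_of_real (inner (\<phi> \<tau> - \<phi> \<sigma>) b) * w b (\<tau>, x))"
        if \<tau>: "\<tau> \<in> N" for \<tau> x
      proof -
        have 1: "\<phi> \<tau> \<in> ball (\<phi> \<sigma>) (r/2)" using near[OF \<tau>] r(1) by auto
        have "integral {0..1} (\<lambda>t. frechet_derivative (\<lambda>y. u (inv_into U \<phi> y, x)) (at (\<phi> \<sigma> + t *\<^sub>R (\<phi> \<tau> - \<phi> \<sigma>))) b) = w b (\<tau>, x)"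
          if b: "b \<in> onb" for b
          unfolding w_def fst_conv snd_conv
        proof (rule integral_cong)
          fix t :: real assume "t \<in> {0..1}"
          then have "\<phi> \<sigma> + t *\<^sub>R (\<phi> \<tau> - \<phi> \<sigma>) \<in> ball (\<phi> \<sigma>0) r"
            using segment_in_ball[OF near[OF \<tau>], of t] sub by auto
          then show "frechet_derivative (\<lambda>y. u (inv_into U \<phi> y, x)) (at (\<phi> \<sigma> + t *\<^sub>R (\<phi> \<tau> - \<phi> \<sigma>))) b =
            B (X b) (inv_into U \<phi> (\<phi> \<sigma> + t *\<^sub>R (\<phi> \<tau> - \<phi> \<sigma>)), x)" by (rule XB[OF _ b])
        qed
        then show ?thesis
          using chart_segment_expand[OF U(1) sU N(3)[OF \<tau>] 1 N(3)[OF s(1)] u] by simp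
      qed
      have "msmooth_at (prod_atlas \<T> \<M>) (\<lambda>p. u (\<sigma>, snd p) + (\<Sum>b\<in>onb. complex_of_real (inner (\<phi> (fst p) - \<phi> \<sigma>) b) * w b p)) (\<tau>0, x)"
      proof (intro PM.msmooth_at_add PM.msmooth_at_sum PM.msmooth_at_mult w PM.msmooth_at_of_real)
        show "msmooth_at (prod_atlas \<T> \<M>) (\<lambda>p. u (\<sigma>, snd p)) (\<tau>0, x)"
          by (rule msmooth_at_snd[OF M.smooth_funsD[OF s(2)]])
        show "msmooth_at (prod_atlas \<T> \<M>) (\<lambda>p. inner (\<phi> (fst p) - \<phi> \<sigma>) b) (\<tau>0, x)" for b
          unfolding inner_diff_left
          by (intro PM.msmooth_at_diff PM.msmooth_at_const msmooth_at_fst[OF T.msmooth_at_coord[OF U(1) N(3)[OF t]]])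
      qed
      moreover have "\<forall>\<^sub>F p in nhds (\<tau>0, x). u (\<sigma>, snd p) + (\<Sum>b\<in>onb. complex_of_real (inner (\<phi> (fst p) - \<phi> \<sigma>) b) * w b p) = u p"
      proof -
        have "\<forall>\<^sub>F p in nhds (\<tau>0, x). p \<in> N \<times> UNIV"
          using N(1) t by (intro eventually_nhds_in_open open_Times) auto
        then show ?thesis by (rule eventually_mono) (auto simp: eq)
      qed
      ultimately show ?thesis by (rule PM.msmooth_at_cong[rotated])
    qed
    then show ?thesis using N(1,2) by (intro exI[of _ N] conjI ballI impI allI)
  qed
  have slice: "(\<lambda>x. u (\<sigma>, x)) \<in> M.S" for \<sigma>
  proof (rule T.base_clopen[where P="\<lambda>\<sigma>. (\<lambda>x. u (\<sigma>, x)) \<in> M.S"])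
    fix \<sigma>0
    from loc[of \<sigma>0] obtain N where N: "open N" "\<sigma>0 \<in> N" "\<forall>\<sigma>\<in>N. (\<lambda>x. u (\<sigma>, x)) \<in> M.S \<longrightarrow>
      (\<forall>\<tau>\<in>N. \<forall>x. msmooth_at (prod_atlas \<T> \<M>) u (\<tau>, x))" by (elim exE conjE)
    show "\<exists>N. open N \<and> \<sigma>0 \<in> N \<and> (\<forall>q\<in>N. \<forall>q'\<in>N. (\<lambda>x. u (q, x)) \<in> M.S \<longrightarrow> (\<lambda>x. u (q', x)) \<in> M.S)"
    proof (intro exI[of _ N] conjI N(1,2) ballI impI)
      fix q q' assume "q \<in> N" "q' \<in> N" "(\<lambda>x. u (q, x)) \<in> M.S"
      then have "\<forall>x. msmooth_at (prod_atlas \<T> \<M>) u (q', x)" using N(3)[rule_format] by (intro allI)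
      then show "(\<lambda>x. u (q', x)) \<in> M.S" unfolding M.smooth_funs_iff by (intro allI msmooth_at_slice(1)) simp
    qed
  qed (rule b0)
  show ?thesis unfolding PM.smooth_funs_iff
  proof
    fix p :: "'t \<times> 'm"
    from loc[of "fst p"] obtain N where N: "open N" "fst p \<in> N" "\<forall>\<sigma>\<in>N. (\<lambda>x. u (\<sigma>, x)) \<in> M.S \<longrightarrow>
      (\<forall>\<tau>\<in>N. \<forall>x. msmooth_at (prod_atlas \<T> \<M>) u (\<tau>, x))" by (elim exE conjE)
    then have "\<forall>x. msmooth_at (prod_atlas \<T> \<M>) u (fst p, x)" using slice[of "fst p"] by blast
    then have "msmooth_at (prod_atlas \<T> \<M>) u (fst p, snd p)" ..
    then show "msmooth_at (prod_atlas \<T> \<M>) u p" by (simp only: prod.collapse)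
  qed
qed

end

section \<open>Formal operators and connections\<close>

lemma fun_sum_apply: "(\<Sum>i\<in>I. f i) x = (\<Sum>i\<in>I. f i x)"
  by (induction I rule: infinite_finite_induct) auto

lemma act_nth: "fps_nth (act P f) n = (\<Sum>k\<le>n. P k (fps_nth f (n - k)))"
  by (simp add: act_def)

lemma act_nth_apply: "fps_nth (act P f) n x = (\<Sum>k\<le>n. P k (fps_nth f (n - k)) x)"
  by (simp add: act_nth fun_sum_apply)

lemma star_nth: "fps_nth (star c f g) n = (\<Sum>k\<le>n. \<Sum>i\<le>n - k. c k (fps_nth f i) (fps_nth g (n - k - i)))"
  by (simp add: star_def)

lemma section_deriv_nth: "fps_nth (section_deriv V f \<sigma>) n = (\<lambda>x. complex_deriv (V \<sigma>) (\<lambda>\<tau>. fps_nth (f \<tau>) n x))"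
  by (simp add: section_deriv_def)

definition form_connection :: "(nat \<Rightarrow> 't \<Rightarrow> 't tvec \<Rightarrow> 'm operator) \<Rightarrow> ('t, 'm) connection" where
  "form_connection A V f = (\<lambda>\<sigma>. section_deriv V f \<sigma> + act (\<lambda>k. A k \<sigma> (V \<sigma>)) (f \<sigma>))"

text \<open>Sums of functions are kept unevaluated while operators are applied to them as
  arguments.\<close>

declare plus_fun_apply [simp del] minus_apply [simp del]

section \<open>Formal operators, star products and the defect of multiplicativity\<close>

context manifold
begin

lemma S_add_fun: "f \<in> S \<Longrightarrow> g \<in> S \<Longrightarrow> (\<lambda>x. f x + g x) \<in> S"
  by (simp add: smooth_funs_iff msmooth_at_add)
lemma S_diff_fun: "f \<in> S \<Longrightarrow> g \<in> S \<Longrightarrow> (\<lambda>x. f x - g x) \<in> S"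
  by (simp add: smooth_funs_iff msmooth_at_diff)

definition lin_op :: "'a operator \<Rightarrow> bool" where
  "lin_op Q \<longleftrightarrow> (\<forall>f\<in>S. Q f \<in> S) \<and> (\<forall>p. lin_on S (\<lambda>f. Q f p))"

lemma
  assumes "lin_op Q"
  shows lin_op_S: "f \<in> S \<Longrightarrow> Q f \<in> S"
    and lin_op_add: "f \<in> S \<Longrightarrow> g \<in> S \<Longrightarrow> Q (f + g) = Q f + Q g"
    and lin_op_diff: "f \<in> S \<Longrightarrow> g \<in> S \<Longrightarrow> Q (f - g) = Q f - Q g"
    and lin_op_zero: "Q 0 = 0"
    and lin_op_sum: "(\<And>i. i \<in> I \<Longrightarrow> h i \<in> S) \<Longrightarrow> Q (\<Sum>i\<in>I. h i) = (\<Sum>i\<in>I. Q (h i))"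
proof -
  have l: "lin_on S (\<lambda>f. Q f p)" for p using assms unfolding lin_op_def by blast
  show "f \<in> S \<Longrightarrow> Q f \<in> S" using assms unfolding lin_op_def by blast
  show add: "Q (f + g) = Q f + Q g" if "f \<in> S" "g \<in> S" for f g
    using S.lin_on_add[OF l that] by (simp add: fun_eq_iff plus_fun_def)
  show "f \<in> S \<Longrightarrow> g \<in> S \<Longrightarrow> Q (f - g) = Q f - Q g"
    using S.lin_on_diff[OF l] by (simp add: fun_eq_iff fun_diff_def)
  show zero: "Q 0 = 0"
    using S.lin_on_zero[OF l] by (simp add: fun_eq_iff zero_fun_def)
  show "(\<And>i. i \<in> I \<Longrightarrow> h i \<in> S) \<Longrightarrow> Q (\<Sum>i\<in>I. h i) = (\<Sum>i\<in>I. Q (h i))"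
  proof (induction I rule: infinite_finite_induct)
    case (insert i I)
    have "Q (h i + (\<Sum>i\<in>I. h i)) = Q (h i) + Q (\<Sum>i\<in>I. h i)"
      by (intro add S_sum insert.prems) auto
    then show ?case using insert by (simp del: plus_fun_apply)
  qed (simp_all add: zero)
qed

definition lin_fop :: "'a formal_operator \<Rightarrow> bool" where
  "lin_fop P \<longleftrightarrow> (\<forall>k. lin_op (P k))"

abbreviation "FF \<equiv> formal_funs \<A>"

lemma FF_nth: "f \<in> FF \<Longrightarrow> fps_nth f n \<in> S" by (simp add: formal_funs_def)

lemma FF_const: "f \<in> S \<Longrightarrow> fps_const f \<in> FF" by (simp add: formal_funs_def)
lemma FF_X: "f \<in> FF \<Longrightarrow> fps_X * f \<in> FF" by (simp add: formal_funs_def)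
lemma FF_shift: "f \<in> FF \<Longrightarrow> fps_shift 1 f \<in> FF" by (simp add: formal_funs_def)

lemma act_FF: assumes "lin_fop P" "f \<in> FF" shows "act P f \<in> FF"
proof -
  have "P k (fps_nth f m) \<in> S" for k m
    using lin_op_S[of "P k", OF _ FF_nth[OF assms(2)]] assms(1) unfolding lin_fop_def by simp
  then show ?thesis unfolding formal_funs_def mem_Collect_eq act_nth by (intro allI S_sum)
qed

lemma act_add: "lin_fop P \<Longrightarrow> f \<in> FF \<Longrightarrow> g \<in> FF \<Longrightarrow> act P (f + g) = act P f + act P g"
  by (simp add: fps_eq_iff act_nth lin_fop_def lin_op_add FF_nth sum.distrib)

lemma act_diff: "lin_fop P \<Longrightarrow> f \<in> FF \<Longrightarrow> g \<in> FF \<Longrightarrow> act P (f - g) = act P f - act P g"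
  by (simp add: fps_eq_iff act_nth lin_fop_def lin_op_diff FF_nth sum_subtractf)

text \<open>\<open>fps_X\<close> plays the role of h. Additivity and commutation with
  \<open>fps_X\<close> are the form in which the head-tail arguments use linearity over
  C[[h]].\<close>

lemma act_X: assumes "lin_fop P" shows "act P (fps_X * f) = fps_X * act P f"
proof (rule fps_ext)
  fix n
  have z: "P k 0 = 0" for k using assms lin_op_zero unfolding lin_fop_def by blast
  show "fps_nth (act P (fps_X * f)) n = fps_nth (fps_X * act P f) n"
  proof (cases n)
    case (Suc m)
    have "(\<Sum>k\<le>m. P k (fps_nth (fps_X * f) (Suc m - k))) = (\<Sum>k\<le>m. P k (fps_nth f (m - k)))"
      by (intro sum.cong refl) (simp add: Suc_diff_le)
    then show ?thesis by (simp add: Suc act_nth z)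
  qed (simp add: act_nth z)
qed

definition star_like :: "'a cochains \<Rightarrow> bool" where
  "star_like c \<longleftrightarrow> (\<forall>k. \<forall>g\<in>S. lin_op (\<lambda>f. c k f g) \<and> lin_op (c k g))"

lemma
  assumes "star_like c"
  shows star_S: "f \<in> S \<Longrightarrow> g \<in> S \<Longrightarrow> c k f g \<in> S"
    and star_add_left: "f \<in> S \<Longrightarrow> f' \<in> S \<Longrightarrow> g \<in> S \<Longrightarrow> c k (f + f') g = c k f g + c k f' g"
    and star_add_right: "f \<in> S \<Longrightarrow> g \<in> S \<Longrightarrow> g' \<in> S \<Longrightarrow> c k f (g + g') = c k f g + c k f g'"
    and star_zero_left: "g \<in> S \<Longrightarrow> c k 0 g = 0" and star_zero_right: "f \<in> S \<Longrightarrow> c k f 0 = 0"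
proof -
  have l: "lin_op (\<lambda>f. c k f g)" "lin_op (c k g)" if "g \<in> S" for g
    using assms that unfolding star_like_def by blast+
  show "f \<in> S \<Longrightarrow> g \<in> S \<Longrightarrow> c k f g \<in> S" using lin_op_S[OF l(2)] by blast
  show "f \<in> S \<Longrightarrow> f' \<in> S \<Longrightarrow> g \<in> S \<Longrightarrow> c k (f + f') g = c k f g + c k f' g" using lin_op_add[OF l(1)] by blast
  show "f \<in> S \<Longrightarrow> g \<in> S \<Longrightarrow> g' \<in> S \<Longrightarrow> c k f (g + g') = c k f g + c k f g'" using lin_op_add[OF l(2)] by blast
  show "g \<in> S \<Longrightarrow> c k 0 g = 0" using lin_op_zero[OF l(1)] by blast
  show "f \<in> S \<Longrightarrow> c k f 0 = 0" using lin_op_zero[OF l(2)] by blast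
qed

lemma star_FF: assumes "star_like c" "f \<in> FF" "g \<in> FF" shows "star c f g \<in> FF"
proof -
  have "c k (fps_nth f i) (fps_nth g j) \<in> S" for k i j
    by (rule star_S[OF assms(1) FF_nth[OF assms(2)] FF_nth[OF assms(3)]])
  then show ?thesis unfolding formal_funs_def mem_Collect_eq star_nth by (intro allI S_sum)
qed

lemma star_fps_add_left:
  "star_like c \<Longrightarrow> f \<in> FF \<Longrightarrow> f' \<in> FF \<Longrightarrow> g \<in> FF \<Longrightarrow> star c (f + f') g = star c f g + star c f' g"
  by (simp add: fps_eq_iff star_nth star_add_left FF_nth sum.distrib)

lemma star_fps_add_right:
  "star_like c \<Longrightarrow> f \<in> FF \<Longrightarrow> g \<in> FF \<Longrightarrow> g' \<in> FF \<Longrightarrow> star c f (g + g') = star c f g + star c f g'"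
  by (simp add: fps_eq_iff star_nth star_add_right FF_nth sum.distrib)

lemma star_X_left:
  assumes "star_like c" "f \<in> FF" "g \<in> FF" shows "star c (fps_X * f) g = fps_X * star c f g"
proof (rule fps_ext)
  fix n
  show "fps_nth (star c (fps_X * f) g) n = fps_nth (fps_X * star c f g) n"
  proof (cases n)
    case (Suc m)
    have "(\<Sum>i\<le>Suc m - k. c k (fps_nth (fps_X * f) i) (fps_nth g (Suc m - k - i))) =
      (\<Sum>i\<le>m - k. c k (fps_nth f i) (fps_nth g (m - k - i)))" if "k \<le> m" for k
      using that by (simp add: Suc_diff_le sum.atMost_Suc_shift star_zero_left[OF assms(1)] FF_nth[OF assms(3)]
          del: sum.atMost_Suc)
    then show ?thesis by (simp add: Suc star_nth star_zero_left[OF assms(1)] FF_nth[OF assms(3)])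
  qed (simp add: star_nth star_zero_left[OF assms(1)] FF_nth[OF assms(3)])
qed

lemma star_X_right:
  assumes "star_like c" "f \<in> FF" "g \<in> FF" shows "star c f (fps_X * g) = fps_X * star c f g"
proof (rule fps_ext)
  fix n
  show "fps_nth (star c f (fps_X * g)) n = fps_nth (fps_X * star c f g) n"
  proof (cases n)
    case (Suc m)
    have "(\<Sum>i\<le>Suc m - k. c k (fps_nth f i) (fps_nth (fps_X * g) (Suc m - k - i))) =
      (\<Sum>i\<le>m - k. c k (fps_nth f i) (fps_nth g (m - k - i)))" if "k \<le> m" for k
    proof -
      have "(\<Sum>i\<le>Suc (m - k). c k (fps_nth f i) (fps_nth (fps_X * g) (Suc (m - k) - i))) =
        (\<Sum>i\<le>m - k. c k (fps_nth f i) (fps_nth (fps_X * g) (Suc (m - k) - i)))"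
        by (simp add: star_zero_right[OF assms(1)] FF_nth[OF assms(2)])
      also have "\<dots> = (\<Sum>i\<le>m - k. c k (fps_nth f i) (fps_nth g (m - k - i)))"
        by (intro sum.cong refl) (simp add: Suc_diff_le)
      finally show ?thesis using that by (simp only: Suc_diff_le)
    qed
    then show ?thesis by (simp add: Suc star_nth star_zero_right[OF assms(1)] FF_nth[OF assms(2)])
  qed (simp add: star_nth star_zero_right[OF assms(1)] FF_nth[OF assms(2)])
qed

lemma fps_head_tail: "f = fps_const (fps_nth f 0) + fps_X * fps_shift 1 f" for f :: "('a \<Rightarrow> complex) fps"
  by (rule fps_ext) auto

definition defect :: "'a formal_operator \<Rightarrow> 'a cochains \<Rightarrow>
    ('a \<Rightarrow> complex) fps \<Rightarrow> ('a \<Rightarrow> complex) fps \<Rightarrow> ('a \<Rightarrow> complex) fps" where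
  "defect P c f g = act P (star c f g) - star c (act P f) (act P g)"

lemma
  assumes "lin_fop P" "star_like c"
  shows defect_add_left: "f \<in> FF \<Longrightarrow> f' \<in> FF \<Longrightarrow> g \<in> FF \<Longrightarrow> defect P c (f + f') g = defect P c f g + defect P c f' g"
    and defect_add_right: "f \<in> FF \<Longrightarrow> g \<in> FF \<Longrightarrow> g' \<in> FF \<Longrightarrow> defect P c f (g + g') = defect P c f g + defect P c f g'"
    and defect_X_left: "f \<in> FF \<Longrightarrow> g \<in> FF \<Longrightarrow> defect P c (fps_X * f) g = fps_X * defect P c f g"
    and defect_X_right: "f \<in> FF \<Longrightarrow> g \<in> FF \<Longrightarrow> defect P c f (fps_X * g) = fps_X * defect P c f g"
  unfolding defect_def
  by (simp_all add: star_fps_add_left star_fps_add_right act_add act_FF star_FF act_X star_X_left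
      star_X_right assms right_diff_distrib)

text \<open>Splitting both arguments into constant term plus h times a rest reduces the coefficient
  at \<open>j\<close> to the one for ordinary functions and to coefficients at \<open>j - 1\<close>.
  So vanishing below \<open>n\<close> may be checked on ordinary functions.\<close>

lemma defect_nth_zero:
  assumes P: "lin_fop P" and c: "star_like c"
    and z: "\<And>m f g. m < n \<Longrightarrow> f \<in> S \<Longrightarrow> g \<in> S \<Longrightarrow> fps_nth (defect P c (fps_const f) (fps_const g)) m = 0"
  shows "j < n \<Longrightarrow> f \<in> FF \<Longrightarrow> g \<in> FF \<Longrightarrow> fps_nth (defect P c f g) j = 0"
proof (induction j arbitrary: f g rule: less_induct)
  case (less j)
  let ?f0 = "fps_const (fps_nth f 0)" and ?g0 = "fps_const (fps_nth g 0)"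
  have F: "?f0 \<in> FF" "fps_shift 1 f \<in> FF" "fps_X * fps_shift 1 f \<in> FF"
    "?g0 \<in> FF" "fps_shift 1 g \<in> FF" "fps_X * fps_shift 1 g \<in> FF"
    using less.prems by (simp_all only: FF_const FF_nth FF_shift FF_X)
  have X: "fps_nth (fps_X * defect P c a b) j = 0" if "a \<in> FF" "b \<in> FF" for a b
    using less.IH[of "j - 1" a b] less.prems(1) that by (cases j) auto
  have "defect P c f g = defect P c ?f0 g + fps_X * defect P c (fps_shift 1 f) g"
    using defect_add_left[OF P c F(1,3) less.prems(3)] defect_X_left[OF P c F(2) less.prems(3)] fps_head_tail[of f]
    by metis
  moreover have "defect P c ?f0 g = defect P c ?f0 ?g0 + fps_X * defect P c ?f0 (fps_shift 1 g)"
    using defect_add_right[OF P c F(1,4,6)] defect_X_right[OF P c F(1,5)] fps_head_tail[of g] by metis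
  ultimately have "fps_nth (defect P c f g) j = fps_nth (defect P c ?f0 ?g0) j +
      fps_nth (fps_X * defect P c ?f0 (fps_shift 1 g)) j + fps_nth (fps_X * defect P c (fps_shift 1 f) g) j"
    by (simp only: fps_add_nth)
  also have "\<dots> = 0"
    using z[OF less.prems(1) FF_nth[OF less.prems(2)] FF_nth[OF less.prems(3)]] X[OF F(1,5)] X[OF F(2) less.prems(3)]
    by (simp only: add_0_right)
  finally show ?case .
qed

text \<open>An argument divisible by h shifts the defect by one power of h, so that vanishing
  strictly below \<open>n\<close> already covers \<open>n\<close>.\<close>

lemma defect_nth_zero_left:
  assumes "lin_fop P" "star_like c"
    and z: "\<And>m f g. m < n \<Longrightarrow> f \<in> S \<Longrightarrow> g \<in> S \<Longrightarrow> fps_nth (defect P c (fps_const f) (fps_const g)) m = 0"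
    and f: "f \<in> FF" "g \<in> FF" "fps_nth f 0 = 0"
  shows "fps_nth (defect P c f g) n = 0"
proof -
  have "f = fps_X * fps_shift 1 f" using fps_head_tail[of f] f(3) by simp
  then have "defect P c f g = fps_X * defect P c (fps_shift 1 f) g"
    using defect_X_left[OF assms(1,2) FF_shift[OF f(1)] f(2)] by simp
  moreover have "fps_nth (defect P c (fps_shift 1 f) g) j = 0" if "j < n" for j
    by (rule defect_nth_zero[OF assms(1,2) _ that FF_shift[OF f(1)] f(2)]) (rule z; assumption)
  ultimately show ?thesis by (cases n) simp_all
qed

lemma defect_nth_zero_right:
  assumes "lin_fop P" "star_like c"
    and z: "\<And>m f g. m < n \<Longrightarrow> f \<in> S \<Longrightarrow> g \<in> S \<Longrightarrow> fps_nth (defect P c (fps_const f) (fps_const g)) m = 0"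
    and f: "f \<in> FF" "g \<in> FF" "fps_nth g 0 = 0"
  shows "fps_nth (defect P c f g) n = 0"
proof -
  have "g = fps_X * fps_shift 1 g" using fps_head_tail[of g] f(3) by simp
  then have "defect P c f g = fps_X * defect P c f (fps_shift 1 g)"
    using defect_X_right[OF assms(1,2) f(1) FF_shift[OF f(2)]] by simp
  moreover have "fps_nth (defect P c f (fps_shift 1 g)) j = 0" if "j < n" for j
    by (rule defect_nth_zero[OF assms(1,2) _ that f(1) FF_shift[OF f(2)]]) (rule z; assumption)
  ultimately show ?thesis by (cases n) simp_all
qed

text \<open>The system is triangular: the coefficient at \<open>n\<close> of \<open>act P f\<close>
  is that of \<open>f\<close> plus terms in lower coefficients of \<open>f\<close>.\<close>

lemma act_inj:
  assumes P: "lin_fop P" "\<And>f. f \<in> S \<Longrightarrow> P 0 f = f"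
  shows "inj_on (act P) FF"
proof (rule inj_onI)
  fix f g assume f: "f \<in> FF" and g: "g \<in> FF" and e: "act P f = act P g"
  show "f = g"
  proof (rule fps_ext)
    fix n show "fps_nth f n = fps_nth g n"
    proof (induction n rule: less_induct)
      case (less n)
      have s: "fps_nth (act P h) n = fps_nth h n + (\<Sum>k\<in>{1..n}. P k (fps_nth h (n - k)))" if "h \<in> FF" for h
      proof -
        have "{..n} = insert 0 {1..n}" by auto
        then show ?thesis using P(2)[OF FF_nth[OF that]] by (simp add: act_nth)
      qed
      have "(\<Sum>k\<in>{1..n}. P k (fps_nth f (n - k))) = (\<Sum>k\<in>{1..n}. P k (fps_nth g (n - k)))"
        using less.IH by (intro sum.cong refl) simp
      then show ?case using s[OF f] s[OF g] e by simp
    qed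
  qed
qed

text \<open>The base point lies in the component of \<open>p\<close>, and the choice depends on the
  component only. Hence subtracting the value at the base point gives a function that vanishes
  there.\<close>

lemma base_base [simp]: "base (base p) = base p"
proof -
  have "base p \<in> connected_component_set UNIV p"
    unfolding base_def by (rule someI[of _ p]) simp
  then have "connected_component_set UNIV (base p) = connected_component_set UNIV p"
    using connected_component_eq[of "base p" UNIV p] by simp
  moreover have "base q = base p" if "connected_component_set UNIV q = connected_component_set UNIV p" for q
    unfolding base_def that ..
  ultimately show ?thesis by blast
qed

end

declare plus_fun_apply [simp] minus_apply [simp]

section \<open>Smooth sections and connections of the form d + A\<close>

context manifold_pair
begin

abbreviation "SS \<equiv> smooth_sections \<T> \<M>"
abbreviation "VF \<equiv> vector_fields \<T>"

lemma SS_iff: "F \<in> SS \<longleftrightarrow> (\<forall>n. (\<lambda>p. fps_nth (F (fst p)) n (snd p)) \<in> PM.S)"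
  unfolding smooth_sections_def by (simp add: split_beta')

lemma SS_nth: "F \<in> SS \<Longrightarrow> (\<lambda>p. fps_nth (F (fst p)) n (snd p)) \<in> PM.S"
  by (simp add: SS_iff)

lemma SS_FF: "F \<in> SS \<Longrightarrow> F \<sigma> \<in> M.FF"
  using S_slice(1)[OF SS_nth] by (fastforce simp: formal_funs_def)

lemma SS_nth_T: "F \<in> SS \<Longrightarrow> (\<lambda>\<sigma>. fps_nth (F \<sigma>) n x) \<in> T.S"
  using S_slice(2)[OF SS_nth] by fastforce

lemma SS_const: "f \<in> M.S \<Longrightarrow> (\<lambda>\<sigma>. fps_const f) \<in> SS"
  unfolding SS_iff using S_snd by auto

lemma SS_add: "F \<in> SS \<Longrightarrow> G \<in> SS \<Longrightarrow> (\<lambda>\<sigma>. F \<sigma> + G \<sigma>) \<in> SS"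
  by (auto simp: SS_iff intro!: PM.S_add_fun)
lemma SS_diff: "F \<in> SS \<Longrightarrow> G \<in> SS \<Longrightarrow> (\<lambda>\<sigma>. F \<sigma> - G \<sigma>) \<in> SS"
  by (auto simp: SS_iff intro!: PM.S_diff_fun)

lemma op_family_lin_op: "op_family n Q \<Longrightarrow> M.lin_op (Q \<sigma>)"
  unfolding M.lin_op_def using op_family_S op_family_lin by blast

text \<open>The order bound of each coefficient is uniform in the parameter and on \<open>M\<close>,
  but its growth with \<open>k\<close> is left open.\<close>

definition formal_family :: "('t \<Rightarrow> 'm formal_operator) \<Rightarrow> bool" where
  "formal_family P \<longleftrightarrow> (\<forall>k. \<exists>n. op_family n (\<lambda>\<sigma>. P \<sigma> k))"

lemma formal_family_lin_fop: "formal_family P \<Longrightarrow> M.lin_fop (P \<sigma>)"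
  unfolding M.lin_fop_def formal_family_def using op_family_lin_op by blast

lemma SS_act:
  assumes P: "formal_family P" and F: "F \<in> SS" shows "(\<lambda>\<sigma>. act (P \<sigma>) (F \<sigma>)) \<in> SS"
  unfolding SS_iff
proof
  fix n
  have "(\<lambda>p. P (fst p) k (fps_nth (F (fst p)) (n - k)) (snd p)) \<in> PM.S" for k
  proof -
    obtain N where N: "op_family N (\<lambda>\<sigma>. P \<sigma> k)" using P unfolding formal_family_def by blast
    from op_family_apply_smooth[OF N SS_nth[OF F, of "n - k"]] show ?thesis by simp
  qed
  then show "(\<lambda>p. fps_nth (act (P (fst p)) (F (fst p))) n (snd p)) \<in> PM.S"
    unfolding act_nth_apply by (intro PM.S.sum_closed)
qed

lemma SS_section_deriv:
  assumes "V \<in> VF" "F \<in> SS" shows "section_deriv V F \<in> SS"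
  unfolding SS_iff section_deriv_nth using section_deriv_smooth[OF assms(1) SS_nth[OF assms(2)]] by simp

lemma natural_form_op_family:
  assumes A: "A \<in> natural_op_one_forms \<T> \<M>" and V: "V \<in> VF"
  shows "op_family (Suc k) (\<lambda>\<sigma>. A k \<sigma> (V \<sigma>))"
proof -
  have "A k \<sigma> (V \<sigma>) \<in> diff_ops_le \<M> k" for \<sigma>
    using A T.vector_fields_tangent[OF V] unfolding natural_op_one_forms_def by blast
  moreover have "(\<lambda>\<sigma>. A k \<sigma> (V \<sigma>)) \<in> smooth_diff_op_families \<T> \<M>"
    using A V unfolding natural_op_one_forms_def by blast
  ultimately show ?thesis
    unfolding op_family_def smooth_diff_op_families_def split_beta'
    by (intro conjI allI M.diff_ops_le_functional) simp_all
qed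

lemma natural_form_formal_family:
  "A \<in> natural_op_one_forms \<T> \<M> \<Longrightarrow> V \<in> VF \<Longrightarrow> formal_family (\<lambda>\<sigma> k. A k \<sigma> (V \<sigma>))"
  unfolding formal_family_def using natural_form_op_family by blast

lemma natural_form_0:
  "A \<in> natural_op_one_forms \<T> \<M> \<Longrightarrow> v \<in> tangent_space \<T> \<sigma> \<Longrightarrow> f \<in> M.S \<Longrightarrow> A 0 \<sigma> v f = 0"
  unfolding natural_op_one_forms_def by blast

lemma SS_form_connection:
  assumes "A \<in> natural_op_one_forms \<T> \<M>" "V \<in> VF" "F \<in> SS" shows "form_connection A V F \<in> SS"
  using SS_add[OF SS_section_deriv[OF assms(2,3)] SS_act[OF natural_form_formal_family[OF assms(1,2)] assms(3)]]
  by (simp only: form_connection_def)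

lemma form_connection_nth:
  "fps_nth (form_connection A V F \<sigma>) n x = complex_deriv (V \<sigma>) (\<lambda>\<tau>. fps_nth (F \<tau>) n x) +
    (\<Sum>k\<le>n. A k \<sigma> (V \<sigma>) (fps_nth (F \<sigma>) (n - k)) x)"
  by (simp add: form_connection_def section_deriv_nth act_nth_apply)

lemma form_connection_diff:
  assumes A: "A \<in> natural_op_one_forms \<T> \<M>" and V: "V \<in> VF" and F: "F \<in> SS" "G \<in> SS"
  shows "form_connection A V (\<lambda>\<sigma>. F \<sigma> - G \<sigma>) = (\<lambda>\<sigma>. form_connection A V F \<sigma> - form_connection A V G \<sigma>)"
proof
  fix \<sigma>
  have "section_deriv V (\<lambda>\<sigma>. F \<sigma> - G \<sigma>) \<sigma> = section_deriv V F \<sigma> - section_deriv V G \<sigma>"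
    using T.complex_deriv_diff[OF T.vector_fields_tangent[OF V] SS_nth_T[OF F(1)] SS_nth_T[OF F(2)]]
    by (intro fps_ext) (simp add: section_deriv_nth fun_eq_iff)
  moreover have "act (\<lambda>k. A k \<sigma> (V \<sigma>)) (F \<sigma> - G \<sigma>) = act (\<lambda>k. A k \<sigma> (V \<sigma>)) (F \<sigma>) - act (\<lambda>k. A k \<sigma> (V \<sigma>)) (G \<sigma>)"
    by (rule M.act_diff[OF formal_family_lin_fop[OF natural_form_formal_family[OF A V]] SS_FF[OF F(1)] SS_FF[OF F(2)]])
  ultimately show "form_connection A V (\<lambda>\<sigma>. F \<sigma> - G \<sigma>) \<sigma> = form_connection A V F \<sigma> - form_connection A V G \<sigma>"
    by (simp add: form_connection_def)
qed

text \<open>A parameter-independent section has no derivative, and \<open>A\<close> is 0 modulo h.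
  The power of h gained here is what makes the inductions on the order succeed.\<close>

lemma form_connection_const_nth_0:
  assumes A: "A \<in> natural_op_one_forms \<T> \<M>" and V: "V \<in> VF" and f: "f \<in> M.S"
  shows "fps_nth (form_connection A V (\<lambda>\<sigma>. fps_const f) \<sigma>) 0 = 0"
  using natural_form_0[OF A T.vector_fields_tangent[OF V] f]
  by (auto simp: fun_eq_iff form_connection_nth T.complex_deriv_const[OF T.vector_fields_tangent[OF V]])

text \<open>On a section divisible by h^n the form \<open>A\<close> contributes from h^(n+1) on, so
  the coefficient at \<open>n\<close> is differentiated as by the trivial connection.\<close>

lemma form_connection_leading_nth:
  assumes A: "A \<in> natural_op_one_forms \<T> \<M>" and V: "V \<in> VF" and F: "F \<in> SS"
    and z: "\<And>j \<tau>. j < n \<Longrightarrow> fps_nth (F \<tau>) j = 0"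
  shows "fps_nth (form_connection A V F \<sigma>) n x = complex_deriv (V \<sigma>) (\<lambda>\<tau>. fps_nth (F \<tau>) n x)"
proof -
  have "A k \<sigma> (V \<sigma>) (fps_nth (F \<sigma>) (n - k)) = 0" if "k \<le> n" for k
  proof (cases "k = 0")
    case True
    then show ?thesis
      using natural_form_0[OF A T.vector_fields_tangent[OF V] M.FF_nth[OF SS_FF[OF F]]] by simp
  next
    case False
    then have "fps_nth (F \<sigma>) (n - k) = 0" using that by (intro z) simp
    then show ?thesis using M.lin_op_zero[OF op_family_lin_op[OF natural_form_op_family[OF A V]]] by simp
  qed
  then show ?thesis by (simp add: form_connection_nth)
qed

text \<open>Coefficients of dP(V) + A(V) P - P A'(V), with the compositions of formal operators
  expanded in powers of h.\<close>

definition gauge_diff_op ::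
  "(nat \<Rightarrow> 't \<Rightarrow> 't tvec \<Rightarrow> 'm operator) \<Rightarrow> (nat \<Rightarrow> 't \<Rightarrow> 't tvec \<Rightarrow> 'm operator) \<Rightarrow>
    ('t \<Rightarrow> 'm formal_operator) \<Rightarrow> ('t \<Rightarrow> 't tvec) \<Rightarrow> nat \<Rightarrow> 't \<Rightarrow> 'm operator" where
  "gauge_diff_op A A' P V m \<sigma> f x = complex_deriv (V \<sigma>) (\<lambda>\<tau>. P \<tau> m f x) +
    ((\<Sum>k\<le>m. A k \<sigma> (V \<sigma>) (P \<sigma> (m - k) f) x) - (\<Sum>k\<le>m. P \<sigma> k (A' (m - k) \<sigma> (V \<sigma>) f) x))"

text \<open>
  \<open>D\<^sub>V P - P D'\<^sub>V\<close> does not differentiate sections: it is the formal operator with coefficients \<open>gauge_diff_op\<close>.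
\<close>

lemma gauge_difference:
  assumes A: "A \<in> natural_op_one_forms \<T> \<M>" and A': "A' \<in> natural_op_one_forms \<T> \<M>"
    and P: "formal_family P" and V: "V \<in> VF" and F: "F \<in> SS"
  shows "form_connection A V (\<lambda>\<sigma>. act (P \<sigma>) (F \<sigma>)) \<sigma> - act (P \<sigma>) (form_connection A' V F \<sigma>) =
    act (\<lambda>m. gauge_diff_op A A' P V m \<sigma>) (F \<sigma>)"
proof (rule fps_ext, rule ext)
  fix n x
  note v = T.vector_fields_tangent[OF V, of \<sigma>]
  let ?F = "fps_nth (F \<sigma>)"
  note FS = M.FF_nth[OF SS_FF[OF F, of \<sigma>]]
  have Pl: "M.lin_op (P \<sigma> k)" for k using formal_family_lin_fop[OF P, of \<sigma>] unfolding M.lin_fop_def by blast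
  have Al: "M.lin_op (A k \<sigma> (V \<sigma>))" for k using op_family_lin_op[OF natural_form_op_family[OF A V]] .
  have Al': "M.lin_op (A' k \<sigma> (V \<sigma>))" for k using op_family_lin_op[OF natural_form_op_family[OF A' V]] .
  \<comment> \<open>Both sides run over triples with sum \<open>n\<close>; on the right,
    \<open>m\<close> is the degree of the composed operator.\<close>
  have tri: "(\<Sum>k\<le>n. \<Sum>j\<le>n - k. g k j (n - k - j)) = (\<Sum>m\<le>n. \<Sum>k\<le>m. g k (m - k) (n - m))"
    for g :: "nat \<Rightarrow> nat \<Rightarrow> nat \<Rightarrow> complex"
    using fps_mult_assoc_lemma[of g n n] by (simp add: atLeast0AtMost)
  \<comment> \<open>The derivative of the section enters the first term through the product rule and
    the second through D'; the two contributions are equal and cancel.\<close>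
  define d where "d m = fps_nth (section_deriv V F \<sigma>) m" for m
  have dS: "d m \<in> M.S" for m unfolding d_def by (rule M.FF_nth[OF SS_FF[OF SS_section_deriv[OF V F]]])
  have 1: "complex_deriv (V \<sigma>) (\<lambda>\<tau>. fps_nth (act (P \<tau>) (F \<tau>)) n x) =
    (\<Sum>m\<le>n. complex_deriv (V \<sigma>) (\<lambda>\<tau>. P \<tau> m (?F (n - m)) x)) + (\<Sum>m\<le>n. P \<sigma> m (d (n - m)) x)"
  proof -
    have *: "(\<lambda>\<tau>. P \<tau> m (fps_nth (F \<tau>) (n - m)) x) \<in> T.S \<and>
      complex_deriv (V \<sigma>) (\<lambda>\<tau>. P \<tau> m (fps_nth (F \<tau>) (n - m)) x) =
      complex_deriv (V \<sigma>) (\<lambda>\<tau>. P \<tau> m (?F (n - m)) x) + P \<sigma> m (d (n - m)) x" for m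
    proof -
      obtain N where N: "op_family N (\<lambda>\<sigma>. P \<sigma> m)" using P unfolding formal_family_def by blast
      from S_slice(2)[OF op_family_apply_smooth[OF N SS_nth[OF F, of "n - m"]], of x]
        op_family_product_rule[OF N SS_nth[OF F, of "n - m"] v, of x]
      show ?thesis by (simp add: d_def section_deriv_nth)
    qed
    have "complex_deriv (V \<sigma>) (\<lambda>\<tau>. \<Sum>m\<le>n. P \<tau> m (fps_nth (F \<tau>) (n - m)) x) =
      (\<Sum>m\<le>n. complex_deriv (V \<sigma>) (\<lambda>\<tau>. P \<tau> m (fps_nth (F \<tau>) (n - m)) x))"
      by (rule T.complex_deriv_sum[OF v]) (use * in blast)
    also have "\<dots> = (\<Sum>m\<le>n. complex_deriv (V \<sigma>) (\<lambda>\<tau>. P \<tau> m (?F (n - m)) x) + P \<sigma> m (d (n - m)) x)"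
      using * by (intro sum.cong refl) blast
    finally show ?thesis by (simp only: act_nth_apply sum.distrib)
  qed
  have 2: "(\<Sum>k\<le>n. A k \<sigma> (V \<sigma>) (fps_nth (act (P \<sigma>) (F \<sigma>)) (n - k)) x) =
    (\<Sum>m\<le>n. \<Sum>k\<le>m. A k \<sigma> (V \<sigma>) (P \<sigma> (m - k) (?F (n - m))) x)"
  proof -
    have "A k \<sigma> (V \<sigma>) (fps_nth (act (P \<sigma>) (F \<sigma>)) (n - k)) x =
      (\<Sum>j\<le>n - k. A k \<sigma> (V \<sigma>) (P \<sigma> j (?F (n - k - j))) x)" for k
    proof -
      have "A k \<sigma> (V \<sigma>) (\<Sum>j\<le>n - k. P \<sigma> j (?F (n - k - j))) = (\<Sum>j\<le>n - k. A k \<sigma> (V \<sigma>) (P \<sigma> j (?F (n - k - j))))"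
        by (intro M.lin_op_sum[OF Al] M.lin_op_S[OF Pl] FS)
      then show ?thesis by (simp add: act_nth fun_sum_apply)
    qed
    then show ?thesis by (simp only: tri[of "\<lambda>k j i. A k \<sigma> (V \<sigma>) (P \<sigma> j (?F i)) x"])
  qed
  have 3: "fps_nth (act (P \<sigma>) (form_connection A' V F \<sigma>)) n x = (\<Sum>m\<le>n. P \<sigma> m (d (n - m)) x) +
    (\<Sum>m\<le>n. \<Sum>k\<le>m. P \<sigma> k (A' (m - k) \<sigma> (V \<sigma>) (?F (n - m))) x)"
  proof -
    have "P \<sigma> k (fps_nth (form_connection A' V F \<sigma>) (n - k)) x = P \<sigma> k (d (n - k)) x +
      (\<Sum>j\<le>n - k. P \<sigma> k (A' j \<sigma> (V \<sigma>) (?F (n - k - j))) x)" for k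
    proof -
      have s: "(\<Sum>j\<le>n - k. A' j \<sigma> (V \<sigma>) (?F (n - k - j))) \<in> M.S"
        by (intro M.S_sum M.lin_op_S[OF Al'] FS)
      have "P \<sigma> k (d (n - k) + (\<Sum>j\<le>n - k. A' j \<sigma> (V \<sigma>) (?F (n - k - j)))) =
        P \<sigma> k (d (n - k)) + (\<Sum>j\<le>n - k. P \<sigma> k (A' j \<sigma> (V \<sigma>) (?F (n - k - j))))"
        using M.lin_op_add[OF Pl dS s] M.lin_op_sum[OF Pl, of "{..n - k}" "\<lambda>j. A' j \<sigma> (V \<sigma>) (?F (n - k - j))"]
          M.lin_op_S[OF Al' FS] by simp
      then show ?thesis by (simp add: form_connection_def act_nth d_def[symmetric] fun_sum_apply)
    qed
    then show ?thesis
      by (simp only: act_nth_apply sum.distrib tri[of "\<lambda>k j i. P \<sigma> k (A' j \<sigma> (V \<sigma>) (?F i)) x"])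
  qed
  have "fps_nth (form_connection A V (\<lambda>\<sigma>. act (P \<sigma>) (F \<sigma>)) \<sigma> - act (P \<sigma>) (form_connection A' V F \<sigma>)) n x =
    (\<Sum>m\<le>n. complex_deriv (V \<sigma>) (\<lambda>\<tau>. P \<tau> m (?F (n - m)) x)) +
    (\<Sum>m\<le>n. \<Sum>k\<le>m. A k \<sigma> (V \<sigma>) (P \<sigma> (m - k) (?F (n - m))) x) -
    (\<Sum>m\<le>n. \<Sum>k\<le>m. P \<sigma> k (A' (m - k) \<sigma> (V \<sigma>) (?F (n - m))) x)"
    by (simp add: form_connection_nth 1 2 3)
  then show "fps_nth (form_connection A V (\<lambda>\<sigma>. act (P \<sigma>) (F \<sigma>)) \<sigma> - act (P \<sigma>) (form_connection A' V F \<sigma>)) n x =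
    fps_nth (act (\<lambda>m. gauge_diff_op A A' P V m \<sigma>) (F \<sigma>)) n x"
    by (simp add: act_nth_apply gauge_diff_op_def sum.distrib sum_subtractf)
qed

end

section \<open>Construction of the gauge transformation\<close>

context manifold
begin

lemma diff_ops_le_smooth:
  assumes "Q \<in> diff_ops_le \<A> k" and f: "f \<in> S" shows "Q f \<in> S"
  unfolding smooth_funs_iff
proof
  fix p
  obtain U \<phi> where U: "(U, \<phi>) \<in> \<A>" "p \<in> U" by (rule ex_chart)
  have "\<exists>L a. finite L \<and> (\<forall>l\<in>L. length l \<le> k \<and> smooth_on (\<phi> ` U) (a l)) \<and>
     (\<forall>f\<in>S. \<forall>p\<in>U. Q f p = (\<Sum>l\<in>L. a l (\<phi> p) * iter_deriv l (f \<circ> inv_into U \<phi>) (\<phi> p)))"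
    using assms U(1) unfolding diff_ops_le_def by blast
  then obtain L a where "\<forall>l\<in>L. length l \<le> k \<and> smooth_on (\<phi> ` U) (a l)"
    "\<forall>f\<in>S. \<forall>p\<in>U. Q f p = (\<Sum>l\<in>L. a l (\<phi> p) * iter_deriv l (f \<circ> inv_into U \<phi>) (\<phi> p))"
    by (elim exE conjE)
  with f have L: "\<And>l. l \<in> L \<Longrightarrow> smooth_on (\<phi> ` U) (a l)"
    "\<And>p. p \<in> U \<Longrightarrow> Q f p = (\<Sum>l\<in>L. a l (\<phi> p) * iter_deriv l (f \<circ> inv_into U \<phi>) (\<phi> p))"
    by blast+
  have "smooth_at (\<lambda>y. \<Sum>l\<in>L. a l y * iter_deriv l (f \<circ> inv_into U \<phi>) y) (\<phi> p)"
  proof (rule smooth_at_sum, rule smooth_at_mult)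
    show "smooth_at (a l) (\<phi> p)" if "l \<in> L" for l
      using L(1)[OF that] U(2) smooth_on_iff_smooth_at[OF chart_open_image[OF U(1)]] by blast
    show "smooth_at (iter_deriv l (f \<circ> inv_into U \<phi>)) (\<phi> p)" for l
      by (rule smooth_at_iter_deriv[OF msmooth_atD[OF smooth_funsD[OF f] U]])
  qed
  moreover have "\<forall>\<^sub>F y in nhds (\<phi> p). (\<Sum>l\<in>L. a l y * iter_deriv l (f \<circ> inv_into U \<phi>) y) = Q f (inv_into U \<phi> y)"
    using eventually_chart[OF U, of "\<lambda>_. True"]
    by (rule eventually_mono[OF _]) (auto simp: L(2) U(1))
  ultimately show "msmooth_at \<A> (Q f) p" unfolding msmooth_at_iff[OF U] by (rule smooth_at_cong[rotated])
qed

text \<open>The cohomology is real, so real and imaginary parts are integrated separately.\<close>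

lemma complex_primitive:
  fixes b :: "'a \<Rightarrow> 'a tvec \<Rightarrow> complex"
  assumes H1: "H1_vanishes \<A>"
    and lin: "\<And>p v w r s. v \<in> tangent_space \<A> p \<Longrightarrow> w \<in> tangent_space \<A> p \<Longrightarrow>
      b p (\<lambda>f. r * v f + s * w f) = of_real r * b p v + of_real s * b p w"
    and sm: "\<And>X. X \<in> vector_fields \<A> \<Longrightarrow> (\<lambda>p. b p (X p)) \<in> S"
    and cl: "\<And>X Y p. X \<in> vector_fields \<A> \<Longrightarrow> Y \<in> vector_fields \<A> \<Longrightarrow>
      complex_deriv (X p) (\<lambda>q. b q (Y q)) - complex_deriv (Y p) (\<lambda>q. b q (X q)) = b p (lie_bracket \<A> X Y p)"
  obtains u where "u \<in> S" "\<And>p v. v \<in> tangent_space \<A> p \<Longrightarrow> complex_deriv v u = b p v"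
proof -
  have re: "X p (\<lambda>q. Re (b q (Y q))) - Y p (\<lambda>q. Re (b q (X q))) - Re (b p (lie_bracket \<A> X Y p)) = 0"
    and im: "X p (\<lambda>q. Im (b q (Y q))) - Y p (\<lambda>q. Im (b q (X q))) - Im (b p (lie_bracket \<A> X Y p)) = 0"
    if "X \<in> vector_fields \<A>" "Y \<in> vector_fields \<A>" for X Y p
    using arg_cong[OF cl[OF that, of p], of Re] arg_cong[OF cl[OF that, of p], of Im]
    by (simp_all add: complex_deriv_def)
  have "(\<lambda>p v. Re (b p v)) \<in> closed_one_forms \<A>" "(\<lambda>p v. Im (b p v)) \<in> closed_one_forms \<A>"
    unfolding closed_one_forms_def one_forms_def
    using re im S_Re[OF sm] S_Im[OF sm] by (simp_all add: lin)
  then have "(\<lambda>p v. Re (b p v)) \<in> exact_one_forms \<A>" "(\<lambda>p v. Im (b p v)) \<in> exact_one_forms \<A>"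
    using H1 unfolding H1_vanishes_def by blast+
  then obtain u1 u2 where u: "u1 \<in> S" "\<And>p v. v \<in> tangent_space \<A> p \<Longrightarrow> Re (b p v) = v u1"
    "u2 \<in> S" "\<And>p v. v \<in> tangent_space \<A> p \<Longrightarrow> Im (b p v) = v u2"
    unfolding exact_one_forms_def by auto
  show ?thesis
  proof (rule that[of "\<lambda>x. Complex (u1 x) (u2 x)"])
    show "(\<lambda>x. Complex (u1 x) (u2 x)) \<in> S"
      using u(1,3) by (simp add: smooth_funs_iff msmooth_at_Complex)
    show "complex_deriv v (\<lambda>x. Complex (u1 x) (u2 x)) = b p v" if "v \<in> tangent_space \<A> p" for p v
      using u(2,4)[OF that] by (simp add: complex_deriv_def complex_eq_iff)
  qed
qed

end

section \<open>The 1-form prescribing the next coefficient\<close>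

context manifold_pair
begin

text \<open>For fixed \<open>x\<close> the factor \<open>u x\<close> is a constant in the parameter,
  so the commutator of a primitive is a primitive of the commutator. After \<open>m\<close>
  commutators the derivative is zero, and a function with zero derivative that vanishes at the base
  points is zero.\<close>

lemma order_at_primitive:
  assumes "\<And>f. f \<in> M.S \<Longrightarrow> (\<lambda>\<sigma>. L \<sigma> f) \<in> T.S"
    and "\<And>V \<sigma> f. V \<in> VF \<Longrightarrow> f \<in> M.S \<Longrightarrow> complex_deriv (V \<sigma>) (\<lambda>\<tau>. L \<tau> f) = K V \<sigma> f"
    and "\<And>\<sigma> f. f \<in> M.S \<Longrightarrow> L (T.base \<sigma>) f = 0"
    and "\<And>V \<sigma>. V \<in> VF \<Longrightarrow> order_at M.S x m (K V \<sigma>)"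
  shows "order_at M.S x m (L \<sigma>)"
  using assms
proof (induction m arbitrary: L K)
  case 0
  have "L \<sigma> f = 0" if f: "f \<in> M.S" for f
    using T.zero_deriv_const[of "\<lambda>\<sigma>. L \<sigma> f" \<sigma>] 0 f by simp
  then show ?case by simp
next
  case (Suc m)
  have "order_at M.S x m (commutator u x (L \<sigma>))" if u: "u \<in> M.S" for u
  proof (rule Suc.IH[of "\<lambda>\<sigma>. commutator u x (L \<sigma>)" "\<lambda>V \<sigma>. commutator u x (K V \<sigma>)"])
    fix f :: "'m \<Rightarrow> complex" assume f: "f \<in> M.S"
    note s = Suc.prems(1)[OF M.S.mult_closed[OF u f]] Suc.prems(1)[OF f]
    have s': "(\<lambda>\<sigma>. u x * L \<sigma> f) \<in> T.S" using T.S.lin_closed[OF s(2) s(2), where b=0] by simp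
    show "(\<lambda>\<sigma>. commutator u x (L \<sigma>) f) \<in> T.S"
      unfolding commutator_def by (rule T.S_diff_fun[OF s(1) s'])
    show "complex_deriv (V \<sigma>) (\<lambda>\<tau>. commutator u x (L \<tau>) f) = commutator u x (K V \<sigma>) f" if V: "V \<in> VF" for V \<sigma>
      unfolding commutator_def
      using T.complex_deriv_diff[OF T.vector_fields_tangent[OF V] s(1) s']
        T.complex_deriv_cmult[OF T.vector_fields_tangent[OF V] s(2)]
        Suc.prems(2)[OF V f] Suc.prems(2)[OF V M.S.mult_closed[OF u f]] by simp
    show "commutator u x (L (T.base \<sigma>)) f = 0" for \<sigma>
      unfolding commutator_def using Suc.prems(3)[OF f] Suc.prems(3)[OF M.S.mult_closed[OF u f]] by simp
  next
    show "order_at M.S x m (commutator u x (K V \<sigma>))" if "V \<in> VF" for V \<sigma>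
      using Suc.prems(4)[OF that, of \<sigma>] u by simp
  qed
  then show ?case by simp
qed

text \<open>The coefficient of h^n in P A' - A P. Coefficients of \<open>P\<close> at
  \<open>n\<close> would be paired with \<open>A 0\<close> or \<open>A' 0\<close>, which vanish, so
  only earlier ones enter and the equation for the derivative of the coefficient at \<open>n\<close>
  is recursive.\<close>

definition gauge_form ::
  "(nat \<Rightarrow> 't \<Rightarrow> 't tvec \<Rightarrow> 'm operator) \<Rightarrow> (nat \<Rightarrow> 't \<Rightarrow> 't tvec \<Rightarrow> 'm operator) \<Rightarrow>
    ('t \<Rightarrow> 'm formal_operator) \<Rightarrow> nat \<Rightarrow> 't \<Rightarrow> 't tvec \<Rightarrow> 'm operator" where
  "gauge_form A A' P n \<sigma> v f x =
    (\<Sum>k<n. P \<sigma> k (A' (n - k) \<sigma> v f) x) - (\<Sum>k<n. A (n - k) \<sigma> v (P \<sigma> k f) x)"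

lemma gauge_form_cong:
  "(\<And>k \<sigma>. k < n \<Longrightarrow> P \<sigma> k = P' \<sigma> k) \<Longrightarrow> gauge_form A A' P n = gauge_form A A' P' n"
  by (intro ext) (simp add: gauge_form_def)

text \<open>The terms that involve the coefficient of \<open>P\<close> at \<open>n\<close>
  undifferentiated carry a factor \<open>A 0\<close> or \<open>A' 0\<close>.\<close>

lemma gauge_diff_op_eq:
  assumes A: "A \<in> natural_op_one_forms \<T> \<M>" and A': "A' \<in> natural_op_one_forms \<T> \<M>"
    and P: "op_family N (\<lambda>\<sigma>. P \<sigma> n)" and V: "V \<in> VF" and f: "f \<in> M.S"
  shows "gauge_diff_op A A' P V n \<sigma> f x = complex_deriv (V \<sigma>) (\<lambda>\<tau>. P \<tau> n f x) - gauge_form A A' P n \<sigma> (V \<sigma>) f x"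
proof -
  note v = T.vector_fields_tangent[OF V, of \<sigma>]
  have "(\<Sum>k\<le>n. P \<sigma> k (A' (n - k) \<sigma> (V \<sigma>) f) x) = (\<Sum>k<n. P \<sigma> k (A' (n - k) \<sigma> (V \<sigma>) f) x)"
    using natural_form_0[OF A' v f] M.lin_op_zero[OF op_family_lin_op[OF P]]
    by (simp add: lessThan_Suc_atMost[symmetric])
  moreover have "(\<Sum>k\<le>n. A k \<sigma> (V \<sigma>) (P \<sigma> (n - k) f) x) = (\<Sum>k<n. A (n - k) \<sigma> (V \<sigma>) (P \<sigma> k f) x)"
  proof -
    have "(\<Sum>k\<le>n. A k \<sigma> (V \<sigma>) (P \<sigma> (n - k) f) x) = (\<Sum>k\<le>n. A (n - k) \<sigma> (V \<sigma>) (P \<sigma> k f) x)"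
      by (rule sum.reindex_bij_witness[of _ "\<lambda>k. n - k" "\<lambda>k. n - k"]) auto
    also have "\<dots> = (\<Sum>k<n. A (n - k) \<sigma> (V \<sigma>) (P \<sigma> k f) x)"
      using natural_form_0[OF A v op_family_S[OF P f]] by (simp add: lessThan_Suc_atMost[symmetric])
    finally show ?thesis .
  qed
  ultimately show ?thesis by (simp add: gauge_diff_op_def gauge_form_def)
qed

lemma gauge_form_smooth:
  assumes A: "A \<in> natural_op_one_forms \<T> \<M>" and A': "A' \<in> natural_op_one_forms \<T> \<M>"
    and P: "\<forall>k<n. \<exists>N. op_family N (\<lambda>\<sigma>. P \<sigma> k)" and V: "V \<in> VF" and f: "f \<in> M.S"
  shows "(\<lambda>p. gauge_form A A' P n (fst p) (V (fst p)) f (snd p)) \<in> PM.S"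
proof -
  have 1: "(\<lambda>p. P (fst p) k (A' (n - k) (fst p) (V (fst p)) f) (snd p)) \<in> PM.S"
    and 2: "(\<lambda>p. A (n - k) (fst p) (V (fst p)) (P (fst p) k f) (snd p)) \<in> PM.S" if "k < n" for k
  proof -
    obtain N where N: "op_family N (\<lambda>\<sigma>. P \<sigma> k)" using P \<open>k < n\<close> by blast
    show "(\<lambda>p. P (fst p) k (A' (n - k) (fst p) (V (fst p)) f) (snd p)) \<in> PM.S"
      using op_family_apply_smooth[OF N op_family_smooth[OF natural_form_op_family[OF A' V] f]] by simp
    show "(\<lambda>p. A (n - k) (fst p) (V (fst p)) (P (fst p) k f) (snd p)) \<in> PM.S"
      using op_family_apply_smooth[OF natural_form_op_family[OF A V] op_family_smooth[OF N f]] by simp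
  qed
  show ?thesis unfolding gauge_form_def
    by (rule PM.S_diff_fun[OF PM.S.sum_closed PM.S.sum_closed]) (simp_all add: 1 2)
qed

lemma gauge_form_lin_op:
  assumes A: "A \<in> natural_op_one_forms \<T> \<M>" and A': "A' \<in> natural_op_one_forms \<T> \<M>"
    and P: "\<forall>k<n. \<exists>N. op_family N (\<lambda>\<sigma>. P \<sigma> k)" and V: "V \<in> VF" and f: "f \<in> M.S" and g: "g \<in> M.S"
  shows "gauge_form A A' P n \<sigma> (V \<sigma>) (\<lambda>x. a * f x + b * g x) x =
    a * gauge_form A A' P n \<sigma> (V \<sigma>) f x + b * gauge_form A A' P n \<sigma> (V \<sigma>) g x"
proof -
  have 1: "P \<sigma> k (A' (n - k) \<sigma> (V \<sigma>) (\<lambda>x. a * f x + b * g x)) x =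
      a * P \<sigma> k (A' (n - k) \<sigma> (V \<sigma>) f) x + b * P \<sigma> k (A' (n - k) \<sigma> (V \<sigma>) g) x"
    and 2: "A (n - k) \<sigma> (V \<sigma>) (P \<sigma> k (\<lambda>x. a * f x + b * g x)) x =
      a * A (n - k) \<sigma> (V \<sigma>) (P \<sigma> k f) x + b * A (n - k) \<sigma> (V \<sigma>) (P \<sigma> k g) x" if "k < n" for k
  proof -
    obtain N where N: "op_family N (\<lambda>\<sigma>. P \<sigma> k)" using P \<open>k < n\<close> by blast
    have l: "Q \<sigma> (\<lambda>x. a * h x + b * h' x) = (\<lambda>x. a * Q \<sigma> h x + b * Q \<sigma> h' x)"
      if "op_family N Q" "h \<in> M.S" "h' \<in> M.S" for N Q h h'
      using op_family_lin[OF that(1)] that(2,3) unfolding lin_on_def by (intro ext) simp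
    note A'f = natural_form_op_family[OF A' V, of "n - k"] and Af = natural_form_op_family[OF A V, of "n - k"]
    show "P \<sigma> k (A' (n - k) \<sigma> (V \<sigma>) (\<lambda>x. a * f x + b * g x)) x =
      a * P \<sigma> k (A' (n - k) \<sigma> (V \<sigma>) f) x + b * P \<sigma> k (A' (n - k) \<sigma> (V \<sigma>) g) x"
      by (simp only: l[OF A'f f g] l[OF N op_family_S[OF A'f f] op_family_S[OF A'f g]])
    show "A (n - k) \<sigma> (V \<sigma>) (P \<sigma> k (\<lambda>x. a * f x + b * g x)) x =
      a * A (n - k) \<sigma> (V \<sigma>) (P \<sigma> k f) x + b * A (n - k) \<sigma> (V \<sigma>) (P \<sigma> k g) x"
      by (simp only: l[OF N f g] l[OF Af op_family_S[OF N f] op_family_S[OF N g]])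
  qed
  show ?thesis unfolding gauge_form_def
    by (simp add: 1 2 sum.distrib sum_distrib_left right_diff_distrib)
qed

lemma gauge_form_zero:
  assumes A: "A \<in> natural_op_one_forms \<T> \<M>" and A': "A' \<in> natural_op_one_forms \<T> \<M>"
    and P: "\<forall>k<n. \<exists>N. op_family N (\<lambda>\<sigma>. P \<sigma> k)" and V: "V \<in> VF"
  shows "gauge_form A A' P n \<sigma> (V \<sigma>) 0 x = 0"
proof -
  have "gauge_form A A' P n \<sigma> (V \<sigma>) (\<lambda>x. 0 * (0::'m \<Rightarrow> complex) x + 0 * (0::'m \<Rightarrow> complex) x) x = 0"
    using gauge_form_lin_op[OF A A' P V M.S_zero M.S_zero, where \<sigma>=\<sigma> and a=0 and b=0 and x=x] by simp
  then show ?thesis by (simp add: zero_fun_def)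
qed

text \<open>Orders add under composition, and the sum of all bounds is a common majorant for the
  summands with different \<open>k\<close>.\<close>

lemma gauge_form_order:
  assumes A: "A \<in> natural_op_one_forms \<T> \<M>" and A': "A' \<in> natural_op_one_forms \<T> \<M>"
    and P: "\<forall>k<n. op_family (N k) (\<lambda>\<sigma>. P \<sigma> k)" and V: "V \<in> VF"
  shows "order_at M.S x ((\<Sum>k<n. N k) + Suc n) (\<lambda>f. gauge_form A A' P n \<sigma> (V \<sigma>) f x)"
  unfolding gauge_form_def
proof (intro M.S.order_at_diff M.S.order_at_sum)
  fix k assume "k \<in> {..<n}"
  then have k: "k < n" by simp
  have le: "N k + Suc (n - k) \<le> (\<Sum>k<n. N k) + Suc n"
    using member_le_sum[of k "{..<n}" N] k by simp
  show "order_at M.S x ((\<Sum>k<n. N k) + Suc n) (\<lambda>f. P \<sigma> k (A' (n - k) \<sigma> (V \<sigma>) f) x)"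
    by (rule M.S.order_at_mono[OF M.S.order_at_compose[OF op_family_lin[OF P[rule_format, OF k]] op_family_order[OF P[rule_format, OF k]]
          op_family_order[OF natural_form_op_family[OF A' V]] op_family_S[OF natural_form_op_family[OF A' V]]] le])
  have le': "Suc (n - k) + N k \<le> (\<Sum>k<n. N k) + Suc n" using le by simp
  show "order_at M.S x ((\<Sum>k<n. N k) + Suc n) (\<lambda>f. A (n - k) \<sigma> (V \<sigma>) (P \<sigma> k f) x)"
    by (rule M.S.order_at_mono[OF M.S.order_at_compose[OF op_family_lin[OF natural_form_op_family[OF A V]]
          op_family_order[OF natural_form_op_family[OF A V]] op_family_order[OF P[rule_format, OF k]] op_family_S[OF P[rule_format, OF k]]] le'])
qed

text \<open>A 1-form has to be linear on single tangent vectors at each point, not merely on vector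
  fields.\<close>

lemma gauge_form_tangent_linear:
  assumes A: "A \<in> natural_op_one_forms \<T> \<M>" and A': "A' \<in> natural_op_one_forms \<T> \<M>"
    and P: "\<forall>k<n. \<exists>N. op_family N (\<lambda>\<sigma>. P \<sigma> k)" and f: "f \<in> M.S"
    and v: "v \<in> tangent_space \<T> \<sigma>" "w \<in> tangent_space \<T> \<sigma>"
  shows "gauge_form A A' P n \<sigma> (\<lambda>u. r * v u + s * w u) f x =
    of_real r * gauge_form A A' P n \<sigma> v f x + of_real s * gauge_form A A' P n \<sigma> w f x"
proof -
  have lin: "B k \<sigma> (\<lambda>u. r * v u + s * w u) h = (\<lambda>x. of_real r * B k \<sigma> v h x + of_real s * B k \<sigma> w h x)"
    if "B \<in> natural_op_one_forms \<T> \<M>" "h \<in> M.S" for B k h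
    using that v unfolding natural_op_one_forms_def by blast
  have sm: "B k \<sigma> v' h \<in> M.S" if "B \<in> natural_op_one_forms \<T> \<M>" "h \<in> M.S" "v' \<in> tangent_space \<T> \<sigma>" for B k h v'
    using that M.diff_ops_le_smooth unfolding natural_op_one_forms_def by blast
  have 1: "P \<sigma> k (A' (n - k) \<sigma> (\<lambda>u. r * v u + s * w u) f) x =
      of_real r * P \<sigma> k (A' (n - k) \<sigma> v f) x + of_real s * P \<sigma> k (A' (n - k) \<sigma> w f) x"
    and 2: "A (n - k) \<sigma> (\<lambda>u. r * v u + s * w u) (P \<sigma> k f) x =
      of_real r * A (n - k) \<sigma> v (P \<sigma> k f) x + of_real s * A (n - k) \<sigma> w (P \<sigma> k f) x" if "k < n" for k
  proof -
    obtain N where N: "op_family N (\<lambda>\<sigma>. P \<sigma> k)" using P \<open>k < n\<close> by blast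
    show "P \<sigma> k (A' (n - k) \<sigma> (\<lambda>u. r * v u + s * w u) f) x =
      of_real r * P \<sigma> k (A' (n - k) \<sigma> v f) x + of_real s * P \<sigma> k (A' (n - k) \<sigma> w f) x"
      unfolding lin[OF A' f]
      using op_family_lin[OF N] sm[OF A' f v(1)] sm[OF A' f v(2)] unfolding lin_on_def by simp
    show "A (n - k) \<sigma> (\<lambda>u. r * v u + s * w u) (P \<sigma> k f) x =
      of_real r * A (n - k) \<sigma> v (P \<sigma> k f) x + of_real s * A (n - k) \<sigma> w (P \<sigma> k f) x"
      unfolding lin[OF A op_family_S[OF N f]] ..
  qed
  show ?thesis unfolding gauge_form_def
    by (simp add: 1 2 sum.distrib sum_distrib_left right_diff_distrib)
qed

definition flat_form :: "(nat \<Rightarrow> 't \<Rightarrow> 't tvec \<Rightarrow> 'm operator) \<Rightarrow> bool" where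
  "flat_form A \<longleftrightarrow> (\<forall>V\<in>VF. \<forall>W\<in>VF. \<forall>F\<in>SS. \<forall>\<sigma>.
     form_connection A V (form_connection A W F) \<sigma> - form_connection A W (form_connection A V F) \<sigma> = form_connection A (lie_bracket \<T> V W) F \<sigma>)"

text \<open>
  With \<open>E\<^sub>V = D\<^sub>V P - P D'\<^sub>V\<close> for the truncation \<open>P\<close> of the series at order \<open>n\<close>, flatness gives
  \<open>D\<^sub>V E\<^sub>W - D\<^sub>W E\<^sub>V + E\<^sub>V D'\<^sub>W - E\<^sub>W D'\<^sub>V = E\<^bsub>[V,W]\<^esub>\<close>; the leading coefficient of \<open>E\<close> is \<open>- gauge_form\<close>.
\<close>

lemma gauge_form_closed:
  assumes A: "A \<in> natural_op_one_forms \<T> \<M>" and A': "A' \<in> natural_op_one_forms \<T> \<M>"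
    and fl: "flat_form A" "flat_form A'"
    and P: "\<forall>k<n. \<exists>N. op_family N (\<lambda>\<sigma>. P \<sigma> k)"
    and eq: "\<forall>k<n. \<forall>V\<in>VF. \<forall>f\<in>M.S. \<forall>\<sigma> x.
      complex_deriv (V \<sigma>) (\<lambda>\<tau>. P \<tau> k f x) = gauge_form A A' P k \<sigma> (V \<sigma>) f x"
    and V: "V \<in> VF" and W: "W \<in> VF" and f: "f \<in> M.S"
  shows "complex_deriv (V \<sigma>) (\<lambda>\<tau>. gauge_form A A' P n \<tau> (W \<tau>) f x) -
    complex_deriv (W \<sigma>) (\<lambda>\<tau>. gauge_form A A' P n \<tau> (V \<tau>) f x) = gauge_form A A' P n \<sigma> (lie_bracket \<T> V W \<sigma>) f x"
proof -
  \<comment> \<open>Truncation by zero makes a formal family out of the finitely many known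
    coefficients. As its coefficient at \<open>n\<close> is 0, no derivative appears there and the
    error at \<open>n\<close> is exactly minus \<open>gauge_form\<close>.\<close>
  define P' where "P' \<tau> k = (if k < n then P \<tau> k else (\<lambda>f x. 0))" for \<tau> k
  have z: "op_family 0 (\<lambda>\<tau> f x. 0)" unfolding op_family_def by (simp add: lin_on_def)
  have P': "\<exists>N. op_family N (\<lambda>\<sigma>. P' \<sigma> k)" for k
    using P z by (cases "k < n") (auto simp: P'_def)
  then have ff: "formal_family P'" unfolding formal_family_def by blast
  have bP': "gauge_form A A' P' k = gauge_form A A' P k" if "k \<le> n" for k
    by (rule gauge_form_cong) (use that in \<open>simp add: P'_def\<close>)
  have e0: "gauge_diff_op A A' P' X m \<tau> g y = 0" if "m < n" "X \<in> VF" "g \<in> M.S" for X m \<tau> g y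
  proof -
    obtain N where N: "op_family N (\<lambda>\<sigma>. P' \<sigma> m)" using P' ..
    show ?thesis
      using gauge_diff_op_eq[where P=P' and n=m, OF A A' N that(2,3), of \<tau> y] eq bP'[of m] that by (simp add: P'_def)
  qed
  have en: "gauge_diff_op A A' P' X n \<tau> g y = - gauge_form A A' P n \<tau> (X \<tau>) g y" if "X \<in> VF" "g \<in> M.S" for X \<tau> g y
  proof -
    obtain N where N: "op_family N (\<lambda>\<sigma>. P' \<sigma> n)" using P' ..
    show ?thesis
      using gauge_diff_op_eq[where P=P' and n=n, OF A A' N that, of \<tau> y] bP'[of n] T.complex_deriv_const[OF T.vector_fields_tangent[OF that(1)]]
      by (simp add: P'_def)
  qed
  define E where "E X F = (\<lambda>\<sigma>. form_connection A X (\<lambda>\<sigma>. act (P' \<sigma>) (F \<sigma>)) \<sigma> - act (P' \<sigma>) (form_connection A' X F \<sigma>))" for X F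
  have E: "E X F \<tau> = act (\<lambda>m. gauge_diff_op A A' P' X m \<tau>) (F \<tau>)" if "X \<in> VF" "F \<in> SS" for X F \<tau>
    unfolding E_def by (rule gauge_difference[OF A A' ff that])
  have ESS: "E X F \<in> SS" if "X \<in> VF" "F \<in> SS" for X F
    unfolding E_def by (rule SS_diff[OF SS_form_connection[OF A that(1) SS_act[OF ff that(2)]] SS_act[OF ff SS_form_connection[OF A' that]]])
  have Elow: "fps_nth (E X F \<tau>) j = 0" if "X \<in> VF" "F \<in> SS" "j < n" for X F \<tau> j
  proof
    fix y
    have "gauge_diff_op A A' P' X m \<tau> (fps_nth (F \<tau>) (j - m)) y = 0" if "m \<le> j" for m
      by (rule e0) (use that \<open>j < n\<close> \<open>X \<in> VF\<close> M.FF_nth[OF SS_FF[OF \<open>F \<in> SS\<close>]] in auto)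
    then show "fps_nth (E X F \<tau>) j y = 0 y" by (simp add: E[OF \<open>X \<in> VF\<close> \<open>F \<in> SS\<close>] act_nth_apply)
  qed
  have Etop: "fps_nth (E X F \<tau>) n y = - gauge_form A A' P n \<tau> (X \<tau>) (fps_nth (F \<tau>) 0) y"
    if X: "X \<in> VF" and F: "F \<in> SS" for X F \<tau> y
  proof -
    have "gauge_diff_op A A' P' X m \<tau> (fps_nth (F \<tau>) (n - m)) y = 0" if "m < n" for m
      by (rule e0[OF that X M.FF_nth[OF SS_FF[OF F]]])
    then show ?thesis
      using en[OF X M.FF_nth[OF SS_FF[OF F]]] by (simp add: E[OF X F] act_nth_apply lessThan_Suc_atMost[symmetric])
  qed
  \<comment> \<open>The identity between connections is tested on a parameter-independent section,
    whose only coefficient is \<open>f\<close>.\<close>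
  define H where "H = (\<lambda>\<sigma>::'t. fps_const f)"
  have H: "H \<in> SS" unfolding H_def by (rule SS_const[OF f])
  have VW: "lie_bracket \<T> V W \<in> VF" by (rule T.lie_bracket_vector_field[OF V W])
  \<comment> \<open>The mixed compositions D P D' occur in both summands with opposite signs. What
    remains contains second derivatives of one connection at a time, to which flatness
    applies.\<close>
  have half: "form_connection A X (E Y H) \<sigma> + E X (form_connection A' Y H) \<sigma> =
      form_connection A X (form_connection A Y (\<lambda>\<sigma>. act (P' \<sigma>) (H \<sigma>))) \<sigma> - act (P' \<sigma>) (form_connection A' X (form_connection A' Y H) \<sigma>)"
    if X: "X \<in> VF" and Y: "Y \<in> VF" for X Y
  proof -
    have "form_connection A X (E Y H) = (\<lambda>\<sigma>. form_connection A X (form_connection A Y (\<lambda>\<sigma>. act (P' \<sigma>) (H \<sigma>))) \<sigma> - form_connection A X (\<lambda>\<sigma>. act (P' \<sigma>) (form_connection A' Y H \<sigma>)) \<sigma>)"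
      unfolding E_def
      by (rule form_connection_diff[OF A X SS_form_connection[OF A Y SS_act[OF ff H]] SS_act[OF ff SS_form_connection[OF A' Y H]]])
    then show ?thesis by (simp add: E_def)
  qed
  have fop: "M.lin_fop (P' \<sigma>)" by (rule formal_family_lin_fop[OF ff])
  have "(form_connection A V (E W H) \<sigma> + E V (form_connection A' W H) \<sigma>) - (form_connection A W (E V H) \<sigma> + E W (form_connection A' V H) \<sigma>) =
    (form_connection A V (form_connection A W (\<lambda>\<sigma>. act (P' \<sigma>) (H \<sigma>))) \<sigma> - form_connection A W (form_connection A V (\<lambda>\<sigma>. act (P' \<sigma>) (H \<sigma>))) \<sigma>) -
    (act (P' \<sigma>) (form_connection A' V (form_connection A' W H) \<sigma>) - act (P' \<sigma>) (form_connection A' W (form_connection A' V H) \<sigma>))"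
    unfolding half[OF V W] half[OF W V] by (simp add: algebra_simps)
  also have "\<dots> = form_connection A (lie_bracket \<T> V W) (\<lambda>\<sigma>. act (P' \<sigma>) (H \<sigma>)) \<sigma> - act (P' \<sigma>) (form_connection A' (lie_bracket \<T> V W) H \<sigma>)"
  proof -
    have "act (P' \<sigma>) (form_connection A' V (form_connection A' W H) \<sigma>) - act (P' \<sigma>) (form_connection A' W (form_connection A' V H) \<sigma>) =
      act (P' \<sigma>) (form_connection A' V (form_connection A' W H) \<sigma> - form_connection A' W (form_connection A' V H) \<sigma>)"
      by (rule M.act_diff[OF fop SS_FF[OF SS_form_connection[OF A' V SS_form_connection[OF A' W H]]]
            SS_FF[OF SS_form_connection[OF A' W SS_form_connection[OF A' V H]]], symmetric])
    then show ?thesis using fl V W H SS_act[OF ff H] unfolding flat_form_def by simp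
  qed
  also have "\<dots> = E (lie_bracket \<T> V W) H \<sigma>" by (simp add: E_def)
  finally have main: "fps_nth (form_connection A V (E W H) \<sigma>) n x + fps_nth (E V (form_connection A' W H) \<sigma>) n x -
      (fps_nth (form_connection A W (E V H) \<sigma>) n x + fps_nth (E W (form_connection A' V H) \<sigma>) n x) = fps_nth (E (lie_bracket \<T> V W) H \<sigma>) n x"
    by (metis (no_types, lifting) fps_add_nth fps_sub_nth minus_apply plus_fun_apply)
  have t1: "fps_nth (form_connection A X (E Y H) \<sigma>) n x = - complex_deriv (X \<sigma>) (\<lambda>\<tau>. gauge_form A A' P n \<tau> (Y \<tau>) f x)"
    if X: "X \<in> VF" and Y: "Y \<in> VF" for X Y
  proof -
    have s: "(\<lambda>\<tau>. gauge_form A A' P n \<tau> (Y \<tau>) f x) \<in> T.S"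
      using S_slice(2)[OF gauge_form_smooth[OF A A' P Y f], of x] by simp
    have "fps_nth (form_connection A X (E Y H) \<sigma>) n x = complex_deriv (X \<sigma>) (\<lambda>\<tau>. fps_nth (E Y H \<tau>) n x)"
      by (rule form_connection_leading_nth[OF A X ESS[OF Y H] Elow[OF Y H]])
    also have "\<dots> = complex_deriv (X \<sigma>) (\<lambda>\<tau>. - 1 * gauge_form A A' P n \<tau> (Y \<tau>) f x)"
      by (simp only: Etop[OF Y H]) (simp add: H_def)
    finally show ?thesis using T.complex_deriv_cmult[OF T.vector_fields_tangent[OF X] s, where c="- 1"] by simp
  qed
  \<comment> \<open>\<open>E\<close> is divisible by h^n and the derivative of \<open>H\<close> by
    h, so these terms begin at order n + 1.\<close>
  have t2: "fps_nth (E X (form_connection A' Y H) \<sigma>) n x = 0" if X: "X \<in> VF" and Y: "Y \<in> VF" for X Y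
    using Etop[OF X SS_form_connection[OF A' Y H]] form_connection_const_nth_0[OF A' Y f] gauge_form_zero[OF A A' P X]
    by (simp add: H_def)
  have "- (complex_deriv (V \<sigma>) (\<lambda>\<tau>. gauge_form A A' P n \<tau> (W \<tau>) f x) -
    complex_deriv (W \<sigma>) (\<lambda>\<tau>. gauge_form A A' P n \<tau> (V \<tau>) f x)) = - gauge_form A A' P n \<sigma> (lie_bracket \<T> V W \<sigma>) f x"
    using main unfolding t1[OF V W] t1[OF W V] t2[OF V W] t2[OF W V] Etop[OF VW H] by (simp add: H_def)
  then show ?thesis by (simp only: neg_equal_iff_equal)
qed

lemma gauge_step:
  assumes H1: "H1_vanishes \<T>"
    and A: "A \<in> natural_op_one_forms \<T> \<M>" and A': "A' \<in> natural_op_one_forms \<T> \<M>"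
    and fl: "flat_form A" "flat_form A'"
    and P: "\<forall>k<n. \<exists>N. op_family N (\<lambda>\<sigma>. P \<sigma> k)"
    and eq: "\<forall>k<n. \<forall>V\<in>VF. \<forall>f\<in>M.S. \<forall>\<sigma> x.
      complex_deriv (V \<sigma>) (\<lambda>\<tau>. P \<tau> k f x) = gauge_form A A' P k \<sigma> (V \<sigma>) f x"
  obtains Q N where "op_family N Q"
    "\<And>V f \<sigma> x. V \<in> VF \<Longrightarrow> f \<in> M.S \<Longrightarrow> complex_deriv (V \<sigma>) (\<lambda>\<tau>. Q \<tau> f x) = gauge_form A A' P n \<sigma> (V \<sigma>) f x"
    "\<And>f \<sigma>. f \<in> M.S \<Longrightarrow> Q (T.base \<sigma>) f = 0"
proof -
  let ?b = "\<lambda>f x \<sigma> v. gauge_form A A' P n \<sigma> v f x"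
  \<comment> \<open>At this stage the primitive depends on \<open>f\<close> and \<open>x\<close> by
    mere choice, without linearity or regularity.\<close>
  have "\<exists>u. f \<in> M.S \<longrightarrow> u \<in> T.S \<and> (\<forall>\<sigma>. \<forall>v\<in>tangent_space \<T> \<sigma>. complex_deriv v u = ?b f x \<sigma> v)" for f x
  proof (cases "f \<in> M.S")
    case True
    obtain u where "u \<in> T.S" "\<And>\<sigma> v. v \<in> tangent_space \<T> \<sigma> \<Longrightarrow> complex_deriv v u = ?b f x \<sigma> v"
    proof (rule T.complex_primitive[OF H1, of "?b f x"])
      show "?b f x \<sigma> (\<lambda>u. r * v u + s * w u) = of_real r * ?b f x \<sigma> v + of_real s * ?b f x \<sigma> w"
        if "v \<in> tangent_space \<T> \<sigma>" "w \<in> tangent_space \<T> \<sigma>" for \<sigma> v w r s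
        by (rule gauge_form_tangent_linear[OF A A' P True that])
      show "(\<lambda>\<sigma>. ?b f x \<sigma> (X \<sigma>)) \<in> T.S" if "X \<in> VF" for X
        using S_slice(2)[OF gauge_form_smooth[OF A A' P that True], of x] by simp
      show "complex_deriv (X \<sigma>) (\<lambda>q. ?b f x q (Y q)) - complex_deriv (Y \<sigma>) (\<lambda>q. ?b f x q (X q)) =
        ?b f x \<sigma> (lie_bracket \<T> X Y \<sigma>)" if "X \<in> VF" "Y \<in> VF" for X Y \<sigma>
        by (rule gauge_form_closed[OF A A' fl P eq that True])
    qed blast
    then show ?thesis by blast
  qed simp
  then obtain u where u: "\<And>f x. f \<in> M.S \<Longrightarrow> u f x \<in> T.S"
    "\<And>f x \<sigma> v. f \<in> M.S \<Longrightarrow> v \<in> tangent_space \<T> \<sigma> \<Longrightarrow> complex_deriv v (u f x) = ?b f x \<sigma> v"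
    by metis
  \<comment> \<open>Subtracting the value at the base point does not change the derivative, because
    \<open>T.base\<close> is locally constant, and it removes the freedom in the choice of the
    primitive.\<close>
  define Q where "Q \<sigma> f x = u f x \<sigma> - u f x (T.base \<sigma>)" for \<sigma> f x
  have bs: "(\<lambda>\<sigma>. u f x (T.base \<sigma>)) \<in> T.S" for f x
    unfolding T.smooth_funs_iff
  proof
    fix \<sigma>
    have "\<forall>\<^sub>F \<tau> in nhds \<sigma>. u f x (T.base \<sigma>) = u f x (T.base \<tau>)"
      using T.base_locally_const[of \<sigma>] by (rule eventually_mono) simp
    then show "msmooth_at \<T> (\<lambda>\<sigma>. u f x (T.base \<sigma>)) \<sigma>" by (rule T.msmooth_at_cong) simp
  qed
  have QT: "(\<lambda>\<sigma>. Q \<sigma> f x) \<in> T.S" if "f \<in> M.S" for f x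
    unfolding Q_def by (rule T.S_diff_fun[OF u(1)[OF that] bs])
  have dQ: "complex_deriv (V \<sigma>) (\<lambda>\<tau>. Q \<tau> f x) = gauge_form A A' P n \<sigma> (V \<sigma>) f x" if V: "V \<in> VF" and f: "f \<in> M.S" for V f \<sigma> x
  proof -
    note v = T.vector_fields_tangent[OF V, of \<sigma>]
    have "\<forall>\<^sub>F \<tau> in nhds \<sigma>. u f x (T.base \<tau>) = u f x (T.base \<sigma>)"
      using T.base_locally_const[of \<sigma>] by (rule eventually_mono) simp
    from T.complex_deriv_local[OF v bs T.S_const this] have "complex_deriv (V \<sigma>) (\<lambda>\<sigma>. u f x (T.base \<sigma>)) = 0"
      by (simp add: T.complex_deriv_const[OF v])
    then show ?thesis unfolding Q_def
      using T.complex_deriv_diff[OF v u(1)[OF f] bs] u(2)[OF f v] by simp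
  qed
  have Q0: "Q (T.base \<sigma>) f x = 0" for \<sigma> f x by (simp add: Q_def)
  have Qs: "(\<lambda>p. Q (fst p) f (snd p)) \<in> PM.S" if f: "f \<in> M.S" for f
  proof (rule primitive_smooth[where B="\<lambda>X p. gauge_form A A' P n (fst p) (X (fst p)) f (snd p)"])
    show "(\<lambda>\<tau>. Q (fst (\<tau>, x)) f (snd (\<tau>, x))) \<in> T.S" for x using QT[OF f] by simp
    show "(\<lambda>p. gauge_form A A' P n (fst p) (X (fst p)) f (snd p)) \<in> PM.S" if "X \<in> VF" for X
      by (rule gauge_form_smooth[OF A A' P that f])
    show "complex_deriv (X \<sigma>) (\<lambda>\<tau>. Q (fst (\<tau>, x)) f (snd (\<tau>, x))) =
        gauge_form A A' P n (fst (\<sigma>, x)) (X (fst (\<sigma>, x))) f (snd (\<sigma>, x))" if "X \<in> VF" for X \<sigma> x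
      using dQ[OF that f] by simp
    show "(\<lambda>x. Q (fst (T.base \<sigma>, x)) f (snd (T.base \<sigma>, x))) \<in> M.S" for \<sigma> by (simp add: Q0)
  qed
  have lin: "lin_on M.S (\<lambda>f. Q \<sigma> f x)" for \<sigma> x
    unfolding lin_on_def
  proof (intro ballI allI)
    fix f g :: "'m \<Rightarrow> complex" and a b assume f: "f \<in> M.S" and g: "g \<in> M.S"
    have h: "(\<lambda>x. a * f x + b * g x) \<in> M.S" by (rule M.S.lin_closed[OF f g])
    \<comment> \<open>The failure of linearity, as a function of the parameter. Its derivative is
      zero because \<open>gauge_form\<close> is linear in the function, and it vanishes at the base
      points.\<close>
    define w where "w \<tau> = Q \<tau> (\<lambda>x. a * f x + b * g x) x - (a * Q \<tau> f x + b * Q \<tau> g x)" for \<tau>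
    have s: "(\<lambda>\<tau>. a * Q \<tau> f x + b * Q \<tau> g x) \<in> T.S" by (rule T.S.lin_closed[OF QT[OF f] QT[OF g]])
    have sa: "(\<lambda>\<tau>. a * Q \<tau> f x) \<in> T.S" "(\<lambda>\<tau>. b * Q \<tau> g x) \<in> T.S"
      using T.S.lin_closed[OF QT[OF f] QT[OF f], where a=a and b=0]
        T.S.lin_closed[OF QT[OF g] QT[OF g], where a=b and b=0] by simp_all
    have wS: "w \<in> T.S" unfolding w_def by (rule T.S_diff_fun[OF QT[OF h] s])
    have "complex_deriv (X q) w = 0" if X: "X \<in> VF" for X q
    proof -
      note v = T.vector_fields_tangent[OF X, of q]
      show ?thesis unfolding w_def
        using T.complex_deriv_diff[OF v QT[OF h] s] T.complex_deriv_add[OF v sa]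
          T.complex_deriv_cmult[OF v QT[OF f]] T.complex_deriv_cmult[OF v QT[OF g]]
          dQ[OF X f] dQ[OF X g] dQ[OF X h] gauge_form_lin_op[OF A A' P X f g] by simp
    qed
    then have "w \<sigma> = w (T.base \<sigma>)" by (intro T.zero_deriv_const[OF wS])
    then show "Q \<sigma> (\<lambda>x. a * f x + b * g x) x = a * Q \<sigma> f x + b * Q \<sigma> g x"
      by (simp add: w_def Q0)
  qed
  from P obtain N where N: "\<forall>k<n. op_family (N k) (\<lambda>\<sigma>. P \<sigma> k)" by metis
  have ord: "order_at M.S x ((\<Sum>k<n. N k) + Suc n) (\<lambda>f. Q \<sigma> f x)" for \<sigma> x
    by (rule order_at_primitive[where L="\<lambda>\<sigma> f. Q \<sigma> f x" and K="\<lambda>V \<sigma> f. gauge_form A A' P n \<sigma> (V \<sigma>) f x"])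
      (use QT dQ Q0 gauge_form_order[OF A A' N] in \<open>simp_all del: order_at.simps\<close>)
  have "op_family ((\<Sum>k<n. N k) + Suc n) Q" unfolding op_family_def using lin ord Qs by blast
  then show ?thesis by (rule that) (use dQ Q0 in \<open>auto simp: fun_eq_iff\<close>)
qed

end

section \<open>Existence, intertwining property and multiplicativity of the gauge
  transformation\<close>

context manifold_pair
begin

lemma gauge_exists:
  assumes H1: "H1_vanishes \<T>"
    and A: "A \<in> natural_op_one_forms \<T> \<M>" and A': "A' \<in> natural_op_one_forms \<T> \<M>"
    and fl: "flat_form A" "flat_form A'"
  obtains P where "formal_family P"
    "\<And>n V f \<sigma> x. V \<in> VF \<Longrightarrow> f \<in> M.S \<Longrightarrow> complex_deriv (V \<sigma>) (\<lambda>\<tau>. P \<tau> n f x) = gauge_form A A' P n \<sigma> (V \<sigma>) f x"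
    "\<And>n f \<sigma>. f \<in> M.S \<Longrightarrow> P (T.base \<sigma>) n f = (if n = 0 then f else 0)"
    "\<And>f \<sigma>. f \<in> M.S \<Longrightarrow> P \<sigma> 0 f = f"
proof -
  define R where "R p n r \<longleftrightarrow> (\<exists>N. op_family N r) \<and>
    (\<forall>V\<in>VF. \<forall>f\<in>M.S. \<forall>\<sigma> x. complex_deriv (V \<sigma>) (\<lambda>\<tau>. r \<tau> f x) = gauge_form A A' (\<lambda>\<sigma> k. p k \<sigma>) n \<sigma> (V \<sigma>) f x) \<and>
    (\<forall>f\<in>M.S. \<forall>\<sigma>. r (T.base \<sigma>) f = (if n = 0 then f else 0)) \<and> (n = 0 \<longrightarrow> (\<forall>f\<in>M.S. \<forall>\<sigma>. r \<sigma> f = f))"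
    for p :: "nat \<Rightarrow> 't \<Rightarrow> 'm operator" and n and r :: "'t \<Rightarrow> 'm operator"
  have "\<exists>p. \<forall>n. R p n (p n)"
  \<comment> \<open>Each coefficient is chosen in dependence on all earlier ones. The choice
    principle requires that the specification at \<open>n\<close> looks at \<open>p\<close> below
    \<open>n\<close> only.\<close>
  proof (rule dependent_wf_choice[OF wf_less_than])
    fix p q :: "nat \<Rightarrow> 't \<Rightarrow> 'm operator" and n r
    assume "\<And>k. (k, n) \<in> less_than \<Longrightarrow> p k = q k"
    then have "gauge_form A A' (\<lambda>\<sigma> k. p k \<sigma>) n = gauge_form A A' (\<lambda>\<sigma> k. q k \<sigma>) n"
      by (intro gauge_form_cong) simp
    then show "R p n r = R q n r" unfolding R_def by simp
  next
    fix n and p :: "nat \<Rightarrow> 't \<Rightarrow> 'm operator"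
    assume "\<And>k. (k, n) \<in> less_than \<Longrightarrow> R p k (p k)"
    then have IH: "R p k (p k)" if "k < n" for k using that by simp
    show "\<exists>r. R p n r"
    proof (cases "n = 0")
      case True
      \<comment> \<open>At order 0 the prescribed derivative is an empty sum, so the identity is the
        normalised solution. Its order 0 is \<open>Suc 0\<close> in the strict count.\<close>
      have "op_family (Suc 0) (\<lambda>\<sigma> f. f)"
        unfolding op_family_def by (auto intro: S_snd simp: lin_on_def commutator_def times_fun_apply)
      then have "R p n (\<lambda>\<sigma> f. f)"
        unfolding R_def using True T.complex_deriv_const[OF T.vector_fields_tangent] by (auto simp: gauge_form_def)
      then show ?thesis by (rule exI[of "R p n"])
    next
      case False
      have P: "\<forall>k<n. \<exists>N. op_family N (\<lambda>\<sigma>. (\<lambda>\<sigma> k. p k \<sigma>) \<sigma> k)"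
        using IH unfolding R_def by simp
      have eq: "\<forall>k<n. \<forall>V\<in>VF. \<forall>f\<in>M.S. \<forall>\<sigma> x. complex_deriv (V \<sigma>) (\<lambda>\<tau>. (\<lambda>\<sigma> k. p k \<sigma>) \<tau> k f x) =
          gauge_form A A' (\<lambda>\<sigma> k. p k \<sigma>) k \<sigma> (V \<sigma>) f x"
        using IH unfolding R_def by simp
      obtain Q N where Q: "op_family N Q"
        "\<And>V f \<sigma> x. V \<in> VF \<Longrightarrow> f \<in> M.S \<Longrightarrow> complex_deriv (V \<sigma>) (\<lambda>\<tau>. Q \<tau> f x) = gauge_form A A' (\<lambda>\<sigma> k. p k \<sigma>) n \<sigma> (V \<sigma>) f x"
        "\<And>f \<sigma>. f \<in> M.S \<Longrightarrow> Q (T.base \<sigma>) f = 0"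
        by (rule gauge_step[OF H1 A A' fl P eq]) blast
      have "R p n Q" unfolding R_def
        by (intro conjI exI[of _ N] ballI allI impI) (simp_all add: Q False)
      then show ?thesis by (rule exI[of "R p n"])
    qed
  qed
  then obtain p where p: "\<forall>n. R p n (p n)" ..
  show ?thesis
  proof (rule that[of "\<lambda>\<sigma> n. p n \<sigma>"])
    show "formal_family (\<lambda>\<sigma> n. p n \<sigma>)" using p unfolding formal_family_def R_def by blast
    show "complex_deriv (V \<sigma>) (\<lambda>\<tau>. p n \<tau> f x) = gauge_form A A' (\<lambda>\<sigma> n. p n \<sigma>) n \<sigma> (V \<sigma>) f x"
      if "V \<in> VF" "f \<in> M.S" for n V f \<sigma> x using p[rule_format, of n] that unfolding R_def by simp
    show "p n (T.base \<sigma>) f = (if n = 0 then f else 0)" if "f \<in> M.S" for n f \<sigma>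
      using p[rule_format, of n] that unfolding R_def by simp
    show "p 0 \<sigma> f = f" if "f \<in> M.S" for f \<sigma> using p[rule_format, of 0] that unfolding R_def by simp
  qed
qed

text \<open>The recursion says that every \<open>gauge_diff_op\<close> vanishes, and these are the
  coefficients of D P - P D'.\<close>

lemma gauge_intertwines:
  assumes A: "A \<in> natural_op_one_forms \<T> \<M>" and A': "A' \<in> natural_op_one_forms \<T> \<M>"
    and P: "formal_family P"
    and eq: "\<And>n V f \<sigma> x. V \<in> VF \<Longrightarrow> f \<in> M.S \<Longrightarrow>
      complex_deriv (V \<sigma>) (\<lambda>\<tau>. P \<tau> n f x) = gauge_form A A' P n \<sigma> (V \<sigma>) f x"
    and V: "V \<in> VF" and F: "F \<in> SS"
  shows "form_connection A V (\<lambda>\<sigma>. act (P \<sigma>) (F \<sigma>)) \<sigma> = act (P \<sigma>) (form_connection A' V F \<sigma>)"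
proof -
  have "gauge_diff_op A A' P V n \<sigma> f x = 0" if "f \<in> M.S" for n f x
  proof -
    obtain N where N: "op_family N (\<lambda>\<sigma>. P \<sigma> n)" using P unfolding formal_family_def by blast
    show ?thesis using gauge_diff_op_eq[where P=P and n=n, OF A A' N V that] eq[OF V that] by simp
  qed
  then have "fps_nth (act (\<lambda>m. gauge_diff_op A A' P V m \<sigma>) (F \<sigma>)) n x = 0" for n x
    using M.FF_nth[OF SS_FF[OF F]] by (simp add: act_nth_apply)
  then have "act (\<lambda>m. gauge_diff_op A A' P V m \<sigma>) (F \<sigma>) = 0"
    by (intro fps_ext ext) simp
  then show ?thesis using gauge_difference[OF A A' P V F, of \<sigma>] by simp
qed

text \<open>Bidifferential operators are read as differential operators in one argument with the
  other frozen, so that sections can be inserted one after the other.\<close>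

definition star_family :: "('t \<Rightarrow> 'm cochains) \<Rightarrow> bool" where
  "star_family c \<longleftrightarrow> (\<forall>\<sigma>. M.star_like (c \<sigma>)) \<and>
     (\<forall>k. \<forall>g\<in>M.S. op_family (Suc k) (\<lambda>\<sigma> f. c \<sigma> k f g)) \<and>
     (\<forall>k \<sigma> x. \<forall>g\<in>M.S. lin_on M.S (\<lambda>f. c \<sigma> k g f x) \<and> order_at M.S x (Suc k) (\<lambda>f. c \<sigma> k g f x))"

lemma natural_family_star_family:
  assumes "smooth_natural_star_family \<T> \<M> \<omega> c" shows "star_family c"
proof -
  have nat: "natural_star_product \<M> \<omega> (c \<sigma>)" for \<sigma>
    using assms unfolding smooth_natural_star_family_def by blast
  have bd: "c \<sigma> k \<in> bidiff_ops_le \<M> k" for \<sigma> k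
    using nat unfolding natural_star_product_def by blast
  have cl: "c \<sigma> k f g \<in> M.S" if "f \<in> M.S" "g \<in> M.S" for \<sigma> k f g
    using nat[of \<sigma>] that unfolding natural_star_product_def star_product_def by blast
  have sm: "(\<lambda>p. c (fst p) k f g (snd p)) \<in> PM.S" if "f \<in> M.S" "g \<in> M.S" for k f g
    using assms that unfolding smooth_natural_star_family_def split_beta' by blast
  show ?thesis unfolding star_family_def M.star_like_def M.lin_op_def op_family_def
    by (intro conjI allI ballI cl sm M.bidiff_ops_le_functional[OF bd])
qed

text \<open>The section \<open>F\<close> is inserted while the second argument is frozen; the result
  is a smooth family of operators in the second argument, into which \<open>G\<close> is
  inserted.\<close>

lemma SS_star:
  assumes c: "star_family c" and F: "F \<in> SS" and G: "G \<in> SS"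
  shows "(\<lambda>\<sigma>. star (c \<sigma>) (F \<sigma>) (G \<sigma>)) \<in> SS"
  unfolding SS_iff
proof
  fix n
  have "(\<lambda>p. c (fst p) k (fps_nth (F (fst p)) i) (fps_nth (G (fst p)) j) (snd p)) \<in> PM.S" for k i j
  proof -
    have "op_family (Suc k) (\<lambda>\<sigma> g. c \<sigma> k (fps_nth (F \<sigma>) i) g)"
      unfolding op_family_def
    proof (intro conjI allI ballI)
      fix g :: "'m \<Rightarrow> complex" assume g: "g \<in> M.S"
      have "op_family (Suc k) (\<lambda>\<sigma> f. c \<sigma> k f g)" using c g unfolding star_family_def by blast
      from op_family_apply_smooth[OF this SS_nth[OF F, of i]]
      show "(\<lambda>p. c (fst p) k (fps_nth (F (fst p)) i) g (snd p)) \<in> PM.S" by simp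
    qed (use c M.FF_nth[OF SS_FF[OF F]] in \<open>simp_all add: star_family_def del: order_at.simps\<close>)
    from op_family_apply_smooth[OF this SS_nth[OF G, of j]] show ?thesis by simp
  qed
  then show "(\<lambda>p. fps_nth (star (c (fst p)) (F (fst p)) (G (fst p))) n (snd p)) \<in> PM.S"
    unfolding star_nth fun_sum_apply by (intro PM.S.sum_closed)
qed

definition compat_form :: "('t \<Rightarrow> 'm cochains) \<Rightarrow> (nat \<Rightarrow> 't \<Rightarrow> 't tvec \<Rightarrow> 'm operator) \<Rightarrow> bool" where
  "compat_form c A \<longleftrightarrow> (\<forall>V\<in>VF. \<forall>F\<in>SS. \<forall>G\<in>SS. \<forall>\<sigma>.
     form_connection A V (\<lambda>\<sigma>. star (c \<sigma>) (F \<sigma>) (G \<sigma>)) \<sigma> =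
       star (c \<sigma>) (form_connection A V F \<sigma>) (G \<sigma>) + star (c \<sigma>) (F \<sigma>) (form_connection A V G \<sigma>))"

text \<open>
  The defect \<open>S(f, g) = P(f \<star> g) - P f \<star> P g\<close> satisfies \<open>D\<^sub>V S(f, g) = S(D'\<^sub>V f, g) + S(f, D'\<^sub>V g)\<close>. As
  \<open>D'\<^sub>V f\<close> is divisible by \<open>h\<close> for constant \<open>f\<close>, its coefficients are constant, one after the other.
\<close>

lemma gauge_multiplicative:
  assumes A: "A \<in> natural_op_one_forms \<T> \<M>" and A': "A' \<in> natural_op_one_forms \<T> \<M>"
    and c: "star_family c" and cA: "compat_form c A" and cA': "compat_form c A'"
    and P: "formal_family P"
    and eq: "\<And>V F \<sigma>. V \<in> VF \<Longrightarrow> F \<in> SS \<Longrightarrow> form_connection A V (\<lambda>\<sigma>. act (P \<sigma>) (F \<sigma>)) \<sigma> = act (P \<sigma>) (form_connection A' V F \<sigma>)"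
    and base: "\<And>n f \<sigma>. f \<in> M.S \<Longrightarrow> P (T.base \<sigma>) n f = (if n = 0 then f else 0)"
  shows "f \<in> M.S \<Longrightarrow> g \<in> M.S \<Longrightarrow> fps_nth (M.defect (P \<sigma>) (c \<sigma>) (fps_const f) (fps_const g)) n = 0"
proof (induction n arbitrary: f g \<sigma> rule: less_induct)
  case (less n)
  note f = less.prems(1) and g = less.prems(2)
  have fop: "M.lin_fop (P \<sigma>)" for \<sigma> by (rule formal_family_lin_fop[OF P])
  have sl: "M.star_like (c \<sigma>)" for \<sigma> using c unfolding star_family_def by blast
  define f' where "f' = (\<lambda>\<sigma>::'t. fps_const f)"
  define g' where "g' = (\<lambda>\<sigma>::'t. fps_const g)"
  have fS: "f' \<in> SS" and gS: "g' \<in> SS" unfolding f'_def g'_def by (rule SS_const[OF f], rule SS_const[OF g])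
  define W where "W = (\<lambda>\<sigma>. act (P \<sigma>) (star (c \<sigma>) (f' \<sigma>) (g' \<sigma>)) - star (c \<sigma>) (act (P \<sigma>) (f' \<sigma>)) (act (P \<sigma>) (g' \<sigma>)))"
  have W: "W \<sigma> = M.defect (P \<sigma>) (c \<sigma>) (fps_const f) (fps_const g)" for \<sigma>
    by (simp add: W_def M.defect_def f'_def g'_def)
  note PfS = SS_act[OF P fS] and PgS = SS_act[OF P gS] and sS = SS_star[OF c fS gS]
  have WS: "W \<in> SS" unfolding W_def by (rule SS_diff[OF SS_act[OF P sS] SS_star[OF c PfS PgS]])
  \<comment> \<open>Since the defect starts at order \<open>n\<close>, the connection differentiates
    its coefficient there as the trivial connection would.\<close>
  have low: "fps_nth (W \<tau>) j = 0" if "j < n" for j \<tau>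
    unfolding W by (rule less.IH[OF that f g])
  have Vz: "complex_deriv (V \<sigma>) (\<lambda>\<tau>. fps_nth (W \<tau>) n x) = 0" if V: "V \<in> VF" for V \<sigma> x
  proof -
    note f'S = SS_form_connection[OF A' V fS] and g'S = SS_form_connection[OF A' V gS]
    have "form_connection A V W \<sigma> = form_connection A V (\<lambda>\<sigma>. act (P \<sigma>) (star (c \<sigma>) (f' \<sigma>) (g' \<sigma>))) \<sigma> -
        form_connection A V (\<lambda>\<sigma>. star (c \<sigma>) (act (P \<sigma>) (f' \<sigma>)) (act (P \<sigma>) (g' \<sigma>))) \<sigma>"
      unfolding W_def form_connection_diff[OF A V SS_act[OF P sS] SS_star[OF c PfS PgS]] ..
    also have "form_connection A V (\<lambda>\<sigma>. act (P \<sigma>) (star (c \<sigma>) (f' \<sigma>) (g' \<sigma>))) \<sigma> =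
        act (P \<sigma>) (star (c \<sigma>) (form_connection A' V f' \<sigma>) (g' \<sigma>) + star (c \<sigma>) (f' \<sigma>) (form_connection A' V g' \<sigma>))"
      using eq[OF V sS, of \<sigma>] cA' V fS gS unfolding compat_form_def by simp
    also have "\<dots> = act (P \<sigma>) (star (c \<sigma>) (form_connection A' V f' \<sigma>) (g' \<sigma>)) + act (P \<sigma>) (star (c \<sigma>) (f' \<sigma>) (form_connection A' V g' \<sigma>))"
      by (rule M.act_add[OF fop M.star_FF[OF sl SS_FF[OF f'S] SS_FF[OF gS]] M.star_FF[OF sl SS_FF[OF fS] SS_FF[OF g'S]]])
    also have "form_connection A V (\<lambda>\<sigma>. star (c \<sigma>) (act (P \<sigma>) (f' \<sigma>)) (act (P \<sigma>) (g' \<sigma>))) \<sigma> =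
        star (c \<sigma>) (act (P \<sigma>) (form_connection A' V f' \<sigma>)) (act (P \<sigma>) (g' \<sigma>)) + star (c \<sigma>) (act (P \<sigma>) (f' \<sigma>)) (act (P \<sigma>) (form_connection A' V g' \<sigma>))"
      using cA V PfS PgS eq[OF V fS, of \<sigma>] eq[OF V gS, of \<sigma>] unfolding compat_form_def by simp
    finally have "form_connection A V W \<sigma> = M.defect (P \<sigma>) (c \<sigma>) (form_connection A' V f' \<sigma>) (g' \<sigma>) + M.defect (P \<sigma>) (c \<sigma>) (f' \<sigma>) (form_connection A' V g' \<sigma>)"
      by (simp add: M.defect_def algebra_simps)
    \<comment> \<open>In each of the two defects one argument is divisible by h, so the induction
      hypothesis below \<open>n\<close> is enough for the coefficient at \<open>n\<close>.\<close>
    moreover have "fps_nth (M.defect (P \<sigma>) (c \<sigma>) (form_connection A' V f' \<sigma>) (g' \<sigma>)) n = 0"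
    proof (rule M.defect_nth_zero_left[OF fop sl _ SS_FF[OF f'S] SS_FF[OF gS]])
      show "fps_nth (form_connection A' V f' \<sigma>) 0 = 0" unfolding f'_def by (rule form_connection_const_nth_0[OF A' V f])
    qed (rule less.IH)
    moreover have "fps_nth (M.defect (P \<sigma>) (c \<sigma>) (f' \<sigma>) (form_connection A' V g' \<sigma>)) n = 0"
    proof (rule M.defect_nth_zero_right[OF fop sl _ SS_FF[OF fS] SS_FF[OF g'S]])
      show "fps_nth (form_connection A' V g' \<sigma>) 0 = 0" unfolding g'_def by (rule form_connection_const_nth_0[OF A' V g])
    qed (rule less.IH)
    ultimately have "fps_nth (form_connection A V W \<sigma>) n x = 0" by simp
    then show ?thesis using form_connection_leading_nth[OF A V WS low] by simp
  qed
  have "fps_nth (W \<sigma>) n x = 0" for x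
  proof -
    have "fps_nth (W \<sigma>) n x = fps_nth (W (T.base \<sigma>)) n x"
      by (rule T.zero_deriv_const[OF SS_nth_T[OF WS]]) (rule Vz)
    also have "\<dots> = 0"
    proof -
      \<comment> \<open>At base points the higher coefficients of \<open>P\<close> vanish, so
        \<open>P\<close> acts as the identity and the defect is zero there.\<close>
      have id: "act (P (T.base \<sigma>)) F = F" if "F \<in> M.FF" for F
      proof (rule fps_ext)
        fix m
        have "fps_nth (act (P (T.base \<sigma>)) F) m = (\<Sum>k\<le>m. if k = 0 then fps_nth F (m - k) else 0)"
          unfolding act_nth using base M.FF_nth[OF that] by (intro sum.cong refl) simp
        then show "fps_nth (act (P (T.base \<sigma>)) F) m = fps_nth F m" by simp
      qed
      show ?thesis unfolding W_def
        using id[OF SS_FF[OF fS]] id[OF SS_FF[OF gS]] id[OF SS_FF[OF sS]] by simp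
    qed
    finally show ?thesis .
  qed
  then show ?case unfolding W[symmetric] by (simp add: fun_eq_iff)
qed

text \<open>\<open>D\<close> agrees with d + A on smooth sections only. Rewriting the nested terms
  of flatness and compatibility therefore rests on the fact that connections and star products
  preserve smooth sections.\<close>

lemma compatible_connection_form:
  assumes D: "D \<in> compatible_connections \<T> \<M> c" and fl: "flat_connection \<T> \<M> D" and c: "star_family c"
  obtains A where "A \<in> natural_op_one_forms \<T> \<M>" "\<And>V F. V \<in> VF \<Longrightarrow> F \<in> SS \<Longrightarrow> D V F = form_connection A V F"
    "compat_form c A" "flat_form A"
proof -
  obtain A where A: "A \<in> natural_op_one_forms \<T> \<M>" and DA: "\<And>V F. V \<in> VF \<Longrightarrow> F \<in> SS \<Longrightarrow> D V F = form_connection A V F"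
    using D unfolding compatible_connections_def natural_formal_connection_def form_connection_def by blast
  have "compat_form c A" unfolding compat_form_def
  proof (intro ballI allI)
    fix V F G \<sigma> assume V: "V \<in> VF" and F: "F \<in> SS" and G: "G \<in> SS"
    have "D V (\<lambda>\<sigma>. star (c \<sigma>) (F \<sigma>) (G \<sigma>)) =
        (\<lambda>\<sigma>. star (c \<sigma>) (D V F \<sigma>) (G \<sigma>) + star (c \<sigma>) (F \<sigma>) (D V G \<sigma>))"
      using D V F G unfolding compatible_connections_def by blast
    then show "form_connection A V (\<lambda>\<sigma>. star (c \<sigma>) (F \<sigma>) (G \<sigma>)) \<sigma> =
       star (c \<sigma>) (form_connection A V F \<sigma>) (G \<sigma>) + star (c \<sigma>) (F \<sigma>) (form_connection A V G \<sigma>)"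
      unfolding DA[OF V F] DA[OF V G] DA[OF V SS_star[OF c F G]] by (rule fun_cong)
  qed
  moreover have "flat_form A" unfolding flat_form_def
  proof (intro ballI allI)
    fix V W F \<sigma> assume V: "V \<in> VF" and W: "W \<in> VF" and F: "F \<in> SS"
    have "D V (D W F) - D W (D V F) - D (lie_bracket \<T> V W) F = 0"
      using fl V W F unfolding flat_connection_def by blast
    from fun_cong[OF this, of \<sigma>] show "form_connection A V (form_connection A W F) \<sigma> - form_connection A W (form_connection A V F) \<sigma> = form_connection A (lie_bracket \<T> V W) F \<sigma>"
      unfolding DA[OF V F] DA[OF W F] DA[OF V SS_form_connection[OF A W F]] DA[OF W SS_form_connection[OF A V F]]
        DA[OF T.lie_bracket_vector_field[OF V W] F] by simp
  qed
  ultimately show ?thesis using that[OF A DA] by blast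
qed

lemma formal_family_smooth_family:
  assumes "formal_family P" shows "(\<lambda>\<sigma>. P \<sigma> k) \<in> smooth_diff_op_families \<T> \<M>"
proof -
  obtain N where N: "op_family N (\<lambda>\<sigma>. P \<sigma> k)" using assms unfolding formal_family_def by blast
  show ?thesis unfolding smooth_diff_op_families_def diff_ops_def split_beta'
    using op_family_diff_ops[OF N] op_family_smooth[OF N] by blast
qed

end

theorem theorem1p6:
  fixes \<T> :: "('t::{t2_space,second_countable_topology}, 'e::finite_dim_inner) atlas"
    and \<M> :: "('m::{t2_space,second_countable_topology}, 'f::finite_dim_inner) atlas"
    and \<omega> :: "'m two_form"
    and c :: "'t \<Rightarrow> 'm cochains"
    and D D' :: "('t, 'm) connection"
  assumes "smooth_atlas \<T>" and "H1_vanishes \<T>"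
    and "smooth_atlas \<M>" and "symplectic_form \<M> \<omega>"
    and "smooth_natural_star_family \<T> \<M> \<omega> c"
    and "D \<in> compatible_connections \<T> \<M> c" and "D' \<in> compatible_connections \<T> \<M> c"
    and "flat_connection \<T> \<M> D" and "flat_connection \<T> \<M> D'"
  shows "\<exists>P. self_equivalence \<T> \<M> c P \<and> gauge_related \<T> \<M> P D D'"
proof -
  interpret manifold_pair \<T> \<M> by unfold_locales (rule assms)+
  have c: "star_family c" by (rule natural_family_star_family[OF assms(5)])
  obtain A where A: "A \<in> natural_op_one_forms \<T> \<M>" "\<And>V F. V \<in> VF \<Longrightarrow> F \<in> SS \<Longrightarrow> D V F = form_connection A V F"
    "compat_form c A" "flat_form A" by (rule compatible_connection_form[OF assms(6,8) c]) blast
  obtain A' where A': "A' \<in> natural_op_one_forms \<T> \<M>" "\<And>V F. V \<in> VF \<Longrightarrow> F \<in> SS \<Longrightarrow> D' V F = form_connection A' V F"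
    "compat_form c A'" "flat_form A'" by (rule compatible_connection_form[OF assms(7,9) c]) blast
  obtain P where P: "formal_family P"
    "\<And>n V f \<sigma> x. V \<in> VF \<Longrightarrow> f \<in> M.S \<Longrightarrow> complex_deriv (V \<sigma>) (\<lambda>\<tau>. P \<tau> n f x) = gauge_form A A' P n \<sigma> (V \<sigma>) f x"
    "\<And>n f \<sigma>. f \<in> M.S \<Longrightarrow> P (T.base \<sigma>) n f = (if n = 0 then f else 0)"
    "\<And>f \<sigma>. f \<in> M.S \<Longrightarrow> P \<sigma> 0 f = f"
    by (rule gauge_exists[OF assms(2) A(1) A'(1) A(4) A'(4)]) blast
  have tw: "form_connection A V (\<lambda>\<sigma>. act (P \<sigma>) (F \<sigma>)) \<sigma> = act (P \<sigma>) (form_connection A' V F \<sigma>)"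
    if "V \<in> VF" "F \<in> SS" for V F \<sigma>
    by (rule gauge_intertwines[OF A(1) A'(1) P(1) _ that]) (rule P(2))
  have mult: "fps_nth (M.defect (P \<sigma>) (c \<sigma>) (fps_const f) (fps_const g)) n = 0"
    if "f \<in> M.S" "g \<in> M.S" for \<sigma> f g n
    by (rule gauge_multiplicative[OF A(1) A'(1) c A(3) A'(3) P(1) _ _ that]) (simp_all add: tw P(3))
  have "act (P \<sigma>) (star (c \<sigma>) (fps_const f) (fps_const g)) =
      star (c \<sigma>) (act (P \<sigma>) (fps_const f)) (act (P \<sigma>) (fps_const g))"
    if "f \<in> M.S" "g \<in> M.S" for \<sigma> f g
  proof -
    have "M.defect (P \<sigma>) (c \<sigma>) (fps_const f) (fps_const g) = 0"
      by (rule fps_ext) (simp add: mult that)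
    then show ?thesis by (simp add: M.defect_def)
  qed
  then have "self_equivalence \<T> \<M> c P"
    unfolding self_equivalence_def using formal_family_smooth_family[OF P(1)] P(4) by blast
  moreover have "gauge_related \<T> \<M> P D D'" unfolding gauge_related_def act_inverse_def
  proof (intro ballI ext)
    fix V F \<sigma> assume V: "V \<in> VF" and F: "F \<in> SS"
    \<comment> \<open>\<open>inv_into\<close> merely chooses a preimage among the formal functions;
      injectivity determines it, and D P F = P D' F exhibits D' F as a preimage.\<close>
    have "inv_into M.FF (act (P \<sigma>)) (act (P \<sigma>) (form_connection A' V F \<sigma>)) = form_connection A' V F \<sigma>"
      by (rule inv_into_f_f[OF M.act_inj[OF formal_family_lin_fop[OF P(1)] P(4)] SS_FF[OF SS_form_connection[OF A'(1) V F]]])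
    then show "D' V F \<sigma> = inv_into M.FF (act (P \<sigma>)) (D V (\<lambda>\<tau>. act (P \<tau>) (F \<tau>)) \<sigma>)"
      by (simp add: A(2)[OF V SS_act[OF P(1) F]] A'(2)[OF V F] tw[OF V F])
  qed
  ultimately show ?thesis by blast
qed

end
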